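(* Let $n$ be a positive integer, let $b^\pm_0 \in \mathcal{D}'(\partial D)$, let $b^\pm_k\in \operatorname{Re}\{(H^{p^\pm_k}(D))_b\}$ for $1\leq k \leq n-1$, where $p^\pm_k > \frac{1}{2}$, let $c^\pm_k \in \mathbb{R}$ for $0 \leq k \leq n-1$, and let $f \in L^1(D, \mathbb{B})$. The bicomplex Schwarz boundary value problem for $w: D\to\mathbb{B}$, \[ \begin{cases} \bar\partial^n w = f,\\ \operatorname{Re}\{(\bar\partial^k w)_b^+\} = b^+_k, & 0\le k\le n-1, \\ \operatorname{Re}\{(\bar\partial^k w)_b^-\} = b^-_k, & 0\le k\le n-1,\\ \operatorname{Im}\{ (\bar\partial^k w)^+(0)\} = c^+_k, & 0\le k\le n-1, \\ \operatorname{Im}\{ (\bar\partial^k w)^-(0) \} = c^-_k, & 0\le k\le n-1, \end{cases} \] is uniquely solved by $w(z) = p^+ w^+(z) + p^- w^-(z)$, where, with $z = re^{i\theta}$ and $\zeta=\xi+i\eta$, \begin{align*} \overline{w^+(z)} &:= -i\sum_{k = 0}^{n-1}\frac{c^+_k}{k!}(z+\bar z)^k + \sum_{k=0}^{n-1}\frac{(-1)^k}{2\pi k!} \left\langle b^+_k, (P_r(\theta - \cdot)+iQ_r(\theta - \cdot))\left(e^{i(\cdot)} - re^{i\theta}+\overline{e^{i(\cdot)} - re^{i\theta}}\right)^k\right\rangle \\ &\quad - \frac{1}{2\pi}\iint_{|\zeta|<1} \left( \frac{\overline{f^+(\zeta)}}{\zeta}\,\frac{\zeta + z}{\zeta - z}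 + \frac{f^+(\zeta)}{\overline{\zeta}}\,\frac{1+z\overline{\zeta}}{1-z\overline{\zeta}}\right)\left(\zeta - z+\overline{\zeta - z}\right)^{n-1}\,d\xi\,d\eta \end{align*} and \begin{align*} w^-(z) &:= i\sum_{k = 0}^{n-1}\frac{c^-_k}{k!}(z+\bar z)^k + \sum_{k=0}^{n-1}\frac{(-1)^k}{2\pi k!} \left\langle b^-_k, (P_r(\theta - \cdot)+iQ_r(\theta - \cdot))\left(e^{i(\cdot)} - re^{i\theta}+\overline{e^{i(\cdot)} - re^{i\theta}}\right)^k\right\rangle \\ &\quad - \frac{1}{2\pi}\iint_{|\zeta|<1} \left( \frac{f^-(\zeta)}{\zeta}\,\frac{\zeta + z}{\zeta - z} + \frac{\overline{f^-(\zeta)}}{\overline{\zeta}}\,\frac{1+z\overline{\zeta}}{1-z\overline{\zeta}}\right)\left(\zeta - z+\overline{\zeta - z}\right)^{n-1}\,d\xi\,d\eta. \end{align*}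
   Context: $D$ is the open unit disk in $\mathbb{C}$ and $\partial D$ is the unit circle; $\mathcal{D}'(\partial D)$ is the set of distributions on $\partial D$ (continuous linear functionals on $C^\infty(\partial D)$), and $\langle\cdot,\cdot\rangle$ is the duality pairing. A function $h:D\to\mathbb{C}$ has a boundary value in the sense of distributions (distributional boundary value) $h_b$ if for every $\gamma\in C^\infty(\partial D)$ the limit $\langle h_b,\gamma\rangle = \lim_{r\nearrow 1}\int_0^{2\pi} h(re^{i\theta})\gamma(\theta)\,d\theta$ exists. The real part $\operatorname{Re}\{h\}$ of a distribution $h$ is the distribution with $\langle \operatorname{Re}\{h\},\gamma\rangle = \operatorname{Re}\langle h,\gamma\rangle$ for real-valued $\gamma\in C^\infty(\partial D)$. For $0<p<\infty$, $H^p(D)$ is the set of complex holomorphic functions $h$ on $D$ with $\sup_{0<r<1}\int_0^{2\pi}|h(re^{i\theta})|^p\,d\theta<\infty$, and $\operatorname{Re}\{(H^p(D))_b\} := \{\operatorname{Re}\{h\}_b : h\in H^p(D)\}\subset\mathcal{D}'(\partial D)$ is the set of real parts of distributional boundary values of functions in $H^p(D)$. The Poisson and conjugate Poisson kernels are $P_r(\theta) = \frac{1-r^2}{1-2r\cos\theta + r^2}$ and $Q_r(\theta) = \frac{2r\sin\theta}{1-2r\cos\theta + r^2}$. The bicomplex numbers $\mathbb{B}$ are $\mathbb{C}^2$ with the usual addition and scalar multiplication and with the commutative product $(z_1,z_2)(w_1,w_2) = (z_1w_1 - z_2w_2,\, z_1w_2+z_2w_1)$; one writes $(z_1,z_2)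 = z_1 + j z_2$, so $j^2=-1$ and $j$ commutes with $i$. Put $p^\pm := \frac12(1 \pm ji)\in\mathbb{B}$ (the exponents $p_k^\pm$ are real numbers unrelated to these). Every $z\in\mathbb{B}$ has a unique representation $z = p^+ z^+ + p^- z^-$ with $z^\pm\in\mathbb{C}$; for a $\mathbb{B}$-valued function $w$, the complex-valued functions $w^\pm$ are the components in this representation, and $(w)_b^\pm$ denotes the distributional boundary value of $w^\pm$. The norm on $\mathbb{B}$ is $\|z\|_{\mathbb{B}} := \sqrt{(|z^+|^2+|z^-|^2)/2}$, and $L^1(D,\mathbb{B})$ is the set of $f:D\to\mathbb{B}$ with $\iint_D \|f(z)\|_{\mathbb{B}}\,dx\,dy<\infty$. The bicomplex operator $\bar\partial$ is $\bar\partial := p^+\frac{\partial}{\partial z} + p^-\frac{\partial}{\partial \bar z}$, where $\frac{\partial}{\partial z},\frac{\partial}{\partial\bar z}$ are the complex Wirtinger derivatives; thus $\bar\partial^k w = p^+ \frac{\partial^k w^+}{\partial z^k} + p^- \frac{\partial^k w^-}{\partial \bar z^k}$. Overlines on numbers or complex-valued functions denote ordinary complex conjugation.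
   Formalization: The factor −1/(2π) of the area integrals is corrected to (−1)^n/(2π(n−1)!) (as printed it fails for n ≥ 2); f(ζ)/|ζ| is also assumed integrable on D (else the formula and the value at 0 can fail to exist); b_0^± are assumed real (else no solution). *)

theory Defs
  imports "HOL-Analysis.Analysis"
begin

section \<open>Bicomplex numbers\<close>

text \<open>The pair \<open>(z1, z2)\<close> is \<open>z1 + j z2\<close>. Addition and scalar multiplication are those of the
  product space; only the multiplication has to be added.\<close>

type_synonym bicomplex = "complex \<times> complex"

definition bc_mult :: "bicomplex \<Rightarrow> bicomplex \<Rightarrow> bicomplex" (infixl "\<odot>" 70) where
  "z \<odot> w = (fst z * fst w - snd z * snd w, fst z * snd w + snd z * fst w)"

definition bc_of :: "complex \<Rightarrow> bicomplex" where
  "bc_of a = (a, 0)"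

definition bc_j :: bicomplex where
  "bc_j = (0, 1)"

definition bc_pp :: bicomplex where
  "bc_pp = bc_of (1/2) \<odot> (bc_of 1 + bc_j \<odot> bc_of \<i>)"

definition bc_pm :: bicomplex where
  "bc_pm = bc_of (1/2) \<odot> (bc_of 1 - bc_j \<odot> bc_of \<i>)"

text \<open>The components \<open>z\<^sup>+\<close> and \<open>z\<^sup>-\<close>; they are characterised by lemma \<open>bc_decomp_iff\<close> below.\<close>

definition bc_plus :: "bicomplex \<Rightarrow> complex" where
  "bc_plus z = fst z - \<i> * snd z"

definition bc_minus :: "bicomplex \<Rightarrow> complex" where
  "bc_minus z = fst z + \<i> * snd z"

lemma bc_decomp_iff:
  "z = bc_pp \<odot> bc_of a + bc_pm \<odot> bc_of b \<longleftrightarrow> a = bc_plus z \<and> b = bc_minus z"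
proof
  assume "z = bc_pp \<odot> bc_of a + bc_pm \<odot> bc_of b"
  then show "a = bc_plus z \<and> b = bc_minus z"
    by (auto simp: bc_pp_def bc_pm_def bc_of_def bc_j_def bc_mult_def bc_plus_def bc_minus_def
        field_simps)
next
  assume "a = bc_plus z \<and> b = bc_minus z"
  then show "z = bc_pp \<odot> bc_of a + bc_pm \<odot> bc_of b"
    by (cases z) (auto simp: bc_pp_def bc_pm_def bc_of_def bc_j_def bc_mult_def bc_plus_def
        bc_minus_def field_simps)
qed

definition bc_norm :: "bicomplex \<Rightarrow> real" where
  "bc_norm z = sqrt (((cmod (bc_plus z))\<^sup>2 + (cmod (bc_minus z))\<^sup>2) / 2)"

lemma bc_norm_eq_norm: "bc_norm z = norm z"
proof -
  have "((cmod (bc_plus z))\<^sup>2 + (cmod (bc_minus z))\<^sup>2) / 2 = (cmod (fst z))\<^sup>2 + (cmod (snd z))\<^sup>2"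
    unfolding cmod_power2 by (simp add: bc_plus_def bc_minus_def power2_eq_square algebra_simps)
  then show ?thesis
    by (simp add: bc_norm_def norm_prod_def)
qed


section \<open>The unit disk and Lebesgue classes of functions on it\<close>

abbreviation unit_disk :: "complex set" where
  "unit_disk \<equiv> ball 0 1"

definition bc_L1 :: "(complex \<Rightarrow> bicomplex) \<Rightarrow> bool" where
  "bc_L1 f \<longleftrightarrow> f \<in> borel_measurable (lebesgue_on unit_disk)
     \<and> integrable (lebesgue_on unit_disk) (\<lambda>z. bc_norm (f z))"

definition locally_integrable :: "(complex \<Rightarrow> complex) \<Rightarrow> bool" where
  "locally_integrable u \<longleftrightarrow>
     (\<forall>K. compact K \<and> K \<subseteq> unit_disk \<longrightarrow> set_integrable lebesgue K u)"

text \<open>A locally integrable function is determined only up to null sets, so its value at a point is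
  taken at Lebesgue points; it is the ordinary value wherever the function is continuous.\<close>

definition has_value_at :: "(complex \<Rightarrow> complex) \<Rightarrow> complex \<Rightarrow> complex \<Rightarrow> bool" where
  "has_value_at u z a \<longleftrightarrow>
     ((\<lambda>\<epsilon>. (LINT \<zeta>:ball z \<epsilon>|lebesgue. cmod (u \<zeta> - a)) / measure lebesgue (ball z \<epsilon>)) \<longlongrightarrow> 0)
       (at_right 0)"


section \<open>Weak Wirtinger derivatives\<close>

definition dx :: "(complex \<Rightarrow> complex) \<Rightarrow> complex \<Rightarrow> complex" where
  "dx \<phi> z = frechet_derivative \<phi> (at z) 1"

definition dy :: "(complex \<Rightarrow> complex) \<Rightarrow> complex \<Rightarrow> complex" where
  "dy \<phi> z = frechet_derivative \<phi> (at z) \<i>"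

definition d_z :: "(complex \<Rightarrow> complex) \<Rightarrow> complex \<Rightarrow> complex" where
  "d_z \<phi> z = (dx \<phi> z - \<i> * dy \<phi> z) / 2"

definition d_zbar :: "(complex \<Rightarrow> complex) \<Rightarrow> complex \<Rightarrow> complex" where
  "d_zbar \<phi> z = (dx \<phi> z + \<i> * dy \<phi> z) / 2"

text \<open>Differentiability is real (Frechet) differentiability on the plane, and iterating it through
  all mixed partial derivatives gives \<open>C\<^sup>\<infinity>\<close>.\<close>

coinductive plane_smooth :: "(complex \<Rightarrow> complex) \<Rightarrow> bool" where
  "(\<forall>z. \<phi> differentiable (at z)) \<Longrightarrow> plane_smooth (dx \<phi>) \<Longrightarrow> plane_smooth (dy \<phi>)
     \<Longrightarrow> plane_smooth \<phi>"

definition disk_test :: "(complex \<Rightarrow> complex) \<Rightarrow> bool" where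
  "disk_test \<phi> \<longleftrightarrow> plane_smooth \<phi> \<and> (\<exists>K. compact K \<and> K \<subseteq> unit_disk \<and> (\<forall>z. z \<notin> K \<longrightarrow> \<phi> z = 0))"

text \<open>\<open>g\<close> represents the \<open>k\<close>-th derivative in the sense of distributions on the disk. For
  \<open>k = 0\<close> this says that \<open>g = u\<close> almost everywhere.\<close>

definition weak_d_z :: "nat \<Rightarrow> (complex \<Rightarrow> complex) \<Rightarrow> (complex \<Rightarrow> complex) \<Rightarrow> bool" where
  "weak_d_z k u g \<longleftrightarrow> locally_integrable u \<and> locally_integrable g \<and>
     (\<forall>\<phi>. disk_test \<phi> \<longrightarrow>
        (LINT z:unit_disk|lebesgue. u z * (d_z ^^ k) \<phi> z)
          = (-1) ^ k * (LINT z:unit_disk|lebesgue. g z * \<phi> z))"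

definition weak_d_zbar :: "nat \<Rightarrow> (complex \<Rightarrow> complex) \<Rightarrow> (complex \<Rightarrow> complex) \<Rightarrow> bool" where
  "weak_d_zbar k u g \<longleftrightarrow> locally_integrable u \<and> locally_integrable g \<and>
     (\<forall>\<phi>. disk_test \<phi> \<longrightarrow>
        (LINT z:unit_disk|lebesgue. u z * (d_zbar ^^ k) \<phi> z)
          = (-1) ^ k * (LINT z:unit_disk|lebesgue. g z * \<phi> z))"

text \<open>The \<open>k\<close>-th power of the bicomplex operator \<open>p\<^sup>+ d_z + p\<^sup>- d_zbar\<close> maps \<open>w\<close> to \<open>g\<close>. It acts
  componentwise because \<open>p\<^sup>+\<close> and \<open>p\<^sup>-\<close> are idempotent with product 0 and sum 1.\<close>

definition bc_dbar :: "nat \<Rightarrow> (complex \<Rightarrow> bicomplex) \<Rightarrow> (complex \<Rightarrow> bicomplex) \<Rightarrow> bool" where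
  "bc_dbar k w g \<longleftrightarrow>
     weak_d_z k (\<lambda>z. bc_plus (w z)) (\<lambda>z. bc_plus (g z)) \<and>
     weak_d_zbar k (\<lambda>z. bc_minus (w z)) (\<lambda>z. bc_minus (g z))"


section \<open>Distributions on the unit circle\<close>

text \<open>A function on the circle is a \<open>2\<pi>\<close>-periodic function of the angle.\<close>

definition vderiv :: "(real \<Rightarrow> complex) \<Rightarrow> real \<Rightarrow> complex" where
  "vderiv \<gamma> t = vector_derivative \<gamma> (at t)"

definition circle_test :: "(real \<Rightarrow> complex) set" where
  "circle_test = {\<gamma>. (\<forall>t. \<gamma> (t + 2 * pi) = \<gamma> t) \<and> (\<forall>m t. (vderiv ^^ m) \<gamma> differentiable (at t))}"

text \<open>\<open>C\<^sup>\<infinity>\<close> of the circle is metrizable (uniform convergence of every derivative), so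
  continuity is sequential continuity. The values of a functional outside \<open>circle_test\<close> are
  irrelevant.\<close>

definition circle_distribution :: "((real \<Rightarrow> complex) \<Rightarrow> complex) \<Rightarrow> bool" where
  "circle_distribution b \<longleftrightarrow>
     (\<forall>\<gamma>\<in>circle_test. \<forall>\<delta>\<in>circle_test. \<forall>x y. b (\<lambda>t. x * \<gamma> t + y * \<delta> t) = x * b \<gamma> + y * b \<delta>) \<and>
     (\<forall>\<Gamma> \<gamma>. (\<forall>i::nat. \<Gamma> i \<in> circle_test) \<and> \<gamma> \<in> circle_test \<and>
        (\<forall>m. uniform_limit UNIV (\<lambda>i. (vderiv ^^ m) (\<Gamma> i)) ((vderiv ^^ m) \<gamma>) sequentially)
        \<longrightarrow> (\<lambda>i. b (\<Gamma> i)) \<longlonglongrightarrow> b \<gamma>)"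

definition is_real_part ::
  "((real \<Rightarrow> complex) \<Rightarrow> complex) \<Rightarrow> ((real \<Rightarrow> complex) \<Rightarrow> complex) \<Rightarrow> bool" where
  "is_real_part b h \<longleftrightarrow>
     (\<forall>\<gamma>\<in>circle_test. (\<forall>t. \<gamma> t \<in> \<real>) \<longrightarrow> b \<gamma> = of_real (Re (h \<gamma>)))"

definition real_distribution :: "((real \<Rightarrow> complex) \<Rightarrow> complex) \<Rightarrow> bool" where
  "real_distribution b \<longleftrightarrow> circle_distribution b \<and>
     (\<forall>\<gamma>\<in>circle_test. (\<forall>t. \<gamma> t \<in> \<real>) \<longrightarrow> b \<gamma> \<in> \<real>)"

definition has_boundary_value ::
  "(complex \<Rightarrow> complex) \<Rightarrow> ((real \<Rightarrow> complex) \<Rightarrow> complex) \<Rightarrow> bool" where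
  "has_boundary_value h hb \<longleftrightarrow>
     (\<forall>r\<in>{0<..<1}. set_integrable lebesgue {0..2 * pi} (\<lambda>\<theta>. h (of_real r * cis \<theta>))) \<and>
     (\<forall>\<gamma>\<in>circle_test.
        ((\<lambda>r. LINT \<theta>:{0..2 * pi}|lebesgue. h (of_real r * cis \<theta>) * \<gamma> \<theta>) \<longlongrightarrow> hb \<gamma>) (at_left 1))"


section \<open>Hardy spaces and kernels\<close>

definition Hp :: "real \<Rightarrow> (complex \<Rightarrow> complex) set" where
  "Hp p = {h. h holomorphic_on unit_disk \<and>
     bdd_above ((\<lambda>r. LINT \<theta>:{0..2 * pi}|lebesgue. cmod (h (of_real r * cis \<theta>)) powr p) ` {0<..<1})}"

definition Re_Hp_boundary :: "real \<Rightarrow> ((real \<Rightarrow> complex) \<Rightarrow> complex) set" where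
  "Re_Hp_boundary p = {b. circle_distribution b \<and>
     (\<exists>h\<in>Hp p. \<exists>hb. has_boundary_value h hb \<and> is_real_part b hb)}"

definition poisson_P :: "real \<Rightarrow> real \<Rightarrow> real" where
  "poisson_P r \<theta> = (1 - r\<^sup>2) / (1 - 2 * r * cos \<theta> + r\<^sup>2)"

definition poisson_Q :: "real \<Rightarrow> real \<Rightarrow> real" where
  "poisson_Q r \<theta> = 2 * r * sin \<theta> / (1 - 2 * r * cos \<theta> + r\<^sup>2)"

text \<open>The test function paired with \<open>b\<^sub>k\<close>, with \<open>r\<close> and \<open>\<theta>\<close> the polar coordinates of \<open>z\<close>. At
  \<open>z = 0\<close> it does not depend on the choice of \<open>\<theta>\<close>.\<close>

definition schwarz_test :: "nat \<Rightarrow> complex \<Rightarrow> real \<Rightarrow> complex" where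
  "schwarz_test k z = (let r = cmod z; \<theta> = Arg z in
     (\<lambda>t. (of_real (poisson_P r (\<theta> - t)) + \<i> * of_real (poisson_Q r (\<theta> - t)))
            * (cis t - of_real r * cis \<theta> + cnj (cis t - of_real r * cis \<theta>)) ^ k))"


section \<open>The Schwarz boundary value problem\<close>

text \<open>Derivatives of order \<open>k\<close> are weak and hence almost-everywhere classes; \<open>g\<close> is the
  representative for which the circle integrals are taken. For integrable \<open>f\<close> a fixed
  representative, in particular the function given by an area integral, need not even be defined on
  every circle \<open>|z| = r\<close>.

  Two facts about the solution formula built on this problem. Each application of d_zbar to
  \<open>(\<zeta> - z + cnj (\<zeta> - z)) ^ (n - 1)\<close> brings down a factor and a sign, so its area integral
  carries \<open>(-1) ^ n / (2 * pi * fact (n - 1))\<close>. And \<open>f \<in> L\<^sup>1\<close> alone does not make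
  \<open>f \<zeta> / \<zeta>\<close> integrable at 0: for \<open>f\<^sup>- \<zeta> = \<i> / cnj \<zeta>\<close>, \<open>n = 1\<close>, every weak solution has minus
  component \<open>2 * \<i> * ln (cmod z)\<close> plus a holomorphic function, which has no value at 0.\<close>

definition schwarz_solution ::
  "nat \<Rightarrow> (complex \<Rightarrow> bicomplex) \<Rightarrow>
   (nat \<Rightarrow> (real \<Rightarrow> complex) \<Rightarrow> complex) \<Rightarrow> (nat \<Rightarrow> (real \<Rightarrow> complex) \<Rightarrow> complex) \<Rightarrow>
   (nat \<Rightarrow> real) \<Rightarrow> (nat \<Rightarrow> real) \<Rightarrow> (complex \<Rightarrow> bicomplex) \<Rightarrow> bool" where
  "schwarz_solution n f bp bm cp cm w \<longleftrightarrow>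
     bc_dbar n w f \<and>
     (\<forall>k<n. \<exists>g. bc_dbar k w g \<and>
        (\<exists>h. has_boundary_value (\<lambda>z. bc_plus (g z)) h \<and> is_real_part (bp k) h) \<and>
        (\<exists>h. has_boundary_value (\<lambda>z. bc_minus (g z)) h \<and> is_real_part (bm k) h) \<and>
        (\<exists>a. has_value_at (\<lambda>z. bc_plus (g z)) 0 a \<and> Im a = cp k) \<and>
        (\<exists>a. has_value_at (\<lambda>z. bc_minus (g z)) 0 a \<and> Im a = cm k))"

end

theory Submission imports "HOL-Complex_Analysis.Complex_Analysis" Defs begin

text \<open>Conjugating the plus component leaves one scalar problem for powers of the weak derivative
  d_zbar. Write \<open>x = z + cnj z\<close>, so that \<open>d_zbar x = 1\<close>.

  Existence: if \<open>d_zbar u\<^sub>a = x ^ a * g\<close> for all \<open>a\<close>, then the binomial combinations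
  \<open>(- 1) ^ m / m! * (\<Sum>a. (m choose a) * (- x) ^ (m - a) * u\<^sub>a)\<close> are successive primitives of \<open>g\<close>. If
  the boundary value of \<open>u\<^sub>a\<close> has real part \<open>(2 * cos \<theta>) ^ a * b\<close>, the alternating binomial sum makes
  that of the combination vanish for \<open>m > 0\<close>. This is applied to the Schwarz integrals of
  \<open>(2 * cos \<theta>) ^ a * b\<^sub>k\<close>, which are power series in \<open>z\<close>, and to the area potentials of
  \<open>(\<zeta> + cnj \<zeta>) ^ a * f \<zeta> / \<zeta>\<close>, whose pairings with test functions are computed by Fubini on almost
  every circle and converge at the boundary by dominated convergence.

  Uniqueness: going down from order \<open>n\<close>, the difference of two \<open>k\<close>-th derivatives is annihilated by
  d_zbar, hence holomorphic almost everywhere by Weyl's lemma. Testing its boundary value with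
  \<open>cos (l * \<theta>)\<close> and \<open>sin (l * \<theta>)\<close> determines all Taylor coefficients but the imaginary part of the
  constant one, which the value at the origin fixes.\<close>

section \<open>Test functions on the circle\<close>

text \<open>All kernels come from one function, the Cayley map \<open>(1 + q) / (1 - q)\<close> with
  Taylor coefficients 1, 2, 2, ...: \<open>q = z * cis (- t)\<close> gives the kernel with real part
  P and imaginary part Q, while \<open>q = z / \<zeta>\<close> and
  \<open>q = z * cnj \<zeta>\<close> give the two area kernels. Expanding in q turns every pairing
  on a circle into a series in Fourier coefficients of the test function. These decrease rapidly, so
  distributions act term by term and radial limits are limits of coefficients. The two area kernels
  belong together: for \<open>cmod z = 1\<close> the second is minus the conjugate of the first, so
  against a density and its conjugate their sum is purely imaginary on the circle; at
  \<open>z = 0\<close> both equal 1 and the sum is real. Hence the area part adds nothing to the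
  prescribed data. The obstacle is that an integrable density gives no pointwise control of its
  potential. At the origin only means over small balls are estimated. On circles the singularity is
  averaged over the angle first, which leaves \<open>1 / sqrt \<bar>cmod \<zeta> - r\<bar>\<close>;
  this is integrable in r with a bound independent of \<zeta>, so almost every circle is
  admissible.\<close>

lemma vderiv_eqI: "(\<gamma> has_vector_derivative D) (at t) \<Longrightarrow> vderiv \<gamma> t = D"
  unfolding vderiv_def by (rule vector_derivative_at)

text \<open>An explicit tower \<open>D\<close> of successive derivatives settles smoothness and
  computes all iterates of \<open>vderiv\<close> at once; periodicity has to be checked only at the
  bottom of the tower.\<close>

lemma circle_testI:
  assumes "\<And>t. D 0 (t + 2 * pi) = D 0 t"
    and D: "\<And>m t. (D m has_vector_derivative D (Suc m) t) (at t)"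
  shows "D 0 \<in> circle_test" "(vderiv ^^ m) (D 0) = D m"
proof -
  have eq: "(vderiv ^^ m) (D 0) = D m" for m
  proof (induction m)
    case (Suc m)
    have "vderiv (D m) = D (Suc m)" using vderiv_eqI[OF D] by auto
    then show ?case using Suc by simp
  qed simp
  show "(vderiv ^^ m) (D 0) = D m" by (rule eq)
  show "D 0 \<in> circle_test"
    unfolding circle_test_def using assms(1) D
    by (auto simp: eq intro: differentiableI_vector)
qed

lemma circle_test_vderiv:
  assumes "\<gamma> \<in> circle_test"
  shows "((vderiv ^^ m) \<gamma> has_vector_derivative (vderiv ^^ Suc m) \<gamma> t) (at t)"
  using assms unfolding circle_test_def
  by (simp add: vderiv_def vector_derivative_works[symmetric])

lemma circle_test_deriv: "\<gamma> \<in> circle_test \<Longrightarrow> (\<gamma> has_vector_derivative vderiv \<gamma> t) (at t)"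
  using circle_test_vderiv[of \<gamma> 0] by simp

lemma circle_test_periodic: "\<gamma> \<in> circle_test \<Longrightarrow> \<gamma> (t + 2 * pi) = \<gamma> t"
  by (simp add: circle_test_def)

lemma vderiv_in_circle_test:
  assumes "\<gamma> \<in> circle_test" shows "vderiv \<gamma> \<in> circle_test"
proof -
  have "vderiv \<gamma> (t + 2 * pi) = vderiv \<gamma> t" for t
  proof -
    have "((\<lambda>s. \<gamma> (s + 2 * pi)) has_vector_derivative vderiv \<gamma> (t + 2 * pi)) (at t)"
    proof -
      have "((\<lambda>s. s + 2 * pi) has_vector_derivative 1) (at t)"
        by (auto intro!: derivative_eq_intros simp: has_vector_derivative_def)
      from vector_diff_chain_at[OF this circle_test_deriv[OF assms]] show ?thesis by (simp add: o_def)
    qed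
    then show ?thesis
      using circle_test_deriv[OF assms, of t] circle_test_periodic[OF assms]
      by (metis (no_types, lifting) ext vector_derivative_at)
  qed
  moreover have "(vderiv ^^ m) (vderiv \<gamma>) = (vderiv ^^ Suc m) \<gamma>" for m
    by (simp add: funpow_Suc_right del: funpow.simps)
  ultimately show ?thesis
    using assms unfolding circle_test_def by (auto simp del: funpow.simps)
qed

lemma circle_test_lincomb:
  assumes "\<gamma> \<in> circle_test" "\<delta> \<in> circle_test"
  shows "(\<lambda>t. x * \<gamma> t + y * \<delta> t) \<in> circle_test"
    and "(vderiv ^^ m) (\<lambda>t. x * \<gamma> t + y * \<delta> t)
           = (\<lambda>t. x * (vderiv ^^ m) \<gamma> t + y * (vderiv ^^ m) \<delta> t)"
proof -
  define D where "D = (\<lambda>m t. x * (vderiv ^^ m) \<gamma> t + y * (vderiv ^^ m) \<delta> t)"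
  have p: "D 0 (t + 2 * pi) = D 0 t" for t
    using assms by (simp add: D_def circle_test_def)
  have d: "(D m has_vector_derivative D (Suc m) t) (at t)" for m t
    unfolding D_def by (intro has_vector_derivative_add has_vector_derivative_mult_right circle_test_vderiv assms)
  show "(\<lambda>t. x * \<gamma> t + y * \<delta> t) \<in> circle_test"
    using circle_testI(1)[of D, OF p d] by (simp add: D_def)
  show "(vderiv ^^ m) (\<lambda>t. x * \<gamma> t + y * \<delta> t)
           = (\<lambda>t. x * (vderiv ^^ m) \<gamma> t + y * (vderiv ^^ m) \<delta> t)"
    using circle_testI(2)[of D, OF p d, of m] by (simp add: D_def)
qed

lemma circle_test_add: "\<gamma> \<in> circle_test \<Longrightarrow> \<delta> \<in> circle_test \<Longrightarrow> (\<lambda>t. \<gamma> t + \<delta> t) \<in> circle_test"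
  using circle_test_lincomb(1)[of \<gamma> \<delta> 1 1] by simp

lemma circle_test_cmult: "\<gamma> \<in> circle_test \<Longrightarrow> (\<lambda>t. x * \<gamma> t) \<in> circle_test"
  using circle_test_lincomb(1)[of \<gamma> \<gamma> x 0] by simp

lemma circle_test_sum:
  assumes "finite A" "\<And>a. a \<in> A \<Longrightarrow> \<gamma> a \<in> circle_test"
  shows "(\<lambda>t. \<Sum>a\<in>A. x a * \<gamma> a t) \<in> circle_test"
  using assms
proof (induction A rule: finite_induct)
  case empty
  have "(\<lambda>m t. 0 :: complex) (0::nat) \<in> circle_test"
    by (rule circle_testI) auto
  then show ?case by simp
next
  case (insert a A)
  then show ?case using circle_test_add[OF circle_test_cmult[of "\<gamma> a" "x a"]] by simp
qed

lemma circle_test_continuous: "\<gamma> \<in> circle_test \<Longrightarrow> continuous_on UNIV \<gamma>"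
  by (intro continuous_at_imp_continuous_on ballI has_vector_derivative_continuous[OF circle_test_deriv])

lemma circle_test_measurable [measurable_dest]: "\<gamma> \<in> circle_test \<Longrightarrow> \<gamma> \<in> borel_measurable borel"
  by (rule borel_measurable_continuous_onI) (rule circle_test_continuous)

text \<open>Reduction of an angle difference modulo \<open>2 * pi\<close>. The representative is
  taken in the symmetric interval because \<open>cis_chord\<close> compares arc and chord
  there.\<close>

lemma circle_test_shift:
  assumes "\<gamma> \<in> circle_test" shows "\<exists>s\<in>{-pi..pi}. \<exists>k::int. x - t = s + 2 * pi * k" "\<gamma> (t + 2 * pi * of_int k) = \<gamma> t"
proof -
  define k where "k = \<lfloor>(x - t + pi) / (2 * pi)\<rfloor>"
  have "of_int k \<le> (x - t + pi) / (2 * pi)" "(x - t + pi) / (2 * pi) < of_int k + 1"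
    unfolding k_def by linarith+
  then have "2 * pi * of_int k \<le> x - t + pi" "x - t + pi < 2 * pi * of_int k + 2 * pi"
    by (auto simp: field_simps)
  then show "\<exists>s\<in>{-pi..pi}. \<exists>k::int. x - t = s + 2 * pi * k"
    by (intro bexI[of _ "x - t - 2 * pi * of_int k"]) auto
  have n: "\<gamma> (t + 2 * pi * real n) = \<gamma> t" for n t
  proof (induction n)
    case (Suc n)
    have "\<gamma> ((t + 2 * pi * real n) + 2 * pi) = \<gamma> (t + 2 * pi * real n)"
      by (rule circle_test_periodic[OF assms])
    then show ?case using Suc by (simp add: algebra_simps)
  qed simp
  show "\<gamma> (t + 2 * pi * of_int k) = \<gamma> t" for k
  proof (cases "k \<ge> 0")
    case True then show ?thesis using n[of t "nat k"] by simp
  next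
    case False then show ?thesis using n[of "t + 2 * pi * of_int k" "nat (-k)"] by simp
  qed
qed

lemma circle_test_bounded:
  assumes "\<gamma> \<in> circle_test" shows "\<exists>B\<ge>0. \<forall>t. cmod (\<gamma> t) \<le> B"
proof -
  have "compact (\<gamma> ` {-pi..pi})"
    by (intro compact_continuous_image continuous_on_subset[OF circle_test_continuous[OF assms]]) auto
  then obtain B where B: "\<And>s. s \<in> {-pi..pi} \<Longrightarrow> cmod (\<gamma> s) \<le> B"
    by (meson bounded_iff compact_imp_bounded image_eqI)
  have "cmod (\<gamma> t) \<le> B" for t
  proof -
    obtain s k where "s \<in> {-pi..pi}" "t - 0 = s + 2 * pi * of_int k"
      using circle_test_shift(1)[OF assms, of t 0] by blast
    then show ?thesis using B[of s] circle_test_shift(2)[OF assms, of s k] by simp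
  qed
  then show ?thesis using norm_ge_zero order_trans by blast
qed

lemma has_vector_derivative_cis:
  "((\<lambda>t. cis (a * t)) has_vector_derivative \<i> * of_real a * cis (a * t)) (at t)"
proof -
  have "((\<lambda>z. exp (\<i> * of_real a * z)) has_field_derivative \<i> * of_real a * exp (\<i> * of_real a * of_real t)) (at (of_real t))"
    by (auto intro!: derivative_eq_intros)
  from has_vector_derivative_real_field[OF this] show ?thesis
    by (simp add: cis_conv_exp mult.assoc)
qed

text \<open>Differentiating \<open>cis (\<sigma> * t) * \<gamma> t\<close> gives the same shape with
  another test function in place of \<gamma>. An induction on the order that generalises over
  \<gamma> therefore replaces the Leibniz formula. The factor \<open>1 *\<close> keeps the new test
  function literally in the form of \<open>circle_test_lincomb\<close>.\<close>

lemma circle_test_mult_cis: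
  assumes "\<gamma> \<in> circle_test" "\<sigma> \<in> {1, -1}"
  shows "(\<lambda>t. cis (\<sigma> * t) * \<gamma> t) \<in> circle_test"
    and "vderiv (\<lambda>t. cis (\<sigma> * t) * \<gamma> t) = (\<lambda>t. cis (\<sigma> * t) * (\<i> * \<sigma> * \<gamma> t + 1 * vderiv \<gamma> t))"
proof -
  have d: "((\<lambda>t. cis (\<sigma> * t) * \<gamma> t) has_vector_derivative
            cis (\<sigma> * t) * (\<i> * \<sigma> * \<gamma> t + 1 * vderiv \<gamma> t)) (at t)" if "\<gamma> \<in> circle_test" for \<gamma> t
  proof -
    from has_vector_derivative_mult[OF has_vector_derivative_cis[of \<sigma>] circle_test_deriv[OF that, of t]]
    show ?thesis by (simp add: algebra_simps)
  qed
  show eq: "vderiv (\<lambda>t. cis (\<sigma> * t) * \<gamma> t) = (\<lambda>t. cis (\<sigma> * t) * (\<i> * \<sigma> * \<gamma> t + 1 * vderiv \<gamma> t))"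
    using vderiv_eqI[OF d[OF assms(1)]] by auto
  have diff: "(vderiv ^^ m) (\<lambda>t. cis (\<sigma> * t) * \<gamma> t) differentiable (at t)" if "\<gamma> \<in> circle_test" for m t \<gamma>
    using that
  proof (induction m arbitrary: \<gamma>)
    case 0 show ?case using differentiableI_vector[OF d[OF 0]] by simp
  next
    case (Suc m)
    have "vderiv (\<lambda>t. cis (\<sigma> * t) * \<gamma> t) = (\<lambda>t. cis (\<sigma> * t) * (\<i> * \<sigma> * \<gamma> t + 1 * vderiv \<gamma> t))"
      using vderiv_eqI[OF d[OF Suc.prems]] by auto
    then show ?case
      using Suc.IH[OF circle_test_lincomb(1)[OF Suc.prems vderiv_in_circle_test[OF Suc.prems], of "\<i> * \<sigma>" 1]]
      by (simp add: funpow_Suc_right del: funpow.simps)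
  qed
  have "cis (\<sigma> * (t + 2 * pi)) = cis (\<sigma> * t)" for t
  proof -
    have "cis (\<sigma> * (t + 2 * pi)) = cis (\<sigma> * t) * cis (\<sigma> * (2 * pi))"
      by (simp add: cis_mult distrib_left)
    also have "cis (\<sigma> * (2 * pi)) = 1" using assms(2) by (auto simp: complex_eq_iff)
    finally show ?thesis by simp
  qed
  then show "(\<lambda>t. cis (\<sigma> * t) * \<gamma> t) \<in> circle_test"
    unfolding circle_test_def using diff[OF assms(1)] circle_test_periodic[OF assms(1)] by auto
qed

lemma two_cos: "complex_of_real (2 * cos t) = cis t + cis (- t)"
  by (simp add: complex_eq_iff)

lemma circle_test_mult_2cos:
  assumes "\<gamma> \<in> circle_test" shows "(\<lambda>t. of_real (2 * cos t) * \<gamma> t) \<in> circle_test"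
proof -
  have "(\<lambda>t. cis (1 * t) * \<gamma> t + cis ((-1) * t) * \<gamma> t) \<in> circle_test"
    by (intro circle_test_add circle_test_mult_cis assms) auto
  then show ?thesis by (simp add: two_cos ring_distribs del: of_real_mult)
qed

lemma circle_test_mult_2cos_power:
  assumes "\<gamma> \<in> circle_test" shows "(\<lambda>t. of_real (2 * cos t) ^ k * \<gamma> t) \<in> circle_test"
proof (induction k)
  case (Suc k)
  from circle_test_mult_2cos[OF this] show ?case by (simp add: mult.assoc)
qed (use assms in simp)

section \<open>Rapidly decreasing trigonometric series\<close>

text \<open>Only frequencies \<open>- l\<close> with \<open>l \<ge> 0\<close> occur, since this is
  the shape of the Schwarz kernel as a function of the angle: its coefficients are multiples of
  \<open>z ^ l\<close>, so pairing it with a distribution yields a power series in z.\<close>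

definition tser :: "(nat \<Rightarrow> complex) \<Rightarrow> real \<Rightarrow> complex" where
  "tser c t = (\<Sum>l. c l * cis (- (real l * t)))"

text \<open>Weights of every polynomial order make the class stable under termwise differentiation,
  so the series stay inside \<open>circle_test\<close>.\<close>

definition rapid :: "(nat \<Rightarrow> complex) \<Rightarrow> bool" where
  "rapid c \<longleftrightarrow> (\<forall>m. summable (\<lambda>l. real l ^ m * cmod (c l)))"

lemma rapid_imp_summable: "rapid c \<Longrightarrow> summable (\<lambda>l. cmod (c l))"
  unfolding rapid_def by (drule spec[of _ 0]) simp

lemma rapid_deriv: assumes "rapid c" shows "rapid (\<lambda>l. (- \<i> * of_nat l) ^ k * c l)"
  unfolding rapid_def
proof
  fix m
  have "summable (\<lambda>l. real l ^ (m + k) * cmod (c l))"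
    using assms unfolding rapid_def by blast
  then show "summable (\<lambda>l. real l ^ m * cmod ((- \<i> * of_nat l) ^ k * c l))"
    by (simp add: norm_mult norm_power power_add mult.assoc)
qed

lemma rapid_bounded:
  assumes "rapid d" "\<And>l. cmod (c l) \<le> B * cmod (d l)" shows "rapid c"
  unfolding rapid_def
proof
  fix m
  have "summable (\<lambda>l. B * (real l ^ m * cmod (d l)))"
    using assms(1) unfolding rapid_def by (intro summable_mult) blast
  then show "summable (\<lambda>l. real l ^ m * cmod (c l))"
  proof (rule summable_comparison_test')
    fix l show "norm (real l ^ m * cmod (c l)) \<le> B * (real l ^ m * cmod (d l))"
      using mult_left_mono[OF assms(2)[of l], of "real l ^ m"] by (simp add: mult_ac)
  qed
qed

lemma tser_summable: "rapid c \<Longrightarrow> summable (\<lambda>l. c l * cis (- (real l * t)))"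
  by (rule summable_norm_cancel) (simp add: norm_mult rapid_imp_summable)

text \<open>Termwise differentiation: \<open>rapid\<close> survives the additional factor l, so the
  differentiated series converges uniformly on the whole line by the Weierstrass M-test.\<close>

lemma tser_has_vector_derivative:
  assumes "rapid c"
  shows "(tser c has_vector_derivative tser (\<lambda>l. (- \<i> * of_nat l) * c l) t) (at t)"
proof -
  define f' where "f' = (\<lambda>n t. (- \<i> * of_nat n) * c n * cis (- (real n * t)))"
  have r: "rapid (\<lambda>l. (- \<i> * of_nat l) * c l)" using rapid_deriv[OF assms, of 1] by simp
  have 1: "((\<lambda>x. c n * cis (- (real n * x))) has_derivative (\<lambda>h. h *\<^sub>R f' n x)) (at x within UNIV)" for n x
      using has_vector_derivative_mult_right[OF has_vector_derivative_cis[of "- real n" x], of "c n"]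
      by (simp add: has_vector_derivative_def f'_def mult_ac)
  have 2: "\<forall>\<^sub>F n in sequentially. \<forall>x\<in>UNIV. \<forall>h. norm ((\<Sum>i<n. h *\<^sub>R f' i x) - h *\<^sub>R tser (\<lambda>l. (- \<i> * of_nat l) * c l) x) \<le> e * norm h"
    if e: "e > 0" for e
  proof -
    have "uniform_limit UNIV (\<lambda>n x. \<Sum>i<n. f' i x) (\<lambda>x. suminf (\<lambda>i. f' i x)) sequentially"
      by (rule Weierstrass_m_test[OF _ rapid_imp_summable[OF r]]) (simp add: f'_def norm_mult)
    then have "\<forall>\<^sub>F n in sequentially. \<forall>x\<in>UNIV. dist (\<Sum>i<n. f' i x) (suminf (\<lambda>i. f' i x)) < e"
      using e unfolding uniform_limit_iff by blast
    then show ?thesis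
    proof (rule eventually_mono, intro ballI allI)
      fix n x h assume *: "\<forall>x\<in>UNIV. dist (\<Sum>i<n. f' i x) (suminf (\<lambda>i. f' i x)) < e"
      have "norm ((\<Sum>i<n. h *\<^sub>R f' i x) - h *\<^sub>R tser (\<lambda>l. (- \<i> * of_nat l) * c l) x)
           = norm h * dist (\<Sum>i<n. f' i x) (suminf (\<lambda>i. f' i x))"
        by (simp only: tser_def f'_def dist_norm scaleR_sum_right[symmetric] scaleR_diff_right[symmetric] norm_scaleR real_norm_def)
      also have "\<dots> \<le> e * norm h" using mult_left_mono[OF less_imp_le[OF *[rule_format, of x]], of "norm h"] by (simp add: mult.commute)
      finally show "norm ((\<Sum>i<n. h *\<^sub>R f' i x) - h *\<^sub>R tser (\<lambda>l. (- \<i> * of_nat l) * c l) x) \<le> e * norm h" .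
    qed
  qed
  have 3: "(\<lambda>n. c n * cis (- (real n * 0))) sums tser c 0"
    unfolding tser_def by (rule summable_sums[OF tser_summable[OF assms]])
  obtain g where "\<forall>x\<in>UNIV. (\<lambda>n. c n * cis (- (real n * x))) sums g x \<and>
     (g has_derivative (\<lambda>h. h *\<^sub>R tser (\<lambda>l. (- \<i> * of_nat l) * c l) x)) (at x within UNIV)"
    using has_derivative_series[OF convex_UNIV 1 2 UNIV_I 3] that by blast
  then have g: "(\<lambda>n. c n * cis (- (real n * x))) sums g x"
    "(g has_derivative (\<lambda>h. h *\<^sub>R tser (\<lambda>l. (- \<i> * of_nat l) * c l) x)) (at x)" for x
    by blast+
  have "g = tser c" using g(1) by (auto simp: tser_def fun_eq_iff sums_iff)
  then show ?thesis using g(2) by (simp add: has_vector_derivative_def)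
qed

lemma tser_circle_test:
  assumes "rapid c"
  shows "tser c \<in> circle_test" "(vderiv ^^ m) (tser c) = tser (\<lambda>l. (- \<i> * of_nat l) ^ m * c l)"
proof -
  define D where "D = (\<lambda>m. tser (\<lambda>l. (- \<i> * of_nat l) ^ m * c l))"
  have D0: "D 0 = tser c" by (simp add: D_def)
  have p: "D 0 (t + 2 * pi) = D 0 t" for t
  proof -
    have "cis (- (real l * (t + 2 * pi))) = cis (- (real l * t))" for l
    proof -
      have "cis (- (real l * (t + 2 * pi))) = cis (- (real l * t)) / cis (2 * pi * real l)"
        by (simp add: cis_divide algebra_simps)
      then show ?thesis by (metis cis_multiple_2pi div_by_1 Ints_of_nat)
    qed
    then show ?thesis unfolding D0 tser_def by simp
  qed
  have d: "(D m has_vector_derivative D (Suc m) t) (at t)" for m t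
    using tser_has_vector_derivative[OF rapid_deriv[OF assms, of m]] by (simp add: D_def mult.assoc)
  show "tser c \<in> circle_test" "(vderiv ^^ m) (tser c) = tser (\<lambda>l. (- \<i> * of_nat l) ^ m * c l)"
    using circle_testI[of D, OF p d, unfolded D0] by (auto simp: D_def)
qed

section \<open>Distributions applied to trigonometric series\<close>

lemma circle_distribution_lincomb:
  "circle_distribution b \<Longrightarrow> \<gamma> \<in> circle_test \<Longrightarrow> \<delta> \<in> circle_test \<Longrightarrow>
     b (\<lambda>t. x * \<gamma> t + y * \<delta> t) = x * b \<gamma> + y * b \<delta>"
  unfolding circle_distribution_def by blast

lemma circle_distribution_tendsto:
  assumes "circle_distribution b" "\<And>i::nat. \<Gamma> i \<in> circle_test" "\<gamma> \<in> circle_test"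
    "\<And>m. uniform_limit UNIV (\<lambda>i. (vderiv ^^ m) (\<Gamma> i)) ((vderiv ^^ m) \<gamma>) sequentially"
  shows "(\<lambda>i. b (\<Gamma> i)) \<longlonglongrightarrow> b \<gamma>"
  using assms(1) unfolding circle_distribution_def by (elim conjE allE[of _ \<Gamma>] allE[of _ \<gamma>] mp) (use assms in auto)

lemma circle_distribution_sum:
  assumes b: "circle_distribution b" and "finite A" "\<And>a. a \<in> A \<Longrightarrow> \<gamma> a \<in> circle_test"
  shows "b (\<lambda>t. \<Sum>a\<in>A. x a * \<gamma> a t) = (\<Sum>a\<in>A. x a * b (\<gamma> a))"
  using assms(2,3)
proof (induction A rule: finite_induct)
  case empty
  have z: "(\<lambda>t. 0 :: complex) \<in> circle_test" using circle_test_sum[of "{}"] by simp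
  show ?case using circle_distribution_lincomb[OF b z z, of 0 0] by simp
next
  case (insert a A)
  then show ?case
    using circle_distribution_lincomb[OF b, of "\<gamma> a" "\<lambda>t. \<Sum>a\<in>A. x a * \<gamma> a t" "x a" 1]
      circle_test_sum[of A \<gamma> x] by simp
qed

text \<open>A dominated convergence theorem for distributions. Under a rapidly decreasing majorant,
  convergence of each coefficient forces uniform convergence of every derivative, which is the
  topology in which \<open>b\<close> is continuous. It serves both for partial sums and for radial
  limits.\<close>

lemma circle_distribution_tser_tendsto:
  assumes b: "circle_distribution b" and d: "rapid d"
    and bd: "\<And>i l. cmod (c i l) \<le> cmod (d l)"
    and lim: "\<And>l. (\<lambda>i. c i l) \<longlonglongrightarrow> c' l"
  shows "(\<lambda>i. b (tser (c i))) \<longlonglongrightarrow> b (tser c')"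
proof -
  have bd': "cmod (c' l) \<le> cmod (d l)" for l
    by (rule LIMSEQ_le_const2[OF tendsto_norm[OF lim]]) (use bd in auto)
  have rc: "rapid (c i)" for i by (rule rapid_bounded[OF d, of _ 1]) (use bd in simp)
  have rc': "rapid c'" by (rule rapid_bounded[OF d, of _ 1]) (use bd' in simp)
  have "uniform_limit UNIV (\<lambda>i. (vderiv ^^ m) (tser (c i))) ((vderiv ^^ m) (tser c')) sequentially" for m
  proof -
    \<comment> \<open>The sum of \<open>D i\<close> bounds the m-th derivative of the difference of
      the two series uniformly in the angle; Tannery's theorem sends this sum to 0.\<close>
    define D where "D = (\<lambda>i l. cmod ((- \<i> * of_nat l) ^ m * (c i l - c' l)))"
    have s: "summable (\<lambda>l. 2 * (real l ^ m * cmod (d l)))"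
      using d unfolding rapid_def by (intro summable_mult) blast
    have le: "D i l \<le> 2 * (real l ^ m * cmod (d l))" for i l
      using mult_left_mono[OF norm_triangle_le_diff[of "c i l" "c' l" "2 * cmod (d l)"], of "real l ^ m"] bd[of i l] bd'[of l]
      by (simp add: D_def norm_mult norm_power mult_ac)
    have sD: "summable (D i)" for i
      by (rule summable_comparison_test'[OF s, of 0]) (use le in \<open>simp add: D_def\<close>)
    have "(\<lambda>i. suminf (D i)) \<longlonglongrightarrow> suminf (\<lambda>l. 0 :: real)"
    proof -
      have "(\<lambda>i. D i l) \<longlonglongrightarrow> 0" for l
      proof -
        have "(\<lambda>i. D i l) \<longlonglongrightarrow> cmod ((- \<i> * of_nat l) ^ m * (c' l - c' l))"
          unfolding D_def by (intro tendsto_intros lim)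
        then show ?thesis by simp
      qed
      then show ?thesis
        using tannerys_theorem[where a = "\<lambda>l i. D i l" and M = "\<lambda>l. 2 * (real l ^ m * cmod (d l))"
            and b = "\<lambda>_. 0" and F = sequentially] s le
        by (auto simp: D_def intro!: always_eventually)
    qed
    then have lim0: "(\<lambda>i. suminf (D i)) \<longlonglongrightarrow> 0" by simp
    show ?thesis
      unfolding tser_circle_test(2)[OF rc] tser_circle_test(2)[OF rc'] uniform_limit_iff
    proof (intro allI impI)
      fix e :: real assume "e > 0"
      with lim0 have "\<forall>\<^sub>F i in sequentially. suminf (D i) < e"
        using order_tendstoD(2) by blast
      then show "\<forall>\<^sub>F i in sequentially. \<forall>t\<in>UNIV. dist (tser (\<lambda>l. (- \<i> * of_nat l) ^ m * c i l) t)
                    (tser (\<lambda>l. (- \<i> * of_nat l) ^ m * c' l) t) < e"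
      proof (rule eventually_mono, intro ballI)
        fix i t assume *: "suminf (D i) < e"
        have "tser (\<lambda>l. (- \<i> * of_nat l) ^ m * c i l) t - tser (\<lambda>l. (- \<i> * of_nat l) ^ m * c' l) t
            = (\<Sum>l. (- \<i> * of_nat l) ^ m * (c i l - c' l) * cis (- (real l * t)))"
          unfolding tser_def
          by (subst suminf_diff[OF tser_summable[OF rapid_deriv[OF rc]] tser_summable[OF rapid_deriv[OF rc']]])
             (simp only: left_diff_distrib right_diff_distrib)
        also have "cmod \<dots> \<le> suminf (D i)"
        proof -
          have "summable (\<lambda>l. norm ((- \<i> * of_nat l) ^ m * (c i l - c' l) * cis (- (real l * t))))"
            using sD[of i] by (simp add: D_def norm_mult)
          from summable_norm[OF this] show ?thesis by (simp add: D_def norm_mult)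
        qed
        finally show "dist (tser (\<lambda>l. (- \<i> * of_nat l) ^ m * c i l) t)
                    (tser (\<lambda>l. (- \<i> * of_nat l) ^ m * c' l) t) < e"
          using * by (simp add: dist_norm)
      qed
    qed
  qed
  then show ?thesis
    by (rule circle_distribution_tendsto[OF b tser_circle_test(1)[OF rc] tser_circle_test(1)[OF rc']])
qed

lemma tser_finite: "tser (\<lambda>l. if l < N then c l else 0) t = (\<Sum>l<N. c l * cis (- (real l * t)))"
  unfolding tser_def by (subst suminf_finite[of "{..<N}"]) auto

lemma rapid_single: "rapid (\<lambda>l. if l = k then a else 0)"
proof -
  have "summable (\<lambda>l. real l ^ m * cmod (if l = k then a else 0))" for m
    by (rule summable_finite[of "{k}"]) auto
  then show ?thesis by (simp add: rapid_def)
qed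

lemma circle_test_cis: "(\<lambda>t. cis (- (real l * t))) \<in> circle_test"
proof -
  have "tser (\<lambda>k. if k = l then 1 else 0) = (\<lambda>t. cis (- (real l * t)))"
    unfolding tser_def by (auto simp: fun_eq_iff intro!: trans[OF suminf_finite[of "{l}"]] split: if_splits)
  then show ?thesis using tser_circle_test(1)[OF rapid_single[of l 1]] by simp
qed

text \<open>Truncated coefficient sequences are dominated by \<open>c\<close> itself, so the partial
  sums converge in the topology of test functions and \<open>b\<close> may be applied term by
  term.\<close>

lemma circle_distribution_tser_sums:
  assumes b: "circle_distribution b" and c: "rapid c"
  shows "(\<lambda>l. c l * b (\<lambda>t. cis (- (real l * t)))) sums b (tser c)"
proof -
  have "(\<lambda>N. b (tser (\<lambda>l. if l < N then c l else 0))) \<longlonglongrightarrow> b (tser c)"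
  proof (rule circle_distribution_tser_tendsto[OF b c])
    show "(\<lambda>N. if l < N then c l else 0) \<longlonglongrightarrow> c l" for l
      by (rule tendsto_eventually, rule eventually_mono[OF eventually_gt_at_top[of l]]) auto
  qed auto
  moreover have "b (tser (\<lambda>l. if l < N then c l else 0)) = (\<Sum>l<N. c l * b (\<lambda>t. cis (- (real l * t))))" for N
  proof -
    have "tser (\<lambda>l. if l < N then c l else 0) = (\<lambda>t. \<Sum>l<N. c l * cis (- (real l * t)))"
      by (simp add: fun_eq_iff tser_finite)
    then show ?thesis
      using circle_distribution_sum[OF b, of "{..<N}" "\<lambda>l t. cis (- (real l * t))" c]
      by (simp add: circle_test_cis)
  qed
  ultimately show ?thesis by (simp add: sums_def)
qed

text \<open>Multiplication by a fixed smooth function is continuous on test functions. Writing the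
  factor as \<open>cis t + cis (- t)\<close> reduces this to multiplication by a single
  exponential.\<close>

lemma circle_distribution_mult_2cos:
  assumes b: "circle_distribution b"
  shows "circle_distribution (\<lambda>\<gamma>. b (\<lambda>t. of_real (2 * cos t) * \<gamma> t))"
  unfolding circle_distribution_def
proof (intro conjI ballI allI impI)
  fix \<gamma> \<delta> x y assume "\<gamma> \<in> circle_test" "\<delta> \<in> circle_test"
  then show "b (\<lambda>t. of_real (2 * cos t) * (x * \<gamma> t + y * \<delta> t)) =
     x * b (\<lambda>t. of_real (2 * cos t) * \<gamma> t) + y * b (\<lambda>t. of_real (2 * cos t) * \<delta> t)"
    using circle_distribution_lincomb[OF b circle_test_mult_2cos[of \<gamma>] circle_test_mult_2cos[of \<delta>], of x y]
    by (simp add: algebra_simps)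
next
  fix \<Gamma> :: "nat \<Rightarrow> real \<Rightarrow> complex" and \<gamma>
  assume *: "(\<forall>i. \<Gamma> i \<in> circle_test) \<and> \<gamma> \<in> circle_test \<and>
    (\<forall>m. uniform_limit UNIV (\<lambda>i. (vderiv ^^ m) (\<Gamma> i)) ((vderiv ^^ m) \<gamma>) sequentially)"
  have ul_lin: "uniform_limit UNIV (\<lambda>i t. x * (F i t :: complex) + y * G i t) (\<lambda>t. x * f t + y * g t) sequentially"
    if "uniform_limit UNIV F f sequentially" "uniform_limit UNIV G g sequentially"
    for x y and F G :: "nat \<Rightarrow> real \<Rightarrow> complex" and f g
  proof -
    have "uniform_limit UNIV (\<lambda>i t. x * F i t) (\<lambda>t. x * f t) sequentially"
         "uniform_limit UNIV (\<lambda>i t. y * G i t) (\<lambda>t. y * g t) sequentially"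
      by (rule bounded_linear.uniform_limit[OF bounded_linear_mult_right that(1)] bounded_linear.uniform_limit[OF bounded_linear_mult_right that(2)])+
    then show ?thesis by (rule uniform_limit_add)
  qed
  \<comment> \<open>The sequence and its limit are generalised in this claim because the induction
    on the order replaces them by the combinations that \<open>circle_test_mult_cis\<close>
    produces.\<close>
  have cis: "uniform_limit UNIV (\<lambda>i. (vderiv ^^ m) (\<lambda>t. cis (\<sigma> * t) * \<Gamma> i t))
      ((vderiv ^^ m) (\<lambda>t. cis (\<sigma> * t) * \<gamma> t)) sequentially"
    if "\<sigma> \<in> {1, -1}" "\<forall>i. \<Gamma> i \<in> circle_test" "\<gamma> \<in> circle_test"
      "\<forall>m. uniform_limit UNIV (\<lambda>i. (vderiv ^^ m) (\<Gamma> i)) ((vderiv ^^ m) \<gamma>) sequentially"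
    for \<sigma> :: real and m and \<Gamma> :: "nat \<Rightarrow> real \<Rightarrow> complex" and \<gamma>
    using that(2-)
  proof (induction m arbitrary: \<Gamma> \<gamma>)
    case 0
    have "uniform_limit UNIV \<Gamma> \<gamma> sequentially" using 0(3)[rule_format, of 0] by simp
    then show ?case by (simp add: uniform_limit_iff dist_norm right_diff_distrib[symmetric] norm_mult)
  next
    case (Suc m)
    have ct: "\<Gamma> i \<in> circle_test" "vderiv (\<Gamma> i) \<in> circle_test" for i
      using Suc.prems(1) by (simp_all add: vderiv_in_circle_test)
    have ct': "vderiv \<gamma> \<in> circle_test" using Suc.prems(2) by (rule vderiv_in_circle_test)
    have "uniform_limit UNIV (\<lambda>i. (vderiv ^^ m) (\<lambda>t. cis (\<sigma> * t) * (\<i> * \<sigma> * \<Gamma> i t + 1 * vderiv (\<Gamma> i) t)))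
      ((vderiv ^^ m) (\<lambda>t. cis (\<sigma> * t) * (\<i> * \<sigma> * \<gamma> t + 1 * vderiv \<gamma> t))) sequentially"
    proof (rule Suc.IH)
      show "\<forall>i. (\<lambda>t. \<i> * \<sigma> * \<Gamma> i t + 1 * vderiv (\<Gamma> i) t) \<in> circle_test"
        by (intro allI circle_test_lincomb(1) ct)
      show "(\<lambda>t. \<i> * \<sigma> * \<gamma> t + 1 * vderiv \<gamma> t) \<in> circle_test"
        by (intro circle_test_lincomb(1) ct' Suc.prems)
      show "\<forall>m. uniform_limit UNIV (\<lambda>i. (vderiv ^^ m) (\<lambda>t. \<i> * \<sigma> * \<Gamma> i t + 1 * vderiv (\<Gamma> i) t))
          ((vderiv ^^ m) (\<lambda>t. \<i> * \<sigma> * \<gamma> t + 1 * vderiv \<gamma> t)) sequentially"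
      proof
        fix m
        have "uniform_limit UNIV (\<lambda>i. (vderiv ^^ m) (vderiv (\<Gamma> i))) ((vderiv ^^ m) (vderiv \<gamma>)) sequentially"
          using Suc.prems(3)[rule_format, of "Suc m"] by (simp add: funpow_Suc_right del: funpow.simps)
        then show "uniform_limit UNIV (\<lambda>i. (vderiv ^^ m) (\<lambda>t. \<i> * \<sigma> * \<Gamma> i t + 1 * vderiv (\<Gamma> i) t))
          ((vderiv ^^ m) (\<lambda>t. \<i> * \<sigma> * \<gamma> t + 1 * vderiv \<gamma> t)) sequentially"
          unfolding circle_test_lincomb(2)[OF ct] circle_test_lincomb(2)[OF Suc.prems(2) ct']
          by (intro ul_lin Suc.prems(3)[rule_format])
      qed
    qed
    then show ?case
      using circle_test_mult_cis(2)[OF ct(1) that(1)] circle_test_mult_cis(2)[OF Suc.prems(2) that(1)]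
      by (simp add: funpow_Suc_right del: funpow.simps)
  qed
  have ct: "(\<lambda>t. cis (\<sigma> * t) * \<Gamma> i t) \<in> circle_test" "(\<lambda>t. cis (\<sigma> * t) * \<gamma> t) \<in> circle_test"
    if "\<sigma> \<in> {1, -1}" for \<sigma> i
    by (rule circle_test_mult_cis(1)[OF _ that], use * in blast)+
  have eq: "(\<lambda>t. of_real (2 * cos t) * \<gamma> t) = (\<lambda>t. 1 * (cis (1 * t) * \<gamma> t) + 1 * (cis ((-1) * t) * \<gamma> t))"
    for \<gamma> :: "real \<Rightarrow> complex"
    by (simp add: two_cos ring_distribs del: of_real_mult)
  have "uniform_limit UNIV (\<lambda>i. (vderiv ^^ m) (\<lambda>t. of_real (2 * cos t) * \<Gamma> i t))
      ((vderiv ^^ m) (\<lambda>t. of_real (2 * cos t) * \<gamma> t)) sequentially" for m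
  proof -
    have "uniform_limit UNIV (\<lambda>i. (vderiv ^^ m) (\<lambda>t. cis (\<sigma> * t) * \<Gamma> i t))
      ((vderiv ^^ m) (\<lambda>t. cis (\<sigma> * t) * \<gamma> t)) sequentially" if "\<sigma> \<in> {1, -1}" for \<sigma>
      by (rule cis[OF that]) (use * in blast)+
    from ul_lin[OF this[of 1] this[of "-1"], of 1 1] show ?thesis
      unfolding eq using circle_test_lincomb(2)[OF ct(1)[of 1] ct(1)[of "-1"], where x = 1 and y = 1]
        circle_test_lincomb(2)[OF ct(2)[of 1] ct(2)[of "-1"], where x = 1 and y = 1] by simp
  qed
  note ul = this
  show "(\<lambda>i. b (\<lambda>t. of_real (2 * cos t) * \<Gamma> i t)) \<longlonglongrightarrow> b (\<lambda>t. of_real (2 * cos t) * \<gamma> t)"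
    by (rule circle_distribution_tendsto[OF b _ _ ul]) (use * circle_test_mult_2cos in blast)+
qed

text \<open>On the unit circle \<open>z + cnj z\<close> equals \<open>2 * cos t\<close>, so this is
  the boundary operation that corresponds to multiplication by \<open>(z + cnj z) ^ k\<close> in the
  disk.\<close>

definition mult_2cos :: "nat \<Rightarrow> ((real \<Rightarrow> complex) \<Rightarrow> complex) \<Rightarrow> (real \<Rightarrow> complex) \<Rightarrow> complex" where
  "mult_2cos k b \<gamma> = b (\<lambda>t. of_real (2 * cos t) ^ k * \<gamma> t)"

lemma real_distribution_mult_2cos:
  assumes "real_distribution b" shows "real_distribution (mult_2cos k b)"
proof (induction k)
  case 0 then show ?case using assms by (simp add: mult_2cos_def[abs_def])
next
  case (Suc k)
  have eq: "mult_2cos (Suc k) b = (\<lambda>\<gamma>. mult_2cos k b (\<lambda>t. of_real (2 * cos t) * \<gamma> t))"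
    by (simp add: mult_2cos_def fun_eq_iff mult_ac)
  have r: "\<forall>t. complex_of_real (2 * cos t) * \<gamma> t \<in> \<real>" if "\<forall>t. \<gamma> t \<in> \<real>" for \<gamma> :: "real \<Rightarrow> complex"
    using that by (intro allI Reals_mult Reals_of_real) auto
  show ?case
    unfolding real_distribution_def
  proof (intro conjI ballI impI)
    show "circle_distribution (mult_2cos (Suc k) b)"
      unfolding eq using Suc by (intro circle_distribution_mult_2cos) (simp add: real_distribution_def)
    fix \<gamma> assume "\<gamma> \<in> circle_test" "\<forall>t. \<gamma> t \<in> \<real>"
    then show "mult_2cos (Suc k) b \<gamma> \<in> \<real>"
      using Suc r[of \<gamma>] circle_test_mult_2cos[of \<gamma>] unfolding real_distribution_def eq by simp
  qed
qed

section \<open>Smooth functions on the plane\<close>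

lemma
  assumes "(\<phi> has_derivative D) (at z)"
  shows dx_eqI: "dx \<phi> z = D 1" and dy_eqI: "dy \<phi> z = D \<i>"
  unfolding dx_def dy_def using frechet_derivative_at[OF assms] by auto

lemma has_derivative_frechet:
  "\<phi> differentiable (at z) \<Longrightarrow> (\<phi> has_derivative frechet_derivative \<phi> (at z)) (at z)"
  by (simp add: frechet_derivative_works)

lemma has_derivative_dx_dy:
  assumes "\<phi> differentiable (at z)"
  shows "(\<phi> has_derivative (\<lambda>h. Re h *\<^sub>R dx \<phi> z + Im h *\<^sub>R dy \<phi> z)) (at z)"
proof -
  let ?D = "frechet_derivative \<phi> (at z)"
  have D: "(\<phi> has_derivative ?D) (at z)" by (rule has_derivative_frechet[OF assms])
  have l: "linear ?D" using D by (rule has_derivative_linear)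
  have "?D h = Re h *\<^sub>R dx \<phi> z + Im h *\<^sub>R dy \<phi> z" for h
  proof -
    have "?D h = ?D (Re h *\<^sub>R 1 + Im h *\<^sub>R \<i>)"
      by (rule arg_cong[of _ _ ?D]) (simp add: complex_eq_iff)
    also have "\<dots> = Re h *\<^sub>R dx \<phi> z + Im h *\<^sub>R dy \<phi> z"
      unfolding dx_def dy_def linear_add[OF l] linear_cmul[OF l] ..
    finally show ?thesis .
  qed
  then show ?thesis using D by (metis (no_types, lifting) ext)
qed

text \<open>Finite-order stages of the coinductive \<open>plane_smooth\<close>. Closure under
  products or reciprocals is a plain induction on the order, whereas a coinduction would need an
  invariant already closed under all sums and products that the derivative rules create.\<close>

primrec plane_Ck :: "nat \<Rightarrow> (complex \<Rightarrow> complex) \<Rightarrow> bool" where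
  "plane_Ck 0 \<phi> = True"
| "plane_Ck (Suc k) \<phi> = ((\<forall>z. \<phi> differentiable (at z)) \<and> plane_Ck k (dx \<phi>) \<and> plane_Ck k (dy \<phi>))"

lemma plane_smooth_iff: "plane_smooth \<phi> \<longleftrightarrow> (\<forall>k. plane_Ck k \<phi>)"
proof
  assume "plane_smooth \<phi>"
  have "plane_Ck k \<phi>" if "plane_smooth \<phi>" for k \<phi>
    using that by (induction k arbitrary: \<phi>) (simp, erule plane_smooth.cases, simp)
  with \<open>plane_smooth \<phi>\<close> show "\<forall>k. plane_Ck k \<phi>" by blast
next
  assume "\<forall>k. plane_Ck k \<phi>"
  then show "plane_smooth \<phi>"
  proof (coinduction arbitrary: \<phi>)
    case (plane_smooth \<phi>)
    have "plane_Ck k (dx \<phi>)" "plane_Ck k (dy \<phi>)" for k using plane_smooth[rule_format, of "Suc k"] by auto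
    moreover have "\<phi> differentiable (at z)" for z using plane_smooth[rule_format, of "Suc 0"] by auto
    ultimately show ?case by blast
  qed
qed

lemma plane_Ck_SucD: "plane_Ck (Suc k) \<phi> \<Longrightarrow> plane_Ck k \<phi>"
proof (induction k arbitrary: \<phi>)
  case (Suc k)
  from Suc.prems have "\<forall>z. \<phi> differentiable (at z)" "plane_Ck (Suc k) (dx \<phi>)" "plane_Ck (Suc k) (dy \<phi>)"
    using plane_Ck.simps(2)[of "Suc k"] by blast+
  then show ?case using Suc.IH plane_Ck.simps(2)[of k] by blast
qed simp

lemma dx_const [simp]: "dx (\<lambda>z. c) = (\<lambda>z. 0)" and dy_const [simp]: "dy (\<lambda>z. c) = (\<lambda>z. 0)"
  using dx_eqI[OF has_derivative_const] dy_eqI[OF has_derivative_const] by auto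

lemma plane_Ck_const: "plane_Ck k (\<lambda>z. c)"
  by (induction k arbitrary: c) auto

lemma
  assumes "\<And>z. \<phi> differentiable (at z)" "\<And>z. \<psi> differentiable (at z)"
  shows dx_add: "dx (\<lambda>z. \<phi> z + \<psi> z) = (\<lambda>z. dx \<phi> z + dx \<psi> z)"
    and dy_add: "dy (\<lambda>z. \<phi> z + \<psi> z) = (\<lambda>z. dy \<phi> z + dy \<psi> z)"
    and dx_mult: "dx (\<lambda>z. \<phi> z * \<psi> z) = (\<lambda>z. \<phi> z * dx \<psi> z + dx \<phi> z * \<psi> z)"
    and dy_mult: "dy (\<lambda>z. \<phi> z * \<psi> z) = (\<lambda>z. \<phi> z * dy \<psi> z + dy \<phi> z * \<psi> z)"
proof -
  note d = assms[THEN has_derivative_frechet]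
  show "dx (\<lambda>z. \<phi> z + \<psi> z) = (\<lambda>z. dx \<phi> z + dx \<psi> z)" "dy (\<lambda>z. \<phi> z + \<psi> z) = (\<lambda>z. dy \<phi> z + dy \<psi> z)"
    using dx_eqI[OF has_derivative_add[OF d]] dy_eqI[OF has_derivative_add[OF d]]
    by (auto simp: dx_def dy_def fun_eq_iff)
  show "dx (\<lambda>z. \<phi> z * \<psi> z) = (\<lambda>z. \<phi> z * dx \<psi> z + dx \<phi> z * \<psi> z)"
    "dy (\<lambda>z. \<phi> z * \<psi> z) = (\<lambda>z. \<phi> z * dy \<psi> z + dy \<phi> z * \<psi> z)"
    using dx_eqI[OF has_derivative_mult[OF d]] dy_eqI[OF has_derivative_mult[OF d]]
    by (auto simp: dx_def dy_def fun_eq_iff)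
qed

lemma
  assumes "\<And>z. \<phi> differentiable (at z)"
  shows dx_cnj: "dx (\<lambda>z. cnj (\<phi> z)) = (\<lambda>z. cnj (dx \<phi> z))"
    and dy_cnj: "dy (\<lambda>z. cnj (\<phi> z)) = (\<lambda>z. cnj (dy \<phi> z))"
    and differentiable_cnj: "(\<lambda>z. cnj (\<phi> z)) differentiable (at z)"
proof -
  note d = has_derivative_cnj[OF has_derivative_frechet[OF assms]]
  show "dx (\<lambda>z. cnj (\<phi> z)) = (\<lambda>z. cnj (dx \<phi> z))" "dy (\<lambda>z. cnj (\<phi> z)) = (\<lambda>z. cnj (dy \<phi> z))"
    using dx_eqI[OF d] dy_eqI[OF d] by (auto simp: dx_def dy_def fun_eq_iff)
  show "(\<lambda>z. cnj (\<phi> z)) differentiable (at z)" using d differentiable_def by blast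
qed

lemma plane_Ck_add: "plane_Ck k \<phi> \<Longrightarrow> plane_Ck k \<psi> \<Longrightarrow> plane_Ck k (\<lambda>z. \<phi> z + \<psi> z)"
proof (induction k arbitrary: \<phi> \<psi>)
  case (Suc k)
  then have d: "\<phi> differentiable (at z)" "\<psi> differentiable (at z)" for z by simp_all
  show ?case
    unfolding plane_Ck.simps dx_add[OF d] dy_add[OF d]
    using Suc.prems by (intro conjI allI differentiable_add d Suc.IH) simp_all
qed simp

lemma plane_Ck_mult: "plane_Ck k \<phi> \<Longrightarrow> plane_Ck k \<psi> \<Longrightarrow> plane_Ck k (\<lambda>z. \<phi> z * \<psi> z)"
proof (induction k arbitrary: \<phi> \<psi>)
  case (Suc k)
  then have d: "\<phi> differentiable (at z)" "\<psi> differentiable (at z)" for z by simp_all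
  have "plane_Ck k \<phi>" "plane_Ck k \<psi>" using Suc.prems[THEN plane_Ck_SucD] by simp_all
  then show ?case
    unfolding plane_Ck.simps dx_mult[OF d] dy_mult[OF d]
    using Suc.prems by (intro conjI allI differentiable_mult d plane_Ck_add Suc.IH) simp_all
qed simp

lemma plane_Ck_cnj: "plane_Ck k \<phi> \<Longrightarrow> plane_Ck k (\<lambda>z. cnj (\<phi> z))"
proof (induction k arbitrary: \<phi>)
  case (Suc k)
  then have d: "\<phi> differentiable (at z)" for z using plane_Ck.simps(2) by blast
  show ?case
    unfolding plane_Ck.simps dx_cnj[OF d] dy_cnj[OF d]
    using Suc.prems by (intro conjI allI differentiable_cnj d Suc.IH) simp_all
qed simp

text \<open>The first derivatives of a reciprocal contain only the reciprocal itself and first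
  derivatives of \<open>\<phi>\<close>, all available at the previous order.\<close>

lemma plane_Ck_inverse:
  assumes "\<And>z. \<phi> z \<noteq> 0" shows "plane_Ck k \<phi> \<Longrightarrow> plane_Ck k (\<lambda>z. inverse (\<phi> z))"
proof (induction k)
  case (Suc k)
  have diff: "\<phi> differentiable (at z)" for z using Suc.prems plane_Ck.simps(2) by blast
  have d: "((\<lambda>z. inverse (\<phi> z)) has_derivative
      (\<lambda>h. - (inverse (\<phi> z) * frechet_derivative \<phi> (at z) h * inverse (\<phi> z)))) (at z)" for z
    by (rule Deriv.has_derivative_inverse[OF assms has_derivative_frechet[OF diff]])
  have "dx (\<lambda>z. inverse (\<phi> z)) = (\<lambda>z. (-1) * (inverse (\<phi> z) * dx \<phi> z * inverse (\<phi> z)))"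
    "dy (\<lambda>z. inverse (\<phi> z)) = (\<lambda>z. (-1) * (inverse (\<phi> z) * dy \<phi> z * inverse (\<phi> z)))"
    using dx_eqI[OF d] dy_eqI[OF d] by (auto simp: dx_def dy_def fun_eq_iff)
  note eq = this
  have i: "plane_Ck k (\<lambda>z. inverse (\<phi> z))" by (rule Suc.IH[OF plane_Ck_SucD[OF Suc.prems]])
  have j: "(\<lambda>z. inverse (\<phi> z)) differentiable (at z)" for z
    using d[of z] unfolding differentiable_def by blast
  have k: "plane_Ck k (dx \<phi>)" "plane_Ck k (dy \<phi>)" using Suc.prems plane_Ck.simps(2) by blast+
  show ?case
    unfolding plane_Ck.simps eq
    by (intro conjI allI plane_Ck_mult plane_Ck_const i j k)
qed simp

lemma plane_smooth_const: "plane_smooth (\<lambda>z. c)"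
  by (simp add: plane_smooth_iff plane_Ck_const)

lemma plane_smooth_add: "plane_smooth \<phi> \<Longrightarrow> plane_smooth \<psi> \<Longrightarrow> plane_smooth (\<lambda>z. \<phi> z + \<psi> z)"
  by (simp add: plane_smooth_iff plane_Ck_add)

lemma plane_smooth_mult: "plane_smooth \<phi> \<Longrightarrow> plane_smooth \<psi> \<Longrightarrow> plane_smooth (\<lambda>z. \<phi> z * \<psi> z)"
  by (simp add: plane_smooth_iff plane_Ck_mult)

lemma plane_smooth_diff: "plane_smooth \<phi> \<Longrightarrow> plane_smooth \<psi> \<Longrightarrow> plane_smooth (\<lambda>z. \<phi> z - \<psi> z)"
  using plane_smooth_add[OF _ plane_smooth_mult[OF plane_smooth_const[of "-1"]], of \<phi> \<psi>] by simp

lemma plane_smooth_power: "plane_smooth \<phi> \<Longrightarrow> plane_smooth (\<lambda>z. \<phi> z ^ k)"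
  by (induction k) (simp_all add: plane_smooth_const plane_smooth_mult)

lemma plane_smooth_cnj: "plane_smooth \<phi> \<Longrightarrow> plane_smooth (\<lambda>z. cnj (\<phi> z))"
  by (simp add: plane_smooth_iff plane_Ck_cnj)

lemma plane_smooth_inverse:
  "plane_smooth \<phi> \<Longrightarrow> (\<And>z. \<phi> z \<noteq> 0) \<Longrightarrow> plane_smooth (\<lambda>z. inverse (\<phi> z))"
  by (simp add: plane_smooth_iff plane_Ck_inverse)

lemma plane_smooth_differentiable: "plane_smooth \<phi> \<Longrightarrow> \<phi> differentiable (at z)"
  by (erule plane_smooth.cases) simp

lemma plane_smooth_dx: "plane_smooth \<phi> \<Longrightarrow> plane_smooth (dx \<phi>)"
  and plane_smooth_dy: "plane_smooth \<phi> \<Longrightarrow> plane_smooth (dy \<phi>)"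
  by (erule plane_smooth.cases, simp)+

lemma d_zbar_eq: "d_zbar \<phi> = (\<lambda>z. 1/2 * (dx \<phi> z + \<i> * dy \<phi> z))"
  and d_z_eq: "d_z \<phi> = (\<lambda>z. 1/2 * (dx \<phi> z - \<i> * dy \<phi> z))"
  by (auto simp: d_zbar_def d_z_def)

lemma plane_smooth_d_zbar: "plane_smooth \<phi> \<Longrightarrow> plane_smooth (d_zbar \<phi>)"
  and plane_smooth_d_z: "plane_smooth \<phi> \<Longrightarrow> plane_smooth (d_z \<phi>)"
  unfolding d_zbar_eq d_z_eq
  by (intro plane_smooth_mult plane_smooth_add plane_smooth_diff plane_smooth_const plane_smooth_dx plane_smooth_dy; assumption)+

lemma plane_smooth_id: "plane_smooth (\<lambda>z. z)"
proof -
  have "dx (\<lambda>z. z) = (\<lambda>z. 1)" "dy (\<lambda>z. z) = (\<lambda>z. \<i>)"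
    using dx_eqI[OF has_derivative_ident] dy_eqI[OF has_derivative_ident] by auto
  then have "plane_Ck k (\<lambda>z. z)" for k by (cases k) (auto simp: plane_Ck_const)
  then show ?thesis by (simp add: plane_smooth_iff)
qed

lemma d_zbar_ident [simp]: "d_zbar (\<lambda>z. z) = (\<lambda>z. 0)" and d_zbar_cnj_ident [simp]: "d_zbar cnj = (\<lambda>z. 1)"
proof -
  have "dx cnj z = 1" "dy cnj z = - \<i>" for z
    using dx_eqI[OF has_derivative_cnj[OF has_derivative_ident]] dy_eqI[OF has_derivative_cnj[OF has_derivative_ident]] by auto
  moreover have "dx (\<lambda>z. z) z = 1" "dy (\<lambda>z. z) z = \<i>" for z
    using dx_eqI[OF has_derivative_ident] dy_eqI[OF has_derivative_ident] by auto
  ultimately show "d_zbar (\<lambda>z. z) = (\<lambda>z. 0)" "d_zbar cnj = (\<lambda>z. 1)" by (auto simp: d_zbar_def)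
qed

lemma plane_smooth_Re: "plane_smooth (\<lambda>z. of_real (Re z))"
  and plane_smooth_Im: "plane_smooth (\<lambda>z. of_real (Im z))"
proof -
  have "plane_smooth (\<lambda>z. 1/2 * (z + cnj z))" "plane_smooth (\<lambda>z. (-\<i>/2) * (z - cnj z))"
    by (intro plane_smooth_mult plane_smooth_add plane_smooth_diff plane_smooth_const plane_smooth_id plane_smooth_cnj)+
  moreover have "1/2 * (z + cnj z) = of_real (Re z)" "(-\<i>/2) * (z - cnj z) = of_real (Im z)" for z
    by (auto simp: complex_eq_iff)
  ultimately show "plane_smooth (\<lambda>z. of_real (Re z))" "plane_smooth (\<lambda>z. of_real (Im z))" by simp_all
qed

lemma plane_smooth_continuous: "plane_smooth \<phi> \<Longrightarrow> continuous_on UNIV \<phi>"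
  by (intro continuous_at_imp_continuous_on ballI differentiable_imp_continuous_within plane_smooth_differentiable)

lemma plane_smooth_measurable [measurable_dest]: "plane_smooth \<phi> \<Longrightarrow> \<phi> \<in> borel_measurable borel"
  by (rule borel_measurable_continuous_onI) (rule plane_smooth_continuous)

lemma d_zbar_add: "plane_smooth \<phi> \<Longrightarrow> plane_smooth \<psi> \<Longrightarrow>
    d_zbar (\<lambda>z. \<phi> z + \<psi> z) = (\<lambda>z. d_zbar \<phi> z + d_zbar \<psi> z)"
  by (auto simp: d_zbar_def dx_add dy_add plane_smooth_differentiable field_simps)

lemma d_zbar_mult: "plane_smooth \<phi> \<Longrightarrow> plane_smooth \<psi> \<Longrightarrow>
    d_zbar (\<lambda>z. \<phi> z * \<psi> z) = (\<lambda>z. \<phi> z * d_zbar \<psi> z + d_zbar \<phi> z * \<psi> z)"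
  by (auto simp: d_zbar_def dx_mult dy_mult plane_smooth_differentiable field_simps)

lemma d_z_cnj: "plane_smooth \<phi> \<Longrightarrow> d_z (\<lambda>z. cnj (\<phi> z)) = (\<lambda>z. cnj (d_zbar \<phi> z))"
  by (auto simp: d_z_def d_zbar_def dx_cnj dy_cnj plane_smooth_differentiable)

section \<open>Test functions on the disk\<close>

lemma
  assumes "\<And>z. z \<in> S \<Longrightarrow> \<phi> z = 0" "open S" "z \<in> S"
  shows dx_eq_0: "dx \<phi> z = 0" and dy_eq_0: "dy \<phi> z = 0" and d_zbar_eq_0: "d_zbar \<phi> z = 0" and d_z_eq_0: "d_z \<phi> z = 0"
proof -
  have "(\<phi> has_derivative (\<lambda>h. 0)) (at z)"
    by (rule has_derivative_transform_within_open[OF has_derivative_const assms(2,3)]) (use assms(1) in auto)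
  then show 1: "dx \<phi> z = 0" "dy \<phi> z = 0" by (auto dest: dx_eqI dy_eqI)
  then show "d_zbar \<phi> z = 0" "d_z \<phi> z = 0" by (auto simp: d_zbar_def d_z_def)
qed

lemma disk_test_smooth: "disk_test \<phi> \<Longrightarrow> plane_smooth \<phi>"
  by (simp add: disk_test_def)

lemma disk_test_support:
  assumes "disk_test \<phi>" obtains K where "compact K" "K \<subseteq> unit_disk" "\<And>z. z \<notin> K \<Longrightarrow> \<phi> z = 0"
  using assms by (auto simp: disk_test_def)

lemma disk_test_mult:
  assumes "disk_test \<phi>" "plane_smooth \<psi>" shows "disk_test (\<lambda>z. \<psi> z * \<phi> z)"
  using assms unfolding disk_test_def by (auto intro: plane_smooth_mult)

lemma disk_test_d_zbar: assumes "disk_test \<phi>" shows "disk_test (d_zbar \<phi>)"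
proof -
  obtain K where K: "compact K" "K \<subseteq> unit_disk" "\<And>z. z \<notin> K \<Longrightarrow> \<phi> z = 0"
    using disk_test_support[OF assms] by blast
  have "d_zbar \<phi> z = 0" if "z \<notin> K" for z
    by (rule d_zbar_eq_0[of "- K"]) (use K that in \<open>auto simp: compact_imp_closed open_Compl\<close>)
  then show ?thesis unfolding disk_test_def
    using K plane_smooth_d_zbar[OF disk_test_smooth[OF assms]] by blast
qed

lemma disk_test_d_zbar_funpow: "disk_test \<phi> \<Longrightarrow> disk_test ((d_zbar ^^ k) \<phi>)"
  by (induction k) (auto intro: disk_test_d_zbar)

lemma disk_test_cnj: "disk_test \<phi> \<Longrightarrow> disk_test (\<lambda>z. cnj (\<phi> z))"
  unfolding disk_test_def by (auto intro: plane_smooth_cnj)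

lemma d_z_funpow_cnj: "plane_smooth \<phi> \<Longrightarrow> (d_z ^^ k) (\<lambda>z. cnj (\<phi> z)) = (\<lambda>z. cnj ((d_zbar ^^ k) \<phi> z))"
proof (induction k arbitrary: \<phi>)
  case (Suc k)
  then show ?case using Suc.IH[OF plane_smooth_d_zbar[OF Suc.prems]]
    by (simp add: funpow_Suc_right d_z_cnj del: funpow.simps)
qed simp

subsection \<open>Bump functions\<close>

text \<open>The classical flat function \<open>exp (- 1 / t)\<close> together with its quotients by
  powers of t. The exponent is carried along because differentiation raises it; the family as a
  whole is closed under differentiation.\<close>

definition flat :: "nat \<Rightarrow> real \<Rightarrow> real" where
  "flat m t = (if t \<le> 0 then 0 else exp (- (1 / t)) / t ^ m)"

lemma flat_tendsto_0: "(flat m \<longlongrightarrow> 0) (at_right 0)"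
proof -
  have "((\<lambda>t::real. inverse t ^ m / exp (inverse t)) \<longlongrightarrow> 0) (at_right 0)"
    by (rule filterlim_compose[OF tendsto_power_div_exp_0 filterlim_inverse_at_top_right])
  then show ?thesis
    by (rule Lim_transform_eventually)
       (auto simp: eventually_at_right_field flat_def exp_minus field_simps intro!: exI[of _ 1])
qed

lemma flat_deriv: "(flat m has_real_derivative - real m * flat (Suc m) t + flat (m + 2) t) (at t)"
proof -
  consider "t < 0" | "t = 0" | "t > 0" by linarith
  then show ?thesis
  proof cases
    case 1
    have "(flat m has_real_derivative 0) (at t)"
      by (rule DERIV_cong_ev[THEN iffD2, OF refl _ refl DERIV_const[of 0]])
         (use 1 in \<open>auto simp: flat_def eventually_nhds intro!: exI[of _ "{..<0}"]\<close>)
    then show ?thesis using 1 by (simp add: flat_def)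
  next
    case 3
    have "((\<lambda>t. exp (- (1 / t)) / t ^ m) has_real_derivative - real m * flat (Suc m) t + flat (m + 2) t) (at t)"
    proof -
      have e: "((\<lambda>t. exp (- (1 / t))) has_real_derivative exp (- (1 / t)) / t ^ 2) (at t)"
        using 3 by (auto intro!: derivative_eq_intros simp: field_simps power2_eq_square)
      have p: "((\<lambda>t. t ^ m) has_real_derivative real m * (t ^ m / t)) (at t)"
        using DERIV_pow[of m t] 3 by (cases m) auto
      show ?thesis
        by (rule DERIV_cong[OF DERIV_divide[OF e p]])
           (use 3 in \<open>simp_all add: flat_def field_simps power2_eq_square\<close>)
    qed
    then show ?thesis
      by (rule DERIV_cong_ev[THEN iffD1, OF refl _ refl, rotated])
         (use 3 in \<open>auto simp: flat_def eventually_nhds intro!: exI[of _ "{0<..}"]\<close>)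
  next
    case 2
    \<comment> \<open>To the right of 0 the difference quotient of \<open>flat m\<close> at 0 is
      exactly \<open>flat (Suc m)\<close>, whose limit is already known.\<close>
    have r: "((\<lambda>h. (flat m h - flat m 0) / (h - 0)) \<longlongrightarrow> 0) (at_right 0)"
      by (rule Lim_transform_eventually[OF flat_tendsto_0[of "Suc m"]])
         (auto simp: eventually_at_right_field flat_def field_simps intro!: exI[of _ 1])
    have l: "((\<lambda>h. (flat m h - flat m 0) / (h - 0)) \<longlongrightarrow> 0) (at_left 0)"
      by (rule Lim_transform_eventually[OF tendsto_const])
         (auto simp: eventually_at_left_field flat_def intro!: exI[of _ "-1"])
    have "(flat m has_real_derivative 0) (at 0)"
      unfolding has_field_derivative_iff using filterlim_split_at[OF l r] by simp
    then show ?thesis using 2 by (simp add: flat_def)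
  qed
qed

lemma flat_nonneg: "flat m t \<ge> 0" and flat_0_le_1: "flat 0 t \<le> 1"
  and flat_pos: "t > 0 \<Longrightarrow> flat m t > 0" and flat_eq_0: "t \<le> 0 \<Longrightarrow> flat m t = 0"
  by (auto simp: flat_def)

text \<open>By the chain rule the first derivatives of a composite with \<open>flat m\<close>
  involve composites with \<open>flat (Suc m)\<close> and \<open>flat (m + 2)\<close>, so the
  induction on the order generalises over m.\<close>

lemma plane_smooth_flat:
  assumes "plane_smooth (\<lambda>z. of_real (\<rho> z))" shows "plane_smooth (\<lambda>z. of_real (flat m (\<rho> z)))"
proof -
  have d: "((\<lambda>z. of_real (flat m (\<rho> z)) :: complex) has_derivative
     (\<lambda>h. of_real (- real m * flat (Suc m) (\<rho> z) + flat (m + 2) (\<rho> z)) *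
           of_real (Re (frechet_derivative (\<lambda>z. of_real (\<rho> z)) (at z) h)))) (at z)" for z m
  proof -
    have "((\<lambda>z. Re (of_real (\<rho> z))) has_derivative
       (\<lambda>h. Re (frechet_derivative (\<lambda>z. of_real (\<rho> z)) (at z) h))) (at z)"
      by (rule bounded_linear.has_derivative[OF bounded_linear_Re has_derivative_frechet[OF plane_smooth_differentiable[OF assms]]])
    then have "(\<rho> has_derivative (\<lambda>h. Re (frechet_derivative (\<lambda>z. of_real (\<rho> z)) (at z) h))) (at z)" by simp
    from bounded_linear.has_derivative[OF bounded_linear_of_real has_derivative_compose[OF this flat_deriv[unfolded has_field_derivative_def]]]
    show ?thesis by simp
  qed
  \<comment> \<open>The chain rule passes through a real-valued inner function and leaves real parts
    of its derivatives. Expressing them through conjugates makes the closure rules for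
    \<open>plane_Ck\<close> applicable.\<close>
  have re: "of_real (Re (dx (\<lambda>z. of_real (\<rho> z)) z)) = 1/2 * (dx (\<lambda>z. of_real (\<rho> z)) z + cnj (dx (\<lambda>z. of_real (\<rho> z)) z))"
     "of_real (Re (dy (\<lambda>z. of_real (\<rho> z)) z)) = 1/2 * (dy (\<lambda>z. of_real (\<rho> z)) z + cnj (dy (\<lambda>z. of_real (\<rho> z)) z))" for z
    by (simp_all add: complex_eq_iff)
  have "plane_Ck k (\<lambda>z. of_real (flat m (\<rho> z)))" for k m
  proof (induction k arbitrary: m)
    case (Suc k)
    let ?g = "\<lambda>z. complex_of_real (- real m) * of_real (flat (Suc m) (\<rho> z)) + of_real (flat (m + 2) (\<rho> z))"
    have eq: "dx (\<lambda>z. of_real (flat m (\<rho> z))) = (\<lambda>z. ?g z * (1/2 * (dx (\<lambda>z. of_real (\<rho> z)) z + cnj (dx (\<lambda>z. of_real (\<rho> z)) z))))"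
      "dy (\<lambda>z. of_real (flat m (\<rho> z))) = (\<lambda>z. ?g z * (1/2 * (dy (\<lambda>z. of_real (\<rho> z)) z + cnj (dy (\<lambda>z. of_real (\<rho> z)) z))))"
      unfolding re[symmetric] using dx_eqI[OF d] dy_eqI[OF d] by (auto simp: dx_def dy_def fun_eq_iff)
    have k: "plane_Ck k (dx (\<lambda>z. of_real (\<rho> z)))" "plane_Ck k (dy (\<lambda>z. of_real (\<rho> z)))"
      using plane_smooth_dx[OF assms] plane_smooth_dy[OF assms] by (auto simp: plane_smooth_iff)
    have j: "(\<lambda>z. of_real (flat m (\<rho> z)) :: complex) differentiable (at z)" for z
      using d[of m z] unfolding differentiable_def by blast
    show ?case
      unfolding plane_Ck.simps eq
      by (intro conjI allI plane_Ck_mult plane_Ck_add plane_Ck_const plane_Ck_cnj Suc j k)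
  qed simp
  then show ?thesis by (simp add: plane_smooth_iff)
qed

text \<open>Rescaling turns \<open>flat 0\<close> into smooth approximations, bounded by 1, of the
  indicator of the positive half line; products of four of them approximate the indicator of an open
  rectangle.\<close>

lemma flat_limit: "t > 0 \<Longrightarrow> (\<lambda>k. flat 0 (real k * t)) \<longlonglongrightarrow> 1"
proof -
  assume t: "t > 0"
  have "(\<lambda>k. exp (- (1 / t) * (1 / real k))) \<longlonglongrightarrow> exp (- (1 / t) * 0)"
    by (intro tendsto_intros lim_1_over_n)
  then have "(\<lambda>k. exp (- (1 / t) * (1 / real k))) \<longlonglongrightarrow> 1" by simp
  then show ?thesis
  proof (rule Lim_transform_eventually)
    show "\<forall>\<^sub>F k in sequentially. exp (- (1 / t) * (1 / real k)) = flat 0 (real k * t)"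
      using eventually_gt_at_top[of 0]
    proof eventually_elim
      case (elim k)
      then have "real k * t > 0" using t by simp
      then show ?case by (simp add: flat_def field_simps)
    qed
  qed
qed

text \<open>The cutoff is the quotient \<open>a / (a + b)\<close>, where \<open>a\<close> is
  positive exactly for \<open>cmod z < Q\<close> and \<open>b\<close> exactly for
  \<open>cmod z > R\<close>. Since \<open>R < Q\<close> the denominator never vanishes, and since
  \<open>Q < 1\<close> the support is compact in the disk.\<close>

lemma disk_cutoff:
  assumes "0 < R" "R < 1"
  obtains \<eta> where "disk_test \<eta>" "\<And>z. cmod z \<le> R \<Longrightarrow> \<eta> z = 1"
proof -
  define Q where "Q = (1 + R) / 2"
  have Q: "R < Q" "Q < 1" using assms by (auto simp: Q_def)
  define a where "a = (\<lambda>z. complex_of_real (flat 0 (Q\<^sup>2 - (cmod z)\<^sup>2)))"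
  define b where "b = (\<lambda>z. complex_of_real (flat 0 ((cmod z)\<^sup>2 - R\<^sup>2)))"
  have "plane_smooth (\<lambda>z. complex_of_real (Q\<^sup>2) - z * cnj z)" "plane_smooth (\<lambda>z. z * cnj z - complex_of_real (R\<^sup>2))"
    by (intro plane_smooth_diff plane_smooth_mult plane_smooth_const plane_smooth_id plane_smooth_cnj)+
  then have s: "plane_smooth a" "plane_smooth b"
    unfolding a_def b_def by (intro plane_smooth_flat; simp add: complex_norm_square[symmetric])+
  have "R\<^sup>2 < Q\<^sup>2" using assms Q by (intro power_strict_mono) auto
  then have nz: "a z + b z \<noteq> 0" for z
  proof -
    have "Q\<^sup>2 - (cmod z)\<^sup>2 > 0 \<or> (cmod z)\<^sup>2 - R\<^sup>2 > 0" using \<open>R\<^sup>2 < Q\<^sup>2\<close> by linarith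
    then have "flat 0 (Q\<^sup>2 - (cmod z)\<^sup>2) + flat 0 ((cmod z)\<^sup>2 - R\<^sup>2) > 0"
      using flat_pos flat_nonneg by (metis add_nonneg_pos add_pos_nonneg)
    then show ?thesis unfolding a_def b_def
      by (metis of_real_add of_real_eq_0_iff less_irrefl)
  qed
  define \<eta> where "\<eta> = (\<lambda>z. inverse (a z + b z) * a z)"
  have "plane_smooth \<eta>"
    unfolding \<eta>_def by (intro plane_smooth_mult plane_smooth_inverse plane_smooth_add s nz)
  moreover have "\<eta> z = 0" if "z \<notin> cball 0 Q" for z
  proof -
    have "Q\<^sup>2 < (cmod z)\<^sup>2" using that Q assms by (intro power_strict_mono) auto
    then show ?thesis by (simp add: \<eta>_def a_def flat_eq_0)
  qed
  moreover have "\<eta> z = 1" if "cmod z \<le> R" for z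
  proof -
    have "(cmod z)\<^sup>2 \<le> R\<^sup>2" using that by (intro power_mono) auto
    then have "b z = 0" by (simp add: b_def flat_eq_0)
    then show ?thesis using nz[of z] by (simp add: \<eta>_def)
  qed
  moreover have "cball 0 Q \<subseteq> unit_disk" using Q by auto
  ultimately have "disk_test \<eta>" unfolding disk_test_def by (intro conjI exI[of _ "cball 0 Q"]) auto
  then show ?thesis by (rule that) fact
qed

section \<open>Integration by parts in the plane\<close>

lemma ball_in_sets_borel [measurable]: "ball c R \<in> sets borel" "cball c R \<in> sets borel"
  by auto

lemma cnj_borel_measurable [measurable]: "cnj \<in> borel_measurable borel"
  by (intro borel_measurable_continuous_onI continuous_intros)

lemma emeasure_ball_finite: "emeasure lborel (ball (c::complex) R) < top" "emeasure lborel (cball (c::complex) R) < top"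
  using emeasure_bounded_finite[OF bounded_ball, of c R] emeasure_bounded_finite[OF bounded_cball, of c R] by auto

lemma integrable_bounded_support:
  fixes f :: "complex \<Rightarrow> complex"
  assumes "f \<in> borel_measurable borel" "\<And>z. cmod (f z) \<le> B" "\<And>z. cmod z > R \<Longrightarrow> f z = 0"
  shows "integrable lborel f"
proof (rule Bochner_Integration.integrable_bound)
  show "integrable lborel (\<lambda>z::complex. B * indicator (cball 0 R) z)"
    by (intro integrable_mult_right integrable_real_indicator) (auto simp: emeasure_ball_finite)
  have "B \<ge> 0" using assms(2)[of 0] norm_ge_zero order_trans by blast
  then show "AE z in lborel. norm (f z) \<le> norm (B * indicator (cball 0 R) z)"
    using assms(2,3) by (intro AE_I2) (auto simp: indicator_def not_le)
qed (use assms(1) in simp)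

lemma integral_lborel_translate:
  fixes f :: "complex \<Rightarrow> complex"
  assumes [measurable]: "f \<in> borel_measurable borel"
  shows "integral\<^sup>L lborel (\<lambda>z. f (z + c)) = integral\<^sup>L lborel f"
proof -
  have "integral\<^sup>L lborel f = integral\<^sup>L (distr lborel borel ((+) c)) f" by (simp add: lborel_distr_plus)
  also have "\<dots> = integral\<^sup>L lborel (\<lambda>z. f (c + z))" by (rule integral_distr) auto
  finally show ?thesis by (simp add: add.commute)
qed

text \<open>The regularised Cauchy kernel below has a kink along a circle and is only Lipschitz.
  This is still enough for integration by parts, because difference quotients stay uniformly bounded
  and converge off a null set.\<close>

definition bounded_lipschitz :: "(complex \<Rightarrow> complex) \<Rightarrow> bool" where
  "bounded_lipschitz f \<longleftrightarrow> (\<exists>B L. B \<ge> 0 \<and> L \<ge> 0 \<and> (\<forall>z. cmod (f z) \<le> B) \<and> (\<forall>z w. cmod (f z - f w) \<le> L * cmod (z - w)))"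

lemma bounded_lipschitz_mult:
  assumes "bounded_lipschitz f" "bounded_lipschitz g" shows "bounded_lipschitz (\<lambda>z. f z * g z)"
proof -
  obtain A K B L where *: "A \<ge> 0" "K \<ge> 0" "B \<ge> 0" "L \<ge> 0" "\<And>z. cmod (f z) \<le> A" "\<And>z w. cmod (f z - f w) \<le> K * cmod (z - w)"
    "\<And>z. cmod (g z) \<le> B" "\<And>z w. cmod (g z - g w) \<le> L * cmod (z - w)"
    using assms unfolding bounded_lipschitz_def by metis
  have "cmod (f z * g z) \<le> A * B" for z by (simp add: norm_mult mult_mono' *)
  moreover have "cmod (f z * g z - f w * g w) \<le> (A * L + K * B) * cmod (z - w)" for z w
  proof -
    have "f z * g z - f w * g w = f z * (g z - g w) + (f z - f w) * g w" by (simp add: algebra_simps)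
    then have "cmod (f z * g z - f w * g w) \<le> cmod (f z) * cmod (g z - g w) + cmod (f z - f w) * cmod (g w)"
      by (metis norm_mult norm_triangle_ineq)
    also have "\<dots> \<le> A * (L * cmod (z - w)) + (K * cmod (z - w)) * B"
      by (intro add_mono mult_mono' *) auto
    finally show ?thesis by (simp add: algebra_simps)
  qed
  ultimately show ?thesis unfolding bounded_lipschitz_def
    using * by (intro exI[of _ "A * B"] exI[of _ "A * L + K * B"]) auto
qed

lemma bounded_lipschitz_measurable:
  assumes "bounded_lipschitz f" shows "f \<in> borel_measurable borel"
proof (rule borel_measurable_continuous_onI)
  obtain L where L: "L \<ge> 0" "\<And>z w. cmod (f z - f w) \<le> L * cmod (z - w)"
    using assms unfolding bounded_lipschitz_def by blast
  then have "L-lipschitz_on UNIV f" by (intro lipschitz_onI) (auto simp: dist_norm)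
  then show "continuous_on UNIV f" by (rule lipschitz_on_continuous_on)
qed

text \<open>This plays the role of the divergence theorem. Each difference quotient has integral 0
  by translation invariance, is bounded by \<open>L * cmod e\<close>, and vanishes outside the ball
  of radius \<open>R + cmod e\<close>; dominated convergence passes to the derivative.\<close>

lemma integral_directional_derivative:
  assumes lip: "bounded_lipschitz \<psi>" and supp: "\<And>z. cmod z > R \<Longrightarrow> \<psi> z = 0"
    and D: "D \<in> borel_measurable borel"
    and lim: "AE z in lborel. (\<lambda>i. of_nat (Suc i) * (\<psi> (z + e / of_nat (Suc i)) - \<psi> z)) \<longlonglongrightarrow> D z"
  shows "integrable lborel D" "integral\<^sup>L lborel D = 0"
proof -
  obtain B L where L: "L \<ge> 0" "\<And>z. cmod (\<psi> z) \<le> B" "\<And>z w. cmod (\<psi> z - \<psi> w) \<le> L * cmod (z - w)"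
    using lip unfolding bounded_lipschitz_def by blast
  define s where "s = (\<lambda>i z. of_nat (Suc i) * (\<psi> (z + e / of_nat (Suc i)) - \<psi> z))"
  note [measurable] = bounded_lipschitz_measurable[OF lip] D
  have int: "integrable lborel \<psi>"
    by (rule integrable_bounded_support[of _ B R]) (use L supp in auto)
  have intt: "integrable lborel (\<lambda>z. \<psi> (z + c))" for c
    by (rule integrable_bounded_support[of _ B "R + cmod c"]) (use L supp norm_diff_ineq in \<open>auto intro!: supp simp: add.commute\<close>,
        smt (verit) norm_diff_ineq supp)
  have s0: "integral\<^sup>L lborel (s i) = 0" for i
    unfolding s_def by (simp add: int intt integral_lborel_translate)
  have bd: "norm (s i z) \<le> (L * cmod e) * indicator (cball 0 (R + cmod e)) z" for i z
  proof (cases "cmod z \<le> R + cmod e")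
    case True
    have "norm (s i z) \<le> real (Suc i) * (L * cmod (e / of_nat (Suc i)))"
      unfolding s_def norm_mult using L(3)[of "z + e / of_nat (Suc i)" z] by (intro mult_mono) (auto simp del: of_nat_Suc)
    also have "\<dots> = L * cmod e" by (simp add: norm_divide del: of_nat_Suc)
    finally show ?thesis using True by simp
  next
    case False
    have "cmod (e / of_nat (Suc i)) \<le> cmod e"
      by (simp add: norm_divide divide_le_eq mult_le_cancel_left1 del: of_nat_Suc)
    then have "cmod (z + e / of_nat (Suc i)) > R" using False norm_diff_ineq[of z "e / of_nat (Suc i)"] by linarith
    moreover have "cmod z > R" using False norm_ge_zero[of e] by linarith
    ultimately show ?thesis using L(1) by (simp add: s_def supp)
  qed
  have [measurable]: "s i \<in> borel_measurable lborel" for i unfolding s_def by measurable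
  have w: "integrable lborel (\<lambda>z::complex. (L * cmod e) * indicator (cball 0 (R + cmod e)) z)"
    by (intro integrable_mult_right integrable_real_indicator) (auto simp: emeasure_ball_finite)
  note dct = lim[folded s_def, unfolded s_def[symmetric]]
  have lim': "AE z in lborel. (\<lambda>i. s i z) \<longlonglongrightarrow> D z" using lim by (simp add: s_def)
  show "integrable lborel D"
    by (rule integrable_dominated_convergence[OF _ _ w lim']) (use bd in auto)
  have "(\<lambda>i. integral\<^sup>L lborel (s i)) \<longlonglongrightarrow> integral\<^sup>L lborel D"
    by (rule integral_dominated_convergence[OF _ _ w lim']) (use bd in auto)
  then show "integral\<^sup>L lborel D = 0" unfolding s0 by (simp add: LIMSEQ_const_iff)
qed

lemma directional_derivative_sequence:
  fixes \<psi> :: "complex \<Rightarrow> complex"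
  assumes "(\<psi> has_derivative D) (at z)"
  shows "(\<lambda>i. of_nat (Suc i) * (\<psi> (z + e / of_nat (Suc i)) - \<psi> z)) \<longlonglongrightarrow> (D e :: complex)"
proof (cases "e = 0")
  case True
  have "(\<lambda>i. of_nat (Suc i) * (\<psi> (z + 0 / of_nat (Suc i)) - \<psi> z)) = (\<lambda>i. 0 :: complex)" by simp
  then show ?thesis using linear_0[OF has_derivative_linear[OF assms]] unfolding True by (simp del: of_nat_Suc div_0)
next
  case False
  define y where "y = (\<lambda>i. z + e / of_nat (Suc i))"
  have "(\<lambda>i. z + e * complex_of_real (inverse (real (Suc i)))) \<longlonglongrightarrow> z + e * complex_of_real 0"
    by (intro tendsto_intros LIMSEQ_inverse_real_of_nat)
  then have "y \<longlonglongrightarrow> z" by (simp add: y_def field_simps)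
  then have "filterlim y (at z) sequentially"
    using False by (intro filterlim_atI) (auto simp: y_def simp del: of_nat_Suc)
  then have "(\<lambda>i. (1 / norm (y i - z)) *\<^sub>R (\<psi> (y i) - (\<psi> z + D (y i - z)))) \<longlonglongrightarrow> 0"
    using assms unfolding has_derivative_within by (auto intro: filterlim_compose)
  then have "(\<lambda>i. cmod e *\<^sub>R ((1 / norm (y i - z)) *\<^sub>R (\<psi> (y i) - (\<psi> z + D (y i - z))))) \<longlonglongrightarrow> cmod e *\<^sub>R 0"
    by (intro tendsto_intros)
  moreover have "cmod e *\<^sub>R ((1 / norm (y i - z)) *\<^sub>R (\<psi> (y i) - (\<psi> z + D (y i - z))))
      = of_nat (Suc i) * (\<psi> (z + e / of_nat (Suc i)) - \<psi> z) - D e" for i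
  proof -
    have "D (y i - z) = D ((1 / real (Suc i)) *\<^sub>R e)" by (simp add: y_def scaleR_conv_of_real field_simps)
    also have "\<dots> = (1 / real (Suc i)) *\<^sub>R D e" by (rule linear_cmul[OF has_derivative_linear[OF assms]])
    finally have e1: "D (y i - z) = (1 / real (Suc i)) *\<^sub>R D e" .
    have e2: "norm (y i - z) = cmod e / real (Suc i)" by (simp add: y_def norm_divide del: of_nat_Suc)
    define n where "n = real (Suc i)"
    have n: "n \<noteq> 0" "complex_of_real n \<noteq> 0" "of_nat (Suc i) = complex_of_real n" by (auto simp: n_def simp del: of_nat_Suc)
    show ?thesis
      unfolding e1 e2 unfolding y_def n(3) n_def[symmetric] using False n(1,2)
      by (simp add: scaleR_conv_of_real field_simps)
  qed
  ultimately have "(\<lambda>i. of_nat (Suc i) * (\<psi> (z + e / of_nat (Suc i)) - \<psi> z) - D e) \<longlonglongrightarrow> 0" by simp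
  then show ?thesis by (simp add: LIM_zero_iff)
qed

lemma smooth_bounded_support:
  assumes "plane_smooth \<phi>" "\<And>z. cmod z > R \<Longrightarrow> \<phi> z = 0"
  shows "\<exists>B\<ge>0. \<forall>z. cmod (\<phi> z) \<le> B"
proof -
  have "compact (\<phi> ` cball 0 R)"
    by (intro compact_continuous_image continuous_on_subset[OF plane_smooth_continuous[OF assms(1)]]) auto
  then obtain B where B: "B > 0" "\<And>s. s \<in> cball 0 R \<Longrightarrow> cmod (\<phi> s) \<le> B"
    by (metis bounded_pos compact_imp_bounded image_eqI)
  then have "cmod (\<phi> z) \<le> B" for z
    using assms(2)[of z] by (cases "cmod z > R") auto
  then show ?thesis using B(1) by (auto intro!: exI[of _ B])
qed

lemma dx_dy_bounded_support:
  assumes "\<And>z. cmod z > R \<Longrightarrow> \<phi> z = 0" "cmod z > R" shows "dx \<phi> z = 0" "dy \<phi> z = 0" "d_zbar \<phi> z = 0"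
proof -
  have "open {z. cmod z > R}" by (intro open_Collect_less continuous_intros)
  then show "dx \<phi> z = 0" "dy \<phi> z = 0" "d_zbar \<phi> z = 0"
    using dx_eq_0[of "{z. cmod z > R}" \<phi> z] dy_eq_0[of "{z. cmod z > R}" \<phi> z] d_zbar_eq_0[of "{z. cmod z > R}" \<phi> z] assms by auto
qed

lemma smooth_bounded_lipschitz:
  assumes "plane_smooth \<phi>" "\<And>z. cmod z > R \<Longrightarrow> \<phi> z = 0"
  shows "bounded_lipschitz \<phi>"
proof -
  obtain A where A: "A \<ge> 0" "\<And>z. cmod (\<phi> z) \<le> A" using smooth_bounded_support[OF assms] by blast
  obtain B where B: "B \<ge> 0" "\<And>z. cmod (dx \<phi> z) \<le> B"
    using smooth_bounded_support[OF plane_smooth_dx[OF assms(1)] dx_dy_bounded_support(1)[OF assms(2), of R]] by blast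
  obtain C where C: "C \<ge> 0" "\<And>z. cmod (dy \<phi> z) \<le> C"
    using smooth_bounded_support[OF plane_smooth_dy[OF assms(1)] dx_dy_bounded_support(2)[OF assms(2), of R]] by blast
  have "cmod (\<phi> z - \<phi> w) \<le> (B + C) * cmod (z - w)" for z w
  proof (rule differentiable_bound[of UNIV])
    fix z
    show "(\<phi> has_derivative (\<lambda>h. Re h *\<^sub>R dx \<phi> z + Im h *\<^sub>R dy \<phi> z)) (at z within UNIV)"
      using has_derivative_dx_dy[OF plane_smooth_differentiable[OF assms(1)]] by simp
    show "onorm (\<lambda>h. Re h *\<^sub>R dx \<phi> z + Im h *\<^sub>R dy \<phi> z) \<le> B + C"
    proof (rule onorm_le)
      fix h
      have "norm (Re h *\<^sub>R dx \<phi> z + Im h *\<^sub>R dy \<phi> z) \<le> \<bar>Re h\<bar> * cmod (dx \<phi> z) + \<bar>Im h\<bar> * cmod (dy \<phi> z)"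
        by (rule order_trans[OF norm_triangle_ineq]) simp
      also have "\<dots> \<le> cmod h * B + cmod h * C"
        by (intro add_mono mult_mono abs_Re_le_cmod abs_Im_le_cmod A B C) auto
      finally show "norm (Re h *\<^sub>R dx \<phi> z + Im h *\<^sub>R dy \<phi> z) \<le> (B + C) * norm h" by (simp add: algebra_simps)
    qed
  qed auto
  note l = this
  show ?thesis unfolding bounded_lipschitz_def
    by (rule exI[of _ A], rule exI[of _ "B + C"]) (intro conjI allI A l add_nonneg_nonneg B(1) C(1))
qed

lemma integral_d_zbar:
  assumes "plane_smooth \<phi>" "\<And>z. cmod z > R \<Longrightarrow> \<phi> z = 0"
  shows "integral\<^sup>L lborel (d_zbar \<phi>) = 0"
proof -
  note d = directional_derivative_sequence[OF has_derivative_dx_dy[OF plane_smooth_differentiable[OF assms(1)]]]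
  note [measurable] = plane_smooth_measurable[OF plane_smooth_dx[OF assms(1)]] plane_smooth_measurable[OF plane_smooth_dy[OF assms(1)]]
  have "AE z in lborel. (\<lambda>i. of_nat (Suc i) * (\<phi> (z + 1 / of_nat (Suc i)) - \<phi> z)) \<longlonglongrightarrow> dx \<phi> z"
    "AE z in lborel. (\<lambda>i. of_nat (Suc i) * (\<phi> (z + \<i> / of_nat (Suc i)) - \<phi> z)) \<longlonglongrightarrow> dy \<phi> z"
    using d[of _ 1] d[of _ \<i>] by auto
  note * = integral_directional_derivative[OF smooth_bounded_lipschitz[OF assms] assms(2) _ this(1), simplified]
    integral_directional_derivative[OF smooth_bounded_lipschitz[OF assms] assms(2) _ this(2), simplified]
  show ?thesis unfolding d_zbar_eq using * by simp
qed

section \<open>The Cauchy kernel\<close>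

lemma emeasure_ball_complex: "R \<ge> 0 \<Longrightarrow> emeasure lborel (ball (c::complex) R) = ennreal (pi * R\<^sup>2)"
  using emeasure_ball[of R c] by (simp add: unit_ball_vol_2)

text \<open>Dyadic decomposition: at distance between \<open>R / 2 ^ Suc k\<close> and
  \<open>R / 2 ^ k\<close> the integrand is at most \<open>2 ^ Suc k / R\<close>, and the ball of
  radius \<open>R / 2 ^ k\<close> has area \<open>pi * R\<^sup>2 / 4 ^ k\<close>. The contributions
  \<open>2 * pi * R / 2 ^ k\<close> add up to \<open>4 * pi * R\<close>.\<close>

lemma nn_integral_inverse_ball:
  assumes "R > 0"
  shows "(\<integral>\<^sup>+z. ennreal (1 / cmod (z - \<zeta>)) * indicator (ball \<zeta> R) z \<partial>lborel) \<le> ennreal (4 * pi * R)"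
proof -
  define g where "g = (\<lambda>k z. ennreal (2 ^ Suc k / R) * indicator (ball \<zeta> (R / 2 ^ k)) z)"
  have le: "ennreal (1 / cmod (z - \<zeta>)) * indicator (ball \<zeta> R) z \<le> (\<Sum>k. g k z)" for z
  proof (cases "z \<in> ball \<zeta> R \<and> z \<noteq> \<zeta>")
    \<comment> \<open>Outside the ball the indicator vanishes; at the centre the left-hand side is 0
      because \<open>1 / 0 = 0\<close>.\<close>
    case False
    then show ?thesis by (auto simp: indicator_def)
  next
    case True
    define d where "d = cmod (z - \<zeta>)"
    have d: "0 < d" "d < R" using True by (auto simp: d_def dist_norm norm_minus_commute)
    have ex: "\<exists>n. R / 2 ^ n \<le> d"
    proof -
      obtain n where "R / d < 2 ^ n" using real_arch_pow[of 2 "R / d"] by auto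
      then show ?thesis using d by (intro exI[of _ n]) (simp add: field_simps)
    qed
    define n where "n = (LEAST n. R / 2 ^ n \<le> d)"
    have n: "R / 2 ^ n \<le> d" unfolding n_def by (rule LeastI_ex[OF ex])
    have "n \<noteq> 0" using n d by (intro notI) simp
    then obtain k where k: "n = Suc k" using not0_implies_Suc by blast
    have lt: "d < R / 2 ^ k" using not_less_Least[of k "\<lambda>n. R / 2 ^ n \<le> d"] k unfolding n_def by (auto simp: not_le)
    have "1 / d \<le> 2 ^ Suc k / R" using n k d assms by (simp add: field_simps)
    then have "ennreal (1 / d) \<le> g k z"
      using lt by (simp add: g_def d_def dist_norm norm_minus_commute ennreal_leI)
    also have "\<dots> \<le> (\<Sum>k. g k z)"
      using sum_le_suminf[of "\<lambda>k. g k z" "{k}"] by simp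
    finally show ?thesis using True by (simp add: d_def)
  qed
  have "(\<integral>\<^sup>+z. ennreal (1 / cmod (z - \<zeta>)) * indicator (ball \<zeta> R) z \<partial>lborel) \<le> (\<integral>\<^sup>+z. (\<Sum>k. g k z) \<partial>lborel)"
    by (intro nn_integral_mono le)
  also have "\<dots> = (\<Sum>k. \<integral>\<^sup>+z. g k z \<partial>lborel)"
    by (rule nn_integral_suminf) (auto simp: g_def)
  also have "\<dots> = (\<Sum>k. ennreal (2 * pi * R * (1/2) ^ k))"
  proof (rule arg_cong[of _ _ suminf], rule ext)
    fix k
    have "(\<integral>\<^sup>+z. g k z \<partial>lborel) = ennreal (2 ^ Suc k / R) * ennreal (pi * (R / 2 ^ k)\<^sup>2)"
      unfolding g_def using assms by (subst nn_integral_cmult_indicator) (auto simp: emeasure_ball_complex)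
    also have "\<dots> = ennreal (2 * pi * R * (1/2) ^ k)"
      using assms by (subst ennreal_mult[symmetric]) (auto simp: field_simps power2_eq_square)
    finally show "(\<integral>\<^sup>+z. g k z \<partial>lborel) = ennreal (2 * pi * R * (1/2) ^ k)" .
  qed
  also have "\<dots> = ennreal (2 * pi * R * 2)"
  proof -
    have "(\<lambda>k. 2 * pi * R * (1/2) ^ k) sums (2 * pi * R * (1 / (1 - 1/2)))"
      by (intro sums_mult geometric_sums) auto
    then show ?thesis using assms by (intro suminf_ennreal_eq) auto
  qed
  finally show ?thesis by (simp add: mult.assoc)
qed

text \<open>The point is uniformity in \<zeta>. If \<zeta> lies within \<open>2 * R\<close> of the
  centre, the ball is contained in the one of radius \<open>3 * R\<close> about \<zeta>, whence
  \<open>12 = 4 * 3\<close>; otherwise the integrand is at most \<open>1 / R\<close> on the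
  ball.\<close>

lemma nn_integral_inverse_dist:
  assumes "R > 0"
  shows "(\<integral>\<^sup>+z. ennreal (1 / cmod (z - \<zeta>)) * indicator (ball c R) z \<partial>lborel) \<le> ennreal (12 * pi * R)"
proof (cases "cmod (\<zeta> - c) \<le> 2 * R")
  case True
  have "ball c R \<subseteq> ball \<zeta> (3 * R)"
  proof
    fix z assume "z \<in> ball c R"
    then show "z \<in> ball \<zeta> (3 * R)" using True dist_triangle[of \<zeta> z c] by (simp add: dist_norm)
  qed
  then have "(\<integral>\<^sup>+z. ennreal (1 / cmod (z - \<zeta>)) * indicator (ball c R) z \<partial>lborel) \<le>
     (\<integral>\<^sup>+z. ennreal (1 / cmod (z - \<zeta>)) * indicator (ball \<zeta> (3 * R)) z \<partial>lborel)"
    by (intro nn_integral_mono mult_left_mono) (auto simp: indicator_def)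
  also have "\<dots> \<le> ennreal (4 * pi * (3 * R))" using assms by (intro nn_integral_inverse_ball) auto
  finally show ?thesis by (simp add: mult_ac)
next
  case False
  have "(\<integral>\<^sup>+z. ennreal (1 / cmod (z - \<zeta>)) * indicator (ball c R) z \<partial>lborel) \<le> (\<integral>\<^sup>+z. ennreal (1 / R) * indicator (ball c R) z \<partial>lborel)"
  proof (intro nn_integral_mono)
    fix z
    show "ennreal (1 / cmod (z - \<zeta>)) * indicator (ball c R) z \<le> ennreal (1 / R) * indicator (ball c R) z"
    proof (cases "z \<in> ball c R")
      case True
      then have "R \<le> cmod (z - \<zeta>)" using False dist_triangle[of \<zeta> c z] by (simp add: dist_norm norm_minus_commute)
      then have "1 / cmod (z - \<zeta>) \<le> 1 / R" using assms by (intro divide_left_mono) (auto intro!: mult_pos_pos)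
      then show ?thesis by (auto simp: indicator_def intro: ennreal_leI)
    qed simp
  qed
  also have "\<dots> = ennreal (1 / R) * ennreal (pi * R\<^sup>2)"
    using assms by (subst nn_integral_cmult_indicator) (auto simp: emeasure_ball_complex)
  also have "\<dots> = ennreal (pi * R)"
    using assms by (subst ennreal_mult[symmetric]) (auto simp: field_simps power2_eq_square)
  also have "\<dots> \<le> ennreal (12 * pi * R)" using assms by (intro ennreal_leI) auto
  finally show ?thesis .
qed

text \<open>The support lies in a closed ball of radius R, hence in the open ball of radius
  \<open>2 * R\<close>, to which the uniform bound for \<open>1 / cmod (z - \<zeta>)\<close>
  applies.\<close>

lemma integrable_cauchy_kernel:
  fixes f :: "complex \<Rightarrow> complex"
  assumes [measurable]: "f \<in> borel_measurable borel" and "\<And>z. cmod (f z) \<le> B" "\<And>z. cmod z > R \<Longrightarrow> f z = 0" "R > 0"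
  shows "integrable lborel (\<lambda>z. f z / (z - \<zeta>))"
proof (rule integrableI_bounded)
  have B: "B \<ge> 0" using assms(2)[of 0] norm_ge_zero order_trans by blast
  have "(\<integral>\<^sup>+z. ennreal (norm (f z / (z - \<zeta>))) \<partial>lborel) \<le>
     (\<integral>\<^sup>+z. ennreal B * (ennreal (1 / cmod (z - \<zeta>)) * indicator (ball 0 (2 * R)) z) \<partial>lborel)"
  proof (intro nn_integral_mono)
    fix z
    show "ennreal (norm (f z / (z - \<zeta>))) \<le> ennreal B * (ennreal (1 / cmod (z - \<zeta>)) * indicator (ball 0 (2 * R)) z)"
    proof (cases "cmod z > R")
      case False
      have "norm (f z / (z - \<zeta>)) \<le> B * (1 / cmod (z - \<zeta>))"
        using assms(2)[of z] by (simp add: norm_divide divide_right_mono)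
      then show ?thesis using False B assms(4) by (simp add: ennreal_mult[symmetric] ennreal_leI)
    qed (simp add: assms(3))
  qed
  also have "\<dots> = ennreal B * (\<integral>\<^sup>+z. (ennreal (1 / cmod (z - \<zeta>)) * indicator (ball 0 (2 * R)) z) \<partial>lborel)"
    by (rule nn_integral_cmult) measurable
  also have "\<dots> \<le> ennreal B * ennreal (12 * pi * (2 * R))"
    using assms(4) by (intro mult_left_mono nn_integral_inverse_dist) auto
  also have "\<dots> < \<infinity>" by (simp add: ennreal_mult[symmetric] ennreal_mult_less_top)
  finally show "(\<integral>\<^sup>+z. ennreal (norm (f z / (z - \<zeta>))) \<partial>lborel) < \<infinity>" .
qed measurable

text \<open>The Cauchy kernel \<open>1 / (z - \<zeta>)\<close> outside the ball of radius
  \<epsilon>, continued by \<open>cnj (z - \<zeta>) / \<epsilon>\<^sup>2\<close> inside. Its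
  \<open>d_zbar\<close> is 0 outside and the constant \<open>1 / \<epsilon>\<^sup>2\<close> inside,
  a mass of \<open>pi\<close> spread over the ball. The form with two factors \<open>1 / max\<close>
  makes it a product of Lipschitz functions after multiplication by a smooth function of bounded
  support.\<close>

definition reg_kernel :: "real \<Rightarrow> complex \<Rightarrow> complex \<Rightarrow> complex" where
  "reg_kernel \<epsilon> \<zeta> z = cnj (z - \<zeta>) * of_real (1 / max \<epsilon> (cmod (z - \<zeta>))) * of_real (1 / max \<epsilon> (cmod (z - \<zeta>)))"

lemma reg_kernel_inside: "cmod (z - \<zeta>) \<le> \<epsilon> \<Longrightarrow> reg_kernel \<epsilon> \<zeta> z = cnj (z - \<zeta>) / of_real (\<epsilon>\<^sup>2)"
  by (simp add: reg_kernel_def max_def power2_eq_square)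

lemma reg_kernel_outside: assumes "cmod (z - \<zeta>) \<ge> \<epsilon>" "\<epsilon> > 0" shows "reg_kernel \<epsilon> \<zeta> z = 1 / (z - \<zeta>)"
proof -
  have "z - \<zeta> \<noteq> 0" using assms by auto
  moreover have "complex_of_real (cmod (z - \<zeta>)) * of_real (cmod (z - \<zeta>)) = (z - \<zeta>) * cnj (z - \<zeta>)"
    using complex_norm_square[of "z - \<zeta>"] by (simp add: power2_eq_square)
  ultimately show ?thesis using assms
    by (simp add: reg_kernel_def max_def field_simps)
qed

lemma bounded_lipschitz_inverse_max:
  assumes "\<epsilon> > 0" shows "bounded_lipschitz (\<lambda>z. of_real (1 / max \<epsilon> (cmod (z - \<zeta>))))"
proof -
  have "cmod (of_real (1 / max \<epsilon> (cmod (z - \<zeta>)))) \<le> 1 / \<epsilon>" for z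
  proof -
    have "1 / max \<epsilon> (cmod (z - \<zeta>)) \<le> 1 / \<epsilon>" using assms by (intro divide_left_mono) (auto intro!: mult_pos_pos)
    then show ?thesis using assms by (simp only: norm_of_real) (simp add: max_def)
  qed
  moreover have "cmod (complex_of_real (1 / max \<epsilon> (cmod (z - \<zeta>))) - of_real (1 / max \<epsilon> (cmod (w - \<zeta>)))) \<le> (1 / \<epsilon>\<^sup>2) * cmod (z - w)" for z w
  proof -
    define a where "a = max \<epsilon> (cmod (z - \<zeta>))"
    define b where "b = max \<epsilon> (cmod (w - \<zeta>))"
    have ab: "a \<ge> \<epsilon>" "b \<ge> \<epsilon>" by (auto simp: a_def b_def)
    have "\<bar>cmod (z - \<zeta>) - cmod (w - \<zeta>)\<bar> \<le> cmod (z - w)"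
      using norm_triangle_ineq3[of "z - \<zeta>" "w - \<zeta>"] by simp
    then have d: "\<bar>b - a\<bar> \<le> cmod (z - w)" unfolding a_def b_def by linarith
    have "cmod (complex_of_real (1 / a) - of_real (1 / b)) = \<bar>1 / a - 1 / b\<bar>"
      by (simp only: of_real_diff[symmetric] norm_of_real)
    also have "1 / a - 1 / b = (b - a) / (a * b)" using ab assms by (simp add: field_simps)
    also have "\<bar>(b - a) / (a * b)\<bar> \<le> cmod (z - w) / (\<epsilon> * \<epsilon>)"
      unfolding abs_divide using ab assms d by (intro frac_le) (auto intro!: mult_mono simp: abs_mult)
    finally show ?thesis by (simp add: a_def b_def power2_eq_square)
  qed
  ultimately show ?thesis unfolding bounded_lipschitz_def using assms
    by (intro exI[of _ "1 / \<epsilon>"] exI[of _ "1 / \<epsilon>\<^sup>2"]) auto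
qed

lemma reg_kernel_norm_le: "\<epsilon> > 0 \<Longrightarrow> cmod (reg_kernel \<epsilon> \<zeta> z) \<le> 1 / cmod (z - \<zeta>)"
proof (cases "cmod (z - \<zeta>) \<le> \<epsilon>")
  case True
  assume e: "\<epsilon> > 0"
  show ?thesis
  proof (cases "z = \<zeta>")
    case False
    have "cmod (z - \<zeta>) * cmod (z - \<zeta>) \<le> \<epsilon> * \<epsilon>" using True e by (intro mult_mono) auto
    then show ?thesis using False e
      by (simp add: reg_kernel_inside[OF True] norm_divide norm_power power2_eq_square norm_mult field_simps del: complex_cnj_diff)
  qed (simp add: reg_kernel_def)
next
  case False
  assume "\<epsilon> > 0"
  then show ?thesis using False by (simp add: reg_kernel_outside norm_divide)
qed

text \<open>The integrand is \<open>d_zbar\<close> of the product of \<phi> and the regularised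
  kernel. This product is Lipschitz with bounded support and differentiable off the circle of radius
  \<epsilon> about \<zeta>, a null set, so its derivatives integrate to 0.\<close>

lemma reg_kernel_pompeiu:
  assumes s: "plane_smooth \<phi>" and supp: "\<And>z. cmod z > R \<Longrightarrow> \<phi> z = 0" and e: "\<epsilon> > 0"
  shows "integral\<^sup>L lborel (\<lambda>z. d_zbar \<phi> z * reg_kernel \<epsilon> \<zeta> z + indicator (ball \<zeta> \<epsilon>) z * \<phi> z / of_real (\<epsilon>\<^sup>2)) = 0"
proof -
  define \<psi> where "\<psi> = (\<lambda>z. \<phi> z * reg_kernel \<epsilon> \<zeta> z)"
  have "bounded_lipschitz (\<lambda>z. cnj (z - \<zeta>) * \<phi> z)"
    by (rule smooth_bounded_lipschitz[of _ R])
       (use supp in \<open>auto intro!: plane_smooth_mult plane_smooth_cnj plane_smooth_diff plane_smooth_id plane_smooth_const s simp del: complex_cnj_diff\<close>)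
  from bounded_lipschitz_mult[OF bounded_lipschitz_mult[OF this bounded_lipschitz_inverse_max[OF e, of \<zeta>]] bounded_lipschitz_inverse_max[OF e, of \<zeta>]]
  have bl: "bounded_lipschitz \<psi>" unfolding \<psi>_def reg_kernel_def by (simp only: mult_ac)
  have supp': "\<psi> z = 0" if "cmod z > R" for z using supp[OF that] by (simp add: \<psi>_def)
  \<comment> \<open>The derivative of the product in direction \<open>d\<close>, computed separately
    inside and outside the circle where the two formulas for the kernel meet.\<close>
  define D :: "complex \<Rightarrow> complex \<Rightarrow> complex" where "D = (\<lambda>d z. if cmod (z - \<zeta>) < \<epsilon>
      then (Re d *\<^sub>R dx \<phi> z + Im d *\<^sub>R dy \<phi> z) * cnj (z - \<zeta>) / of_real (\<epsilon>\<^sup>2) + \<phi> z * cnj d / of_real (\<epsilon>\<^sup>2)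
      else (Re d *\<^sub>R dx \<phi> z + Im d *\<^sub>R dy \<phi> z) / (z - \<zeta>) - \<phi> z * d / (z - \<zeta>)\<^sup>2)"
  note [measurable] = plane_smooth_measurable[OF s] plane_smooth_measurable[OF plane_smooth_dx[OF s]] plane_smooth_measurable[OF plane_smooth_dy[OF s]]
  have [measurable]: "D d \<in> borel_measurable borel" for d unfolding D_def by measurable
  have lim: "(\<lambda>i. of_nat (Suc i) * (\<psi> (z + d / of_nat (Suc i)) - \<psi> z)) \<longlonglongrightarrow> D d z" if z: "cmod (z - \<zeta>) \<noteq> \<epsilon>" for d z
  proof -
    note d\<phi> = has_derivative_dx_dy[OF plane_smooth_differentiable[OF s]]
    have "(\<psi> has_derivative (\<lambda>d. D d z)) (at z)"
    proof (cases "cmod (z - \<zeta>) < \<epsilon>")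
      case True
      have "((\<lambda>z. \<phi> z * (cnj (z - \<zeta>) / of_real (\<epsilon>\<^sup>2))) has_derivative
         (\<lambda>d. \<phi> z * (cnj (d - 0) / of_real (\<epsilon>\<^sup>2)) + (Re d *\<^sub>R dx \<phi> z + Im d *\<^sub>R dy \<phi> z) * (cnj (z - \<zeta>) / of_real (\<epsilon>\<^sup>2)))) (at z)"
        by (intro has_derivative_mult d\<phi> has_derivative_cnj has_derivative_diff has_derivative_ident has_derivative_const
            bounded_linear.has_derivative[OF bounded_linear_divide[of "of_real (\<epsilon>\<^sup>2)"]])
      then have "((\<lambda>z. \<phi> z * (cnj (z - \<zeta>) / of_real (\<epsilon>\<^sup>2))) has_derivative (\<lambda>d. D d z)) (at z)"
        using True by (simp add: D_def add.commute)
      then show ?thesis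
      proof (rule has_derivative_transform_within_open[of _ _ _ _ "ball \<zeta> \<epsilon>"])
        show "\<phi> w * (cnj (w - \<zeta>) / of_real (\<epsilon>\<^sup>2)) = \<psi> w" if "w \<in> ball \<zeta> \<epsilon>" for w
          using that by (simp add: \<psi>_def reg_kernel_inside dist_norm norm_minus_commute)
      qed (use True in \<open>auto simp: dist_norm norm_minus_commute\<close>)
    next
      case False
      then have ne: "z - \<zeta> \<noteq> 0" using e by auto
      have "((\<lambda>z. \<phi> z * inverse (z - \<zeta>)) has_derivative
         (\<lambda>d. \<phi> z * (- (inverse (z - \<zeta>) * (d - 0) * inverse (z - \<zeta>))) + (Re d *\<^sub>R dx \<phi> z + Im d *\<^sub>R dy \<phi> z) * inverse (z - \<zeta>))) (at z)"
        by (intro has_derivative_mult d\<phi> Deriv.has_derivative_inverse has_derivative_diff has_derivative_ident has_derivative_const ne)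
      then have "((\<lambda>z. \<phi> z * inverse (z - \<zeta>)) has_derivative (\<lambda>d. D d z)) (at z)"
        using False ne by (simp add: D_def divide_inverse power2_eq_square mult_ac)
      then show ?thesis
      proof (rule has_derivative_transform_within_open[of _ _ _ _ "- cball \<zeta> \<epsilon>"])
        show "\<phi> w * inverse (w - \<zeta>) = \<psi> w" if "w \<in> - cball \<zeta> \<epsilon>" for w
          using that e by (simp add: \<psi>_def reg_kernel_outside dist_norm norm_minus_commute divide_inverse)
      qed (use False z in \<open>auto simp: dist_norm norm_minus_commute\<close>)
    qed
    then show ?thesis by (rule directional_derivative_sequence)
  qed
  have "AE z in lborel. z \<notin> sphere \<zeta> \<epsilon>"
    by (rule AE_not_in) (simp add: null_sets_completion_iff[symmetric] negligible_iff_null_sets[symmetric] negligible_sphere)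
  then have AE: "AE z in lborel. (\<lambda>i. of_nat (Suc i) * (\<psi> (z + d / of_nat (Suc i)) - \<psi> z)) \<longlonglongrightarrow> D d z" for d
    by eventually_elim (use lim in \<open>auto simp: dist_norm norm_minus_commute\<close>)
  have *: "integrable lborel (D d)" "integral\<^sup>L lborel (D d) = 0" for d
    by (rule integral_directional_derivative[OF bl supp' _ AE]; measurable)+
  \<comment> \<open>The directions 1 and \<i> combine to \<open>d_zbar\<close>; outside the ball the
    terms from the holomorphic kernel cancel, inside they leave the mass
    \<open>1 / \<epsilon>\<^sup>2\<close>.\<close>
  have "integral\<^sup>L lborel (\<lambda>z. 1/2 * (D 1 z + \<i> * D \<i> z)) = 0"
    using *[of 1] *[of \<i>] by simp
  moreover have "1/2 * (D 1 z + \<i> * D \<i> z) = d_zbar \<phi> z * reg_kernel \<epsilon> \<zeta> z + indicator (ball \<zeta> \<epsilon>) z * \<phi> z / of_real (\<epsilon>\<^sup>2)" for z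
  proof (cases "cmod (z - \<zeta>) < \<epsilon>")
    case True
    then show ?thesis
      using e by (simp add: D_def reg_kernel_inside d_zbar_def dist_norm norm_minus_commute field_simps)
  next
    case False
    then have "z - \<zeta> \<noteq> 0" using e by auto
    then show ?thesis
      using e False by (simp add: D_def reg_kernel_outside d_zbar_def dist_norm norm_minus_commute divide_simps power2_eq_square)
        (simp add: algebra_simps)
  qed
  ultimately show ?thesis by (simp only:)
qed

text \<open>Let the regularisation radius tend to 0 in \<open>reg_kernel_pompeiu\<close>. The first
  term converges with majorant \<open>cmod (d_zbar \<phi> z) / cmod (z - \<zeta>)\<close>; the
  second is \<open>pi\<close> times the mean of \<phi> over a shrinking ball.\<close>

theorem cauchy_pompeiu:
  assumes s: "plane_smooth \<phi>" and supp: "\<And>z. cmod z > R \<Longrightarrow> \<phi> z = 0" and R: "R > 0"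
  shows "integral\<^sup>L lborel (\<lambda>z. d_zbar \<phi> z / (z - \<zeta>)) = - of_real pi * \<phi> \<zeta>"
proof -
  note [measurable] = plane_smooth_measurable[OF s] plane_smooth_measurable[OF plane_smooth_d_zbar[OF s]]
  obtain B L where L: "B \<ge> 0" "L \<ge> 0" "\<And>z. cmod (\<phi> z) \<le> B" "\<And>z w. cmod (\<phi> z - \<phi> w) \<le> L * cmod (z - w)"
    using smooth_bounded_lipschitz[OF s supp] unfolding bounded_lipschitz_def by blast
  obtain C where C: "\<And>z. cmod (d_zbar \<phi> z) \<le> C"
    using smooth_bounded_support[OF plane_smooth_d_zbar[OF s] dx_dy_bounded_support(3)[OF supp, of R]] by blast
  define \<epsilon> where "\<epsilon> = (\<lambda>n. 1 / real (Suc n))"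
  have e: "\<epsilon> n > 0" for n by (simp add: \<epsilon>_def)
  have e0: "\<epsilon> \<longlonglongrightarrow> 0" unfolding \<epsilon>_def using LIMSEQ_inverse_real_of_nat by (simp add: inverse_eq_divide)
  have int: "integrable lborel (\<lambda>z. d_zbar \<phi> z / (z - \<zeta>))"
    by (rule integrable_cauchy_kernel[OF _ C dx_dy_bounded_support(3)[OF supp] R]) auto
  have [measurable]: "reg_kernel \<epsilon> \<zeta> \<in> borel_measurable borel" for \<epsilon> unfolding reg_kernel_def by measurable
  have 1: "(\<lambda>n. integral\<^sup>L lborel (\<lambda>z. d_zbar \<phi> z * reg_kernel (\<epsilon> n) \<zeta> z)) \<longlonglongrightarrow> integral\<^sup>L lborel (\<lambda>z. d_zbar \<phi> z / (z - \<zeta>))"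
  proof (rule integral_dominated_convergence[where w = "\<lambda>z. norm (d_zbar \<phi> z / (z - \<zeta>))"])
    show "AE z in lborel. (\<lambda>n. d_zbar \<phi> z * reg_kernel (\<epsilon> n) \<zeta> z) \<longlonglongrightarrow> d_zbar \<phi> z / (z - \<zeta>)"
    proof (rule AE_I2)
      fix z
      show "(\<lambda>n. d_zbar \<phi> z * reg_kernel (\<epsilon> n) \<zeta> z) \<longlonglongrightarrow> d_zbar \<phi> z / (z - \<zeta>)"
      proof (cases "z = \<zeta>")
        case False
        then have "\<forall>\<^sub>F n in sequentially. \<epsilon> n < cmod (z - \<zeta>)" using order_tendstoD(2)[OF e0] by simp
        then show ?thesis
          by (intro tendsto_eventually, eventually_elim) (simp add: reg_kernel_outside e)
      qed (simp add: reg_kernel_def)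
    qed
    show "AE z in lborel. norm (d_zbar \<phi> z * reg_kernel (\<epsilon> n) \<zeta> z) \<le> norm (d_zbar \<phi> z / (z - \<zeta>))" for n
      using mult_left_mono[OF reg_kernel_norm_le[OF e[of n]], of "cmod (d_zbar \<phi> _)"]
      by (intro AE_I2) (simp add: norm_mult norm_divide)
  qed (use int in auto)
  have ib: "integrable lborel (\<lambda>z. d_zbar \<phi> z * reg_kernel (\<epsilon> n) \<zeta> z)" for n
    by (rule Bochner_Integration.integrable_bound[OF int])
       (use mult_left_mono[OF reg_kernel_norm_le[OF e[of n]], of "cmod (d_zbar \<phi> _)"] in \<open>auto simp: norm_mult norm_divide\<close>)
  have ip: "integrable lborel (\<lambda>z. indicator (ball \<zeta> (\<epsilon> n)) z * \<phi> z / of_real ((\<epsilon> n)\<^sup>2))" for n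
    by (rule integrable_bounded_support[of _ "B / (\<epsilon> n)\<^sup>2" R])
       (use L supp in \<open>auto simp: norm_mult norm_divide norm_power indicator_def divide_right_mono\<close>)
  \<comment> \<open>On the ball \<phi> differs from its central value by at most
    \<open>L * \<epsilon> n\<close>. Division by the squared radius and integration over the area
    \<open>pi * (\<epsilon> n)\<^sup>2\<close> gives the error
    \<open>L * pi * \<epsilon> n\<close>.\<close>
  have 2: "(\<lambda>n. integral\<^sup>L lborel (\<lambda>z. indicator (ball \<zeta> (\<epsilon> n)) z * \<phi> z / of_real ((\<epsilon> n)\<^sup>2))) \<longlonglongrightarrow> of_real pi * \<phi> \<zeta>"
  proof (rule LIM_zero_cancel, rule Lim_null_comparison[where g = "\<lambda>n. L * pi * \<epsilon> n"])
    show "(\<lambda>n. L * pi * \<epsilon> n) \<longlonglongrightarrow> 0" using tendsto_mult_right_zero[OF e0] by simp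
    show "\<forall>\<^sub>F n in sequentially. norm (integral\<^sup>L lborel (\<lambda>z. indicator (ball \<zeta> (\<epsilon> n)) z * \<phi> z / of_real ((\<epsilon> n)\<^sup>2)) - of_real pi * \<phi> \<zeta>) \<le> L * pi * \<epsilon> n"
    proof (intro always_eventually allI)
      fix n
      have m: "measure lborel (ball \<zeta> (\<epsilon> n)) = pi * (\<epsilon> n)\<^sup>2"
        using e[of n] by (simp add: measure_def emeasure_ball_complex)
      have i1: "integrable lborel (\<lambda>z. indicator (ball \<zeta> (\<epsilon> n)) z *\<^sub>R (\<phi> \<zeta> / of_real ((\<epsilon> n)\<^sup>2)))"
        by (intro integrable_scaleR_left integrable_real_indicator) (auto simp: emeasure_ball_finite)
      have "integral\<^sup>L lborel (\<lambda>z. indicator (ball \<zeta> (\<epsilon> n)) z *\<^sub>R (\<phi> \<zeta> / of_real ((\<epsilon> n)\<^sup>2))) = of_real pi * \<phi> \<zeta>"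
        using e[of n] by (subst integral_scaleR_left) (auto simp: m emeasure_ball_finite scaleR_conv_of_real)
      then have "integral\<^sup>L lborel (\<lambda>z. indicator (ball \<zeta> (\<epsilon> n)) z * \<phi> z / of_real ((\<epsilon> n)\<^sup>2)) - of_real pi * \<phi> \<zeta>
        = integral\<^sup>L lborel (\<lambda>z. indicator (ball \<zeta> (\<epsilon> n)) z * \<phi> z / of_real ((\<epsilon> n)\<^sup>2) - indicator (ball \<zeta> (\<epsilon> n)) z *\<^sub>R (\<phi> \<zeta> / of_real ((\<epsilon> n)\<^sup>2)))"
        by (subst Bochner_Integration.integral_diff[OF ip i1]) simp
      also have "norm \<dots> \<le> integral\<^sup>L lborel (\<lambda>z. (L / \<epsilon> n) * indicator (ball \<zeta> (\<epsilon> n)) z)"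
      proof (rule Bochner_Integration.integral_norm_bound_integral)
        show "integrable lborel (\<lambda>z. (L / \<epsilon> n) * indicator (ball \<zeta> (\<epsilon> n)) z)"
          by (intro integrable_mult_right integrable_real_indicator) (auto simp: emeasure_ball_finite)
        fix z
        show "norm (indicator (ball \<zeta> (\<epsilon> n)) z * \<phi> z / of_real ((\<epsilon> n)\<^sup>2) - indicator (ball \<zeta> (\<epsilon> n)) z *\<^sub>R (\<phi> \<zeta> / of_real ((\<epsilon> n)\<^sup>2)))
            \<le> (L / \<epsilon> n) * indicator (ball \<zeta> (\<epsilon> n)) z"
        proof (cases "z \<in> ball \<zeta> (\<epsilon> n)")
          case True
          have "cmod (\<phi> z - \<phi> \<zeta>) \<le> L * \<epsilon> n"
            using L(4)[of z \<zeta>] True L(2) by (smt (verit) dist_norm dist_commute mem_ball mult_left_mono)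
          then have "cmod (\<phi> z - \<phi> \<zeta>) / (\<epsilon> n)\<^sup>2 \<le> L / \<epsilon> n"
            using e[of n] by (simp add: field_simps power2_eq_square)
          then show ?thesis using True by (simp add: diff_divide_distrib[symmetric] norm_divide norm_power)
        qed simp
      qed (use ip i1 in auto)
      also have "\<dots> = L * pi * \<epsilon> n" using e[of n] by (simp add: m power2_eq_square)
      finally show "norm (integral\<^sup>L lborel (\<lambda>z. indicator (ball \<zeta> (\<epsilon> n)) z * \<phi> z / of_real ((\<epsilon> n)\<^sup>2)) - of_real pi * \<phi> \<zeta>) \<le> L * pi * \<epsilon> n" .
    qed
  qed
  have z: "integral\<^sup>L lborel (\<lambda>z. d_zbar \<phi> z * reg_kernel (\<epsilon> n) \<zeta> z + indicator (ball \<zeta> (\<epsilon> n)) z * \<phi> z / of_real ((\<epsilon> n)\<^sup>2)) = 0" for n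
    by (rule reg_kernel_pompeiu[OF s _ e, of R]) (rule supp)
  have "(\<lambda>n. 0) \<longlonglongrightarrow> integral\<^sup>L lborel (\<lambda>z. d_zbar \<phi> z / (z - \<zeta>)) + of_real pi * \<phi> \<zeta>"
    using tendsto_add[OF 1 2]
    unfolding Bochner_Integration.integral_add[OF ib ip, symmetric] z .
  then show ?thesis by (simp add: LIMSEQ_const_iff add_eq_0_iff2)
qed

section \<open>Locally integrable functions\<close>

text \<open>Completeness of Lebesgue measure: altering a measurable function on a null set preserves
  measurability. Representatives can thus be exchanged without a separate measurability
  argument.\<close>

lemma borel_measurable_lebesgue_AE:
  fixes f g :: "complex \<Rightarrow> 'b::{second_countable_topology, metric_space}"
  assumes "f \<in> borel_measurable lebesgue" "AE z in lebesgue. f z = g z"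
  shows "g \<in> borel_measurable lebesgue"
proof (rule measurableI)
  fix A :: "'b set" assume A: "A \<in> sets borel"
  have 1: "f -` A \<inter> space lebesgue \<in> sets lebesgue" by (rule measurable_sets[OF assms(1) A])
  show "g -` A \<inter> space lebesgue \<in> sets lebesgue"
    by (rule completion.in_sets_AE[OF _ 1]) (use assms(2) in \<open>auto elim!: eventually_mono\<close>)
qed auto

lemma lebesgue_borel_version:
  fixes f :: "complex \<Rightarrow> complex"
  assumes "f \<in> borel_measurable lebesgue"
  obtains g where "g \<in> borel_measurable borel" "AE z in lebesgue. f z = g z"
proof -
  have "(\<lambda>z. Re (f z)) \<in> borel_measurable lebesgue" "(\<lambda>z. Im (f z)) \<in> borel_measurable lebesgue"
    using assms by measurable
  then obtain a b where ab: "a \<in> borel_measurable lborel" "AE z in lborel. Re (f z) = a z"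
    "b \<in> borel_measurable lborel" "AE z in lborel. Im (f z) = b z"
    using completion_ex_borel_measurable_real by metis
  have "AE z in lborel. f z = Complex (a z) (b z)"
    using ab(2,4) by eventually_elim (simp add: complex_eq_iff)
  then have "AE z in lebesgue. f z = Complex (a z) (b z)" by (simp add: AE_completion_iff)
  moreover have "(\<lambda>z. Complex (a z) (b z)) \<in> borel_measurable borel"
    using ab(1,3) by (simp add: borel_measurable_complex_iff)
  ultimately show ?thesis using that by blast
qed

lemma compact_subset_disk:
  assumes "compact K" "K \<subseteq> unit_disk" obtains R where "0 < R" "R < 1" "K \<subseteq> cball 0 R"
proof (cases "K = {}")
  case True then show ?thesis using that[of "1/2"] by auto
next
  case False
  obtain x where x: "x \<in> K" "\<And>y. y \<in> K \<Longrightarrow> cmod y \<le> cmod x"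
    using continuous_attains_sup[OF assms(1) False, of cmod] continuous_on_norm_id by blast
  have "cmod x < 1" using x assms(2) by auto
  show ?thesis
  proof (rule that[of "(1 + cmod x) / 2"])
    show "0 < (1 + cmod x) / 2" "(1 + cmod x) / 2 < 1" using \<open>cmod x < 1\<close> by (auto simp: add_pos_nonneg)
    show "K \<subseteq> cball 0 ((1 + cmod x) / 2)"
    proof
      fix y assume "y \<in> K"
      from x(2)[OF this] \<open>cmod x < 1\<close> show "y \<in> cball 0 ((1 + cmod x) / 2)" by simp
    qed
  qed
qed

lemma locally_integrable_iff:
  "locally_integrable u \<longleftrightarrow> (\<forall>R. 0 < R \<and> R < 1 \<longrightarrow> set_integrable lebesgue (cball 0 R) u)"
proof
  assume "locally_integrable u"
  then show "\<forall>R. 0 < R \<and> R < 1 \<longrightarrow> set_integrable lebesgue (cball 0 R) u"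
    unfolding locally_integrable_def by (auto simp: subset_eq)
next
  assume *: "\<forall>R. 0 < R \<and> R < 1 \<longrightarrow> set_integrable lebesgue (cball 0 R) u"
  show "locally_integrable u" unfolding locally_integrable_def
  proof (intro allI impI)
    fix K assume K: "compact K \<and> K \<subseteq> unit_disk"
    then obtain R where R: "0 < R" "R < 1" "K \<subseteq> cball 0 R" using compact_subset_disk by blast
    have "K \<in> sets lebesgue" using K by (simp add: borel_compact)
    then show "set_integrable lebesgue K u"
      using * R by (intro set_integrable_subset[of lebesgue "cball 0 R" u K]) auto
  qed
qed

lemma locally_integrable_measurable:
  assumes "locally_integrable u" shows "(\<lambda>z. indicator unit_disk z *\<^sub>R u z) \<in> borel_measurable lebesgue"
proof (rule borel_measurable_LIMSEQ_metric)
  fix n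
  \<comment> \<open>The shift \<open>n + 2\<close> keeps the radii strictly between 0 and 1 already
    for \<open>n = 0\<close>.\<close>
  have "set_integrable lebesgue (cball 0 (1 - 1 / real (n + 2))) u"
    using assms unfolding locally_integrable_iff by (auto simp: field_simps)
  then show "(\<lambda>z. indicator (cball 0 (1 - 1 / real (n + 2))) z *\<^sub>R u z) \<in> borel_measurable lebesgue"
    unfolding set_integrable_def by auto
next
  fix z
  show "(\<lambda>n. indicator (cball 0 (1 - 1 / real (n + 2))) z *\<^sub>R u z) \<longlonglongrightarrow> indicator unit_disk z *\<^sub>R u z"
  proof (cases "z \<in> unit_disk")
    case True
    have "(\<lambda>n. 1 - 1 / real (n + 2)) \<longlonglongrightarrow> 1 - 0"
      by (intro tendsto_diff tendsto_const LIMSEQ_ignore_initial_segment[OF lim_1_over_n, of 2])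
    then have "\<forall>\<^sub>F n in sequentially. cmod z < 1 - 1 / real (n + 2)"
      using True by (intro order_tendstoD(1)[of _ 1]) auto
    then have "\<forall>\<^sub>F n in sequentially. indicator (cball 0 (1 - 1 / real (n + 2))) z *\<^sub>R u z = indicator unit_disk z *\<^sub>R u z"
      by eventually_elim (use True in \<open>auto simp: indicator_def\<close>)
    then show ?thesis by (rule tendsto_eventually)
  next
    case False
    have "indicator (cball 0 (1 - 1 / real (n + 2))) z = (0::real)" for n
    proof -
      have "1 / real (n + 2) > 0" by simp
      then have "1 - 1 / real (n + 2) < 1" by linarith
      then have "\<not> cmod z \<le> 1 - 1 / real (n + 2)" using False unfolding mem_ball_0 by linarith
      then show ?thesis by (simp add: indicator_def del: of_nat_add)
    qed
    then show ?thesis using False by (simp del: of_nat_add)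
  qed
qed

lemma locally_integrable_cong:
  assumes "AE z in lebesgue. z \<in> unit_disk \<longrightarrow> u z = v z" "locally_integrable u"
  shows "locally_integrable v"
  unfolding locally_integrable_iff
proof (intro allI impI)
  fix R :: real assume R: "0 < R \<and> R < 1"
  have u: "integrable lebesgue (\<lambda>z. indicator (cball 0 R) z *\<^sub>R u z)"
    using assms(2) R unfolding locally_integrable_iff set_integrable_def by auto
  have AE: "AE z in lebesgue. indicator (cball 0 R) z *\<^sub>R u z = indicator (cball 0 R) z *\<^sub>R v z"
    using assms(1) by eventually_elim (use R in \<open>auto simp: indicator_def\<close>)
  show "set_integrable lebesgue (cball 0 R) v"
    unfolding set_integrable_def
    by (rule integrable_cong_AE_imp[OF u borel_measurable_lebesgue_AE[OF borel_measurable_integrable[OF u] AE] AE])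
qed

definition test_pairing :: "(complex \<Rightarrow> complex) \<Rightarrow> (complex \<Rightarrow> complex) \<Rightarrow> complex" where
  "test_pairing u \<phi> = (LINT z:unit_disk|lebesgue. u z * \<phi> z)"

lemma weak_d_zbar_iff:
  "weak_d_zbar k u g \<longleftrightarrow> locally_integrable u \<and> locally_integrable g \<and>
     (\<forall>\<phi>. disk_test \<phi> \<longrightarrow> test_pairing u ((d_zbar ^^ k) \<phi>) = (-1) ^ k * test_pairing g \<phi>)"
  by (simp add: weak_d_zbar_def test_pairing_def)

lemma test_pairing_integrable:
  assumes "locally_integrable u" "disk_test \<phi>"
  shows "set_integrable lebesgue unit_disk (\<lambda>z. u z * \<phi> z)"
proof -
  obtain K where K: "compact K" "K \<subseteq> unit_disk" "\<And>z. z \<notin> K \<Longrightarrow> \<phi> z = 0"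
    using disk_test_support[OF assms(2)] by blast
  obtain B where B: "B \<ge> 0" "\<And>z. cmod (\<phi> z) \<le> B"
    using smooth_bounded_support[OF disk_test_smooth[OF assms(2)], of 1] K by force
  have m: "\<phi> \<in> borel_measurable lebesgue"
    using plane_smooth_measurable[OF disk_test_smooth[OF assms(2)]] by (simp add: measurable_completion)
  have u: "integrable lebesgue (\<lambda>z. indicator K z *\<^sub>R u z)"
    using assms(1) K unfolding locally_integrable_def set_integrable_def by blast
  have eq: "indicator unit_disk z *\<^sub>R (u z * \<phi> z) = (indicator K z *\<^sub>R u z) * \<phi> z" for z
    using K by (auto simp: indicator_def)
  show ?thesis unfolding set_integrable_def eq
  proof (rule Bochner_Integration.integrable_bound)
    show "integrable lebesgue (\<lambda>z. B * norm (indicator K z *\<^sub>R u z))" by (intro integrable_mult_right integrable_norm u)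
    show "(\<lambda>z. (indicator K z *\<^sub>R u z) * \<phi> z) \<in> borel_measurable lebesgue"
      using borel_measurable_integrable[OF u] m by measurable
    show "AE z in lebesgue. norm (indicator K z *\<^sub>R u z * \<phi> z) \<le> norm (B * norm (indicator K z *\<^sub>R u z))"
      using B by (intro AE_I2) (auto simp: norm_mult abs_mult indicator_def mult.commute intro!: mult_right_mono)
  qed
qed

lemma test_pairing_cong:
  assumes "AE z in lebesgue. z \<in> unit_disk \<longrightarrow> u z = v z" "locally_integrable u" "disk_test \<phi>"
  shows "test_pairing u \<phi> = test_pairing v \<phi>"
  unfolding test_pairing_def set_lebesgue_integral_def
proof (rule integral_cong_AE)
  show "(\<lambda>z. indicator unit_disk z *\<^sub>R (u z * \<phi> z)) \<in> borel_measurable lebesgue"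
    "(\<lambda>z. indicator unit_disk z *\<^sub>R (v z * \<phi> z)) \<in> borel_measurable lebesgue"
    using test_pairing_integrable[OF assms(2,3)] test_pairing_integrable[OF locally_integrable_cong[OF assms(1,2)] assms(3)]
    unfolding set_integrable_def by auto
  show "AE z in lebesgue. indicator unit_disk z *\<^sub>R (u z * \<phi> z) = indicator unit_disk z *\<^sub>R (v z * \<phi> z)"
    using assms(1) by eventually_elim (auto simp: indicator_def)
qed

lemma weak_d_zbar_cong:
  assumes "AE z in lebesgue. z \<in> unit_disk \<longrightarrow> u z = u' z" "AE z in lebesgue. z \<in> unit_disk \<longrightarrow> g z = g' z"
    "weak_d_zbar k u g"
  shows "weak_d_zbar k u' g'"
  using assms(3) unfolding weak_d_zbar_iff
  using locally_integrable_cong[OF assms(1)] locally_integrable_cong[OF assms(2)]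
    test_pairing_cong[OF assms(1)] test_pairing_cong[OF assms(2)] disk_test_d_zbar_funpow by metis

lemma test_pairing_lincomb:
  assumes "locally_integrable u" "locally_integrable v" "disk_test \<phi>"
  shows "test_pairing (\<lambda>z. a * u z + b * v z) \<phi> = a * test_pairing u \<phi> + b * test_pairing v \<phi>"
proof -
  have "test_pairing (\<lambda>z. a * u z + b * v z) \<phi> = (LINT z:unit_disk|lebesgue. a * (u z * \<phi> z) + b * (v z * \<phi> z))"
    by (simp add: test_pairing_def algebra_simps)
  also have "\<dots> = a * test_pairing u \<phi> + b * test_pairing v \<phi>"
    unfolding test_pairing_def
    using test_pairing_integrable[OF assms(1,3)] test_pairing_integrable[OF assms(2,3)]
    by (subst set_integral_add(2)) auto
  finally show ?thesis .
qed

lemma test_pairing_add_right: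
  assumes "locally_integrable u" "disk_test \<phi>" "disk_test \<psi>"
  shows "test_pairing u (\<lambda>z. \<phi> z + \<psi> z) = test_pairing u \<phi> + test_pairing u \<psi>"
  unfolding test_pairing_def distrib_left
  using test_pairing_integrable[OF assms(1,2)] test_pairing_integrable[OF assms(1,3)]
  by (subst set_integral_add(2)) auto

lemma locally_integrable_lincomb:
  assumes "locally_integrable u" "locally_integrable v" shows "locally_integrable (\<lambda>z. a * u z + b * v z)"
  unfolding locally_integrable_def
proof (intro allI impI)
  fix K assume "compact K \<and> K \<subseteq> unit_disk"
  then have "set_integrable lebesgue K u" "set_integrable lebesgue K v"
    using assms unfolding locally_integrable_def by auto
  then show "set_integrable lebesgue K (\<lambda>z. a * u z + b * v z)"
    by (intro set_integral_add(1) set_integrable_mult_right) auto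
qed

lemma locally_integrable_add: "locally_integrable u \<Longrightarrow> locally_integrable v \<Longrightarrow> locally_integrable (\<lambda>z. u z + v z)"
  using locally_integrable_lincomb[of u v 1 1] by simp

lemma locally_integrable_mult_continuous:
  assumes "locally_integrable u" "continuous_on UNIV \<psi>"
  shows "locally_integrable (\<lambda>z. \<psi> z * u z)"
  unfolding locally_integrable_def set_integrable_def
proof (intro allI impI)
  fix K assume K: "compact K \<and> K \<subseteq> unit_disk"
  then have u: "integrable lebesgue (\<lambda>z. indicator K z *\<^sub>R u z)"
    using assms(1) unfolding locally_integrable_def set_integrable_def by auto
  have "compact (\<psi> ` K)" using K assms(2) by (intro compact_continuous_image continuous_on_subset[OF assms(2)]) auto
  then obtain B where B: "B > 0" "\<And>z. z \<in> K \<Longrightarrow> cmod (\<psi> z) \<le> B"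
    by (metis bounded_pos compact_imp_bounded image_eqI)
  have m: "\<psi> \<in> borel_measurable lebesgue"
    using assms(2) by (intro measurable_completion) (simp add: borel_measurable_continuous_onI)
  show "integrable lebesgue (\<lambda>z. indicator K z *\<^sub>R (\<psi> z * u z))"
  proof (rule Bochner_Integration.integrable_bound)
    show "integrable lebesgue (\<lambda>z. B * norm (indicator K z *\<^sub>R u z))" by (intro integrable_mult_right integrable_norm u)
    have "(\<lambda>z. \<psi> z * (indicator K z *\<^sub>R u z)) \<in> borel_measurable lebesgue"
      using borel_measurable_integrable[OF u] m by measurable
    then show "(\<lambda>z. indicator K z *\<^sub>R (\<psi> z * u z)) \<in> borel_measurable lebesgue" by simp
    show "AE z in lebesgue. norm (indicator K z *\<^sub>R (\<psi> z * u z)) \<le> norm (B * norm (indicator K z *\<^sub>R u z))"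
      using B by (intro AE_I2) (auto simp: indicator_def norm_mult abs_mult intro!: mult_right_mono)
  qed
qed

section \<open>Calculus of weak derivatives\<close>

lemma weak_d_zbar_lincomb:
  assumes "weak_d_zbar k u g" "weak_d_zbar k v h"
  shows "weak_d_zbar k (\<lambda>z. a * u z + b * v z) (\<lambda>z. a * g z + b * h z)"
  using assms unfolding weak_d_zbar_iff
  by (auto simp: locally_integrable_lincomb test_pairing_lincomb disk_test_d_zbar_funpow algebra_simps)

lemma weak_d_zbar_add: "weak_d_zbar k u g \<Longrightarrow> weak_d_zbar k v h \<Longrightarrow> weak_d_zbar k (\<lambda>z. u z + v z) (\<lambda>z. g z + h z)"
  using weak_d_zbar_lincomb[of k u g v h 1 1] by simp

lemma weak_d_zbar_cmult: "weak_d_zbar k u g \<Longrightarrow> weak_d_zbar k (\<lambda>z. a * u z) (\<lambda>z. a * g z)"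
  using weak_d_zbar_lincomb[of k u g u g a 0] by simp

lemma locally_integrable_0: "locally_integrable (\<lambda>z. 0)"
  by (simp add: locally_integrable_def set_integrable_def)

lemma weak_d_zbar_0: "weak_d_zbar k (\<lambda>z. 0) (\<lambda>z. 0)"
  by (simp add: weak_d_zbar_iff locally_integrable_0 test_pairing_def)

lemma weak_d_zbar_sum:
  assumes "finite A" "\<And>i. i \<in> A \<Longrightarrow> weak_d_zbar k (u i) (g i)"
  shows "weak_d_zbar k (\<lambda>z. \<Sum>i\<in>A. u i z) (\<lambda>z. \<Sum>i\<in>A. g i z)"
  using assms by (induction A rule: finite_induct) (auto simp: weak_d_zbar_0 intro!: weak_d_zbar_add)

lemma weak_d_zbar_0_self: "locally_integrable u \<Longrightarrow> weak_d_zbar 0 u u"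
  by (simp add: weak_d_zbar_iff)

lemma weak_d_zbar_Suc: "weak_d_zbar 1 u v \<Longrightarrow> weak_d_zbar k v g \<Longrightarrow> weak_d_zbar (Suc k) u g"
  unfolding weak_d_zbar_iff using disk_test_d_zbar_funpow by auto

text \<open>Testing against \<open>d_zbar \<phi>\<close> compares the two iterated derivatives of
  \<open>u\<close>. This converts data about derivatives of different orders of one function into a
  first-order equation, as the descent in the uniqueness proof requires.\<close>

lemma weak_d_zbar_quotient:
  assumes "weak_d_zbar k u g" "weak_d_zbar (Suc k) u h" shows "weak_d_zbar 1 g h"
  unfolding weak_d_zbar_iff
proof (intro conjI allI impI)
  fix \<phi> assume \<phi>: "disk_test \<phi>"
  have "(-1) ^ k * test_pairing g (d_zbar \<phi>) = test_pairing u ((d_zbar ^^ k) (d_zbar \<phi>))"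
    using assms(1) disk_test_d_zbar[OF \<phi>] unfolding weak_d_zbar_iff by auto
  also have "\<dots> = test_pairing u ((d_zbar ^^ Suc k) \<phi>)" by (simp add: funpow_Suc_right del: funpow.simps)
  also have "\<dots> = (-1) ^ Suc k * test_pairing h \<phi>"
    using assms(2) \<phi> unfolding weak_d_zbar_iff by blast
  also have "\<dots> = (-1) ^ k * (- test_pairing h \<phi>)" by simp
  finally have "test_pairing g (d_zbar \<phi>) = - test_pairing h \<phi>" by (subst (asm) mult_cancel_left) simp
  then show "test_pairing g ((d_zbar ^^ 1) \<phi>) = (-1) ^ 1 * test_pairing h \<phi>" by simp
qed (use assms in \<open>auto simp: weak_d_zbar_iff\<close>)

lemma d_zbar_x: "d_zbar (\<lambda>z. z + cnj z) = (\<lambda>z. 1)"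
  using d_zbar_add[OF plane_smooth_id plane_smooth_cnj[OF plane_smooth_id]] by simp

lemma plane_smooth_x: "plane_smooth (\<lambda>z. z + cnj z)"
  by (intro plane_smooth_add plane_smooth_id plane_smooth_cnj)

text \<open>The product rule is carried out on the test function: \<open>u\<close> is tested with
  \<open>(z + cnj z) * \<phi> z\<close>, whose \<open>d_zbar\<close> has the additional summand
  \<phi> because \<open>d_zbar\<close> of \<open>z + cnj z\<close> is 1.\<close>

lemma weak_d_zbar_mult_x:
  assumes "weak_d_zbar 1 u g" shows "weak_d_zbar 1 (\<lambda>z. (z + cnj z) * u z) (\<lambda>z. u z + (z + cnj z) * g z)"
proof -
  have l: "locally_integrable u" "locally_integrable g" using assms by (auto simp: weak_d_zbar_iff)
  have lx: "locally_integrable (\<lambda>z. (z + cnj z) * u z)" "locally_integrable (\<lambda>z. (z + cnj z) * g z)"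
    by (intro locally_integrable_mult_continuous l continuous_intros)+
  show ?thesis unfolding weak_d_zbar_iff
  proof (intro conjI allI impI lx locally_integrable_add l)
    fix \<phi> assume \<phi>: "disk_test \<phi>"
    have x\<phi>: "disk_test (\<lambda>z. (z + cnj z) * \<phi> z)" by (rule disk_test_mult[OF \<phi> plane_smooth_x])
    have xd\<phi>: "disk_test (\<lambda>z. (z + cnj z) * d_zbar \<phi> z)" by (rule disk_test_mult[OF disk_test_d_zbar[OF \<phi>] plane_smooth_x])
    have "d_zbar (\<lambda>z. (z + cnj z) * \<phi> z) = (\<lambda>z. (z + cnj z) * d_zbar \<phi> z + \<phi> z)"
      unfolding d_zbar_mult[OF plane_smooth_x disk_test_smooth[OF \<phi>]] d_zbar_x by simp
    moreover have "test_pairing u (d_zbar (\<lambda>z. (z + cnj z) * \<phi> z)) = - test_pairing g (\<lambda>z. (z + cnj z) * \<phi> z)"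
      using assms x\<phi> unfolding weak_d_zbar_iff by auto
    ultimately have "test_pairing u (\<lambda>z. (z + cnj z) * d_zbar \<phi> z) + test_pairing u \<phi> = - test_pairing g (\<lambda>z. (z + cnj z) * \<phi> z)"
      using test_pairing_add_right[OF l(1) xd\<phi> \<phi>] by simp
    moreover have ab: "a = - (b + c)" if "a + b = - c" for a b c :: complex
      using that by (simp add: algebra_simps eq_neg_iff_add_eq_0)
    moreover have "test_pairing v (\<lambda>z. (z + cnj z) * \<psi> z) = test_pairing (\<lambda>z. (z + cnj z) * v z) \<psi>" for v \<psi>
      by (simp add: test_pairing_def mult_ac)
    ultimately have "test_pairing (\<lambda>z. (z + cnj z) * u z) (d_zbar \<phi>) = - (test_pairing u \<phi> + test_pairing (\<lambda>z. (z + cnj z) * g z) \<phi>)"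
      using ab by metis
    also have "\<dots> = - test_pairing (\<lambda>z. u z + (z + cnj z) * g z) \<phi>"
      using test_pairing_lincomb[OF l(1) lx(2) \<phi>, of 1 1] by simp
    finally show "test_pairing (\<lambda>z. (z + cnj z) * u z) ((d_zbar ^^ 1) \<phi>) = (-1) ^ 1 * test_pairing (\<lambda>z. u z + (z + cnj z) * g z) \<phi>"
      by simp
  qed
qed

lemma locally_integrable_cnj:
  assumes "locally_integrable u" shows "locally_integrable (\<lambda>z. cnj (u z))"
  unfolding locally_integrable_def set_integrable_def
proof (intro allI impI)
  fix K assume "compact K \<and> K \<subseteq> unit_disk"
  then have "integrable lebesgue (\<lambda>z. cnj (indicator K z *\<^sub>R u z))"
    using assms unfolding locally_integrable_def set_integrable_def
    by (intro Bochner_Integration.integrable_cnj) blast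
  then show "integrable lebesgue (\<lambda>z. indicator K z *\<^sub>R cnj (u z))" by simp
qed

lemma test_pairing_cnj: "test_pairing (\<lambda>z. cnj (u z)) (\<lambda>z. cnj (\<phi> z)) = cnj (test_pairing u \<phi>)"
proof -
  have "indicator unit_disk z *\<^sub>R (cnj (u z) * cnj (\<phi> z)) = cnj (indicator unit_disk z *\<^sub>R (u z * \<phi> z))" for z by simp
  then show ?thesis unfolding test_pairing_def set_lebesgue_integral_def by (simp only: Bochner_Integration.integral_cnj)
qed

text \<open>Conjugation maps test functions bijectively to test functions and exchanges the two
  Wirtinger derivatives; this is what reduces the plus component to a problem for
  \<open>d_zbar\<close>.\<close>

lemma weak_d_z_iff: "weak_d_z k u g \<longleftrightarrow> weak_d_zbar k (\<lambda>z. cnj (u z)) (\<lambda>z. cnj (g z))"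
proof -
  have li: "locally_integrable (\<lambda>z. cnj (v z)) = locally_integrable v" for v
    using locally_integrable_cnj[of v] locally_integrable_cnj[of "\<lambda>z. cnj (v z)"] by auto
  have t: "(\<forall>\<phi>. disk_test \<phi> \<longrightarrow> P \<phi>) \<longleftrightarrow> (\<forall>\<phi>. disk_test \<phi> \<longrightarrow> P (\<lambda>z. cnj (\<phi> z)))" for P
  proof (intro iffI allI impI)
    fix \<phi> assume *: "\<forall>\<phi>. disk_test \<phi> \<longrightarrow> P (\<lambda>z. cnj (\<phi> z))" "disk_test \<phi>"
    from *(1)[rule_format, OF disk_test_cnj[OF *(2)]] show "P \<phi>" by simp
  qed (auto intro: disk_test_cnj)
  have e: "test_pairing u ((d_z ^^ k) (\<lambda>z. cnj (\<phi> z))) = (-1) ^ k * test_pairing g (\<lambda>z. cnj (\<phi> z)) \<longleftrightarrow>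
      test_pairing (\<lambda>z. cnj (u z)) ((d_zbar ^^ k) \<phi>) = (-1) ^ k * test_pairing (\<lambda>z. cnj (g z)) \<phi>" if "disk_test \<phi>" for \<phi>
  proof -
    have "test_pairing u ((d_z ^^ k) (\<lambda>z. cnj (\<phi> z))) = cnj (test_pairing (\<lambda>z. cnj (u z)) ((d_zbar ^^ k) \<phi>))"
      using test_pairing_cnj[of "\<lambda>z. cnj (u z)" "(d_zbar ^^ k) \<phi>"] by (simp add: d_z_funpow_cnj disk_test_smooth that)
    moreover have "test_pairing g (\<lambda>z. cnj (\<phi> z)) = cnj (test_pairing (\<lambda>z. cnj (g z)) \<phi>)"
      using test_pairing_cnj[of "\<lambda>z. cnj (g z)" \<phi>] by simp
    moreover have "(-1) ^ k * cnj b = cnj ((-1) ^ k * b)" for b by simp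
    ultimately show ?thesis by (metis complex_cnj_cancel_iff)
  qed
  show ?thesis
    unfolding weak_d_z_def weak_d_zbar_iff li test_pairing_def[symmetric]
    by (subst t) (use e in auto)
qed

section \<open>Borel representatives and the fundamental lemma of the calculus of variations\<close>

lemma test_pairing_lborel:
  assumes [measurable]: "u \<in> borel_measurable borel" and \<phi>: "disk_test \<phi>"
  shows "test_pairing u \<phi> = integral\<^sup>L lborel (\<lambda>z. u z * \<phi> z)"
proof -
  have [measurable]: "\<phi> \<in> borel_measurable borel" by (rule plane_smooth_measurable[OF disk_test_smooth[OF \<phi>]])
  obtain K where K: "K \<subseteq> unit_disk" "\<And>z. z \<notin> K \<Longrightarrow> \<phi> z = 0" by (rule disk_test_support[OF \<phi>]) auto
  have "indicator unit_disk z *\<^sub>R (u z * \<phi> z) = u z * \<phi> z" for z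
  proof (cases "z \<in> unit_disk")
    case False
    then have "\<phi> z = 0" using K by blast
    then show ?thesis by simp
  qed simp
  then show ?thesis unfolding test_pairing_def set_lebesgue_integral_def by (simp add: integral_completion)
qed

lemma locally_integrable_borelI:
  assumes "u \<in> borel_measurable borel" "\<And>R. 0 < R \<Longrightarrow> R < 1 \<Longrightarrow> integrable lborel (\<lambda>z. indicator (cball 0 R) z *\<^sub>R u z)"
  shows "locally_integrable u"
  unfolding locally_integrable_iff set_integrable_def using assms by (auto simp: integrable_completion)

lemma locally_integrable_borelD:
  assumes "u \<in> borel_measurable borel" "locally_integrable u" "R < 1"
  shows "integrable lborel (\<lambda>z. indicator (cball 0 R) z *\<^sub>R u z)"
proof (cases "R > 0")
  case True
  then show ?thesis using assms unfolding locally_integrable_iff set_integrable_def by (auto simp: integrable_completion)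
next
  case False
  have "integrable lborel (\<lambda>z. indicator (cball 0 (1/2)) z *\<^sub>R u z)"
    using assms unfolding locally_integrable_iff set_integrable_def by (auto simp: integrable_completion)
  then show ?thesis
    using set_integrable_subset[of lborel "cball 0 (1/2)" u "cball 0 R"] subset_cball[of R "1/2"] False by (auto simp: set_integrable_def)
qed

lemma locally_integrable_borel_version:
  assumes "locally_integrable u"
  obtains v where "v \<in> borel_measurable borel" "AE z in lebesgue. z \<in> unit_disk \<longrightarrow> u z = v z" "locally_integrable v"
proof -
  obtain v where v: "v \<in> borel_measurable borel" "AE z in lebesgue. indicator unit_disk z *\<^sub>R u z = v z"
    using lebesgue_borel_version[OF locally_integrable_measurable[OF assms]] by blast
  have AE: "AE z in lebesgue. z \<in> unit_disk \<longrightarrow> u z = v z" using v(2) by eventually_elim auto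
  show ?thesis by (rule that[OF v(1) AE locally_integrable_cong[OF AE assms]])
qed

text \<open>Smooth approximations of box indicators show that \<open>v\<close> integrates to 0 over
  small boxes. Boxes are an intersection-stable generator of the Borel sets, so all Borel integrals
  of \<open>v\<close> cut off to one box vanish and \<open>v\<close> is 0 almost everywhere there;
  countably many boxes fill U.\<close>

lemma fundamental_lemma_borel:
  fixes v :: "complex \<Rightarrow> complex"
  assumes [measurable]: "v \<in> borel_measurable borel" and U: "open U"
    and int: "\<And>K. compact K \<Longrightarrow> K \<subseteq> U \<Longrightarrow> integrable lborel (\<lambda>z. indicator K z *\<^sub>R v z)"
    and 0: "\<And>\<phi> K. plane_smooth \<phi> \<Longrightarrow> compact K \<Longrightarrow> K \<subseteq> U \<Longrightarrow> (\<And>z. z \<notin> K \<Longrightarrow> \<phi> z = 0) \<Longrightarrow> integral\<^sup>L lborel (\<lambda>z. v z * \<phi> z) = 0"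
  shows "AE z in lborel. z \<in> U \<longrightarrow> v z = 0"
proof -
  have box: "AE z in lborel. z \<in> box p q \<longrightarrow> v z = 0" if Q: "cbox p q \<subseteq> U" for p q
  proof -
    define V where "V = (\<lambda>z. indicator (box p q) z *\<^sub>R v z)"
    have [measurable]: "box a b \<in> sets borel" "cbox a b \<in> sets borel" for a b :: complex by auto
    have iQ: "integrable lborel (\<lambda>z. indicator (cbox p q) z *\<^sub>R v z)" by (rule int) (use Q in auto)
    have V: "integrable lborel V"
      using set_integrable_subset[of lborel "cbox p q" v "box p q"] iQ box_subset_cbox
      by (auto simp: set_integrable_def V_def)
    have small: "integral\<^sup>L lborel (\<lambda>z. indicator (box a b) z *\<^sub>R v z) = 0" if ab: "box a b \<subseteq> cbox p q" for a b
    proof -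
      \<comment> \<open>One factor for each side of the box \<open>a\<close>, \<open>b\<close>: the
        product is smooth, lies between 0 and 1, vanishes off the box and increases the scale k
        towards its indicator.\<close>
      define f where "f = (\<lambda>k z. flat 0 (real k * (Re z - Re a)) * flat 0 (real k * (Re b - Re z)) *
        (flat 0 (real k * (Im z - Im a)) * flat 0 (real k * (Im b - Im z))))"
      have sm: "plane_smooth (\<lambda>z. complex_of_real (f k z))" for k
        unfolding f_def of_real_mult
        by (intro plane_smooth_mult plane_smooth_flat)
           (simp_all add: plane_smooth_mult plane_smooth_diff plane_smooth_const plane_smooth_Re plane_smooth_Im)
      have out: "f k z = 0" if "z \<notin> box a b" for k z
        using that by (auto simp: f_def in_box_complex_iff flat_eq_0 mult_nonneg_nonpos not_less)
      have le: "0 \<le> f k z" "f k z \<le> 1" for k z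
        unfolding f_def by (auto intro!: mult_nonneg_nonneg mult_le_one flat_nonneg flat_0_le_1)
      have lim: "(\<lambda>k. f k z) \<longlonglongrightarrow> indicator (box a b) z" for z
      proof (cases "z \<in> box a b")
        case True
        then have "(\<lambda>k. f k z) \<longlonglongrightarrow> 1 * 1 * (1 * 1)"
          unfolding f_def by (intro tendsto_mult flat_limit) (auto simp: in_box_complex_iff)
        then show ?thesis using True by simp
      qed (simp add: out)
      have [measurable]: "f k \<in> borel_measurable borel" for k
        using measurable_compose[OF plane_smooth_measurable[OF sm[of k]] borel_measurable_Re] by simp
      have "(\<lambda>k. integral\<^sup>L lborel (\<lambda>z. v z * f k z)) \<longlonglongrightarrow> integral\<^sup>L lborel (\<lambda>z. indicator (box a b) z *\<^sub>R v z)"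
      proof (rule integral_dominated_convergence[where w = "\<lambda>z. norm (indicator (cbox p q) z *\<^sub>R v z)"])
        show "AE z in lborel. (\<lambda>k. v z * f k z) \<longlonglongrightarrow> indicator (box a b) z *\<^sub>R v z"
        proof (rule AE_I2)
          fix z have "(\<lambda>k. v z * complex_of_real (f k z)) \<longlonglongrightarrow> v z * complex_of_real (indicator (box a b) z)"
            by (intro tendsto_intros lim)
          then show "(\<lambda>k. v z * f k z) \<longlonglongrightarrow> indicator (box a b) z *\<^sub>R v z" by (simp add: scaleR_conv_of_real mult.commute)
        qed
        show "AE z in lborel. norm (v z * f k z) \<le> norm (indicator (cbox p q) z *\<^sub>R v z)" for k
        proof (rule AE_I2)
          fix z show "norm (v z * f k z) \<le> norm (indicator (cbox p q) z *\<^sub>R v z)"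
            using le[of k z] out[of z k] ab by (cases "z \<in> box a b") (auto simp: norm_mult mult_left_le)
        qed
      qed (use integrable_norm[OF iQ] in \<open>auto simp del: norm_scaleR\<close>)
      moreover have "integral\<^sup>L lborel (\<lambda>z. v z * f k z) = 0" for k
        by (rule 0[OF sm compact_cbox Q]) (use out ab in auto)
      ultimately show ?thesis by (simp add: LIMSEQ_const_iff)
    qed
    have "(\<integral>z\<in>A. V z \<partial>lborel) = 0" if "A \<in> sets borel" for A
    proof -
      have st: "Int_stable (range (\<lambda>(a, b). box a b :: complex set))"
        by (auto simp: Int_stable_def box_Int_box)
      have A: "A \<in> sigma_sets UNIV (range (\<lambda>(a, b). box a b :: complex set))"
        using that unfolding borel_eq_box by simp
      have cl: "range (\<lambda>(a, b). box a b :: complex set) \<subseteq> Pow UNIV" by simp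
      from st cl A show ?thesis
      proof (induction A rule: sigma_sets_induct_disjoint)
        case (basic A)
        then obtain a b where A: "A = box a b" by auto
        \<comment> \<open>The intersection of two boxes is the box whose corners are the
          coordinatewise maximum and minimum, so the claim for boxes still applies after the
          cutoff.\<close>
        have "box a b \<inter> box p q \<subseteq> cbox p q" using box_subset_cbox by auto
        then show ?case unfolding A V_def set_lebesgue_integral_def
          using small[of "\<Sum>i\<in>Basis. max (a\<bullet>i) (p\<bullet>i) *\<^sub>R i" "\<Sum>i\<in>Basis. min (b\<bullet>i) (q\<bullet>i) *\<^sub>R i"]
          by (simp add: box_Int_box[symmetric] indicator_inter_arith)
      next
        case empty then show ?case by (simp add: set_lebesgue_integral_def)
      next
        case (compl A)
        then have [measurable]: "A \<in> sets borel" unfolding borel_eq_box by simp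
        have "(\<integral>z\<in>UNIV - A. V z \<partial>lborel) + (\<integral>z\<in>A. V z \<partial>lborel) = (\<integral>z\<in>(UNIV - A) \<union> A. V z \<partial>lborel)"
          using V by (intro set_integral_Un[symmetric])
            (auto simp: set_integrable_def intro!: integrable_mult_indicator)
        \<comment> \<open>Over the whole plane the cutoff function integrates to its integral over
          the box \<open>p\<close>, \<open>q\<close> itself, which has been shown to be 0; this
          handles complements.\<close>
        also have "\<dots> = 0" using small[OF box_subset_cbox] by (simp add: set_lebesgue_integral_def V_def)
        finally show ?case using compl by simp
      next
        case (union F)
        then have [measurable]: "F i \<in> sets borel" for i unfolding borel_eq_box by auto
        have "(\<integral>z\<in>(\<Union>i. F i). V z \<partial>lborel) = (\<Sum>i. (\<integral>z\<in>F i. V z \<partial>lborel))"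
          using union(1) V by (intro lebesgue_integral_countable_add)
             (auto simp: set_integrable_def disjoint_family_on_def intro!: integrable_mult_indicator)
        then show ?case using union by simp
      qed
    qed
    note V0 = this
    have "AE z in lborel. Re (V z) = 0" "AE z in lborel. Im (V z) = 0"
    proof -
      have "(\<integral>z\<in>A. Re (V z) \<partial>lborel) = Re (\<integral>z\<in>A. V z \<partial>lborel)" "(\<integral>z\<in>A. Im (V z) \<partial>lborel) = Im (\<integral>z\<in>A. V z \<partial>lborel)"
        if "A \<in> sets borel" for A
        using V that integrable_mult_indicator[of A lborel V] unfolding set_lebesgue_integral_def
        by (auto simp: integral_Re[symmetric] integral_Im[symmetric])
      then show "AE z in lborel. Re (V z) = 0" "AE z in lborel. Im (V z) = 0"
        using V V0 by (intro density_unique_real; simp add: set_lebesgue_integral_def)+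
    qed
    then show ?thesis by eventually_elim (auto simp: V_def complex_eq_iff indicator_def split: if_splits)
  qed
  obtain \<D> where D: "countable \<D>" "\<D> \<subseteq> Pow U" "\<And>X. X \<in> \<D> \<Longrightarrow> \<exists>a b. X = cbox a b" "\<Union>\<D> = U"
    using open_countable_Union_open_cbox[OF U] by blast
  have "AE z in lborel. z \<in> X \<longrightarrow> v z = 0" if mem: "X \<in> \<D>" for X
  proof -
    obtain a b where X: "X = cbox a b" using D(3)[OF mem] by blast
    have XU: "cbox a b \<subseteq> U" using D(2) mem X by blast
    \<comment> \<open>The vanishing is known on open boxes while the countable cover consists of
      closed ones; the frontiers are null sets.\<close>
    have "AE z in lborel. z \<notin> cbox a b - box a b"
      by (rule AE_not_in) (simp add: null_sets_completion_iff[symmetric] negligible_iff_null_sets[symmetric] negligible_frontier_interval)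
    then show ?thesis using box[OF XU] unfolding X by eventually_elim auto
  qed
  then have "AE z in lborel. \<forall>X\<in>\<D>. z \<in> X \<longrightarrow> v z = 0" by (subst AE_ball_countable[OF D(1)]) blast
  then show ?thesis by eventually_elim (use D(4) in blast)
qed

lemma test_pairing_eq_0:
  assumes "locally_integrable u" "\<And>\<phi>. disk_test \<phi> \<Longrightarrow> test_pairing u \<phi> = 0"
  shows "AE z in lebesgue. z \<in> unit_disk \<longrightarrow> u z = 0"
proof -
  obtain v where v: "v \<in> borel_measurable borel" "AE z in lebesgue. z \<in> unit_disk \<longrightarrow> u z = v z" "locally_integrable v"
    using locally_integrable_borel_version[OF assms(1)] by blast
  have "AE z in lborel. z \<in> unit_disk \<longrightarrow> v z = 0"
  proof (rule fundamental_lemma_borel[OF v(1) open_ball])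
    fix K :: "complex set" assume "compact K" "K \<subseteq> unit_disk"
    then have "integrable lebesgue (\<lambda>z. indicator K z *\<^sub>R v z)"
      using v(3) unfolding locally_integrable_def set_integrable_def by blast
    then show "integrable lborel (\<lambda>z. indicator K z *\<^sub>R v z)"
      by (rule integrable_completion[THEN iffD1, rotated])
         (intro borel_measurable_scaleR borel_measurable_indicator, use v(1) \<open>compact K\<close> in \<open>auto simp: borel_compact\<close>)
  next
    fix \<phi> K assume "plane_smooth \<phi>" "compact K" "K \<subseteq> unit_disk" "\<And>z. z \<notin> K \<Longrightarrow> \<phi> z = 0"
    then have \<phi>: "disk_test \<phi>" unfolding disk_test_def by blast
    then show "integral\<^sup>L lborel (\<lambda>z. v z * \<phi> z) = 0"
      using assms(2)[OF \<phi>] test_pairing_cong[OF v(2) assms(1) \<phi>] test_pairing_lborel[OF v(1) \<phi>] by simp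
  qed
  then have "AE z in lebesgue. z \<in> unit_disk \<longrightarrow> v z = 0" by (simp add: AE_completion_iff)
  with v(2) show ?thesis by eventually_elim auto
qed

lemma weak_d_zbar_0_AE:
  assumes "weak_d_zbar 0 u g" shows "AE z in lebesgue. z \<in> unit_disk \<longrightarrow> u z = g z"
proof -
  have "AE z in lebesgue. z \<in> unit_disk \<longrightarrow> 1 * u z + (-1) * g z = 0"
  proof (rule test_pairing_eq_0[OF locally_integrable_lincomb])
    show l: "locally_integrable u" "locally_integrable g" using assms by (auto simp: weak_d_zbar_iff)
    fix \<phi> assume "disk_test \<phi>"
    then show "test_pairing (\<lambda>z. 1 * u z + (-1) * g z) \<phi> = 0"
      using assms unfolding test_pairing_lincomb[OF l \<open>disk_test \<phi>\<close>] weak_d_zbar_iff by simp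
  qed
  then show ?thesis by eventually_elim auto
qed

section \<open>Weyl's lemma\<close>

lemma disk_test_bounded_support:
  assumes "disk_test \<phi>" shows "cmod z > 1 \<Longrightarrow> \<phi> z = 0"
proof -
  obtain K where K: "K \<subseteq> unit_disk" "\<And>z. z \<notin> K \<Longrightarrow> \<phi> z = 0" by (rule disk_test_support[OF assms]) auto
  show "cmod z > 1 \<Longrightarrow> \<phi> z = 0" using K by force
qed

lemma continuous_locally_integrable:
  assumes "continuous_on unit_disk u" shows "locally_integrable u"
  unfolding locally_integrable_def set_integrable_def
proof (intro allI impI)
  fix K assume K: "compact K \<and> K \<subseteq> unit_disk"
  have i: "integrable lborel (\<lambda>z. indicator K z *\<^sub>R u z)"
    by (rule borel_integrable_compact) (use K in \<open>auto intro: continuous_on_subset[OF assms]\<close>)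
  then show "integrable lebesgue (\<lambda>z. indicator K z *\<^sub>R u z)"
    using borel_measurable_integrable[OF i] by (simp add: integrable_completion)
qed

lemma d_zbar_power: "d_zbar (\<lambda>z. z ^ l) = (\<lambda>z. 0)"
proof (induction l)
  case 0 show ?case by (simp add: d_zbar_def)
next
  case (Suc l)
  then show ?case using d_zbar_mult[OF plane_smooth_id plane_smooth_power[OF plane_smooth_id, of l]] by simp
qed

lemma power_series_holomorphic_disk:
  "(\<And>z. cmod z < 1 \<Longrightarrow> (\<lambda>l. a l * z ^ l) sums H z) \<Longrightarrow> H holomorphic_on unit_disk"
  using power_series_holomorphic[of 0 1 a H] by simp

text \<open>Partial sums are polynomials in z, so \<open>z ^ l * d_zbar \<phi> z\<close> is
  \<open>d_zbar\<close> of \<open>z ^ l * \<phi> z\<close> and integrates to 0. On the support of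
  the test function the partial sums share a bound, and dominated convergence gives the claim for
  the sum.\<close>

lemma weak_d_zbar_power_series:
  assumes H: "\<And>z. cmod z < 1 \<Longrightarrow> (\<lambda>l. a l * z ^ l) sums H z"
  shows "weak_d_zbar 1 H (\<lambda>z. 0)"
proof -
  have cont: "continuous_on unit_disk H"
    by (rule holomorphic_on_imp_continuous_on[OF power_series_holomorphic_disk[OF H]])
  define Hb where "Hb = (\<lambda>z. indicator unit_disk z *\<^sub>R H z)"
  have [measurable]: "Hb \<in> borel_measurable borel"
    unfolding Hb_def by (rule borel_measurable_continuous_on_indicator) (use cont in auto)
  have li: "locally_integrable H" by (rule continuous_locally_integrable[OF cont])
  have AE: "AE z in lebesgue. z \<in> unit_disk \<longrightarrow> H z = Hb z" by (simp add: Hb_def)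
  have "test_pairing H (d_zbar \<phi>) = 0" if \<phi>: "disk_test \<phi>" for \<phi>
  proof -
    have d\<phi>: "disk_test (d_zbar \<phi>)" by (rule disk_test_d_zbar[OF \<phi>])
    obtain K where K: "compact K" "K \<subseteq> unit_disk" "\<And>z. z \<notin> K \<Longrightarrow> d_zbar \<phi> z = 0" using disk_test_support[OF d\<phi>] by blast
    obtain R where R: "0 < R" "R < 1" "K \<subseteq> cball 0 R" using compact_subset_disk[OF K(1,2)] by blast
    have [measurable]: "d_zbar \<phi> \<in> borel_measurable borel" by (rule plane_smooth_measurable[OF disk_test_smooth[OF d\<phi>]])
    obtain B where B: "\<And>z. cmod (d_zbar \<phi> z) \<le> B"
      using smooth_bounded_support[OF disk_test_smooth[OF d\<phi>] disk_test_bounded_support[OF d\<phi>]] by blast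
    have int: "integrable lborel (d_zbar \<phi>)"
      by (rule integrable_bounded_support[OF _ B disk_test_bounded_support[OF d\<phi>]]) auto
    \<comment> \<open>Convergence at the larger radius \<open>(1 + R) / 2\<close>, still below 1,
      yields absolute convergence at R.\<close>
    have sm: "summable (\<lambda>l. norm (a l * of_real R ^ l))"
    proof (rule powser_insidea)
      have "cmod (of_real ((1 + R) / 2)) < 1" using R by (simp only: norm_of_real) simp
      then show "summable (\<lambda>l. a l * of_real ((1 + R) / 2) ^ l)" using H sums_summable by blast
      show "norm (complex_of_real R) < norm (complex_of_real ((1 + R) / 2))" using R by (simp only: norm_of_real) simp
    qed
    define M where "M = (\<Sum>l. norm (a l * of_real R ^ l))"
    define S where "S = (\<lambda>N z. \<Sum>l<N. a l * z ^ l)"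
    have S: "cmod (S N z) \<le> M" if "cmod z \<le> R" for N z
    proof -
      have "cmod (S N z) \<le> (\<Sum>l<N. norm (a l * of_real R ^ l))"
        unfolding S_def using that R by (intro sum_norm_le) (auto simp: norm_mult norm_power intro!: mult_left_mono power_mono)
      also have "\<dots> \<le> M" unfolding M_def by (intro sum_le_suminf sm) auto
      finally show ?thesis .
    qed
    have I0: "integral\<^sup>L lborel (\<lambda>z. S N z * d_zbar \<phi> z) = 0" for N
    proof -
      have e: "z ^ l * d_zbar \<phi> z = d_zbar (\<lambda>z. z ^ l * \<phi> z) z" for l z
        by (simp add: d_zbar_mult[OF plane_smooth_power[OF plane_smooth_id] disk_test_smooth[OF \<phi>]] d_zbar_power)
      have t: "disk_test (\<lambda>z. z ^ l * \<phi> z)" for l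
        by (rule disk_test_mult[OF \<phi> plane_smooth_power[OF plane_smooth_id]])
      note dt = disk_test_d_zbar[OF t]
      obtain C where C: "\<And>l z. cmod (d_zbar (\<lambda>z. z ^ l * \<phi> z) z) \<le> C l"
        using smooth_bounded_support[OF disk_test_smooth[OF dt] disk_test_bounded_support[OF dt]] by metis
      have i: "integrable lborel (d_zbar (\<lambda>z. z ^ l * \<phi> z))" for l
        by (rule integrable_bounded_support[OF plane_smooth_measurable[OF disk_test_smooth[OF dt]] C disk_test_bounded_support[OF dt]])
      have "integral\<^sup>L lborel (\<lambda>z. S N z * d_zbar \<phi> z) = integral\<^sup>L lborel (\<lambda>z. \<Sum>l<N. a l * d_zbar (\<lambda>z. z ^ l * \<phi> z) z)"
        unfolding S_def sum_distrib_right e[symmetric] by (simp add: mult.assoc)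
      also have "\<dots> = (\<Sum>l<N. a l * integral\<^sup>L lborel (d_zbar (\<lambda>z. z ^ l * \<phi> z)))"
        by (subst Bochner_Integration.integral_sum) (use i in auto)
      also have "\<dots> = 0"
        by (intro sum.neutral ballI) (simp add: integral_d_zbar[OF disk_test_smooth[OF t] disk_test_bounded_support[OF t]])
      finally show ?thesis .
    qed
    have "(\<lambda>N. integral\<^sup>L lborel (\<lambda>z. S N z * d_zbar \<phi> z)) \<longlonglongrightarrow> integral\<^sup>L lborel (\<lambda>z. Hb z * d_zbar \<phi> z)"
    proof (rule integral_dominated_convergence[where w = "\<lambda>z. M * norm (d_zbar \<phi> z)"])
      show "integrable lborel (\<lambda>z. M * norm (d_zbar \<phi> z))" by (intro integrable_mult_right integrable_norm int)
      show "AE z in lborel. (\<lambda>N. S N z * d_zbar \<phi> z) \<longlonglongrightarrow> Hb z * d_zbar \<phi> z"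
      proof (rule AE_I2)
        fix z show "(\<lambda>N. S N z * d_zbar \<phi> z) \<longlonglongrightarrow> Hb z * d_zbar \<phi> z"
        proof (cases "z \<in> K")
          case True
          then have z: "z \<in> unit_disk" using K by auto
          then have "(\<lambda>N. S N z) \<longlonglongrightarrow> Hb z" using H[of z] by (simp add: sums_def S_def Hb_def)
          then show ?thesis by (intro tendsto_intros)
        qed (simp add: K)
      qed
      show "AE z in lborel. norm (S N z * d_zbar \<phi> z) \<le> M * norm (d_zbar \<phi> z)" for N
      proof (rule AE_I2)
        fix z show "norm (S N z * d_zbar \<phi> z) \<le> M * norm (d_zbar \<phi> z)"
          using S[of z N] R K(3)[of z] by (cases "z \<in> K") (auto simp: norm_mult subset_eq intro!: mult_right_mono)
      qed
    qed (auto simp: S_def)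
    then have "integral\<^sup>L lborel (\<lambda>z. Hb z * d_zbar \<phi> z) = 0" by (simp add: I0 LIMSEQ_const_iff)
    then show ?thesis using test_pairing_cong[OF AE li d\<phi>] test_pairing_lborel[of Hb, OF _ d\<phi>] by simp
  qed
  then show ?thesis unfolding weak_d_zbar_iff using li locally_integrable_0 by (simp add: test_pairing_def)
qed

subsection \<open>Convolution with the Cauchy kernel\<close>

lemma integral_lborel_reflect:
  fixes f :: "complex \<Rightarrow> complex"
  assumes [measurable]: "f \<in> borel_measurable borel"
  shows "integral\<^sup>L lborel (\<lambda>z. f (c - z)) = integral\<^sup>L lborel f"
proof -
  have "lborel = distr lborel borel (\<lambda>z::complex. c - z)"
    using lborel_affine[of "-1" c] by (simp add: density_1)
  then have "integral\<^sup>L lborel f = integral\<^sup>L (distr lborel borel (\<lambda>z. c - z)) f" by simp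
  also have "\<dots> = integral\<^sup>L lborel (\<lambda>z. f (c - z))" by (rule integral_distr) auto
  finally show ?thesis by simp
qed

text \<open>The convolution of \<phi> with \<open>1 / z\<close>, written with the singularity fixed
  at 0 so that differentiation in \<zeta> falls on the smooth factor only.\<close>

definition cauchy_conv :: "(complex \<Rightarrow> complex) \<Rightarrow> complex \<Rightarrow> complex" where
  "cauchy_conv \<phi> \<zeta> = integral\<^sup>L lborel (\<lambda>z. \<phi> (\<zeta> - z) / z)"

lemma cauchy_conv_eq:
  assumes [measurable]: "\<phi> \<in> borel_measurable borel"
  shows "cauchy_conv \<phi> \<zeta> = integral\<^sup>L lborel (\<lambda>w. \<phi> w / (\<zeta> - w))"
  using integral_lborel_reflect[of "\<lambda>w. \<phi> w / (\<zeta> - w)" \<zeta>] by (simp add: cauchy_conv_def)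

text \<open>First derivatives of a smooth function of bounded support are globally Lipschitz, so the
  constant in the first-order Taylor remainder does not depend on the base point. Differentiation
  under the integral needs exactly this uniformity.\<close>

lemma smooth_quadratic_remainder:
  assumes s: "plane_smooth \<phi>" and supp: "\<And>z. cmod z > R \<Longrightarrow> \<phi> z = 0"
  shows "\<exists>L\<ge>0. \<forall>w h. cmod (\<phi> (w + h) - \<phi> w - (Re h *\<^sub>R dx \<phi> w + Im h *\<^sub>R dy \<phi> w)) \<le> L * (cmod h)\<^sup>2"
proof -
  obtain L1 where L1: "L1 \<ge> 0" "\<And>z w. cmod (dx \<phi> z - dx \<phi> w) \<le> L1 * cmod (z - w)"
    using smooth_bounded_lipschitz[OF plane_smooth_dx[OF s] dx_dy_bounded_support(1)[OF supp, of R]] unfolding bounded_lipschitz_def by blast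
  obtain L2 where L2: "L2 \<ge> 0" "\<And>z w. cmod (dy \<phi> z - dy \<phi> w) \<le> L2 * cmod (z - w)"
    using smooth_bounded_lipschitz[OF plane_smooth_dy[OF s] dx_dy_bounded_support(2)[OF supp, of R]] unfolding bounded_lipschitz_def by blast
  have "cmod (\<phi> (w + h) - \<phi> w - (Re h *\<^sub>R dx \<phi> w + Im h *\<^sub>R dy \<phi> w)) \<le> (L1 + L2) * (cmod h)\<^sup>2" for w h
  proof -
    define k where "k = (\<lambda>y. \<phi> y - (Re y *\<^sub>R dx \<phi> w + Im y *\<^sub>R dy \<phi> w))"
    have "cmod (k (w + h) - k w) \<le> ((L1 + L2) * cmod h) * cmod (w + h - w)"
    proof (rule differentiable_bound[of "cball w (cmod h)"])
      fix y assume y: "y \<in> cball w (cmod h)"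
      have "(k has_derivative (\<lambda>h. (Re h *\<^sub>R dx \<phi> y + Im h *\<^sub>R dy \<phi> y) - (Re h *\<^sub>R dx \<phi> w + Im h *\<^sub>R dy \<phi> w))) (at y)"
        unfolding k_def
        by (intro has_derivative_diff has_derivative_dx_dy plane_smooth_differentiable[OF s] has_derivative_add
            has_derivative_scaleR_left has_derivative_Re has_derivative_Im has_derivative_ident)
      then show "(k has_derivative (\<lambda>h. Re h *\<^sub>R (dx \<phi> y - dx \<phi> w) + Im h *\<^sub>R (dy \<phi> y - dy \<phi> w))) (at y within cball w (cmod h))"
        by (simp add: algebra_simps has_derivative_at_withinI)
      have yw: "cmod (y - w) \<le> cmod h" using y by (simp add: dist_norm norm_minus_commute)
      show "onorm (\<lambda>h. Re h *\<^sub>R (dx \<phi> y - dx \<phi> w) + Im h *\<^sub>R (dy \<phi> y - dy \<phi> w)) \<le> (L1 + L2) * cmod h"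
      proof (rule onorm_le)
        fix g
        have "norm (Re g *\<^sub>R (dx \<phi> y - dx \<phi> w) + Im g *\<^sub>R (dy \<phi> y - dy \<phi> w))
            \<le> \<bar>Re g\<bar> * cmod (dx \<phi> y - dx \<phi> w) + \<bar>Im g\<bar> * cmod (dy \<phi> y - dy \<phi> w)"
          by (rule order_trans[OF norm_triangle_ineq]) simp
        also have "\<dots> \<le> cmod g * (L1 * cmod h) + cmod g * (L2 * cmod h)"
          by (intro add_mono mult_mono abs_Re_le_cmod abs_Im_le_cmod order_trans[OF L1(2)] order_trans[OF L2(2)] mult_left_mono L1(1) L2(1) yw) auto
        finally show "norm (Re g *\<^sub>R (dx \<phi> y - dx \<phi> w) + Im g *\<^sub>R (dy \<phi> y - dy \<phi> w)) \<le> ((L1 + L2) * cmod h) * norm g"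
          by (simp add: algebra_simps)
      qed
    qed (auto simp: dist_norm)
    then show ?thesis by (simp add: k_def algebra_simps power2_eq_square)
  qed
  then show ?thesis using L1(1) L2(1) by (intro exI[of _ "L1 + L2"]) auto
qed

lemma integrable_cauchy_conv:
  assumes s: "plane_smooth \<phi>" and supp: "\<And>z. cmod z > R \<Longrightarrow> \<phi> z = 0" and R: "R > 0"
  shows "integrable lborel (\<lambda>z. \<phi> (\<zeta> - z) / z)"
proof -
  note [measurable] = plane_smooth_measurable[OF s]
  obtain B where B: "\<And>z. cmod (\<phi> z) \<le> B" using smooth_bounded_support[OF s supp] by blast
  have "integrable lborel (\<lambda>z. \<phi> (\<zeta> - z) / (z - 0))"
  proof (rule integrable_cauchy_kernel[OF _ B])
    fix z assume "cmod z > R + cmod \<zeta>"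
    then have "cmod (\<zeta> - z) > R" using norm_triangle_ineq2[of z \<zeta>] by (simp add: norm_minus_commute)
    then show "\<phi> (\<zeta> - z) = 0" by (rule supp)
  qed (use R in \<open>auto simp: add_pos_nonneg\<close>)
  then show ?thesis by simp
qed

text \<open>Differentiation under the integral: the remainder of the convolution is the integral of
  the Taylor remainder of \<phi> divided by z, which is of order \<open>(cmod h)\<^sup>2\<close>
  because \<open>1 / cmod z\<close> is integrable over balls.\<close>

lemma cauchy_conv_has_derivative:
  assumes s: "plane_smooth \<phi>" and supp: "\<And>z. cmod z > R \<Longrightarrow> \<phi> z = 0" and R: "R > 0"
  shows "(cauchy_conv \<phi> has_derivative (\<lambda>h. Re h *\<^sub>R cauchy_conv (dx \<phi>) \<zeta> + Im h *\<^sub>R cauchy_conv (dy \<phi>) \<zeta>)) (at \<zeta>)"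
proof -
  obtain L where L: "L \<ge> 0" "\<And>w h. cmod (\<phi> (w + h) - \<phi> w - (Re h *\<^sub>R dx \<phi> w + Im h *\<^sub>R dy \<phi> w)) \<le> L * (cmod h)\<^sup>2"
    using smooth_quadratic_remainder[OF s supp] by blast
  note i0 = integrable_cauchy_conv[OF s supp R]
  note ix = integrable_cauchy_conv[OF plane_smooth_dx[OF s] dx_dy_bounded_support(1)[OF supp, of R] R]
  note iy = integrable_cauchy_conv[OF plane_smooth_dy[OF s] dx_dy_bounded_support(2)[OF supp, of R] R]
  \<comment> \<open>With \<open>cmod h \<le> 1\<close>, the condition
    \<open>cmod z \<ge> \<rho>\<close> forces \<open>cmod (\<zeta> - z) > R + 1\<close>, so every
    term of the remainder vanishes outside the ball of radius \<rho>.\<close>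
  define \<rho> where "\<rho> = cmod \<zeta> + R + 2"
  have \<rho>: "\<rho> > 0" using R by (simp add: \<rho>_def add_nonneg_pos)
  have bound: "cmod (cauchy_conv \<phi> (\<zeta> + h) - cauchy_conv \<phi> \<zeta> - (Re h *\<^sub>R cauchy_conv (dx \<phi>) \<zeta> + Im h *\<^sub>R cauchy_conv (dy \<phi>) \<zeta>))
      \<le> (L * (12 * pi * \<rho>)) * (cmod h)\<^sup>2" if h: "cmod h \<le> 1" for h
  proof -
    define e where "e = (\<lambda>z. (\<phi> ((\<zeta> - z) + h) - \<phi> (\<zeta> - z) - (Re h *\<^sub>R dx \<phi> (\<zeta> - z) + Im h *\<^sub>R dy \<phi> (\<zeta> - z))) / z)"
    have e_eq: "e = (\<lambda>z. \<phi> (\<zeta> + h - z) / z - \<phi> (\<zeta> - z) / z - (Re h *\<^sub>R (dx \<phi> (\<zeta> - z) / z) + Im h *\<^sub>R (dy \<phi> (\<zeta> - z) / z)))"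
      by (auto simp: e_def fun_eq_iff diff_divide_distrib add_divide_distrib scaleR_conv_of_real algebra_simps)
    have int: "integrable lborel e" unfolding e_eq using i0 ix iy by (intro Bochner_Integration.integrable_diff Bochner_Integration.integrable_add integrable_scaleR_right) auto
    have "cauchy_conv \<phi> (\<zeta> + h) - cauchy_conv \<phi> \<zeta> - (Re h *\<^sub>R cauchy_conv (dx \<phi>) \<zeta> + Im h *\<^sub>R cauchy_conv (dy \<phi>) \<zeta>) = integral\<^sup>L lborel e"
      unfolding e_eq cauchy_conv_def using i0 ix iy
      by (simp only: Bochner_Integration.integral_diff Bochner_Integration.integral_add Bochner_Integration.integrable_diff
          Bochner_Integration.integrable_add integral_scaleR_right integrable_scaleR_right)
    moreover have "ennreal (cmod (integral\<^sup>L lborel e)) \<le> ennreal ((L * (12 * pi * \<rho>)) * (cmod h)\<^sup>2)"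
    proof -
      have "ennreal (cmod (integral\<^sup>L lborel e)) \<le> (\<integral>\<^sup>+z. ennreal (cmod (e z)) \<partial>lborel)"
        by (rule integral_norm_bound_ennreal[OF int])
      also have "\<dots> \<le> (\<integral>\<^sup>+z. ennreal (L * (cmod h)\<^sup>2) * (ennreal (1 / cmod (z - 0)) * indicator (ball 0 \<rho>) z) \<partial>lborel)"
      proof (intro nn_integral_mono)
        fix z
        show "ennreal (cmod (e z)) \<le> ennreal (L * (cmod h)\<^sup>2) * (ennreal (1 / cmod (z - 0)) * indicator (ball 0 \<rho>) z)"
        proof (cases "cmod z < \<rho>")
          case True
          have "cmod (e z) \<le> (L * (cmod h)\<^sup>2) * (1 / cmod z)"
            unfolding e_def norm_divide using L(2)[of "\<zeta> - z" h] by (simp add: divide_right_mono)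
          then show ?thesis using True L(1) by (simp add: ennreal_mult[symmetric] ennreal_leI)
        next
          case False
          have "cmod (\<zeta> - z) > R + 1" using False norm_triangle_ineq2[of z \<zeta>] by (simp add: \<rho>_def norm_minus_commute)
          moreover from this have "cmod ((\<zeta> - z) + h) > R" using h norm_diff_ineq[of "\<zeta> - z" h] by linarith
          ultimately have "e z = 0" using supp dx_dy_bounded_support[OF supp, of R] by (simp add: e_def)
          then show ?thesis by simp
        qed
      qed
      also have "\<dots> = ennreal (L * (cmod h)\<^sup>2) * (\<integral>\<^sup>+z. (ennreal (1 / cmod (z - 0)) * indicator (ball 0 \<rho>) z) \<partial>lborel)"
        by (rule nn_integral_cmult) measurable
      also have "\<dots> \<le> ennreal (L * (cmod h)\<^sup>2) * ennreal (12 * pi * \<rho>)"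
        by (intro mult_left_mono nn_integral_inverse_dist \<rho>) auto
      also have "\<dots> = ennreal ((L * (12 * pi * \<rho>)) * (cmod h)\<^sup>2)"
        using L(1) \<rho> by (simp add: ennreal_mult[symmetric] mult_ac)
      finally show ?thesis .
    qed
    ultimately show ?thesis using L(1) \<rho> by (simp add: ennreal_le_iff)
  qed
  show ?thesis
    unfolding has_derivative_at_alt
  proof (intro conjI allI impI)
    show "bounded_linear (\<lambda>h. Re h *\<^sub>R cauchy_conv (dx \<phi>) \<zeta> + Im h *\<^sub>R cauchy_conv (dy \<phi>) \<zeta>)"
      by (intro bounded_linear_add bounded_linear_scaleR_const bounded_linear_Re bounded_linear_Im)
    fix e :: real assume e: "e > 0"
    define C where "C = L * (12 * pi * \<rho>)"
    have C: "C \<ge> 0" using L(1) \<rho> by (simp add: C_def)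
    show "\<exists>d>0. \<forall>y. norm (y - \<zeta>) < d \<longrightarrow> norm (cauchy_conv \<phi> y - cauchy_conv \<phi> \<zeta> -
        (Re (y - \<zeta>) *\<^sub>R cauchy_conv (dx \<phi>) \<zeta> + Im (y - \<zeta>) *\<^sub>R cauchy_conv (dy \<phi>) \<zeta>)) \<le> e * norm (y - \<zeta>)"
    \<comment> \<open>The minimum with 1 makes the quadratic bound applicable; \<open>C + 1\<close>
      avoids a division by 0 when \<open>C\<close> is 0.\<close>
    proof (intro exI[of _ "min 1 (e / (C + 1))"] conjI allI impI)
      show "0 < min 1 (e / (C + 1))" using e C by simp
      fix y assume y: "norm (y - \<zeta>) < min 1 (e / (C + 1))"
      have "C * cmod (y - \<zeta>) \<le> e"
      proof -
        have "cmod (y - \<zeta>) < e / (C + 1)" using y by simp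
        then have "(C + 1) * cmod (y - \<zeta>) < e" using C by (simp add: pos_less_divide_eq mult.commute)
        then show ?thesis unfolding distrib_right using norm_ge_zero[of "y - \<zeta>"] by linarith
      qed
      then have "C * (cmod (y - \<zeta>))\<^sup>2 \<le> e * cmod (y - \<zeta>)"
        by (simp add: power2_eq_square mult.assoc[symmetric] mult_right_mono)
      then show "norm (cauchy_conv \<phi> y - cauchy_conv \<phi> \<zeta> -
        (Re (y - \<zeta>) *\<^sub>R cauchy_conv (dx \<phi>) \<zeta> + Im (y - \<zeta>) *\<^sub>R cauchy_conv (dy \<phi>) \<zeta>)) \<le> e * norm (y - \<zeta>)"
        using bound[of "y - \<zeta>"] y by (simp add: C_def)
    qed
  qed
qed

text \<open>The first derivatives of the convolution are convolutions of the first derivatives of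
  \<phi>, so smoothness is an induction on the order. \<open>cauchy_pompeiu\<close> then identifies
  \<open>d_zbar\<close> of the convolution, which solves the inhomogeneous equation with right-hand
  side \<open>of_real pi * \<phi> \<zeta>\<close>.\<close>

lemma cauchy_conv_smooth:
  assumes s: "plane_smooth \<phi>" and supp: "\<And>z. cmod z > R \<Longrightarrow> \<phi> z = 0" and R: "R > 0"
  shows "plane_smooth (cauchy_conv \<phi>)" "d_zbar (cauchy_conv \<phi>) = (\<lambda>\<zeta>. of_real pi * \<phi> \<zeta>)"
proof -
  have dxy: "dx (cauchy_conv \<phi>) = cauchy_conv (dx \<phi>)" "dy (cauchy_conv \<phi>) = cauchy_conv (dy \<phi>)"
    if "plane_smooth \<phi>" "\<And>z. cmod z > R \<Longrightarrow> \<phi> z = 0" for \<phi>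
    using dx_eqI[OF cauchy_conv_has_derivative[OF that R]] dy_eqI[OF cauchy_conv_has_derivative[OF that R]] by auto
  have "plane_Ck k (cauchy_conv \<phi>)" if "plane_smooth \<phi>" "\<And>z. cmod z > R \<Longrightarrow> \<phi> z = 0" for k \<phi>
    using that
  proof (induction k arbitrary: \<phi>)
    case (Suc k)
    have d: "cauchy_conv \<phi> differentiable (at z)" for z
      unfolding differentiable_def by (rule exI) (rule cauchy_conv_has_derivative[OF Suc.prems R])
    have k: "plane_Ck k (cauchy_conv (dx \<phi>))" "plane_Ck k (cauchy_conv (dy \<phi>))"
      by (rule Suc.IH[OF plane_smooth_dx[OF Suc.prems(1)]], rule dx_dy_bounded_support(1)[OF Suc.prems(2)], assumption+)
         (rule Suc.IH[OF plane_smooth_dy[OF Suc.prems(1)]], rule dx_dy_bounded_support(2)[OF Suc.prems(2)], assumption+)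
    have dd: "dx (cauchy_conv \<phi>) = cauchy_conv (dx \<phi>)" "dy (cauchy_conv \<phi>) = cauchy_conv (dy \<phi>)"
      by (rule dxy(1)[OF Suc.prems(1)], rule Suc.prems(2), assumption) (rule dxy(2)[OF Suc.prems(1)], rule Suc.prems(2), assumption)
    show ?case
      unfolding plane_Ck.simps dd by (intro conjI allI d k)
  qed simp
  note Ck = this
  show "plane_smooth (cauchy_conv \<phi>)"
    by (rule plane_smooth_iff[THEN iffD2]) (intro allI Ck[OF s], rule supp)
  note ix = integrable_cauchy_conv[OF plane_smooth_dx[OF s] dx_dy_bounded_support(1)[OF supp, of R] R]
  note iy = integrable_cauchy_conv[OF plane_smooth_dy[OF s] dx_dy_bounded_support(2)[OF supp, of R] R]
  show "d_zbar (cauchy_conv \<phi>) = (\<lambda>\<zeta>. of_real pi * \<phi> \<zeta>)"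
  proof
    fix \<zeta>
    have "dx (cauchy_conv \<phi>) = cauchy_conv (dx \<phi>)" "dy (cauchy_conv \<phi>) = cauchy_conv (dy \<phi>)"
      by (rule dxy(1)[OF s], rule supp, assumption) (rule dxy(2)[OF s], rule supp, assumption)
    then have "d_zbar (cauchy_conv \<phi>) \<zeta> = 1/2 * (cauchy_conv (dx \<phi>) \<zeta> + \<i> * cauchy_conv (dy \<phi>) \<zeta>)"
      unfolding d_zbar_eq by simp
    also have "\<dots> = cauchy_conv (d_zbar \<phi>) \<zeta>"
    proof -
      have e: "(\<lambda>z. d_zbar \<phi> (\<zeta> - z) / z) = (\<lambda>z. 1/2 * (dx \<phi> (\<zeta> - z) / z + \<i> * (dy \<phi> (\<zeta> - z) / z)))"
        by (simp add: fun_eq_iff d_zbar_eq add_divide_distrib mult_ac)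
      show ?thesis unfolding cauchy_conv_def e using ix[of \<zeta>] iy[of \<zeta>]
        by (simp only: integral_mult_right_zero Bochner_Integration.integral_add integrable_mult_right)
    qed
    also have "\<dots> = integral\<^sup>L lborel (\<lambda>w. - (d_zbar \<phi> w / (w - \<zeta>)))"
      by (subst cauchy_conv_eq[OF plane_smooth_measurable[OF plane_smooth_d_zbar[OF s]]])
         (simp add: minus_divide_right)
    also have "\<dots> = of_real pi * \<phi> \<zeta>"
      using cauchy_pompeiu[OF s supp R, of \<zeta>] by simp
    finally show "d_zbar (cauchy_conv \<phi>) \<zeta> = of_real pi * \<phi> \<zeta>" .
  qed
qed

text \<open>Integrating over z first costs only a constant independent of \<zeta>, by
  \<open>nn_integral_inverse_dist\<close>; integrability of \<open>q\<close> then suffices for the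
  outer integral.\<close>

lemma kernel_fubini:
  fixes f q :: "complex \<Rightarrow> complex"
  assumes [measurable]: "f \<in> borel_measurable borel" "q \<in> borel_measurable borel"
    and f: "\<And>z. cmod (f z) \<le> B" "\<And>z. cmod z > R \<Longrightarrow> f z = 0" and R: "R > 0" and q: "integrable lborel q"
  shows "integrable (lborel \<Otimes>\<^sub>M lborel) (\<lambda>(\<zeta>, z). q \<zeta> * (f z / (\<zeta> - z)))"
proof (rule integrableI_bounded)
  have B: "B \<ge> 0" using f(1)[of 0] norm_ge_zero order_trans by blast
  have "(\<integral>\<^sup>+x. ennreal (norm (case x of (\<zeta>, z) \<Rightarrow> q \<zeta> * (f z / (\<zeta> - z)))) \<partial>(lborel \<Otimes>\<^sub>M lborel))
      = (\<integral>\<^sup>+\<zeta>. (\<integral>\<^sup>+z. ennreal (norm (q \<zeta> * (f z / (\<zeta> - z)))) \<partial>lborel) \<partial>lborel)"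
    by (subst lborel.nn_integral_fst[symmetric]) auto
  also have "\<dots> \<le> (\<integral>\<^sup>+\<zeta>. ennreal (norm (q \<zeta>)) * ennreal (B * (12 * pi * (2 * R))) \<partial>lborel)"
  proof (intro nn_integral_mono)
    fix \<zeta>
    have "(\<integral>\<^sup>+z. ennreal (norm (q \<zeta> * (f z / (\<zeta> - z)))) \<partial>lborel) \<le>
      (\<integral>\<^sup>+z. ennreal (norm (q \<zeta>) * B) * (ennreal (1 / cmod (z - \<zeta>)) * indicator (ball 0 (2 * R)) z) \<partial>lborel)"
    proof (intro nn_integral_mono)
      fix z
      show "ennreal (norm (q \<zeta> * (f z / (\<zeta> - z)))) \<le> ennreal (norm (q \<zeta>) * B) * (ennreal (1 / cmod (z - \<zeta>)) * indicator (ball 0 (2 * R)) z)"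
      proof (cases "cmod z > R")
        case False
        have "norm (q \<zeta> * (f z / (\<zeta> - z))) \<le> (norm (q \<zeta>) * B) * (1 / cmod (z - \<zeta>))"
          using f(1)[of z] by (simp add: norm_mult norm_divide norm_minus_commute mult_left_mono divide_right_mono)
        then show ?thesis using False B R by (simp add: ennreal_mult[symmetric] ennreal_leI)
      qed (simp add: f)
    qed
    also have "\<dots> = ennreal (norm (q \<zeta>) * B) * (\<integral>\<^sup>+z. (ennreal (1 / cmod (z - \<zeta>)) * indicator (ball 0 (2 * R)) z) \<partial>lborel)"
      by (rule nn_integral_cmult) measurable
    also have "\<dots> \<le> ennreal (norm (q \<zeta>) * B) * ennreal (12 * pi * (2 * R))"
      using R by (intro mult_left_mono nn_integral_inverse_dist) auto
    also have "\<dots> = ennreal (norm (q \<zeta>)) * ennreal (B * (12 * pi * (2 * R)))"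
      using B R by (simp add: ennreal_mult[symmetric] mult_ac)
    finally show "(\<integral>\<^sup>+z. ennreal (norm (q \<zeta> * (f z / (\<zeta> - z)))) \<partial>lborel) \<le> ennreal (norm (q \<zeta>)) * ennreal (B * (12 * pi * (2 * R)))" .
  qed
  also have "\<dots> = (\<integral>\<^sup>+\<zeta>. ennreal (norm (q \<zeta>)) \<partial>lborel) * ennreal (B * (12 * pi * (2 * R)))"
    by (rule nn_integral_multc) measurable
  also have "\<dots> < \<infinity>"
    using q unfolding integrable_iff_bounded by (simp add: ennreal_mult_less_top)
  finally show "(\<integral>\<^sup>+x. ennreal (norm (case x of (\<zeta>, z) \<Rightarrow> q \<zeta> * (f z / (\<zeta> - z)))) \<partial>(lborel \<Otimes>\<^sub>M lborel)) < \<infinity>" .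
qed measurable

text \<open>As \<open>q\<close> vanishes for \<open>cmod \<zeta> < R\<close>, the kernel expands in
  a geometric series in \<open>z / \<zeta>\<close> with ratio at most \<open>cmod z / R\<close>, and
  termwise integration produces a power series.\<close>

lemma cauchy_transform_holomorphic:
  assumes q: "integrable lborel q" and q0: "\<And>\<zeta>. cmod \<zeta> < R \<Longrightarrow> q \<zeta> = 0" and R: "R > 0"
  shows "(\<lambda>z. integral\<^sup>L lborel (\<lambda>\<zeta>. q \<zeta> / (\<zeta> - z))) holomorphic_on ball 0 R"
proof -
  have [measurable]: "q \<in> borel_measurable borel" using q by auto
  have "(\<lambda>l. integral\<^sup>L lborel (\<lambda>\<zeta>. q \<zeta> / \<zeta> ^ Suc l) * (z - 0) ^ l) sums integral\<^sup>L lborel (\<lambda>\<zeta>. q \<zeta> / (\<zeta> - z))"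
    if "z \<in> ball 0 R" for z
  proof -
    have z: "cmod z < R" using that by simp
    have le: "norm (q \<zeta> / \<zeta> ^ Suc l * z ^ l) \<le> norm (q \<zeta>) * (1 / R * (cmod z / R) ^ l)" for \<zeta> l
    proof (cases "cmod \<zeta> < R")
      case False
      have "1 / cmod \<zeta> ^ Suc l \<le> 1 / R ^ Suc l" using False R by (intro divide_left_mono power_mono mult_pos_pos zero_less_power) auto
      then have "norm (q \<zeta>) * (cmod z ^ l * (1 / cmod \<zeta> ^ Suc l)) \<le> norm (q \<zeta>) * (cmod z ^ l * (1 / R ^ Suc l))"
        by (intro mult_left_mono) auto
      then show ?thesis by (simp add: norm_mult norm_divide norm_power power_divide mult_ac)
    qed (simp add: q0)
    have geo: "summable (\<lambda>l. (cmod z / R) ^ l)" using z R by (intro summable_geometric) simp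
    have int: "integrable lborel (\<lambda>\<zeta>. q \<zeta> / \<zeta> ^ Suc l * z ^ l)" for l
      by (rule Bochner_Integration.integrable_bound[OF integrable_mult_left[OF integrable_norm[OF q], of "1 / R * (cmod z / R) ^ l"]])
         (use le R in \<open>auto simp del: power_Suc\<close>)
    have 1: "(\<lambda>l. integral\<^sup>L lborel (\<lambda>\<zeta>. q \<zeta> / \<zeta> ^ Suc l * z ^ l)) sums integral\<^sup>L lborel (\<lambda>\<zeta>. \<Sum>l. q \<zeta> / \<zeta> ^ Suc l * z ^ l)"
    proof (rule sums_integral[OF int])
      show "AE \<zeta> in lborel. summable (\<lambda>l. norm (q \<zeta> / \<zeta> ^ Suc l * z ^ l))"
      proof (rule AE_I2)
        fix \<zeta>
        show "summable (\<lambda>l. norm (q \<zeta> / \<zeta> ^ Suc l * z ^ l))"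
          by (rule summable_comparison_test'[OF summable_mult[OF summable_mult[OF geo, of "1 / R"], of "norm (q \<zeta>)"], of 0])
             (use le in simp)
      qed
      have "norm (integral\<^sup>L lborel (\<lambda>\<zeta>. norm (q \<zeta> / \<zeta> ^ Suc l * z ^ l))) \<le> integral\<^sup>L lborel (\<lambda>\<zeta>. norm (q \<zeta>)) * (1 / R) * (cmod z / R) ^ l" for l
      proof -
        have "integral\<^sup>L lborel (\<lambda>\<zeta>. norm (q \<zeta> / \<zeta> ^ Suc l * z ^ l)) \<le> integral\<^sup>L lborel (\<lambda>\<zeta>. norm (q \<zeta>) * (1 / R * (cmod z / R) ^ l))"
          by (intro integral_mono integrable_norm int integrable_mult_left q le)
        also have "\<dots> = integral\<^sup>L lborel (\<lambda>\<zeta>. norm (q \<zeta>)) * (1 / R) * (cmod z / R) ^ l" by simp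
        finally show ?thesis by simp
      qed
      then show "summable (\<lambda>l. integral\<^sup>L lborel (\<lambda>\<zeta>. norm (q \<zeta> / \<zeta> ^ Suc l * z ^ l)))"
        by (rule summable_comparison_test'[OF summable_mult[OF geo, of "integral\<^sup>L lborel (\<lambda>\<zeta>. norm (q \<zeta>)) * (1 / R)"], of 0])
    qed
    have "(\<Sum>l. q \<zeta> / \<zeta> ^ Suc l * z ^ l) = q \<zeta> / (\<zeta> - z)" for \<zeta>
    proof (cases "cmod \<zeta> < R")
      case False
      then have nz: "\<zeta> \<noteq> 0" "\<zeta> - z \<noteq> 0" using R z by auto
      have "cmod (z / \<zeta>) < 1" using False z R by (simp add: norm_divide divide_less_eq)
      then have "(\<lambda>l. (q \<zeta> / \<zeta>) * (z / \<zeta>) ^ l) sums ((q \<zeta> / \<zeta>) * (1 / (1 - z / \<zeta>)))"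
        by (intro sums_mult geometric_sums)
      also have "(q \<zeta> / \<zeta>) * (1 / (1 - z / \<zeta>)) = q \<zeta> / (\<zeta> - z)"
        using nz by (simp add: field_simps)
      also have "(\<lambda>l. (q \<zeta> / \<zeta>) * (z / \<zeta>) ^ l) = (\<lambda>l. q \<zeta> / \<zeta> ^ Suc l * z ^ l)"
        using nz by (simp add: power_divide field_simps)
      finally show ?thesis by (simp add: sums_iff)
    qed (simp add: q0)
    moreover have "integral\<^sup>L lborel (\<lambda>\<zeta>. q \<zeta> / \<zeta> ^ Suc l * z ^ l) = integral\<^sup>L lborel (\<lambda>\<zeta>. q \<zeta> / \<zeta> ^ Suc l) * z ^ l" for l
      by (rule integral_mult_left_zero)
    ultimately show ?thesis using 1 by (simp only: diff_zero)
  qed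
  then show ?thesis by (rule power_series_holomorphic)
qed

lemma test_integrable_lborel:
  assumes [measurable]: "v \<in> borel_measurable borel" and v: "locally_integrable v" and \<phi>: "disk_test \<phi>"
  shows "integrable lborel (\<lambda>z. v z * \<phi> z)"
proof -
  have [measurable]: "\<phi> \<in> borel_measurable borel" by (rule plane_smooth_measurable[OF disk_test_smooth[OF \<phi>]])
  obtain K where K: "K \<subseteq> unit_disk" "\<And>z. z \<notin> K \<Longrightarrow> \<phi> z = 0" by (rule disk_test_support[OF \<phi>]) auto
  have "indicator unit_disk z *\<^sub>R (v z * \<phi> z) = v z * \<phi> z" for z
  proof (cases "z \<in> unit_disk")
    case False
    then have "\<phi> z = 0" using K by blast
    then show ?thesis by simp
  qed simp
  then show ?thesis using test_pairing_integrable[OF v \<phi>] unfolding set_integrable_def by (simp add: integrable_completion)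
qed

text \<open>For a test function \<phi> supported in the small ball, let \<Phi> be its Cauchy
  convolution. Testing \<open>v\<close> with \<open>\<Phi> z * \<eta> z\<close> gives
  \<open>pi\<close> times the pairing of \<open>v\<close> with \<phi> as minus the integral of
  \<open>q \<zeta> * \<Phi> \<zeta>\<close>. By Fubini this equals the pairing of \<open>H\<close>
  with \<phi>, where \<open>H\<close> is a multiple of the Cauchy transform of \<open>q\<close>;
  \<open>q\<close> vanishes where the cutoff is constant, so \<open>H\<close> is
  holomorphic.\<close>

lemma weyl_local:
  assumes vb [measurable]: "v \<in> borel_measurable borel" and v: "weak_d_zbar 1 v (\<lambda>z. 0)" and R: "0 < R" "R < 1"
  shows "\<exists>H. H holomorphic_on ball 0 R \<and> (AE z in lborel. z \<in> ball 0 R \<longrightarrow> v z = H z)"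
proof -
  have li: "locally_integrable v" using v by (simp add: weak_d_zbar_iff)
  obtain \<eta> where \<eta>: "disk_test \<eta>" "\<And>z. cmod z \<le> R \<Longrightarrow> \<eta> z = 1" using disk_cutoff[OF R] by blast
  have [measurable]: "d_zbar \<eta> \<in> borel_measurable borel" by (rule plane_smooth_measurable[OF plane_smooth_d_zbar[OF disk_test_smooth[OF \<eta>(1)]]])
  define q where "q = (\<lambda>\<zeta>. v \<zeta> * d_zbar \<eta> \<zeta>)"
  have [measurable]: "q \<in> borel_measurable borel" unfolding q_def by measurable
  have qi: "integrable lborel q" unfolding q_def by (rule test_integrable_lborel[OF vb li disk_test_d_zbar[OF \<eta>(1)]])
  have q0: "q \<zeta> = 0" if "cmod \<zeta> < R" for \<zeta>
  proof -
    have "d_zbar (\<lambda>z. \<eta> z + (-1)) \<zeta> = 0" by (rule d_zbar_eq_0[of "ball 0 R"]) (use that \<eta>(2) in auto)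
    moreover have "d_zbar (\<lambda>z. -1) \<zeta> = 0" unfolding d_zbar_def by simp
    ultimately have "d_zbar \<eta> \<zeta> = 0"
      unfolding d_zbar_add[OF disk_test_smooth[OF \<eta>(1)] plane_smooth_const[of "-1"]] by simp
    then show ?thesis by (simp add: q_def)
  qed
  define H where "H = (\<lambda>z. - (1 / of_real pi) * integral\<^sup>L lborel (\<lambda>\<zeta>. q \<zeta> / (\<zeta> - z)))"
  have hol: "H holomorphic_on ball 0 R"
    unfolding H_def by (intro holomorphic_intros cauchy_transform_holomorphic qi q0 R)
  have Hm [measurable]: "H \<in> borel_measurable borel" unfolding H_def by measurable
  have "AE z in lborel. z \<in> ball 0 R \<longrightarrow> v z - H z = 0"
  proof (rule fundamental_lemma_borel)
    have iK: "integrable lborel (\<lambda>z. indicator K z *\<^sub>R v z)" "integrable lborel (\<lambda>z. indicator K z *\<^sub>R H z)"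
      if K: "compact K" "K \<subseteq> ball 0 R" for K
    proof -
      have "integrable lborel (\<lambda>z. indicator (cball 0 R) z *\<^sub>R v z)" using locally_integrable_borelD[OF vb li] R by simp
      then show "integrable lborel (\<lambda>z. indicator K z *\<^sub>R v z)"
        using set_integrable_subset[of lborel "cball 0 R" v K] K order_trans[OF K(2) ball_subset_cball] by (auto simp: set_integrable_def borel_compact)
      show "integrable lborel (\<lambda>z. indicator K z *\<^sub>R H z)"
        by (rule borel_integrable_compact[OF K(1)]) (use holomorphic_on_imp_continuous_on[OF hol] K(2) continuous_on_subset in blast)
    qed
    then show "integrable lborel (\<lambda>z. indicator K z *\<^sub>R (v z - H z))" if K: "compact K" "K \<subseteq> ball 0 R" for K
      using Bochner_Integration.integrable_diff[OF iK[OF K]] by (simp add: scaleR_diff_right)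
    fix \<phi> K assume \<phi>: "plane_smooth \<phi>" and K: "compact K" "K \<subseteq> ball 0 R" "\<And>z. z \<notin> K \<Longrightarrow> \<phi> z = 0"
    have [measurable]: "\<phi> \<in> borel_measurable borel" by (rule plane_smooth_measurable[OF \<phi>])
    have \<phi>t: "disk_test \<phi>" unfolding disk_test_def using \<phi> K R by (intro conjI exI[of _ K]) auto
    have supp: "\<phi> z = 0" if "cmod z > R" for z using K that by force
    define \<Phi> where "\<Phi> = cauchy_conv \<phi>"
    have \<Phi>: "plane_smooth \<Phi>" "d_zbar \<Phi> = (\<lambda>\<zeta>. of_real pi * \<phi> \<zeta>)"
      unfolding \<Phi>_def using cauchy_conv_smooth[OF \<phi> supp R(1)] by auto
    have [measurable]: "\<Phi> \<in> borel_measurable borel" by (rule plane_smooth_measurable[OF \<Phi>(1)])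
    obtain B where B: "\<And>z. cmod (\<phi> z) \<le> B" using smooth_bounded_support[OF \<phi> supp] by blast
    have \<eta>\<Phi>: "disk_test (\<lambda>z. \<Phi> z * \<eta> z)" by (rule disk_test_mult[OF \<eta>(1) \<Phi>(1)])
    have \<Phi>d\<eta>: "disk_test (\<lambda>z. \<Phi> z * d_zbar \<eta> z)" by (rule disk_test_mult[OF disk_test_d_zbar[OF \<eta>(1)] \<Phi>(1)])
    \<comment> \<open>The cutoff equals 1 on the support of \<phi>, so it disappears from the term
      in which \<open>d_zbar\<close> hits \<Phi>.\<close>
    have pe: "\<phi> z * \<eta> z = \<phi> z" for z
    proof (cases "z \<in> K")
      case True then have "cmod z \<le> R" using K(2) by (auto simp: subset_eq less_imp_le)
      then show ?thesis by (simp add: \<eta>)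
    qed (simp add: K)
    have "d_zbar (\<lambda>z. \<Phi> z * \<eta> z) = (\<lambda>z. \<Phi> z * d_zbar \<eta> z + of_real pi * \<phi> z)"
      unfolding d_zbar_mult[OF \<Phi>(1) disk_test_smooth[OF \<eta>(1)]] \<Phi>(2) by (simp only: mult.assoc pe)
    moreover have "test_pairing v (d_zbar (\<lambda>z. \<Phi> z * \<eta> z)) = 0"
      using v \<eta>\<Phi> unfolding weak_d_zbar_iff by (auto simp: test_pairing_def)
    ultimately have "0 = test_pairing v (\<lambda>z. \<Phi> z * d_zbar \<eta> z) + of_real pi * test_pairing v \<phi>"
      using test_pairing_add_right[OF li \<Phi>d\<eta> disk_test_mult[OF \<phi>t plane_smooth_const[of "of_real pi"]]]
      by (simp add: test_pairing_def mult.left_commute)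
    then have v\<phi>: "of_real pi * integral\<^sup>L lborel (\<lambda>z. v z * \<phi> z) = - integral\<^sup>L lborel (\<lambda>\<zeta>. q \<zeta> * \<Phi> \<zeta>)"
      unfolding test_pairing_lborel[OF vb \<phi>t] test_pairing_lborel[OF vb \<Phi>d\<eta>]
      by (simp add: q_def mult_ac add_eq_0_iff2)
    have kf: "integrable (lborel \<Otimes>\<^sub>M lborel) (\<lambda>(\<zeta>, z). q \<zeta> * (\<phi> z / (\<zeta> - z)))"
      by (rule kernel_fubini[OF plane_smooth_measurable[OF \<phi>] _ B supp R(1) qi]) measurable
    have e: "q \<zeta> * (\<phi> z / (\<zeta> - z)) = \<phi> z * (q \<zeta> / (\<zeta> - z))" for \<zeta> z by simp
    have "integral\<^sup>L lborel (\<lambda>z. integral\<^sup>L lborel (\<lambda>\<zeta>. q \<zeta> * (\<phi> z / (\<zeta> - z)))) = integral\<^sup>L lborel (\<lambda>z. \<phi> z * integral\<^sup>L lborel (\<lambda>\<zeta>. q \<zeta> / (\<zeta> - z)))"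
      unfolding e integral_mult_right_zero ..
    moreover have "integral\<^sup>L lborel (\<lambda>\<zeta>. integral\<^sup>L lborel (\<lambda>z. q \<zeta> * (\<phi> z / (\<zeta> - z)))) = integral\<^sup>L lborel (\<lambda>\<zeta>. q \<zeta> * \<Phi> \<zeta>)"
      unfolding \<Phi>_def cauchy_conv_eq[OF plane_smooth_measurable[OF \<phi>]] integral_mult_right_zero ..
    ultimately have "integral\<^sup>L lborel (\<lambda>z. \<phi> z * integral\<^sup>L lborel (\<lambda>\<zeta>. q \<zeta> / (\<zeta> - z))) = integral\<^sup>L lborel (\<lambda>\<zeta>. q \<zeta> * \<Phi> \<zeta>)"
      using lborel_pair.Fubini_integral[OF kf] by simp
    then have H\<phi>: "of_real pi * integral\<^sup>L lborel (\<lambda>z. H z * \<phi> z) = - integral\<^sup>L lborel (\<lambda>\<zeta>. q \<zeta> * \<Phi> \<zeta>)"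
    proof -
      have "(\<lambda>z. of_real pi * (H z * \<phi> z)) = (\<lambda>z. - (\<phi> z * integral\<^sup>L lborel (\<lambda>\<zeta>. q \<zeta> / (\<zeta> - z))))"
        by (auto simp: H_def fun_eq_iff)
      then show ?thesis using \<open>integral\<^sup>L lborel (\<lambda>z. \<phi> z * _ z) = _\<close>
        by (simp only: integral_mult_right_zero[symmetric] Bochner_Integration.integral_minus)
    qed
    have "integrable lborel (\<lambda>z. H z * \<phi> z)"
    proof (rule Bochner_Integration.integrable_bound)
      show "integrable lborel (\<lambda>z. B * norm (indicator K z *\<^sub>R H z))" by (intro integrable_mult_right integrable_norm iK K)
      show "AE z in lborel. norm (H z * \<phi> z) \<le> norm (B * norm (indicator K z *\<^sub>R H z))"
      proof (rule AE_I2)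
        fix z show "norm (H z * \<phi> z) \<le> norm (B * norm (indicator K z *\<^sub>R H z))"
          using mult_left_mono[OF B[of z] norm_ge_zero[of "H z"]] order_trans[OF norm_ge_zero B[of z]]
          by (cases "z \<in> K") (auto simp: norm_mult K abs_mult mult.commute)
      qed
    qed measurable
    then have "integral\<^sup>L lborel (\<lambda>z. (v z - H z) * \<phi> z) = integral\<^sup>L lborel (\<lambda>z. v z * \<phi> z) - integral\<^sup>L lborel (\<lambda>z. H z * \<phi> z)"
      using test_integrable_lborel[OF vb li \<phi>t] by (simp add: left_diff_distrib)
    then show "integral\<^sup>L lborel (\<lambda>z. (v z - H z) * \<phi> z) = 0" 
      using trans[OF v\<phi> H\<phi>[symmetric]] by (simp only: mult_cancel_left of_real_eq_0_iff pi_neq_zero diff_self simp_thms)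
  qed measurable
  then show ?thesis using hol by (intro exI[of _ H]) auto
qed

lemma continuous_AE_eq:
  fixes f g :: "complex \<Rightarrow> complex"
  assumes "open U" "continuous_on U f" "continuous_on U g" "AE z in lborel. z \<in> U \<longrightarrow> f z = g z" "z \<in> U"
  shows "f z = g z"
proof (rule ccontr)
  assume ne: "f z \<noteq> g z"
  define V where "V = {z \<in> U. f z - g z \<noteq> 0}"
  have "open (U \<inter> (\<lambda>z. f z - g z) -` (- {0}))"
    by (rule continuous_open_preimage) (auto intro!: continuous_intros assms)
  then have "open V" by (simp add: V_def Int_def vimage_def)
  have "AE z in lebesgue. z \<notin> V" using assms(4) unfolding AE_completion_iff by eventually_elim (auto simp: V_def)
  then have "negligible V" unfolding negligible_iff_null_sets completion.null_sets_iff_AE by simp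
  moreover have "V \<noteq> {}" using ne assms(5) by (auto simp: V_def)
  ultimately show False using open_not_negligible \<open>open V\<close> by blast
qed

text \<open>The holomorphic versions on two concentric balls are continuous and agree almost
  everywhere, hence everywhere, on the smaller one. This compatibility lets them be glued along an
  exhaustion of the disk.\<close>

theorem weyl:
  assumes "weak_d_zbar 1 u (\<lambda>z. 0)"
  shows "\<exists>H. H holomorphic_on unit_disk \<and> (AE z in lebesgue. z \<in> unit_disk \<longrightarrow> u z = H z)"
proof -
  have "locally_integrable u" using assms by (simp add: weak_d_zbar_iff)
  then obtain v where v: "v \<in> borel_measurable borel" "AE z in lebesgue. z \<in> unit_disk \<longrightarrow> u z = v z"
    using locally_integrable_borel_version by blast
  have wv: "weak_d_zbar 1 v (\<lambda>z. 0)" by (rule weak_d_zbar_cong[OF v(2) _ assms]) auto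
  define HR where "HR = (\<lambda>R. SOME H. H holomorphic_on ball 0 R \<and> (AE z in lborel. z \<in> ball 0 R \<longrightarrow> v z = H z))"
  have HR: "HR R holomorphic_on ball 0 R" "AE z in lborel. z \<in> ball 0 R \<longrightarrow> v z = HR R z" if "0 < R" "R < 1" for R
    using someI_ex[OF weyl_local[OF v(1) wv that]] unfolding HR_def by auto
  have eq: "HR R z = HR S z" if RS: "0 < R" "R < 1" "0 < S" "S < 1" "cmod z < R" "cmod z < S" for R S z
  proof (rule continuous_AE_eq[of "ball 0 R \<inter> ball 0 S" "HR R" "HR S"])
    show "open (ball 0 R \<inter> ball (0::complex) S)" by auto
    show "continuous_on (ball 0 R \<inter> ball 0 S) (HR R)" "continuous_on (ball 0 R \<inter> ball 0 S) (HR S)"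
      using HR(1)[OF RS(1,2)] HR(1)[OF RS(3,4)] by (auto intro: holomorphic_on_imp_continuous_on continuous_on_subset)
    show "AE z in lborel. z \<in> ball 0 R \<inter> ball 0 S \<longrightarrow> HR R z = HR S z"
      using HR(2)[OF RS(1,2)] HR(2)[OF RS(3,4)] by eventually_elim auto
  qed (use RS in auto)
  \<comment> \<open>The midpoint between \<open>cmod z\<close> and 1: a radius whose open ball
    contains z and a neighbourhood of it.\<close>
  define \<rho> where "\<rho> = (\<lambda>z. (1 + cmod z) / 2)"
  have \<rho>: "0 < \<rho> z" "\<rho> z < 1" "cmod z < \<rho> z" if "cmod z < 1" for z using that by (auto simp: \<rho>_def add_pos_nonneg)
  define H where "H = (\<lambda>z. HR (\<rho> z) z)"
  have HH: "H z = HR R z" if "cmod z < R" "R < 1" for z R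
    unfolding H_def using that norm_ge_zero[of z] by (intro eq \<rho>) linarith+
  have "H holomorphic_on unit_disk"
  proof -
    have "H field_differentiable at z" if "z \<in> unit_disk" for z
    proof -
      have z: "cmod z < 1" using that by simp
      have "HR (\<rho> z) field_differentiable at z"
        using HR(1)[OF \<rho>(1,2)[OF z]] \<rho>(3)[OF z] holomorphic_on_imp_differentiable_at by auto
      then obtain d where "(HR (\<rho> z) has_field_derivative d) (at z)" unfolding field_differentiable_def by blast
      then have "(H has_field_derivative d) (at z)"
        by (rule has_field_derivative_transform_within_open[of _ _ _ "ball 0 (\<rho> z)"])
           (use \<rho>[OF z] HH in auto)
      then show ?thesis unfolding field_differentiable_def by blast
    qed
    then show ?thesis by (auto simp: holomorphic_on_def field_differentiable_at_within)
  qed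
  moreover have "AE z in lborel. z \<in> unit_disk \<longrightarrow> v z = H z"
  proof -
    have "AE z in lborel. \<forall>n. z \<in> ball 0 (1 - 1 / real (n + 2)) \<longrightarrow> v z = HR (1 - 1 / real (n + 2)) z"
      by (subst AE_all_countable, intro allI HR(2)) (auto simp: field_simps)
    then show ?thesis
    proof eventually_elim
      case (elim z)
      show ?case
      proof
        assume "z \<in> unit_disk"
        then have "1 - cmod z > 0" by simp
        then obtain n where n: "1 / real (Suc n) < 1 - cmod z" using nat_approx_posE by blast
        have "1 / real (n + 2) \<le> 1 / real (Suc n)" by (intro divide_left_mono) auto
        then have *: "cmod z < 1 - 1 / real (n + 2)" using n by linarith
        then have "v z = HR (1 - 1 / real (n + 2)) z" using elim by auto
        also have "\<dots> = H z" using HH[OF *] by simp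
        finally show "v z = H z" .
      qed
    qed
  qed
  then have "AE z in lebesgue. z \<in> unit_disk \<longrightarrow> u z = H z"
    using v(2) unfolding AE_completion_iff by eventually_elim auto
  ultimately show ?thesis by blast
qed

section \<open>Fourier coefficients of test functions\<close>

text \<open>The angle measure as a finite measure of its own, so that Fubini and dominated
  convergence apply without indicator functions. Both endpoints describe the same point of the
  circle and form a null set.\<close>

definition circ :: "real measure" where
  "circ = restrict_space lborel {0..2 * pi}"

lemma sets_circ_borel: "f \<in> borel_measurable borel \<Longrightarrow> f \<in> borel_measurable circ"
  unfolding circ_def by (rule measurable_restrict_space1) simp

lemma space_circ [simp]: "space circ = {0..2 * pi}"
  by (simp add: circ_def space_restrict_space)

lemma measure_circ [simp]: "measure circ {0..2 * pi} = 2 * pi"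
  by (simp add: circ_def measure_restrict_space)

lemma emeasure_circ: "emeasure circ {0..2 * pi} = ennreal (2 * pi)"
  by (simp add: circ_def emeasure_restrict_space)

interpretation circ: finite_measure circ
  by (rule finite_measureI) (simp add: emeasure_circ)

lemma circ_set_integral:
  fixes g :: "real \<Rightarrow> complex"
  assumes "g \<in> borel_measurable borel"
  shows "(LINT \<theta>:{0..2*pi}|lebesgue. g \<theta>) = integral\<^sup>L circ g"
    and "set_integrable lebesgue {0..2*pi} g \<longleftrightarrow> integrable circ g"
proof -
  have [measurable]: "(\<lambda>\<theta>. indicator {0..2*pi} \<theta> *\<^sub>R g \<theta>) \<in> borel_measurable lborel" using assms by measurable
  show "(LINT \<theta>:{0..2*pi}|lebesgue. g \<theta>) = integral\<^sup>L circ g"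
    unfolding set_lebesgue_integral_def circ_def by (subst integral_restrict_space) (auto simp: integral_completion)
  show "set_integrable lebesgue {0..2*pi} g \<longleftrightarrow> integrable circ g"
    unfolding set_integrable_def circ_def by (subst integrable_restrict_space) (auto simp: integrable_completion)
qed

lemma integrable_circ_bounded:
  fixes g :: "real \<Rightarrow> complex"
  assumes "g \<in> borel_measurable borel" "\<And>t. cmod (g t) \<le> B" shows "integrable circ g"
  by (rule circ.integrable_const_bound[of _ B]) (use assms in \<open>auto intro: sets_circ_borel\<close>)

lemma circ_FTC:
  fixes F f :: "real \<Rightarrow> complex"
  assumes "\<And>t. (F has_vector_derivative f t) (at t)" "continuous_on UNIV f"
  shows "integral\<^sup>L circ f = F (2 * pi) - F 0"
proof -
  have "integral\<^sup>L circ f = integral\<^sup>L lborel (\<lambda>\<theta>. indicator {0..2*pi} \<theta> *\<^sub>R f \<theta>)"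
    unfolding circ_def by (rule integral_restrict_space) simp
  also have "\<dots> = F (2 * pi) - F 0"
    by (rule integral_FTC_atLeastAtMost) (use assms in \<open>auto intro: has_vector_derivative_at_within continuous_on_subset\<close>)
  finally show ?thesis .
qed

text \<open>The positive sign in the exponent matches \<open>(of_real r * cis \<theta>) ^ l\<close>:
  these are the unnormalised coefficients that meet the Taylor coefficients of a holomorphic
  function.\<close>

definition fourier :: "(real \<Rightarrow> complex) \<Rightarrow> nat \<Rightarrow> complex" where
  "fourier \<gamma> l = integral\<^sup>L circ (\<lambda>\<theta>. cis (real l * \<theta>) * \<gamma> \<theta>)"

lemma cis_borel_measurable [measurable]: "(\<lambda>t. cis (a * t)) \<in> borel_measurable borel" "cis \<in> borel_measurable borel"
  by (intro borel_measurable_continuous_onI continuous_intros)+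

lemma cis_2pi_multiple: "cis (real l * (2 * pi)) = 1"
  using cis_multiple_2pi[of "real l"] by (simp add: mult.commute)

lemma fourier_vderiv:
  assumes \<gamma>: "\<gamma> \<in> circle_test" shows "fourier (vderiv \<gamma>) l = - \<i> * of_nat l * fourier \<gamma> l"
proof -
  have d: "((\<lambda>\<theta>. cis (real l * \<theta>) * \<gamma> \<theta>) has_vector_derivative
      (cis (real l * \<theta>) * vderiv \<gamma> \<theta> + (\<i> * of_nat l) * (cis (real l * \<theta>) * \<gamma> \<theta>))) (at \<theta>)" for \<theta>
    using has_vector_derivative_mult[OF has_vector_derivative_cis[of "real l"] circle_test_deriv[OF \<gamma>], of \<theta>]
    by (simp add: mult_ac)
  have c: "continuous_on UNIV \<gamma>" "continuous_on UNIV (vderiv \<gamma>)"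
    using circle_test_continuous \<gamma> vderiv_in_circle_test[OF \<gamma>] by auto
  have [measurable]: "\<gamma> \<in> borel_measurable borel" "vderiv \<gamma> \<in> borel_measurable borel"
    using c by (auto intro: borel_measurable_continuous_onI)
  obtain B B' where B: "\<And>t. cmod (\<gamma> t) \<le> B" "\<And>t. cmod (vderiv \<gamma> t) \<le> B'"
    using circle_test_bounded[OF \<gamma>] circle_test_bounded[OF vderiv_in_circle_test[OF \<gamma>]] by blast
  have i: "integrable circ (\<lambda>\<theta>. cis (real l * \<theta>) * vderiv \<gamma> \<theta>)" "integrable circ (\<lambda>\<theta>. cis (real l * \<theta>) * \<gamma> \<theta>)"
    by (rule integrable_circ_bounded[of _ B'], use B in \<open>auto simp: norm_mult\<close>)
       (rule integrable_circ_bounded[of _ B], use B in \<open>auto simp: norm_mult\<close>)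
  have "integral\<^sup>L circ (\<lambda>\<theta>. cis (real l * \<theta>) * vderiv \<gamma> \<theta> + (\<i> * of_nat l) * (cis (real l * \<theta>) * \<gamma> \<theta>))
      = cis (real l * (2 * pi)) * \<gamma> (2 * pi) - cis (real l * 0) * \<gamma> 0"
    by (rule circ_FTC[OF d]) (intro continuous_intros c)
  also have "\<dots> = 0" using circle_test_periodic[OF \<gamma>, of 0] by (simp only: cis_2pi_multiple) simp
  finally show ?thesis
    unfolding fourier_def using i by (simp add: add_eq_0_iff2)
qed

lemma fourier_bound:
  assumes "\<gamma> \<in> circle_test" "\<And>t. cmod (\<gamma> t) \<le> B" shows "cmod (fourier \<gamma> l) \<le> 2 * pi * B"
proof -
  have [measurable]: "\<gamma> \<in> borel_measurable borel" using circle_test_measurable[OF assms(1)] .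
  have "cmod (fourier \<gamma> l) \<le> integral\<^sup>L circ (\<lambda>\<theta>. norm (cis (real l * \<theta>) * \<gamma> \<theta>))"
    unfolding fourier_def by (rule integral_norm_bound)
  also have "\<dots> \<le> integral\<^sup>L circ (\<lambda>\<theta>. B)"
    by (intro integral_mono integrable_norm integrable_circ_bounded[of _ B]) (use assms(2) in \<open>auto simp: norm_mult\<close>)
  also have "\<dots> = 2 * pi * B" by simp
  finally show ?thesis .
qed

text \<open>Integrating by parts \<open>m + 2\<close> times bounds \<open>real l ^ (m + 2)\<close>
  times the coefficient, and the two spare powers leave the summable
  \<open>1 / real l ^ 2\<close>.\<close>

lemma fourier_rapid: assumes "\<gamma> \<in> circle_test" shows "rapid (fourier \<gamma>)"
  unfolding rapid_def
proof
  fix m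
  have it: "(vderiv ^^ k) \<gamma> \<in> circle_test" for k by (induction k) (auto intro: vderiv_in_circle_test assms)
  have "fourier ((vderiv ^^ k) \<gamma>) l = (- \<i> * of_nat l) ^ k * fourier \<gamma> l" for k l
    by (induction k) (simp_all add: fourier_vderiv[OF it] mult_ac)
  then have n: "real l ^ k * cmod (fourier \<gamma> l) = cmod (fourier ((vderiv ^^ k) \<gamma>) l)" for k l
    by (simp add: norm_mult norm_power)
  obtain B where B: "\<And>t. cmod ((vderiv ^^ (m + 2)) \<gamma> t) \<le> B" using circle_test_bounded[OF it] by blast
  have "real l ^ (m + 2) * cmod (fourier \<gamma> l) \<le> 2 * pi * B" for l
    unfolding n by (rule fourier_bound[OF it B])
  then have le: "norm (real l ^ m * cmod (fourier \<gamma> l)) \<le> 2 * pi * B * (1 / real l ^ 2)" if "l \<ge> 1" for l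
    using that by (simp add: field_simps power_add power2_eq_square)
  have "summable (\<lambda>l. 1 / real l ^ 2)" using inverse_power_summable[of 2, where 'a = real] by (simp add: inverse_eq_divide)
  then show "summable (\<lambda>l. real l ^ m * cmod (fourier \<gamma> l))"
    by (rule summable_comparison_test'[OF summable_mult[of _ "2 * pi * B"], of _ 1, OF _ le])
qed

section \<open>The Cayley map, its Taylor series and its circle integrals\<close>

lemma cis_neg_power: "cis (- (real l * t)) = cis (- t) ^ l"
  by (simp add: Complex.DeMoivre)

text \<open>The Taylor coefficients of the Cayley map \<open>(1 + q) / (1 - q)\<close>.\<close>

definition wt :: "nat \<Rightarrow> complex" where "wt l = (if l = 0 then 1 else 2)"

lemma wt_norm_le: "cmod (wt l) \<le> 2" by (simp add: wt_def)

lemma cayley_sums: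
  assumes "cmod q < 1" shows "(\<lambda>l. wt l * q ^ l) sums ((1 + q) / (1 - q))"
proof -
  have "(\<lambda>l. 2 * q ^ l - (if l = 0 then 1 else 0)) sums (2 * (1 / (1 - q)) - 1)"
    by (intro sums_diff sums_mult geometric_sums assms sums_single[of 0 "\<lambda>_. 1", simplified])
  moreover have "2 * q ^ l - (if l = 0 then 1 else 0) = wt l * q ^ l" for l by (simp add: wt_def)
  moreover have "2 * (1 / (1 - q)) - 1 = (1 + q) / (1 - q)"
  proof -
    have "1 - q \<noteq> 0" using assms by auto
    then show ?thesis by (simp add: field_simps)
  qed
  ultimately show ?thesis by simp
qed

lemma rapid_wt: "rapid c \<Longrightarrow> rapid (\<lambda>l. wt l * c l)"
  by (rule rapid_bounded[of c _ 2]) (auto simp: norm_mult intro: mult_right_mono wt_norm_le)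

definition cayley_int :: "(real \<Rightarrow> complex) \<Rightarrow> complex \<Rightarrow> complex" where
  "cayley_int \<gamma> q = integral\<^sup>L circ (\<lambda>\<theta>. (1 + q * cis \<theta>) / (1 - q * cis \<theta>) * \<gamma> \<theta>)"

lemma cayley_int_sums:
  assumes [measurable]: "\<gamma> \<in> borel_measurable borel" and B: "\<And>t. cmod (\<gamma> t) \<le> B" and q: "cmod q < 1"
  shows "(\<lambda>l. wt l * q ^ l * fourier \<gamma> l) sums cayley_int \<gamma> q"
proof -
  define f where "f = (\<lambda>l \<theta>. wt l * q ^ l * (cis (real l * \<theta>) * \<gamma> \<theta>))"
  have B0: "B \<ge> 0" using B[of 0] norm_ge_zero order_trans by blast
  have le: "norm (f l \<theta>) \<le> 2 * B * cmod q ^ l" for l \<theta>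
  proof -
    have "cmod (wt l) * cmod q ^ l * cmod (\<gamma> \<theta>) \<le> 2 * cmod q ^ l * B"
      by (intro mult_mono wt_norm_le B) (auto simp: B0)
    then show ?thesis by (simp add: f_def norm_mult norm_power mult_ac)
  qed
  have geo: "summable (\<lambda>l. 2 * B * cmod q ^ l)" using q by (intro summable_mult summable_geometric) simp
  have int: "integrable circ (f l)" for l
    by (rule integrable_circ_bounded[of _ "2 * B * cmod q ^ l"]) (use le in \<open>auto simp: f_def\<close>)
  have "(\<lambda>l. integral\<^sup>L circ (f l)) sums integral\<^sup>L circ (\<lambda>\<theta>. \<Sum>l. f l \<theta>)"
  proof (rule sums_integral[OF int])
    show "AE \<theta> in circ. summable (\<lambda>l. norm (f l \<theta>))"
      by (intro AE_I2 summable_comparison_test'[OF geo, of 0]) (use le in simp)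
    have "integral\<^sup>L circ (\<lambda>\<theta>. norm (f l \<theta>)) \<le> integral\<^sup>L circ (\<lambda>\<theta>. 2 * B * cmod q ^ l)" for l
      by (intro integral_mono integrable_norm int circ.integrable_const le)
    then have "norm (integral\<^sup>L circ (\<lambda>\<theta>. norm (f l \<theta>))) \<le> 2 * pi * (2 * B * cmod q ^ l)" for l by simp
    then show "summable (\<lambda>l. integral\<^sup>L circ (\<lambda>\<theta>. norm (f l \<theta>)))"
      by (intro summable_comparison_test'[OF summable_mult[OF geo, of "2 * pi"], of 0]) simp
  qed
  moreover have "(\<Sum>l. f l \<theta>) = (1 + q * cis \<theta>) / (1 - q * cis \<theta>) * \<gamma> \<theta>" for \<theta>
  proof -
    have "(\<lambda>l. wt l * (q * cis \<theta>) ^ l * \<gamma> \<theta>) sums ((1 + q * cis \<theta>) / (1 - q * cis \<theta>) * \<gamma> \<theta>)"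
      by (intro sums_mult2 cayley_sums) (use q in \<open>simp add: norm_mult\<close>)
    moreover have "wt l * (q * cis \<theta>) ^ l * \<gamma> \<theta> = f l \<theta>" for l
      by (simp only: f_def power_mult_distrib Complex.DeMoivre mult_ac)
    ultimately show ?thesis by (simp add: sums_iff)
  qed
  ultimately show ?thesis by (simp add: f_def fourier_def cayley_int_def)
qed

lemma circle_test_1: "(\<lambda>t. 1) \<in> circle_test"
  using circle_test_cis[of 0] by simp

lemma fourier_1: "fourier (\<lambda>t. 1) l = (if l = 0 then 2 * of_real pi else 0)"
proof (cases "l = 0")
  case False
  have "vderiv (\<lambda>t. 1 :: complex) = (\<lambda>t. 0)" by (simp add: vderiv_def fun_eq_iff)
  then have "- \<i> * of_nat l * fourier (\<lambda>t. 1) l = 0"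
    using fourier_vderiv[OF circle_test_1, of l] by (simp add: fourier_def)
  then show ?thesis using False by simp
qed (simp add: fourier_def scaleR_conv_of_real)

lemma cayley_int_1: assumes "cmod q < 1" shows "cayley_int (\<lambda>t. 1) q = 2 * of_real pi"
proof -
  have "(\<lambda>l. wt l * q ^ l * fourier (\<lambda>t. 1) l) sums cayley_int (\<lambda>t. 1) q"
    by (rule cayley_int_sums[of _ 1]) (use assms in auto)
  moreover have "wt l * q ^ l * fourier (\<lambda>t. 1) l = (if l = 0 then 2 * of_real pi else 0)" for l
    by (simp add: fourier_1 wt_def)
  ultimately have "(\<lambda>l. if l = 0 then 2 * complex_of_real pi else 0) sums cayley_int (\<lambda>t. 1) q" by simp
  moreover have "(\<lambda>l. if l = 0 then 2 * complex_of_real pi else 0) sums (2 * complex_of_real pi)"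
    using sums_single[of 0 "\<lambda>_. 2 * complex_of_real pi"] by simp
  ultimately show ?thesis using sums_unique2 by blast
qed

text \<open>For \<open>cmod q < 1\<close> this is \<open>cayley_int\<close>. Because the Fourier
  coefficients of a test function are absolutely summable, the series also makes sense and is
  continuous on the closed disk, where the integrand of \<open>cayley_int\<close> has a
  pole.\<close>

definition cayley_ser :: "(real \<Rightarrow> complex) \<Rightarrow> complex \<Rightarrow> complex" where
  "cayley_ser \<gamma> q = (\<Sum>l. wt l * q ^ l * fourier \<gamma> l)"

lemma cayley_ser_tendsto:
  assumes \<gamma>: "\<gamma> \<in> circle_test" and lim: "(q \<longlongrightarrow> p) F" and bd: "\<forall>\<^sub>F x in F. cmod (q x) \<le> 1" and F: "F \<noteq> bot"
  shows "((\<lambda>x. cayley_ser \<gamma> (q x)) \<longlongrightarrow> cayley_ser \<gamma> p) F"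
proof -
  have s: "summable (\<lambda>l. 2 * cmod (fourier \<gamma> l))"
    by (intro summable_mult rapid_imp_summable fourier_rapid \<gamma>)
  have ev: "\<forall>\<^sub>F (l, x) in at_top \<times>\<^sub>F F. norm (wt l * q x ^ l * fourier \<gamma> l) \<le> 2 * cmod (fourier \<gamma> l)"
    unfolding eventually_prod_filter
  proof (intro exI conjI allI impI)
    show "\<forall>\<^sub>F l in sequentially. True" by simp
    show "\<forall>\<^sub>F x in F. cmod (q x) \<le> 1" by (rule bd)
    fix l x assume "cmod (q x) \<le> 1"
    then have "cmod (wt l) * cmod (q x) ^ l \<le> 2 * 1" by (intro mult_mono wt_norm_le power_le_one) auto
    then show "case (l, x) of (l, x) \<Rightarrow> norm (wt l * q x ^ l * fourier \<gamma> l) \<le> 2 * cmod (fourier \<gamma> l)"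
      by (simp add: norm_mult norm_power mult_right_mono)
  qed
  show ?thesis unfolding cayley_ser_def
    by (rule tannerys_theorem[THEN conjunct2, THEN conjunct2, OF _ ev s F]) (intro tendsto_intros lim)
qed

lemma cayley_ser_eq: "\<gamma> \<in> circle_test \<Longrightarrow> cmod q < 1 \<Longrightarrow> cayley_ser \<gamma> q = cayley_int \<gamma> q"
proof -
  assume \<gamma>: "\<gamma> \<in> circle_test" and q: "cmod q < 1"
  obtain B where "\<And>t. cmod (\<gamma> t) \<le> B" using circle_test_bounded[OF \<gamma>] by blast
  from cayley_int_sums[OF circle_test_measurable[OF \<gamma>] this q] show ?thesis by (simp add: cayley_ser_def sums_iff)
qed

lemma cayley_ser_bound:
  assumes \<gamma>: "\<gamma> \<in> circle_test" shows "\<exists>M\<ge>0. \<forall>q. cmod q \<le> 1 \<longrightarrow> cmod (cayley_ser \<gamma> q) \<le> M"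
proof -
  have s: "summable (\<lambda>l. 2 * cmod (fourier \<gamma> l))"
    by (intro summable_mult rapid_imp_summable fourier_rapid \<gamma>)
  have "cmod (cayley_ser \<gamma> q) \<le> (\<Sum>l. 2 * cmod (fourier \<gamma> l))" if q: "cmod q \<le> 1" for q
  proof -
    have le: "norm (wt l * q ^ l * fourier \<gamma> l) \<le> 2 * cmod (fourier \<gamma> l)" for l
    proof -
      have "cmod (wt l) * cmod q ^ l \<le> 2 * 1" using q by (intro mult_mono wt_norm_le power_le_one) auto
      then show ?thesis by (simp add: norm_mult norm_power mult_right_mono)
    qed
    show ?thesis unfolding cayley_ser_def by (rule norm_suminf_le[OF le s])
  qed
  moreover have "(\<Sum>l. 2 * cmod (fourier \<gamma> l)) \<ge> 0" by (intro suminf_nonneg s) auto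
  ultimately show ?thesis by blast
qed

subsection \<open>Fourier inversion\<close>

text \<open>With \<open>y = \<bar>s\<bar> / 2\<close>, which is at most 2, the Maclaurin bound gives
  \<open>y - sin y \<le> y ^ 3 / 6\<close> and \<open>y ^ 3 \<le> 4 * y\<close>, hence
  \<open>y \<le> 3 * sin y\<close>; the chord is twice the sine of half the angle.\<close>

lemma cis_chord:
  assumes "\<bar>s\<bar> \<le> pi" shows "\<bar>s\<bar> \<le> 3 * cmod (cis s - 1)"
proof -
  define y where "y = \<bar>s\<bar> / 2"
  have y: "0 \<le> y" "y \<le> 2" using assms pi_less_4 by (auto simp: y_def)
  have "\<bar>sin y - y\<bar> \<le> inverse (fact 3) * \<bar>y\<bar> ^ 3"
    using Maclaurin_sin_bound[of y 3] by (simp add: numeral_3_eq_3 sin_coeff_def)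
  then have "\<bar>sin y - y\<bar> \<le> y ^ 3 / 6" using y by (simp add: fact_numeral)
  then have "y - sin y \<le> y ^ 3 / 6" by linarith
  moreover have "y ^ 3 \<le> 4 * y"
  proof -
    have "y * y \<le> 2 * 2" using y by (intro mult_mono) auto
    then have "(y * y) * y \<le> 4 * y" using y by (intro mult_right_mono) auto
    then show ?thesis by (simp add: power3_eq_cube)
  qed
  ultimately have "y \<le> 3 * sin y" by linarith
  moreover have "\<bar>sin (s / 2)\<bar> = \<bar>sin y\<bar>" by (cases "s \<ge> 0") (auto simp: y_def)
  moreover have "cmod (cis s - 1) = 2 * \<bar>sin (s / 2)\<bar>" using dist_exp_i_1[of s] by (simp add: cis_conv_exp)
  ultimately show ?thesis unfolding y_def by linarith
qed

text \<open>A Lipschitz bound in terms of points of the circle rather than angles, which is the form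
  that cancels against the denominator of the Poisson kernel. Its constant is the bound for the
  derivative times the factor 3 of \<open>cis_chord\<close>.\<close>

lemma circle_test_chord_lipschitz:
  assumes \<gamma>: "\<gamma> \<in> circle_test" shows "\<exists>M\<ge>0. \<forall>x t. cmod (\<gamma> x - \<gamma> t) \<le> M * cmod (cis x - cis t)"
proof -
  obtain L where L: "L \<ge> 0" "\<And>t. cmod (vderiv \<gamma> t) \<le> L"
    using circle_test_bounded[OF vderiv_in_circle_test[OF \<gamma>]] by blast
  have lip: "cmod (\<gamma> x - \<gamma> t) \<le> L * norm (x - t)" for x t
  proof (rule differentiable_bound[of UNIV])
    show "(\<gamma> has_derivative (\<lambda>h. h *\<^sub>R vderiv \<gamma> s)) (at s within UNIV)" for s
      using circle_test_deriv[OF \<gamma>, of s] by (simp add: has_vector_derivative_def)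
    show "onorm (\<lambda>h. h *\<^sub>R vderiv \<gamma> s) \<le> L" for s
      by (rule onorm_le) (use L in \<open>simp add: mult.commute[of L] mult_left_mono\<close>)
  qed auto
  have "cmod (\<gamma> x - \<gamma> t) \<le> (L * 3) * cmod (cis x - cis t)" for x t
  proof -
    obtain s k where s: "s \<in> {-pi..pi}" "x - t = s + 2 * pi * of_int k"
      using circle_test_shift(1)[OF \<gamma>, of x t] by blast
    then have x: "x = (t + s) + 2 * pi * of_int k" by simp
    have "cis (2 * pi * of_int k) = 1" by (rule cis_multiple_2pi) simp
    then have "cis x = cis t * cis s" unfolding x by (simp add: cis_mult[symmetric])
    then have "cis x - cis t = cis t * (cis s - 1)" by (simp add: right_diff_distrib)
    then have c: "cmod (cis x - cis t) = cmod (cis s - 1)" by (simp add: norm_mult)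
    have "\<gamma> x = \<gamma> (t + s)" unfolding x by (rule circle_test_shift(2)[OF \<gamma>])
    then have "cmod (\<gamma> x - \<gamma> t) \<le> L * \<bar>s\<bar>" using lip[of "t + s" t] by simp
    also have "\<dots> \<le> L * (3 * cmod (cis s - 1))" using s by (intro mult_left_mono cis_chord L) auto
    finally show ?thesis by (simp add: c)
  qed
  then show ?thesis using L by (intro exI[of _ "L * 3"]) auto
qed

lemma Re_cayley: "Re ((1 + p) / (1 - p)) = (1 - (cmod p)\<^sup>2) / (cmod (1 - p))\<^sup>2"
proof -
  have "(1 + p) / (1 - p) = (1 + p) * cnj (1 - p) / of_real ((cmod (1 - p))\<^sup>2)"
    unfolding complex_norm_square by (cases "1 - p = 0") auto
  then have "Re ((1 + p) / (1 - p)) = Re ((1 + p) * cnj (1 - p)) / (cmod (1 - p))\<^sup>2" by simp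
  also have "Re ((1 + p) * cnj (1 - p)) = 1 - (cmod p)\<^sup>2"
    unfolding cmod_power2 by (simp add: power2_eq_square algebra_simps)
  finally show ?thesis .
qed

text \<open>The chord Lipschitz bound cancels one of the two factors
  \<open>cmod (1 - p i \<theta>)\<close> in the denominator of the Poisson kernel. What remains is
  at most \<open>8 * M\<close>, and it tends to 0 at every point of the circle other than
  \<open>cis t\<close>, so dominated convergence works without splitting the circle.\<close>

lemma poisson_limit:
  assumes \<gamma>: "\<gamma> \<in> circle_test" and r: "\<And>i. r i \<in> {1/2<..<1}" and lim: "r \<longlonglongrightarrow> 1"
  shows "(\<lambda>i. integral\<^sup>L circ (\<lambda>\<theta>. of_real (Re ((1 + of_real (r i) * cis (- t) * cis \<theta>) / (1 - of_real (r i) * cis (- t) * cis \<theta>))) * (\<gamma> \<theta> - \<gamma> t))) \<longlonglongrightarrow> 0"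
proof -
  obtain M where M: "M \<ge> 0" "\<And>x t. cmod (\<gamma> x - \<gamma> t) \<le> M * cmod (cis x - cis t)"
    using circle_test_chord_lipschitz[OF \<gamma>] by blast
  note [measurable] = circle_test_measurable[OF \<gamma>]
  define p where "p = (\<lambda>i \<theta>. complex_of_real (r i) * cis (- t) * cis \<theta>)"
  have np: "cmod (p i \<theta>) = r i" for i \<theta> using r[of i] by (simp add: p_def norm_mult)
  have lb: "1 - r i \<le> cmod (1 - p i \<theta>)" for i \<theta> using norm_triangle_ineq2[of 1 "p i \<theta>"] np[of i \<theta>] by simp
  have pos: "cmod (1 - p i \<theta>) > 0" for i \<theta> using lb[of i \<theta>] r[of i] by auto
  \<comment> \<open>The chord is at most the radial gap \<open>1 - r i\<close> plus
    \<open>cmod (1 - p i \<theta>)\<close>, and the gap is itself bounded by the latter.\<close>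
  have chord: "cmod (cis \<theta> - cis t) \<le> 4 * cmod (1 - p i \<theta>)" for i \<theta>
  proof -
    have "p i \<theta> * cis t = of_real (r i) * (cis \<theta> * (cis (- t) * cis t))" by (simp add: p_def mult_ac)
    then have e: "p i \<theta> * cis t = of_real (r i) * cis \<theta>" by (simp add: cis_mult)
    have "cis \<theta> - cis t = (1 - of_real (r i)) * cis \<theta> - (1 - p i \<theta>) * cis t"
      using e by (simp add: algebra_simps)
    also have "cmod \<dots> \<le> cmod ((1 - of_real (r i)) * cis \<theta>) + cmod ((1 - p i \<theta>) * cis t)" by (rule norm_triangle_ineq4)
    also have "cmod ((1 - of_real (r i)) * cis \<theta>) = 1 - r i"
    proof -
      have "1 - complex_of_real (r i) = of_real (1 - r i)" by simp
      then have "cmod (1 - complex_of_real (r i)) = \<bar>1 - r i\<bar>" by (simp only: norm_of_real)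
      then show ?thesis using r[of i] by (simp add: norm_mult)
    qed
    also have "cmod ((1 - p i \<theta>) * cis t) = cmod (1 - p i \<theta>)" by (simp add: norm_mult)
    finally show ?thesis using lb[of i \<theta>] pos[of i \<theta>] by linarith
  qed
  have bnd: "cmod (of_real (Re ((1 + p i \<theta>) / (1 - p i \<theta>))) * (\<gamma> \<theta> - \<gamma> t)) \<le> 8 * M * ((1 - r i) / cmod (1 - p i \<theta>))" for i \<theta>
  proof -
    have "1 - (r i)\<^sup>2 = (1 - r i) * (1 + r i)" by (simp add: power2_eq_square algebra_simps)
    moreover have "(1 - r i) * (1 + r i) \<le> (1 - r i) * 2" using r[of i] by (intro mult_left_mono) auto
    moreover have "0 \<le> (1 - r i) * (1 + r i)" using r[of i] by (intro mult_nonneg_nonneg) auto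
    ultimately have f: "0 \<le> 1 - (r i)\<^sup>2" "1 - (r i)\<^sup>2 \<le> 2 * (1 - r i)" by linarith+
    have "cmod (of_real (Re ((1 + p i \<theta>) / (1 - p i \<theta>))) * (\<gamma> \<theta> - \<gamma> t)) = (1 - (r i)\<^sup>2) / (cmod (1 - p i \<theta>))\<^sup>2 * cmod (\<gamma> \<theta> - \<gamma> t)"
      unfolding Re_cayley np norm_mult norm_of_real using f by simp
    also have "\<dots> \<le> (2 * (1 - r i)) / (cmod (1 - p i \<theta>))\<^sup>2 * (M * (4 * cmod (1 - p i \<theta>)))"
      using f chord[of \<theta> i] M(1) order_trans[OF M(2)[of \<theta> t] mult_left_mono[OF chord M(1)]]
      by (intro mult_mono divide_right_mono) auto
    also have "\<dots> = 8 * M * ((1 - r i) / cmod (1 - p i \<theta>))" using pos[of i \<theta>] by (simp add: power2_eq_square)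
    finally show ?thesis .
  qed
  have "(\<lambda>i. integral\<^sup>L circ (\<lambda>\<theta>. of_real (Re ((1 + p i \<theta>) / (1 - p i \<theta>))) * (\<gamma> \<theta> - \<gamma> t))) \<longlonglongrightarrow> integral\<^sup>L circ (\<lambda>\<theta>. 0)"
  proof (rule integral_dominated_convergence[where w = "\<lambda>\<theta>. 8 * M"])
    show "AE \<theta> in circ. (\<lambda>i. of_real (Re ((1 + p i \<theta>) / (1 - p i \<theta>))) * (\<gamma> \<theta> - \<gamma> t)) \<longlonglongrightarrow> 0"
    proof (rule AE_I2)
      fix \<theta>
      show "(\<lambda>i. of_real (Re ((1 + p i \<theta>) / (1 - p i \<theta>))) * (\<gamma> \<theta> - \<gamma> t)) \<longlonglongrightarrow> 0"
      proof (cases "cis \<theta> = cis t")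
        case True
        then have "\<gamma> \<theta> = \<gamma> t" using M(2)[of \<theta> t] by simp
        then show ?thesis by simp
      next
        case False
        have "1 - cis (- t) * cis \<theta> \<noteq> 0"
        proof
          assume "1 - cis (- t) * cis \<theta> = 0"
          then have "cis t * (1 - cis (- t) * cis \<theta>) = 0" by simp
          then show False using False by (simp add: right_diff_distrib mult.assoc[symmetric] cis_mult)
        qed
        then have "cmod (1 - of_real 1 * cis (- t) * cis \<theta>) \<noteq> 0" by simp
        then have "(\<lambda>i. 8 * M * ((1 - r i) / cmod (1 - p i \<theta>))) \<longlonglongrightarrow> 8 * M * ((1 - 1) / cmod (1 - of_real 1 * cis (- t) * cis \<theta>))"
          unfolding p_def by (intro tendsto_intros lim) 
        then have l0: "(\<lambda>i. 8 * M * ((1 - r i) / cmod (1 - p i \<theta>))) \<longlonglongrightarrow> 0" by simp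
        show ?thesis by (rule Lim_null_comparison[OF _ l0]) (use bnd in auto)
      qed
    qed
    show "AE \<theta> in circ. norm (of_real (Re ((1 + p i \<theta>) / (1 - p i \<theta>))) * (\<gamma> \<theta> - \<gamma> t)) \<le> 8 * M" for i
    proof (rule AE_I2)
      fix \<theta>
      have "(1 - r i) / cmod (1 - p i \<theta>) \<le> 1" using lb[of i \<theta>] pos[of i \<theta>] by simp
      then have "8 * M * ((1 - r i) / cmod (1 - p i \<theta>)) \<le> 8 * M * 1" using M(1) by (intro mult_left_mono) auto
      then show "norm (of_real (Re ((1 + p i \<theta>) / (1 - p i \<theta>))) * (\<gamma> \<theta> - \<gamma> t)) \<le> 8 * M" using bnd[of i \<theta>] by simp
    qed
    show "(\<lambda>\<theta>. of_real (Re ((1 + p i \<theta>) / (1 - p i \<theta>))) * (\<gamma> \<theta> - \<gamma> t)) \<in> borel_measurable circ" for i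
      unfolding p_def by (rule sets_circ_borel) measurable
  qed auto
  then show ?thesis by (simp add: p_def)
qed

text \<open>Abel summation: inside the disk the real part of the one-sided series is the Poisson
  integral, and both sides are continued to the boundary. The weight 2 lets the real part account
  for the frequencies of the opposite sign, which are conjugate for real \<gamma>.\<close>

lemma fourier_inversion:
  assumes \<gamma>: "\<gamma> \<in> circle_test" and real: "\<And>t. \<gamma> t \<in> \<real>"
  shows "Re (tser (\<lambda>l. wt l * fourier \<gamma> l) t) = 2 * pi * Re (\<gamma> t)"
proof -
  define r where "r = (\<lambda>i. 1 - 1 / real (i + 3))"
  have r: "r i \<in> {1/2<..<1}" for i by (simp add: r_def field_simps)
  have rlim: "r \<longlonglongrightarrow> 1"
  proof -
    have "(\<lambda>i. 1 - 1 / real (i + 3)) \<longlonglongrightarrow> 1 - 0"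
      by (intro tendsto_diff tendsto_const LIMSEQ_ignore_initial_segment[OF lim_1_over_n, of 3])
    then show ?thesis by (simp add: r_def)
  qed
  define q where "q = (\<lambda>i. complex_of_real (r i) * cis (- t))"
  have q: "cmod (q i) < 1" for i using r[of i] by (simp add: q_def norm_mult)
  have "q \<longlonglongrightarrow> of_real 1 * cis (- t)" unfolding q_def by (intro tendsto_intros rlim)
  then have "(\<lambda>i. cayley_ser \<gamma> (q i)) \<longlonglongrightarrow> cayley_ser \<gamma> (cis (- t))"
    by (intro cayley_ser_tendsto[OF \<gamma>]) (use less_imp_le[OF q] in auto)
  moreover have "cayley_ser \<gamma> (cis (- t)) = tser (\<lambda>l. wt l * fourier \<gamma> l) t"
    unfolding cayley_ser_def tser_def cis_neg_power by (simp add: mult_ac)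
  ultimately have 1: "(\<lambda>i. Re (cayley_int \<gamma> (q i))) \<longlonglongrightarrow> Re (tser (\<lambda>l. wt l * fourier \<gamma> l) t)"
    using cayley_ser_eq[OF \<gamma> q] by (intro tendsto_Re) simp
  note [measurable] = circle_test_measurable[OF \<gamma>]
  obtain B where B: "\<And>t. cmod (\<gamma> t) \<le> B" using circle_test_bounded[OF \<gamma>] by blast
  have re: "\<gamma> x = of_real (Re (\<gamma> x))" for x using real[of x] by (simp add: complex_is_Real_iff complex_eq_iff)
  \<comment> \<open>The Poisson kernel has total mass \<open>2 * pi\<close> by
    \<open>cayley_int_1\<close>; subtracting the constant \<open>\<gamma> t\<close> inside the
    integral brings the difference into the form of \<open>poisson_limit\<close>.\<close>
  have eq: "Re (integral\<^sup>L circ (\<lambda>\<theta>. of_real (Re ((1 + q i * cis \<theta>) / (1 - q i * cis \<theta>))) * (\<gamma> \<theta> - \<gamma> t))) = Re (cayley_int \<gamma> (q i)) - 2 * pi * Re (\<gamma> t)" for i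
  proof -
    define k where "k = (\<lambda>\<theta>. (1 + q i * cis \<theta>) / (1 - q i * cis \<theta>))"
    have [measurable]: "k \<in> borel_measurable borel" unfolding k_def by measurable
    have kb: "cmod (k \<theta>) \<le> 2 / (1 - cmod (q i))" for \<theta>
    proof -
      have "1 - cmod (q i) \<le> cmod (1 - q i * cis \<theta>)" using norm_triangle_ineq2[of 1 "q i * cis \<theta>"] by (simp add: norm_mult)
      moreover have "cmod (1 + q i * cis \<theta>) \<le> 2" using norm_triangle_ineq[of 1 "q i * cis \<theta>"] q[of i] by (simp add: norm_mult)
      ultimately show ?thesis unfolding k_def norm_divide using q[of i] by (intro frac_le) auto
    qed
    have i1: "integrable circ k" by (rule integrable_circ_bounded[OF _ kb]) measurable
    have i2: "integrable circ (\<lambda>\<theta>. k \<theta> * \<gamma> \<theta>)"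
    proof (rule integrable_circ_bounded)
      show "cmod (k \<theta> * \<gamma> \<theta>) \<le> 2 / (1 - cmod (q i)) * B" for \<theta>
        unfolding norm_mult using order_trans[OF norm_ge_zero kb[of \<theta>]] by (intro mult_mono kb B) auto
    qed measurable
    have "integral\<^sup>L circ k = 2 * of_real pi" using cayley_int_1[OF q[of i]] by (simp add: cayley_int_def k_def)
    then have "Re (cayley_int \<gamma> (q i)) - 2 * pi * Re (\<gamma> t) = Re (integral\<^sup>L circ (\<lambda>\<theta>. k \<theta> * \<gamma> \<theta>)) - Re (\<gamma> t) * Re (integral\<^sup>L circ k)"
      by (simp add: cayley_int_def k_def)
    also have "\<dots> = integral\<^sup>L circ (\<lambda>\<theta>. Re (k \<theta> * \<gamma> \<theta>) - Re (\<gamma> t) * Re (k \<theta>))"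
      using i1 i2 by (simp only: Bochner_Integration.integral_diff integrable_Re integral_mult_right_zero integrable_mult_right integral_Re)
    also have "\<dots> = integral\<^sup>L circ (\<lambda>\<theta>. Re (k \<theta>) * Re (\<gamma> \<theta> - \<gamma> t))"
      by (rule Bochner_Integration.integral_cong[OF refl], subst re) (simp add: algebra_simps)
    also have "\<dots> = integral\<^sup>L circ (\<lambda>\<theta>. Re (of_real (Re (k \<theta>)) * (\<gamma> \<theta> - \<gamma> t)))" by simp
    also have "\<dots> = Re (integral\<^sup>L circ (\<lambda>\<theta>. of_real (Re (k \<theta>)) * (\<gamma> \<theta> - \<gamma> t)))"
    proof (rule integral_Re)
      show "integrable circ (\<lambda>\<theta>. of_real (Re (k \<theta>)) * (\<gamma> \<theta> - \<gamma> t))"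
      proof (rule integrable_circ_bounded)
        show "cmod (of_real (Re (k \<theta>)) * (\<gamma> \<theta> - \<gamma> t)) \<le> 2 / (1 - cmod (q i)) * (B + B)" for \<theta>
          unfolding norm_mult
          using order_trans[OF abs_Re_le_cmod kb[of \<theta>]] norm_triangle_ineq4[of "\<gamma> \<theta>" "\<gamma> t"] B[of \<theta>] B[of t] order_trans[OF norm_ge_zero kb[of \<theta>]]
          by (intro mult_mono) auto
      qed measurable
    qed
    finally show ?thesis by (simp add: k_def)
  qed
  have "(\<lambda>i. Re (cayley_int \<gamma> (q i)) - 2 * pi * Re (\<gamma> t)) \<longlonglongrightarrow> Re 0"
    unfolding eq[symmetric] using poisson_limit[OF \<gamma> r rlim, of t] by (intro tendsto_Re) (simp add: q_def)
  then have "(\<lambda>i. Re (cayley_int \<gamma> (q i))) \<longlonglongrightarrow> 2 * pi * Re (\<gamma> t)" by (simp add: LIM_zero_iff)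
  then show ?thesis using 1 LIMSEQ_unique by blast
qed

section \<open>The Schwarz integral of a distribution\<close>

text \<open>The pairing of \<open>b\<close> with the Schwarz kernel
  \<open>(1 + z * cis (- t)) / (1 - z * cis (- t))\<close>, divided by
  \<open>2 * pi\<close>.\<close>

definition schwarz :: "((real \<Rightarrow> complex) \<Rightarrow> complex) \<Rightarrow> complex \<Rightarrow> complex" where
  "schwarz b z = b (tser (\<lambda>l. wt l * z ^ l)) / (2 * of_real pi)"

text \<open>Each further factor l arises by differentiating the power series termwise and
  multiplying by x, which does not change the disk of convergence.\<close>

lemma summable_power_times_geometric: "norm (x::real) < 1 \<Longrightarrow> summable (\<lambda>l. real l ^ m * x ^ l)"
proof (induction m arbitrary: x)
  case 0 then show ?case by (simp add: summable_geometric)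
next
  case (Suc m)
  have "summable (\<lambda>l. diffs (\<lambda>l. real l ^ m) l * x ^ l)"
    by (rule termdiff_converges[OF Suc.prems Suc.IH])
  then have "summable (\<lambda>l. x * (diffs (\<lambda>l. real l ^ m) l * x ^ l))" by (rule summable_mult)
  then have "summable (\<lambda>l. real (Suc l) ^ Suc m * x ^ Suc l)" by (simp add: diffs_def mult_ac del: of_nat_Suc)
  then show ?case by (subst (asm) summable_Suc_iff)
qed

lemma rapid_power: assumes "cmod z < 1" shows "rapid (\<lambda>l. z ^ l)"
  unfolding rapid_def norm_power using assms by (intro allI summable_power_times_geometric) simp

lemma schwarz_sums:
  assumes "circle_distribution b" "cmod z < 1"
  shows "(\<lambda>l. (wt l * b (\<lambda>t. cis (- (real l * t))) / (2 * of_real pi)) * z ^ l) sums schwarz b z"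
proof -
  have "(\<lambda>l. wt l * z ^ l * b (\<lambda>t. cis (- (real l * t))) / (2 * of_real pi)) sums schwarz b z"
    unfolding schwarz_def by (intro sums_divide circle_distribution_tser_sums assms(1) rapid_wt rapid_power assms(2))
  then show ?thesis by (simp add: mult_ac)
qed

lemma schwarz_0: "schwarz b 0 = b (\<lambda>t. 1) / (2 * of_real pi)"
proof -
  have "tser (\<lambda>l. wt l * 0 ^ l) = (\<lambda>t. 1)"
    unfolding tser_def by (rule ext, subst suminf_finite[of "{0}"]) (auto simp: wt_def)
  then show ?thesis by (simp add: schwarz_def)
qed

text \<open>On a circle of radius below 1 the power series converges absolutely and uniformly, so
  its integral against \<gamma> pairs Taylor coefficients with Fourier coefficients.\<close>

lemma power_series_circle_integral:
  assumes H: "\<And>z. cmod z < 1 \<Longrightarrow> (\<lambda>l. a l * z ^ l) sums H z" and \<gamma>: "\<gamma> \<in> borel_measurable borel" "\<And>t. cmod (\<gamma> t) \<le> B"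
    and r: "0 < r" "r < 1"
  shows "(\<lambda>l. a l * of_real r ^ l * fourier \<gamma> l) sums integral\<^sup>L circ (\<lambda>\<theta>. H (of_real r * cis \<theta>) * \<gamma> \<theta>)"
    and "(\<lambda>\<theta>. H (of_real r * cis \<theta>)) \<in> borel_measurable borel" "integrable circ (\<lambda>\<theta>. H (of_real r * cis \<theta>))"
proof -
  note [measurable] = \<gamma>(1)
  have B0: "B \<ge> 0" using \<gamma>(2)[of 0] norm_ge_zero order_trans by blast
  have cont: "continuous_on unit_disk H"
    by (rule holomorphic_on_imp_continuous_on[OF power_series_holomorphic_disk[OF H]])
  have cc: "continuous_on UNIV (\<lambda>\<theta>. H (of_real r * cis \<theta>))"
    by (rule continuous_on_compose2[OF cont]) (use r in \<open>auto intro!: continuous_intros simp: norm_mult\<close>)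
  then show Hm [measurable]: "(\<lambda>\<theta>. H (of_real r * cis \<theta>)) \<in> borel_measurable borel" by (rule borel_measurable_continuous_onI)
  have "compact ((\<lambda>z. H z) ` cball 0 r)"
    by (intro compact_continuous_image continuous_on_subset[OF cont]) (use r in auto)
  then obtain C where "\<And>z. z \<in> cball 0 r \<Longrightarrow> cmod (H z) \<le> C" by (metis bounded_iff compact_imp_bounded image_eqI)
  then have C: "cmod (H (of_real r * cis \<theta>)) \<le> C" for \<theta> using r by (simp add: norm_mult)
  show "integrable circ (\<lambda>\<theta>. H (of_real r * cis \<theta>))" by (rule integrable_circ_bounded[OF Hm C])
  have sm: "summable (\<lambda>l. norm (a l * of_real r ^ l))"
  proof (rule powser_insidea)
    have "cmod (of_real ((1 + r) / 2)) < 1" using r by (simp only: norm_of_real) simp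
    then show "summable (\<lambda>l. a l * of_real ((1 + r) / 2) ^ l)" using H sums_summable by blast
    show "norm (complex_of_real r) < norm (complex_of_real ((1 + r) / 2))" using r by (simp only: norm_of_real) simp
  qed
  define f where "f = (\<lambda>l \<theta>. a l * of_real r ^ l * (cis (real l * \<theta>) * \<gamma> \<theta>))"
  have le: "norm (f l \<theta>) \<le> B * norm (a l * of_real r ^ l)" for l \<theta>
    using mult_left_mono[OF \<gamma>(2)[of \<theta>], of "norm (a l * of_real r ^ l)"] by (simp add: f_def norm_mult mult_ac)
  have int: "integrable circ (f l)" for l
    by (rule integrable_circ_bounded[OF _ le]) (simp add: f_def)
  have "(\<lambda>l. integral\<^sup>L circ (f l)) sums integral\<^sup>L circ (\<lambda>\<theta>. \<Sum>l. f l \<theta>)"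
  proof (rule sums_integral[OF int])
    show "AE \<theta> in circ. summable (\<lambda>l. norm (f l \<theta>))"
      by (intro AE_I2 summable_comparison_test'[OF summable_mult[OF sm, of B], of 0]) (use le in simp)
    have "integral\<^sup>L circ (\<lambda>\<theta>. norm (f l \<theta>)) \<le> integral\<^sup>L circ (\<lambda>\<theta>. B * norm (a l * of_real r ^ l))" for l
      by (intro integral_mono integrable_norm int circ.integrable_const le)
    then have "norm (integral\<^sup>L circ (\<lambda>\<theta>. norm (f l \<theta>))) \<le> 2 * pi * (B * norm (a l * of_real r ^ l))" for l by simp
    then show "summable (\<lambda>l. integral\<^sup>L circ (\<lambda>\<theta>. norm (f l \<theta>)))"
      by (intro summable_comparison_test'[OF summable_mult[OF summable_mult[OF sm, of B], of "2 * pi"], of 0]) simp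
  qed
  moreover have "(\<Sum>l. f l \<theta>) = H (of_real r * cis \<theta>) * \<gamma> \<theta>" for \<theta>
  proof -
    have "(\<lambda>l. a l * (of_real r * cis \<theta>) ^ l * \<gamma> \<theta>) sums (H (of_real r * cis \<theta>) * \<gamma> \<theta>)"
      by (intro sums_mult2 H) (use r in \<open>simp add: norm_mult\<close>)
    moreover have "a l * (of_real r * cis \<theta>) ^ l * \<gamma> \<theta> = f l \<theta>" for l
      by (simp only: f_def power_mult_distrib Complex.DeMoivre mult_ac)
    ultimately show ?thesis by (simp add: sums_iff)
  qed
  ultimately show "(\<lambda>l. a l * of_real r ^ l * fourier \<gamma> l) sums integral\<^sup>L circ (\<lambda>\<theta>. H (of_real r * cis \<theta>) * \<gamma> \<theta>)"
    by (simp add: f_def fourier_def)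
qed

text \<open>The value at \<open>r = 1\<close> of the pairing on the circle of radius r: the
  one-sided Fourier projection has been moved from the kernel to the test function.\<close>

definition schwarz_bv :: "((real \<Rightarrow> complex) \<Rightarrow> complex) \<Rightarrow> (real \<Rightarrow> complex) \<Rightarrow> complex" where
  "schwarz_bv b \<gamma> = b (tser (\<lambda>l. wt l * fourier \<gamma> l)) / (2 * of_real pi)"

text \<open>For \<open>r < 1\<close> the circle integral is \<open>b\<close> applied to the series
  with coefficients damped by \<open>r ^ l\<close>. The undamped coefficients are still rapidly
  decreasing and serve as majorant for the limit.\<close>

lemma schwarz_has_boundary_value:
  assumes b: "circle_distribution b" shows "has_boundary_value (schwarz b) (schwarz_bv b)"
  unfolding has_boundary_value_def
proof (intro conjI ballI)
  fix r :: real assume r: "r \<in> {0<..<1}"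
  note * = power_series_circle_integral(2,3)[OF schwarz_sums[OF b] circle_test_measurable[OF circle_test_1], of 1 r]
  show "set_integrable lebesgue {0..2 * pi} (\<lambda>\<theta>. schwarz b (of_real r * cis \<theta>))"
    using * r by (subst circ_set_integral(2)) auto
next
  fix \<gamma> assume \<gamma>: "\<gamma> \<in> circle_test"
  note [measurable] = circle_test_measurable[OF \<gamma>]
  obtain B where B: "\<And>t. cmod (\<gamma> t) \<le> B" using circle_test_bounded[OF \<gamma>] by blast
  have eq: "(LINT \<theta>:{0..2 * pi}|lebesgue. schwarz b (of_real r * cis \<theta>) * \<gamma> \<theta>)
     = b (tser (\<lambda>l. wt l * of_real r ^ l * fourier \<gamma> l)) / (2 * of_real pi)" if r: "r \<in> {0<..<1}" for r
  proof -
    have r': "0 < r" "r < 1" using r by auto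
    note p = power_series_circle_integral[OF schwarz_sums[OF b] circle_test_measurable[OF \<gamma>] B r']
    have rp: "rapid (\<lambda>l. wt l * of_real r ^ l * fourier \<gamma> l)"
    proof (rule rapid_bounded[OF fourier_rapid[OF \<gamma>], of _ 2])
      fix l
      have "cmod (wt l) * r ^ l \<le> 2 * 1" using r' by (intro mult_mono wt_norm_le power_le_one) auto
      then show "cmod (wt l * of_real r ^ l * fourier \<gamma> l) \<le> 2 * cmod (fourier \<gamma> l)"
        using r' by (simp add: norm_mult norm_power mult_right_mono)
    qed
    have "(\<lambda>l. wt l * of_real r ^ l * fourier \<gamma> l * b (\<lambda>t. cis (- (real l * t))) / (2 * of_real pi)) sums
        (b (tser (\<lambda>l. wt l * of_real r ^ l * fourier \<gamma> l)) / (2 * of_real pi))"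
      by (intro sums_divide circle_distribution_tser_sums b rp)
    then have "(\<lambda>l. wt l * b (\<lambda>t. cis (- (real l * t))) / (2 * of_real pi) * of_real r ^ l * fourier \<gamma> l) sums
        (b (tser (\<lambda>l. wt l * of_real r ^ l * fourier \<gamma> l)) / (2 * of_real pi))"
      by (simp add: mult_ac)
    from sums_unique2[OF this p(1)] p(2) show ?thesis
      by (subst circ_set_integral(1)) auto
  qed
  \<comment> \<open>Restricting the filter to the interval from 0 to 1 makes every approximating
    sequence consist of radii to which \<open>eq\<close> applies.\<close>
  have at: "at_left (1::real) = at 1 within {0<..<1}" by (rule at_within_nhd[of _ "{0<..}"]) auto
  show "((\<lambda>r. LINT \<theta>:{0..2 * pi}|lebesgue. schwarz b (of_real r * cis \<theta>) * \<gamma> \<theta>) \<longlongrightarrow> schwarz_bv b \<gamma>) (at_left 1)"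
    unfolding at tendsto_at_iff_sequentially
  proof (intro allI impI)
    fix X assume X: "\<forall>i. X i \<in> {0<..<1} - {1::real}" "X \<longlonglongrightarrow> 1"
    have "(\<lambda>i. b (tser (\<lambda>l. wt l * of_real (X i) ^ l * fourier \<gamma> l))) \<longlonglongrightarrow> b (tser (\<lambda>l. wt l * fourier \<gamma> l))"
    proof (rule circle_distribution_tser_tendsto[OF b rapid_wt[OF fourier_rapid[OF \<gamma>]]])
      fix i l
      have "(X i) ^ l \<le> 1" using X(1) by (intro power_le_one) (auto intro: less_imp_le)
      then have "cmod (wt l * fourier \<gamma> l) * X i ^ l \<le> cmod (wt l * fourier \<gamma> l) * 1" by (intro mult_left_mono) auto
      moreover have "\<bar>X i\<bar> = X i" using X(1)[rule_format, of i] by simp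
      ultimately show "cmod (wt l * of_real (X i) ^ l * fourier \<gamma> l) \<le> cmod (wt l * fourier \<gamma> l)"
        by (simp add: norm_mult norm_power mult_ac)
    next
      fix l
      have "(\<lambda>i. wt l * complex_of_real (X i) ^ l * fourier \<gamma> l) \<longlonglongrightarrow> wt l * of_real 1 ^ l * fourier \<gamma> l"
        by (intro tendsto_intros X(2))
      then show "(\<lambda>i. wt l * complex_of_real (X i) ^ l * fourier \<gamma> l) \<longlonglongrightarrow> wt l * fourier \<gamma> l" by simp
    qed
    then have "(\<lambda>i. b (tser (\<lambda>l. wt l * of_real (X i) ^ l * fourier \<gamma> l)) / (2 * of_real pi)) \<longlonglongrightarrow> schwarz_bv b \<gamma>"
      unfolding schwarz_bv_def by (intro tendsto_divide tendsto_const) auto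
    then show "((\<lambda>r. LINT \<theta>:{0..2 * pi}|lebesgue. schwarz b (of_real r * cis \<theta>) * \<gamma> \<theta>) \<circ> X) \<longlonglongrightarrow> schwarz_bv b \<gamma>"
      using eq X(1) by (simp add: o_def)
  qed
qed

lemma schwarz_bv_real_part:
  assumes b: "real_distribution b" and \<gamma>: "\<gamma> \<in> circle_test" "\<And>t. \<gamma> t \<in> \<real>"
  shows "Re (schwarz_bv b \<gamma>) = Re (b \<gamma>)"
proof -
  have bd: "circle_distribution b" using b by (simp add: real_distribution_def)
  define G where "G = tser (\<lambda>l. wt l * fourier \<gamma> l)"
  have G: "G \<in> circle_test" unfolding G_def by (intro tser_circle_test rapid_wt fourier_rapid \<gamma>)
  \<comment> \<open>By \<open>fourier_inversion\<close> the real part of \<open>G\<close> is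
    \<open>2 * pi\<close> times \<gamma>, so \<open>I\<close> is its imaginary part: a real test
    function, whose contribution to \<open>b G\<close> is purely imaginary.\<close>
  define I where "I = (\<lambda>t. - \<i> * G t + \<i> * (2 * of_real pi) * \<gamma> t)"
  have I: "I \<in> circle_test" unfolding I_def by (rule circle_test_lincomb(1)[OF G \<gamma>(1)])
  have "I t \<in> \<real>" for t
    using fourier_inversion[OF \<gamma>, of t] \<gamma>(2)[of t] by (simp add: I_def G_def complex_is_Real_iff)
  then have bI: "Im (b I) = 0" using b I unfolding real_distribution_def by (auto simp: complex_is_Real_iff)
  have b\<gamma>: "Im (b \<gamma>) = 0" using b \<gamma> unfolding real_distribution_def by (auto simp: complex_is_Real_iff)
  have "G = (\<lambda>t. \<i> * I t + (2 * of_real pi) * \<gamma> t)"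
    by (auto simp: I_def fun_eq_iff algebra_simps)
  then have "b G = \<i> * b I + 2 * of_real pi * b \<gamma>"
    using circle_distribution_lincomb[OF bd I \<gamma>(1), of \<i> "2 * of_real pi"] by simp
  then have "Re (b G) = 2 * pi * Re (b \<gamma>)" using bI by simp
  then show ?thesis unfolding schwarz_bv_def G_def[symmetric]
    by (simp add: Re_divide power2_eq_square)
qed

text \<open>Both sides are the Cayley map at \<open>z * cis (- t)\<close>: the left one after making
  the denominator real, the right one by its Taylor series.\<close>

lemma cayley_poisson:
  assumes "cmod z < 1"
  shows "of_real (poisson_P (cmod z) (Arg z - t)) + \<i> * of_real (poisson_Q (cmod z) (Arg z - t)) = tser (\<lambda>l. wt l * z ^ l) t"
proof -
  define p where "p = z * cis (- t)"
  define r where "r = cmod z"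
  \<comment> \<open>The polar form holds for \<open>z = 0\<close> as well, where the modulus is 0,
    so no case distinction is needed.\<close>
  have z: "z = of_real r * cis (Arg z)" by (metis r_def rcis_cmod_Arg rcis_def)
  have p: "p = of_real r * cis (Arg z - t)" unfolding p_def by (subst z) (simp add: cis_mult)
  have np: "cmod p < 1" using assms by (simp add: p_def norm_mult)
  have "tser (\<lambda>l. wt l * z ^ l) t = (\<Sum>l. wt l * p ^ l)"
    unfolding tser_def p_def cis_neg_power by (simp add: power_mult_distrib mult_ac)
  also have "\<dots> = (1 + p) / (1 - p)" using cayley_sums[OF np] by (simp add: sums_iff)
  also have "\<dots> = (1 + p) * cnj (1 - p) / of_real ((cmod (1 - p))\<^sup>2)"
    unfolding complex_norm_square using np by auto
  also have "(cmod (1 - p))\<^sup>2 = 1 - 2 * r * cos (Arg z - t) + r\<^sup>2"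
  proof -
    have "(r * cos (Arg z - t))\<^sup>2 + (r * sin (Arg z - t))\<^sup>2 = r\<^sup>2"
      by (simp add: power_mult_distrib flip: distrib_left)
    then show ?thesis unfolding cmod_power2 p by (simp add: power2_eq_square algebra_simps)
  qed
  also have "(1 + p) * cnj (1 - p) = of_real (1 - r\<^sup>2) + \<i> * of_real (2 * r * sin (Arg z - t))"
  proof -
    have "(r * cos (Arg z - t))\<^sup>2 + (r * sin (Arg z - t))\<^sup>2 = r\<^sup>2"
      by (simp add: power_mult_distrib flip: distrib_left)
    then show ?thesis by (simp add: complex_eq_iff p power2_eq_square algebra_simps)
  qed
  finally show ?thesis
    by (simp add: poisson_P_def poisson_Q_def r_def add_divide_distrib)
qed

text \<open>For points of the circle the bracket in \<open>schwarz_test\<close> is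
  \<open>2 * cos t - (z + cnj z)\<close>. After the binomial expansion the powers of
  \<open>2 * cos t\<close> are absorbed into the distribution, leaving ordinary Schwarz
  integrals.\<close>

lemma schwarz_test_pairing:
  assumes b: "circle_distribution b" and z: "cmod z < 1"
  shows "b (schwarz_test k z) = (\<Sum>a\<le>k. of_nat (k choose a) * (- (z + cnj z)) ^ (k - a) * (2 * of_real pi * schwarz (mult_2cos a b) z))"
proof -
  define G where "G = tser (\<lambda>l. wt l * z ^ l)"
  have G: "G \<in> circle_test" unfolding G_def by (intro tser_circle_test rapid_wt rapid_power z)
  have rc: "of_real (cmod z) * cis (Arg z) = z" by (metis rcis_cmod_Arg rcis_def)
  have "schwarz_test k z t = (\<Sum>a\<le>k. (of_nat (k choose a) * (- (z + cnj z)) ^ (k - a)) * (of_real (2 * cos t) ^ a * G t))" for t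
  proof -
    have e: "cis t - z + cnj (cis t - z) = of_real (2 * cos t) + - (z + cnj z)"
      by (simp add: complex_eq_iff)
    have "schwarz_test k z t = G t * (of_real (2 * cos t) + - (z + cnj z)) ^ k"
      unfolding schwarz_test_def Let_def rc e G_def cayley_poisson[OF z, symmetric] ..
    also have "\<dots> = (\<Sum>a\<le>k. (of_nat (k choose a) * (- (z + cnj z)) ^ (k - a)) * (of_real (2 * cos t) ^ a * G t))"
      unfolding binomial_ring sum_distrib_left by (intro sum.cong refl) (simp only: mult_ac)
    finally show ?thesis .
  qed
  then have "b (schwarz_test k z) = b (\<lambda>t. \<Sum>a\<le>k. (of_nat (k choose a) * (- (z + cnj z)) ^ (k - a)) * (of_real (2 * cos t) ^ a * G t))"
    by (intro arg_cong[of _ _ b]) auto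
  also have "\<dots> = (\<Sum>a\<le>k. (of_nat (k choose a) * (- (z + cnj z)) ^ (k - a)) * b (\<lambda>t. of_real (2 * cos t) ^ a * G t))"
    by (intro circle_distribution_sum b circle_test_mult_2cos_power G) auto
  finally show ?thesis by (simp add: schwarz_def mult_2cos_def G_def)
qed

section \<open>The area potential\<close>

text \<open>Fubini moves the integration over z onto the kernel, where \<open>cauchy_pompeiu\<close>
  evaluates it. Here z is the singular variable in \<open>1 / (\<zeta> - z)\<close>, which is the
  source of the minus sign.\<close>

lemma weak_d_zbar_cauchy_potential:
  fixes q :: "complex \<Rightarrow> complex"
  assumes q: "integrable lborel q"
  shows "weak_d_zbar 1 (\<lambda>z. integral\<^sup>L lborel (\<lambda>\<zeta>. q \<zeta> / (\<zeta> - z))) (\<lambda>z. - of_real pi * q z)"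
proof -
  have [measurable]: "q \<in> borel_measurable borel" using q by auto
  define C where "C = (\<lambda>z. integral\<^sup>L lborel (\<lambda>\<zeta>. q \<zeta> / (\<zeta> - z)))"
  have Cm [measurable]: "C \<in> borel_measurable borel" unfolding C_def by measurable
  have kf: "integrable (lborel \<Otimes>\<^sub>M lborel) (\<lambda>(\<zeta>, z). q \<zeta> * (f z / (\<zeta> - z)))"
    if "f \<in> borel_measurable borel" "\<And>z. cmod (f z) \<le> B" "\<And>z. cmod z > 1 \<Longrightarrow> f z = 0" for f :: "complex \<Rightarrow> complex" and B
    by (rule kernel_fubini[of _ _ B 1]) (use that q in auto)
  have e: "q \<zeta> * (f z / (\<zeta> - z)) = f z * (q \<zeta> / (\<zeta> - z))" for f :: "complex \<Rightarrow> complex" and \<zeta> z :: complex by simp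
  have C: "integral\<^sup>L lborel (\<lambda>\<zeta>. q \<zeta> * (f z / (\<zeta> - z))) = f z * C z" for f :: "complex \<Rightarrow> complex" and z
    unfolding C_def e integral_mult_right_zero ..
  have liC: "locally_integrable C"
  proof (rule locally_integrable_borelI[OF Cm])
    fix R :: real assume R: "0 < R" "R < 1"
    have "integrable lborel (\<lambda>z. integral\<^sup>L lborel (\<lambda>\<zeta>. q \<zeta> * (indicator (cball 0 R) z / (\<zeta> - z))))"
      by (rule lborel_pair.integrable_snd[OF kf[of _ 1]]) (use R in \<open>auto simp: indicator_def\<close>)
    then show "integrable lborel (\<lambda>z. indicator (cball 0 R) z *\<^sub>R C z)"
      unfolding C by (rule Bochner_Integration.integrable_cong[OF refl, THEN iffD1, rotated]) (auto simp: indicator_def)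
  qed
  have liq: "locally_integrable (\<lambda>z. - of_real pi * q z)"
  proof (rule locally_integrable_borelI)
    fix R :: real
    show "integrable lborel (\<lambda>z. indicator (cball 0 R) z *\<^sub>R (- of_real pi * q z))"
      by (intro integrable_mult_indicator integrable_mult_right q) auto
  qed measurable
  have "test_pairing C (d_zbar \<phi>) = - test_pairing (\<lambda>z. - of_real pi * q z) \<phi>" if \<phi>: "disk_test \<phi>" for \<phi>
  proof -
    note d\<phi> = disk_test_d_zbar[OF \<phi>]
    have [measurable]: "d_zbar \<phi> \<in> borel_measurable borel" by (rule plane_smooth_measurable[OF disk_test_smooth[OF d\<phi>]])
    obtain B where B: "\<And>z. cmod (d_zbar \<phi> z) \<le> B"
      using smooth_bounded_support[OF disk_test_smooth[OF d\<phi>] disk_test_bounded_support[OF d\<phi>]] by blast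
    have "test_pairing C (d_zbar \<phi>) = integral\<^sup>L lborel (\<lambda>z. d_zbar \<phi> z * C z)"
      by (subst test_pairing_lborel[OF Cm d\<phi>]) (simp add: mult.commute)
    also have "\<dots> = integral\<^sup>L lborel (\<lambda>z. integral\<^sup>L lborel (\<lambda>\<zeta>. q \<zeta> * (d_zbar \<phi> z / (\<zeta> - z))))"
      unfolding C ..
    also have "\<dots> = integral\<^sup>L lborel (\<lambda>\<zeta>. integral\<^sup>L lborel (\<lambda>z. q \<zeta> * (d_zbar \<phi> z / (\<zeta> - z))))"
      by (rule lborel_pair.Fubini_integral[OF kf[OF _ B disk_test_bounded_support[OF d\<phi>]]]) measurable
    also have "\<dots> = integral\<^sup>L lborel (\<lambda>\<zeta>. q \<zeta> * (of_real pi * \<phi> \<zeta>))"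
    proof (rule arg_cong[of _ _ "integral\<^sup>L lborel"], rule ext)
      fix \<zeta>
      have "integral\<^sup>L lborel (\<lambda>z. d_zbar \<phi> z / (\<zeta> - z)) = integral\<^sup>L lborel (\<lambda>z. - (d_zbar \<phi> z / (z - \<zeta>)))"
        by (rule arg_cong[of _ _ "integral\<^sup>L lborel"], rule ext) (simp add: minus_divide_right)
      also have "\<dots> = of_real pi * \<phi> \<zeta>"
        using cauchy_pompeiu[of \<phi> 1 \<zeta>, OF disk_test_smooth[OF \<phi>] disk_test_bounded_support[OF \<phi>]] by simp
      finally show "integral\<^sup>L lborel (\<lambda>z. q \<zeta> * (d_zbar \<phi> z / (\<zeta> - z))) = q \<zeta> * (of_real pi * \<phi> \<zeta>)"
        unfolding integral_mult_right_zero by simp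
    qed
    also have "\<dots> = - test_pairing (\<lambda>z. - of_real pi * q z) \<phi>"
      by (subst test_pairing_lborel[OF _ \<phi>]) (simp_all add: mult_ac)
    finally show ?thesis .
  qed
  then show ?thesis unfolding weak_d_zbar_iff using liC liq by (simp add: C_def)
qed

lemma AE_integrable_cauchy:
  assumes q: "integrable lborel q"
  shows "AE z in lborel. z \<in> unit_disk \<longrightarrow> integrable lborel (\<lambda>\<zeta>. q \<zeta> / (\<zeta> - z))"
proof -
  have "integrable (lborel \<Otimes>\<^sub>M lborel) (\<lambda>(\<zeta>, z). q \<zeta> * (indicator (ball 0 1) z / (\<zeta> - z)))"
    by (rule kernel_fubini[of _ _ 1 1]) (use q in \<open>auto simp: indicator_def\<close>)
  from lborel_pair.AE_integrable_snd[OF this] show ?thesis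
    by eventually_elim auto
qed

text \<open>The density stands for \<open>f \<zeta> / \<zeta>\<close> in a Borel version, extended
  by 0 so that disk integrals become plane integrals; the right-hand side of the equation is then
  \<open>\<zeta> * p \<zeta>\<close>.\<close>

locale area_density =
  fixes p :: "complex \<Rightarrow> complex"
  assumes p: "integrable lborel p" and p_support: "\<And>\<zeta>. cmod \<zeta> \<ge> 1 \<Longrightarrow> p \<zeta> = 0"
begin

lemma p_measurable [measurable]: "p \<in> borel_measurable borel"
  using p by auto

definition kernel :: "complex \<Rightarrow> complex \<Rightarrow> complex" where
  "kernel z \<zeta> = p \<zeta> * ((\<zeta> + z) / (\<zeta> - z)) + cnj (p \<zeta>) * ((1 + z * cnj \<zeta>) / (1 - z * cnj \<zeta>))"

definition potential :: "complex \<Rightarrow> complex" where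
  "potential z = - (1 / (2 * of_real pi)) * integral\<^sup>L lborel (kernel z)"

lemma kernel_measurable [measurable]: "(\<lambda>(\<zeta>, z). kernel z \<zeta>) \<in> borel_measurable (borel \<Otimes>\<^sub>M borel)"
  unfolding kernel_def by measurable

lemma potential_measurable [measurable]: "potential \<in> borel_measurable borel"
  unfolding potential_def kernel_def by measurable

lemma q_integrable: "integrable lborel (\<lambda>\<zeta>. \<zeta> * p \<zeta>)"
proof (rule Bochner_Integration.integrable_bound[OF p])
  show "AE \<zeta> in lborel. norm (\<zeta> * p \<zeta>) \<le> norm (p \<zeta>)"
  proof (rule AE_I2)
    fix \<zeta> show "norm (\<zeta> * p \<zeta>) \<le> norm (p \<zeta>)"
      using p_support[of \<zeta>] by (cases "cmod \<zeta> \<ge> 1") (auto simp: norm_mult mult_left_le_one_le)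
  qed
qed measurable

lemma denominator_ge: "cmod \<zeta> \<le> 1 \<Longrightarrow> 1 - cmod z \<le> cmod (1 - z * cnj \<zeta>)"
proof -
  assume "cmod \<zeta> \<le> 1"
  then have "cmod z * cmod \<zeta> \<le> cmod z * 1" by (intro mult_left_mono) auto
  then show ?thesis using norm_triangle_ineq2[of 1 "z * cnj \<zeta>"] by (simp add: norm_mult)
qed

lemma kernel2_le:
  assumes "cmod z < 1"
  shows "cmod (cnj (p \<zeta>) * ((1 + z * cnj \<zeta>) / (1 - z * cnj \<zeta>))) \<le> cmod (p \<zeta>) * (2 / (1 - cmod z))"
proof (cases "cmod \<zeta> \<ge> 1")
  case False
  have "cmod z * cmod \<zeta> \<le> 1 * 1" using assms False by (intro mult_mono) auto
  then have "cmod (1 + z * cnj \<zeta>) \<le> 2" using norm_triangle_ineq[of 1 "z * cnj \<zeta>"] by (simp add: norm_mult)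
  then have "cmod (1 + z * cnj \<zeta>) / cmod (1 - z * cnj \<zeta>) \<le> 2 / (1 - cmod z)"
    using denominator_ge[of \<zeta> z] False assms by (intro frac_le) auto
  then show ?thesis by (simp add: norm_mult norm_divide mult_left_mono del: times_divide_eq_right)
qed (simp add: p_support)

lemma integrable_kernel2:
  assumes "cmod z < 1" shows "integrable lborel (\<lambda>\<zeta>. cnj (p \<zeta>) * ((1 + z * cnj \<zeta>) / (1 - z * cnj \<zeta>)))"
proof (rule Bochner_Integration.integrable_bound)
  show "integrable lborel (\<lambda>\<zeta>. cmod (p \<zeta>) * (2 / (1 - cmod z)))" by (intro integrable_mult_left integrable_norm p)
  show "AE \<zeta> in lborel. norm (cnj (p \<zeta>) * ((1 + z * cnj \<zeta>) / (1 - z * cnj \<zeta>))) \<le> norm (cmod (p \<zeta>) * (2 / (1 - cmod z)))"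
    using kernel2_le[OF assms] assms by (intro AE_I2) auto
qed measurable

definition potential2 :: "complex \<Rightarrow> complex" where
  "potential2 z = integral\<^sup>L lborel (\<lambda>\<zeta>. cnj (p \<zeta>) * ((1 + z * cnj \<zeta>) / (1 - z * cnj \<zeta>)))"

lemma potential2_sums:
  assumes z: "cmod z < 1"
  shows "(\<lambda>l. integral\<^sup>L lborel (\<lambda>\<zeta>. wt l * cnj (p \<zeta>) * cnj \<zeta> ^ l) * z ^ l) sums potential2 z"
proof -
  define f where "f = (\<lambda>l \<zeta>. wt l * cnj (p \<zeta>) * cnj \<zeta> ^ l * z ^ l)"
  have le: "norm (f l \<zeta>) \<le> cmod (p \<zeta>) * (2 * cmod z ^ l)" for l \<zeta>
  proof (cases "cmod \<zeta> \<ge> 1")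
    case False
    have "cmod (wt l) * (cmod \<zeta> ^ l * cmod z ^ l) \<le> 2 * (1 * cmod z ^ l)"
      using False by (intro mult_mono wt_norm_le power_le_one) auto
    then have "cmod (p \<zeta>) * (cmod (wt l) * (cmod \<zeta> ^ l * cmod z ^ l)) \<le> cmod (p \<zeta>) * (2 * (1 * cmod z ^ l))"
      by (rule mult_left_mono) simp
    then show ?thesis by (simp add: f_def norm_mult norm_power mult_ac)
  qed (simp add: f_def p_support)
  have geo: "summable (\<lambda>l. cmod z ^ l)" using z by (intro summable_geometric) simp
  have int: "integrable lborel (f l)" for l
    by (rule Bochner_Integration.integrable_bound[OF integrable_mult_left[OF integrable_norm[OF p], of "2 * cmod z ^ l"]])
       (use le in \<open>auto simp: f_def\<close>)
  have "(\<lambda>l. integral\<^sup>L lborel (f l)) sums integral\<^sup>L lborel (\<lambda>\<zeta>. \<Sum>l. f l \<zeta>)"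
  proof (rule sums_integral[OF int])
    show "AE \<zeta> in lborel. summable (\<lambda>l. norm (f l \<zeta>))"
    proof (rule AE_I2)
      fix \<zeta>
      show "summable (\<lambda>l. norm (f l \<zeta>))"
        by (rule summable_comparison_test'[OF summable_mult[OF summable_mult[OF geo, of 2], of "cmod (p \<zeta>)"], of 0]) (use le in simp)
    qed
    have "norm (integral\<^sup>L lborel (\<lambda>\<zeta>. norm (f l \<zeta>))) \<le> integral\<^sup>L lborel (\<lambda>\<zeta>. norm (p \<zeta>)) * 2 * cmod z ^ l" for l
    proof -
      have "integral\<^sup>L lborel (\<lambda>\<zeta>. norm (f l \<zeta>)) \<le> integral\<^sup>L lborel (\<lambda>\<zeta>. cmod (p \<zeta>) * (2 * cmod z ^ l))"
        by (intro integral_mono integrable_norm int integrable_mult_left p le)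
      also have "\<dots> = integral\<^sup>L lborel (\<lambda>\<zeta>. norm (p \<zeta>)) * 2 * cmod z ^ l" by simp
      finally show ?thesis by simp
    qed
    then show "summable (\<lambda>l. integral\<^sup>L lborel (\<lambda>\<zeta>. norm (f l \<zeta>)))"
      by (rule summable_comparison_test'[OF summable_mult[OF geo], of 0])
  qed
  moreover have "(\<Sum>l. f l \<zeta>) = cnj (p \<zeta>) * ((1 + z * cnj \<zeta>) / (1 - z * cnj \<zeta>))" for \<zeta>
  proof (cases "cmod \<zeta> \<ge> 1")
    case False
    have "cmod z * cmod \<zeta> \<le> cmod z * 1" using False by (intro mult_left_mono) auto
    then have "cmod (z * cnj \<zeta>) < 1" using z by (simp add: norm_mult)
    then have "(\<lambda>l. cnj (p \<zeta>) * (wt l * (z * cnj \<zeta>) ^ l)) sums (cnj (p \<zeta>) * ((1 + z * cnj \<zeta>) / (1 - z * cnj \<zeta>)))"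
      by (intro sums_mult cayley_sums)
    moreover have "cnj (p \<zeta>) * (wt l * (z * cnj \<zeta>) ^ l) = f l \<zeta>" for l
      by (simp add: f_def power_mult_distrib mult_ac)
    ultimately show ?thesis by (simp add: sums_iff)
  qed (simp add: f_def p_support)
  moreover have "integral\<^sup>L lborel (f l) = integral\<^sup>L lborel (\<lambda>\<zeta>. wt l * cnj (p \<zeta>) * cnj \<zeta> ^ l) * z ^ l" for l
    unfolding f_def by (rule integral_mult_left_zero)
  ultimately show ?thesis by (simp add: potential2_def)
qed

lemma AE_neq: "AE \<zeta> in lborel. \<zeta> \<noteq> (c :: complex)"
  by (rule AE_lborel_singleton)

lemma kernel1_eq: "\<zeta> \<noteq> z \<Longrightarrow> p \<zeta> * ((\<zeta> + z) / (\<zeta> - z)) = 2 * (\<zeta> * p \<zeta> / (\<zeta> - z)) - p \<zeta>"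
  by (simp add: field_simps)

lemma integrable_kernel1:
  assumes "integrable lborel (\<lambda>\<zeta>. \<zeta> * p \<zeta> / (\<zeta> - z))"
  shows "integrable lborel (\<lambda>\<zeta>. p \<zeta> * ((\<zeta> + z) / (\<zeta> - z)))"
    and "integral\<^sup>L lborel (\<lambda>\<zeta>. p \<zeta> * ((\<zeta> + z) / (\<zeta> - z))) = 2 * integral\<^sup>L lborel (\<lambda>\<zeta>. \<zeta> * p \<zeta> / (\<zeta> - z)) - integral\<^sup>L lborel p"
proof -
  have i: "integrable lborel (\<lambda>\<zeta>. 2 * (\<zeta> * p \<zeta> / (\<zeta> - z)) - p \<zeta>)" by (intro Bochner_Integration.integrable_diff integrable_mult_right assms p)
  have AE: "AE \<zeta> in lborel. 2 * (\<zeta> * p \<zeta> / (\<zeta> - z)) - p \<zeta> = p \<zeta> * ((\<zeta> + z) / (\<zeta> - z))"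
    using AE_neq[of z] by eventually_elim (rule kernel1_eq[symmetric])
  show "integrable lborel (\<lambda>\<zeta>. p \<zeta> * ((\<zeta> + z) / (\<zeta> - z)))"
    by (rule integrable_cong_AE_imp[OF i _ AE]) measurable
  have "integral\<^sup>L lborel (\<lambda>\<zeta>. p \<zeta> * ((\<zeta> + z) / (\<zeta> - z))) = integral\<^sup>L lborel (\<lambda>\<zeta>. 2 * (\<zeta> * p \<zeta> / (\<zeta> - z)) - p \<zeta>)"
  proof (rule integral_cong_AE)
    show "AE \<zeta> in lborel. p \<zeta> * ((\<zeta> + z) / (\<zeta> - z)) = 2 * (\<zeta> * p \<zeta> / (\<zeta> - z)) - p \<zeta>"
      using AE by (rule eventually_mono) (rule sym)
  qed measurable
  also have "\<dots> = 2 * integral\<^sup>L lborel (\<lambda>\<zeta>. \<zeta> * p \<zeta> / (\<zeta> - z)) - integral\<^sup>L lborel p"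
    unfolding Bochner_Integration.integral_diff[OF integrable_mult_right[OF assms] p] integral_mult_right_zero ..
  finally show "integral\<^sup>L lborel (\<lambda>\<zeta>. p \<zeta> * ((\<zeta> + z) / (\<zeta> - z))) = 2 * integral\<^sup>L lborel (\<lambda>\<zeta>. \<zeta> * p \<zeta> / (\<zeta> - z)) - integral\<^sup>L lborel p" .
qed

lemma AE_integrable_kernel: "AE z in lborel. z \<in> unit_disk \<longrightarrow> integrable lborel (\<lambda>\<zeta>. \<zeta> * p \<zeta> / (\<zeta> - z)) \<and> integrable lborel (kernel z)"
  using AE_integrable_cauchy[OF q_integrable]
proof eventually_elim
  case (elim z)
  show ?case
  proof
    assume z: "z \<in> unit_disk"
    then have *: "integrable lborel (\<lambda>\<zeta>. \<zeta> * p \<zeta> / (\<zeta> - z))" using elim by blast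
    have "integrable lborel (kernel z)" unfolding kernel_def[abs_def]
      using z by (intro Bochner_Integration.integrable_add integrable_kernel1(1)[OF *] integrable_kernel2) auto
    with * show "integrable lborel (\<lambda>\<zeta>. \<zeta> * p \<zeta> / (\<zeta> - z)) \<and> integrable lborel (kernel z)" by blast
  qed
qed

text \<open>The first kernel is
  \<open>2 * (\<zeta> * p \<zeta> / (\<zeta> - z)) - p \<zeta>\<close>, that is, twice a Cauchy
  potential up to a constant, and the second contributes a power series in z. The factor
  \<open>2 * (- pi)\<close> from the Cauchy potential is cancelled by the normalisation
  \<open>- 1 / (2 * pi)\<close>.\<close>

theorem potential_weak_d_zbar: "weak_d_zbar 1 potential (\<lambda>\<zeta>. \<zeta> * p \<zeta>)"
proof -
  define C where "C = (\<lambda>z. integral\<^sup>L lborel (\<lambda>\<zeta>. \<zeta> * p \<zeta> / (\<zeta> - z)))"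
  have w1: "weak_d_zbar 1 C (\<lambda>z. - of_real pi * (z * p z))"
    unfolding C_def by (rule weak_d_zbar_cauchy_potential[OF q_integrable])
  have w2: "weak_d_zbar 1 potential2 (\<lambda>z. 0)" by (rule weak_d_zbar_power_series[OF potential2_sums])
  have "(\<lambda>l. (if l = 0 then integral\<^sup>L lborel p else 0) * z ^ l) sums integral\<^sup>L lborel p" for z
    using sums_single[of 0 "\<lambda>l. integral\<^sup>L lborel p * z ^ l"] by (simp add: if_distrib[of "\<lambda>x. x * _"] cong: if_cong)
  then have w3: "weak_d_zbar 1 (\<lambda>z. integral\<^sup>L lborel p) (\<lambda>z. 0)" by (rule weak_d_zbar_power_series)
  define c where "c = - (1 / (2 * complex_of_real pi))"
  have w: "weak_d_zbar 1 (\<lambda>z. (c * 2) * C z + c * (potential2 z + (-1) * integral\<^sup>L lborel p)) (\<lambda>z. (c * 2) * (- of_real pi * (z * p z)) + c * (0 + (-1) * 0))"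
    by (intro weak_d_zbar_lincomb weak_d_zbar_add weak_d_zbar_cmult w1 w2 w3)
  show ?thesis
  proof (rule weak_d_zbar_cong[OF _ _ w])
    have "AE z in lborel. z \<in> unit_disk \<longrightarrow> (c * 2) * C z + c * (potential2 z + (-1) * integral\<^sup>L lborel p) = potential z"
      using AE_integrable_kernel
    proof eventually_elim
      case (elim z)
      show ?case
      proof
        assume z: "z \<in> unit_disk"
        then have i: "integrable lborel (\<lambda>\<zeta>. \<zeta> * p \<zeta> / (\<zeta> - z))" using elim by blast
        have e: "integral\<^sup>L lborel (kernel z) = 2 * C z - integral\<^sup>L lborel p + potential2 z"
          unfolding kernel_def[abs_def] potential2_def C_def
          unfolding integrable_kernel1(2)[OF i, symmetric]
          by (rule Bochner_Integration.integral_add[OF integrable_kernel1(1)[OF i] integrable_kernel2]) (use z in simp)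
        show "(c * 2) * C z + c * (potential2 z + (-1) * integral\<^sup>L lborel p) = potential z"
          unfolding potential_def c_def[symmetric] e by (simp add: algebra_simps)
      qed
    qed
    then show "AE z in lebesgue. z \<in> unit_disk \<longrightarrow> (c * 2) * C z + c * (potential2 z + (-1) * integral\<^sup>L lborel p) = potential z"
      by (simp only: AE_completion_iff)
    show "AE z in lebesgue. z \<in> unit_disk \<longrightarrow> (c * 2) * (- of_real pi * (z * p z)) + c * (0 + (-1) * 0) = z * p z"
      by (simp add: c_def)
  qed
qed

subsection \<open>The value at the origin\<close>

text \<open>A bound for the mean over the \<epsilon>-ball of the estimate in
  \<open>kernel_difference_le\<close>. The constant is \<open>28 = 24 + 4\<close>, with 24 from
  \<open>2 * \<epsilon> * (12 * pi * \<epsilon>)\<close> divided by the area;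
  \<open>56 = 2 * 28\<close> makes the minimum equal to 28 when \<zeta> is nonzero and within
  \<open>2 * \<epsilon>\<close> of the origin. It is bounded and tends to 0 with \<epsilon>, as
  dominated convergence against the density requires.\<close>

definition origin_bound :: "real \<Rightarrow> complex \<Rightarrow> real" where
  "origin_bound \<epsilon> \<zeta> = min 28 (56 * \<epsilon> / cmod \<zeta> + 4 * \<epsilon>)"

text \<open>Near the origin the singular mean is controlled by
  \<open>nn_integral_inverse_dist\<close>; for \<open>cmod \<zeta> > 2 * \<epsilon>\<close> the
  distance \<open>cmod (\<zeta> - z)\<close> is at least \<open>cmod \<zeta> / 2\<close> and the
  quotient is small pointwise.\<close>

lemma origin_average:
  assumes \<epsilon>: "0 < \<epsilon>" "\<epsilon> \<le> 1" and \<zeta>: "\<zeta> \<noteq> 0"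
  shows "(\<integral>\<^sup>+z. ennreal (2 * cmod z / cmod (\<zeta> - z) + 4 * cmod z) * indicator (ball (0::complex) \<epsilon>) z \<partial>lborel) \<le> ennreal (pi * \<epsilon>\<^sup>2 * origin_bound \<epsilon> \<zeta>)"
proof -
  have A: "(\<integral>\<^sup>+z. ennreal (2 * cmod z / cmod (\<zeta> - z) + 4 * cmod z) * indicator (ball (0::complex) \<epsilon>) z \<partial>lborel) \<le> ennreal (pi * \<epsilon>\<^sup>2 * 28)"
  proof -
    have "(\<integral>\<^sup>+z. ennreal (2 * cmod z / cmod (\<zeta> - z) + 4 * cmod z) * indicator (ball (0::complex) \<epsilon>) z \<partial>lborel)
      \<le> (\<integral>\<^sup>+z. ennreal (2 * \<epsilon>) * (ennreal (1 / cmod (z - \<zeta>)) * indicator (ball (0::complex) \<epsilon>) z) + ennreal (4 * \<epsilon>) * indicator (ball (0::complex) \<epsilon>) z \<partial>lborel)"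
    proof (intro nn_integral_mono)
      fix z
      show "ennreal (2 * cmod z / cmod (\<zeta> - z) + 4 * cmod z) * indicator (ball (0::complex) \<epsilon>) z \<le>
        ennreal (2 * \<epsilon>) * (ennreal (1 / cmod (z - \<zeta>)) * indicator (ball (0::complex) \<epsilon>) z) + ennreal (4 * \<epsilon>) * indicator (ball (0::complex) \<epsilon>) z"
      proof (cases "z \<in> ball 0 \<epsilon>")
        case True
        then have "2 * cmod z / cmod (\<zeta> - z) + 4 * cmod z \<le> 2 * \<epsilon> * (1 / cmod (z - \<zeta>)) + 4 * \<epsilon>"
          by (intro add_mono) (auto simp: norm_minus_commute divide_right_mono)
        then show ?thesis using True \<epsilon> by (simp add: ennreal_mult[symmetric] ennreal_plus[symmetric] ennreal_leI del: ennreal_plus)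
      qed simp
    qed
    also have "\<dots> = ennreal (2 * \<epsilon>) * (\<integral>\<^sup>+z. ennreal (1 / cmod (z - \<zeta>)) * indicator (ball (0::complex) \<epsilon>) z \<partial>lborel) + ennreal (4 * \<epsilon>) * ennreal (pi * \<epsilon>\<^sup>2)"
      using \<epsilon> by (subst nn_integral_add) (auto simp: nn_integral_cmult nn_integral_cmult_indicator emeasure_ball_complex)
    also have "\<dots> \<le> ennreal (2 * \<epsilon>) * ennreal (12 * pi * \<epsilon>) + ennreal (4 * \<epsilon>) * ennreal (pi * \<epsilon>\<^sup>2)"
      using \<epsilon> by (intro add_mono mult_left_mono nn_integral_inverse_dist) auto
    also have "\<dots> = ennreal (2 * \<epsilon> * (12 * pi * \<epsilon>) + 4 * \<epsilon> * (pi * \<epsilon>\<^sup>2))"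
      using \<epsilon> by (simp add: ennreal_mult[symmetric] ennreal_plus[symmetric] del: ennreal_plus)
    also have "\<dots> \<le> ennreal (pi * \<epsilon>\<^sup>2 * 28)"
    proof (rule ennreal_leI)
      have "pi * \<epsilon>\<^sup>2 * (4 * \<epsilon>) \<le> pi * \<epsilon>\<^sup>2 * 4" using \<epsilon> by (intro mult_left_mono) auto
      then show "2 * \<epsilon> * (12 * pi * \<epsilon>) + 4 * \<epsilon> * (pi * \<epsilon>\<^sup>2) \<le> pi * \<epsilon>\<^sup>2 * 28" by (simp add: power2_eq_square algebra_simps)
    qed
    finally show ?thesis .
  qed
  show ?thesis
  proof (cases "2 * \<epsilon> < cmod \<zeta>")
    case False
    have "cmod \<zeta> > 0" using \<zeta> by simp
    then have "28 \<le> 56 * \<epsilon> / cmod \<zeta>" using False by (simp add: field_simps)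
    then have "origin_bound \<epsilon> \<zeta> = 28" using \<epsilon> by (simp add: origin_bound_def)
    then show ?thesis using A by simp
  next
    case True
    have z0: "cmod \<zeta> > 0" using \<zeta> by simp
    have "(\<integral>\<^sup>+z. ennreal (2 * cmod z / cmod (\<zeta> - z) + 4 * cmod z) * indicator (ball (0::complex) \<epsilon>) z \<partial>lborel)
      \<le> (\<integral>\<^sup>+z. ennreal (56 * \<epsilon> / cmod \<zeta> + 4 * \<epsilon>) * indicator (ball (0::complex) \<epsilon>) z \<partial>lborel)"
    proof (intro nn_integral_mono)
      fix z
      show "ennreal (2 * cmod z / cmod (\<zeta> - z) + 4 * cmod z) * indicator (ball (0::complex) \<epsilon>) z \<le> ennreal (56 * \<epsilon> / cmod \<zeta> + 4 * \<epsilon>) * indicator (ball (0::complex) \<epsilon>) z"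
      proof (cases "z \<in> ball 0 \<epsilon>")
        case z: True
        have "cmod \<zeta> / 2 \<le> cmod (\<zeta> - z)" using norm_triangle_ineq2[of \<zeta> z] z True by simp
        then have "2 * cmod z / cmod (\<zeta> - z) \<le> (2 * \<epsilon>) / (cmod \<zeta> / 2)" using z z0 \<epsilon> by (intro frac_le) auto
        also have "\<dots> \<le> 56 * \<epsilon> / cmod \<zeta>" using \<epsilon> z0 by (simp add: field_simps)
        finally have "2 * cmod z / cmod (\<zeta> - z) + 4 * cmod z \<le> 56 * \<epsilon> / cmod \<zeta> + 4 * \<epsilon>" using z by simp
        then show ?thesis by (intro mult_right_mono ennreal_leI) auto
      qed simp
    qed
    also have "\<dots> = ennreal (pi * \<epsilon>\<^sup>2 * (56 * \<epsilon> / cmod \<zeta> + 4 * \<epsilon>))"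
      using \<epsilon> by (subst nn_integral_cmult_indicator) (auto simp: emeasure_ball_complex ennreal_mult[symmetric] mult.commute simp del: ennreal_plus)
    finally show ?thesis using A unfolding origin_bound_def by (simp add: min_def)
  qed
qed

text \<open>At \<open>z = 0\<close> both kernel quotients are 1 for
  \<open>\<zeta> \<noteq> 0\<close>, so the integrand is almost everywhere \<open>p \<zeta>\<close>
  plus its conjugate.\<close>

lemma potential_0: "Im (potential 0) = 0"
proof -
  have "AE \<zeta> in lborel. kernel 0 \<zeta> = p \<zeta> + cnj (p \<zeta>)" using AE_neq[of 0] by eventually_elim (simp add: kernel_def)
  then have "integral\<^sup>L lborel (kernel 0) = integral\<^sup>L lborel (\<lambda>\<zeta>. p \<zeta> + cnj (p \<zeta>))"
    by (intro integral_cong_AE) (auto simp: kernel_def[abs_def])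
  also have "\<dots> = integral\<^sup>L lborel p + cnj (integral\<^sup>L lborel p)"
    using p by (subst Bochner_Integration.integral_add) (auto intro: Bochner_Integration.integrable_cnj simp: Bochner_Integration.integral_cnj)
  finally show ?thesis by (simp add: potential_def)
qed

lemma kernel_0_integrable: "integrable lborel (kernel 0)"
proof -
  have i: "integrable lborel (\<lambda>\<zeta>. p \<zeta> + cnj (p \<zeta>))" using p by (auto intro!: Bochner_Integration.integrable_add Bochner_Integration.integrable_cnj)
  have AE: "AE \<zeta> in lborel. p \<zeta> + cnj (p \<zeta>) = kernel 0 \<zeta>" using AE_neq[of 0] by eventually_elim (simp add: kernel_def)
  show ?thesis by (rule integrable_cong_AE_imp[OF i _ AE]) (simp add: kernel_def[abs_def])
qed

text \<open>The first quotient exceeds 1 by \<open>2 * z / (\<zeta> - z)\<close>, the second by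
  \<open>2 * (z * cnj \<zeta>) / (1 - z * cnj \<zeta>)\<close>, whose denominator has modulus at
  least \<open>1/2\<close>.\<close>

lemma kernel_difference_le:
  assumes z: "cmod z \<le> 1/2" and ne: "\<zeta> \<noteq> 0" "\<zeta> \<noteq> z"
  shows "cmod (kernel z \<zeta> - kernel 0 \<zeta>) \<le> cmod (p \<zeta>) * (2 * cmod z / cmod (\<zeta> - z) + 4 * cmod z)"
proof (cases "cmod \<zeta> \<ge> 1")
  case False
  have nz: "\<zeta> - z \<noteq> 0" using ne by simp
  have d: "1/2 \<le> cmod (1 - z * cnj \<zeta>)" using denominator_ge[of \<zeta> z] False z by auto
  then have nz2: "1 - z * cnj \<zeta> \<noteq> 0" by auto
  have "kernel z \<zeta> - kernel 0 \<zeta> = p \<zeta> * (2 * z / (\<zeta> - z)) + cnj (p \<zeta>) * (2 * (z * cnj \<zeta>) / (1 - z * cnj \<zeta>))"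
  proof -
    have "(\<zeta> + z) / (\<zeta> - z) = 1 + 2 * z / (\<zeta> - z)" using nz by (simp add: divide_simps)
    moreover have "(1 + z * cnj \<zeta>) / (1 - z * cnj \<zeta>) = 1 + 2 * (z * cnj \<zeta>) / (1 - z * cnj \<zeta>)" using nz2 by (simp add: divide_simps)
    ultimately show ?thesis using ne unfolding kernel_def by (simp add: distrib_left)
  qed
  also have "cmod \<dots> \<le> cmod (p \<zeta>) * (2 * cmod z / cmod (\<zeta> - z)) + cmod (p \<zeta>) * (4 * cmod z)"
  proof (rule order_trans[OF norm_triangle_ineq], rule add_mono)
    have "2 * (cmod z * cmod \<zeta>) / cmod (1 - z * cnj \<zeta>) \<le> (2 * (cmod z * 1)) / (1 / 2)"
      using d False by (intro frac_le mult_left_mono mult_nonneg_nonneg) auto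
    then show "cmod (cnj (p \<zeta>) * (2 * (z * cnj \<zeta>) / (1 - z * cnj \<zeta>))) \<le> cmod (p \<zeta>) * (4 * cmod z)"
      by (simp add: norm_mult norm_divide mult_left_mono del: times_divide_eq_right)
  qed (simp add: norm_mult norm_divide)
  finally show ?thesis by (simp add: distrib_left)
qed (simp add: kernel_def p_support)

text \<open>Tonelli lets the mean over z be taken before the integral over \<zeta>; the averaged
  kernel difference is then bounded by \<open>origin_bound\<close>.\<close>

lemma potential_average_le:
  assumes \<epsilon>: "0 < \<epsilon>" "\<epsilon> \<le> 1/2"
  shows "(LINT z:ball 0 \<epsilon>|lebesgue. cmod (potential z - potential 0)) / measure lebesgue (ball (0::complex) \<epsilon>)
     \<le> integral\<^sup>L lborel (\<lambda>\<zeta>. cmod (p \<zeta>) * origin_bound \<epsilon> \<zeta>)"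
proof -
  define E where "E = (\<lambda>\<zeta> z. ennreal (cmod (p \<zeta>)) * (ennreal (2 * cmod z / cmod (\<zeta> - z) + 4 * cmod z) * indicator (ball (0::complex) \<epsilon>) z))"
  have [measurable]: "(\<lambda>(\<zeta>, z). E \<zeta> z) \<in> borel_measurable (lborel \<Otimes>\<^sub>M lborel)" unfolding E_def by measurable
  have ob: "0 \<le> origin_bound \<epsilon> \<zeta>" "origin_bound \<epsilon> \<zeta> \<le> 28" for \<zeta> using \<epsilon> by (auto simp: origin_bound_def)
  have [measurable]: "origin_bound \<epsilon> \<in> borel_measurable borel" unfolding origin_bound_def by measurable
  have obi: "integrable lborel (\<lambda>\<zeta>. cmod (p \<zeta>) * origin_bound \<epsilon> \<zeta>)"
    by (rule Bochner_Integration.integrable_bound[OF integrable_mult_left[OF integrable_norm[OF p], of 28]])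
       (use ob in \<open>auto simp: abs_mult intro!: mult_left_mono\<close>)
  have c: "ennreal (1 / (2 * pi)) \<le> 1" using pi_gt3 by (simp add: divide_le_eq flip: ennreal_1)
  have "AE z in lborel. ennreal (cmod (potential z - potential 0)) * indicator (ball (0::complex) \<epsilon>) z \<le> (\<integral>\<^sup>+\<zeta>. E \<zeta> z \<partial>lborel)"
    using AE_integrable_kernel
  proof eventually_elim
    case (elim z)
    show ?case
    proof (cases "z \<in> ball 0 \<epsilon>")
      case True
      then have z: "z \<in> unit_disk" "cmod z \<le> 1/2" using \<epsilon> by auto
      then have i: "integrable lborel (kernel z)" using elim by blast
      have "potential z - potential 0 = - (1 / (2 * of_real pi)) * integral\<^sup>L lborel (\<lambda>\<zeta>. kernel z \<zeta> - kernel 0 \<zeta>)"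
        unfolding potential_def by (subst Bochner_Integration.integral_diff[OF i kernel_0_integrable]) (simp add: algebra_simps)
      then have "ennreal (cmod (potential z - potential 0)) = ennreal (1 / (2 * pi)) * ennreal (cmod (integral\<^sup>L lborel (\<lambda>\<zeta>. kernel z \<zeta> - kernel 0 \<zeta>)))"
        by (simp add: norm_mult norm_divide ennreal_mult[symmetric])
      also have "\<dots> \<le> 1 * ennreal (cmod (integral\<^sup>L lborel (\<lambda>\<zeta>. kernel z \<zeta> - kernel 0 \<zeta>)))"
        by (intro mult_right_mono c) auto
      also have "\<dots> \<le> (\<integral>\<^sup>+\<zeta>. ennreal (cmod (kernel z \<zeta> - kernel 0 \<zeta>)) \<partial>lborel)"
        using integral_norm_bound_ennreal[OF Bochner_Integration.integrable_diff[OF i kernel_0_integrable]] by simp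
      also have "\<dots> \<le> (\<integral>\<^sup>+\<zeta>. E \<zeta> z \<partial>lborel)"
      proof (rule nn_integral_mono_AE)
        show "AE \<zeta> in lborel. ennreal (cmod (kernel z \<zeta> - kernel 0 \<zeta>)) \<le> E \<zeta> z"
          using AE_neq[of 0] AE_neq[of z]
        proof eventually_elim
          case (elim \<zeta>)
          then show ?case using kernel_difference_le[OF z(2) elim] True
            by (simp add: E_def ennreal_mult[symmetric] ennreal_leI del: ennreal_plus)
        qed
      qed
      finally show ?thesis using True by simp
    qed simp
  qed
  then have "(\<integral>\<^sup>+z. ennreal (cmod (potential z - potential 0)) * indicator (ball (0::complex) \<epsilon>) z \<partial>lborel) \<le> (\<integral>\<^sup>+z. (\<integral>\<^sup>+\<zeta>. E \<zeta> z \<partial>lborel) \<partial>lborel)"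
    by (rule nn_integral_mono_AE)
  also have "\<dots> = (\<integral>\<^sup>+\<zeta>. (\<integral>\<^sup>+z. E \<zeta> z \<partial>lborel) \<partial>lborel)"
    by (rule lborel_pair.Fubini'[of "\<lambda>\<zeta> z. E \<zeta> z"]) measurable
  also have "\<dots> \<le> (\<integral>\<^sup>+\<zeta>. ennreal (cmod (p \<zeta>) * (pi * \<epsilon>\<^sup>2 * origin_bound \<epsilon> \<zeta>)) \<partial>lborel)"
  proof (rule nn_integral_mono_AE)
    show "AE \<zeta> in lborel. (\<integral>\<^sup>+z. E \<zeta> z \<partial>lborel) \<le> ennreal (cmod (p \<zeta>) * (pi * \<epsilon>\<^sup>2 * origin_bound \<epsilon> \<zeta>))"
      using AE_neq[of 0]
    proof eventually_elim
      case (elim \<zeta>)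
      have "(\<integral>\<^sup>+z. E \<zeta> z \<partial>lborel) = ennreal (cmod (p \<zeta>)) * (\<integral>\<^sup>+z. ennreal (2 * cmod z / cmod (\<zeta> - z) + 4 * cmod z) * indicator (ball (0::complex) \<epsilon>) z \<partial>lborel)"
        unfolding E_def by (rule nn_integral_cmult) measurable
      also have "\<dots> \<le> ennreal (cmod (p \<zeta>)) * ennreal (pi * \<epsilon>\<^sup>2 * origin_bound \<epsilon> \<zeta>)"
        using \<epsilon> elim by (intro mult_left_mono origin_average) auto
      finally show ?case using ob by (simp add: ennreal_mult)
    qed
  qed
  also have "\<dots> = ennreal (integral\<^sup>L lborel (\<lambda>\<zeta>. cmod (p \<zeta>) * (pi * \<epsilon>\<^sup>2 * origin_bound \<epsilon> \<zeta>)))"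
  proof (rule nn_integral_eq_integral)
    show "integrable lborel (\<lambda>\<zeta>. cmod (p \<zeta>) * (pi * \<epsilon>\<^sup>2 * origin_bound \<epsilon> \<zeta>))"
      using integrable_mult_right[OF obi, of "pi * \<epsilon>\<^sup>2"] by (simp add: mult_ac)
  qed (use ob in auto)
  also have "integral\<^sup>L lborel (\<lambda>\<zeta>. cmod (p \<zeta>) * (pi * \<epsilon>\<^sup>2 * origin_bound \<epsilon> \<zeta>)) = pi * \<epsilon>\<^sup>2 * integral\<^sup>L lborel (\<lambda>\<zeta>. cmod (p \<zeta>) * origin_bound \<epsilon> \<zeta>)"
    by (simp add: mult_ac flip: integral_mult_right_zero)
  finally have le: "(\<integral>\<^sup>+z. ennreal (cmod (potential z - potential 0)) * indicator (ball (0::complex) \<epsilon>) z \<partial>lborel) \<le> ennreal (pi * \<epsilon>\<^sup>2 * integral\<^sup>L lborel (\<lambda>\<zeta>. cmod (p \<zeta>) * origin_bound \<epsilon> \<zeta>))" .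
  have "(LINT z:ball 0 \<epsilon>|lebesgue. cmod (potential z - potential 0)) = integral\<^sup>L lborel (\<lambda>z. indicator (ball (0::complex) \<epsilon>) z * cmod (potential z - potential 0))"
    unfolding set_lebesgue_integral_def by (subst integral_completion) auto
  also have "\<dots> = enn2real (\<integral>\<^sup>+z. ennreal (indicator (ball (0::complex) \<epsilon>) z * cmod (potential z - potential 0)) \<partial>lborel)"
    by (rule integral_eq_nn_integral) auto
  also have "(\<integral>\<^sup>+z. ennreal (indicator (ball (0::complex) \<epsilon>) z * cmod (potential z - potential 0)) \<partial>lborel) = (\<integral>\<^sup>+z. ennreal (cmod (potential z - potential 0)) * indicator (ball (0::complex) \<epsilon>) z \<partial>lborel)"
    by (intro nn_integral_cong) (auto simp: indicator_def)
  also have "enn2real \<dots> \<le> pi * \<epsilon>\<^sup>2 * integral\<^sup>L lborel (\<lambda>\<zeta>. cmod (p \<zeta>) * origin_bound \<epsilon> \<zeta>)"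
    by (rule enn2real_leI[OF _ le]) (use ob in \<open>auto intro!: mult_nonneg_nonneg Bochner_Integration.integral_nonneg\<close>)
  finally have "(LINT z:ball 0 \<epsilon>|lebesgue. cmod (potential z - potential 0)) \<le> pi * \<epsilon>\<^sup>2 * integral\<^sup>L lborel (\<lambda>\<zeta>. cmod (p \<zeta>) * origin_bound \<epsilon> \<zeta>)" .
  moreover have "measure lebesgue (ball (0::complex) \<epsilon>) = pi * \<epsilon>\<^sup>2"
    using \<epsilon> by (simp add: measure_def emeasure_ball_complex)
  ultimately show ?thesis using \<epsilon> by (simp add: divide_le_eq mult_ac)
qed

text \<open>For a density that is merely integrable, continuity of the potential at 0 is not at
  hand, so the value is obtained as a Lebesgue point: the averaged bound tends to 0 by dominated
  convergence.\<close>

theorem potential_value_at_0: "has_value_at potential 0 (potential 0)"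
proof -
  have at: "at_right (0::real) = at 0 within {0<..<1/2}" by (rule at_within_nhd[of _ "{..<1/2}"]) auto
  show ?thesis unfolding has_value_at_def at tendsto_at_iff_sequentially
  proof (intro allI impI)
    fix X :: "nat \<Rightarrow> real" assume X: "\<forall>i. X i \<in> {0<..<1/2} - {0}" "X \<longlonglongrightarrow> 0"
    have X': "0 < X i" "X i \<le> 1/2" for i using X(1)[rule_format, of i] by auto
    have [measurable]: "origin_bound \<epsilon> \<in> borel_measurable borel" for \<epsilon> unfolding origin_bound_def by measurable
    have ob: "0 \<le> origin_bound (X i) \<zeta>" "origin_bound (X i) \<zeta> \<le> 28" for i \<zeta> using X'(1)[of i] by (auto simp: origin_bound_def)
    have "(\<lambda>i. integral\<^sup>L lborel (\<lambda>\<zeta>. cmod (p \<zeta>) * origin_bound (X i) \<zeta>)) \<longlonglongrightarrow> integral\<^sup>L lborel (\<lambda>\<zeta>. cmod (p \<zeta>) * 0)"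
    proof (rule integral_dominated_convergence[where w = "\<lambda>\<zeta>. cmod (p \<zeta>) * 28"])
      show "AE \<zeta> in lborel. (\<lambda>i. cmod (p \<zeta>) * origin_bound (X i) \<zeta>) \<longlonglongrightarrow> cmod (p \<zeta>) * 0"
      proof (rule AE_I2)
        fix \<zeta>
        have "(\<lambda>i. min 28 (56 * X i * inverse (cmod \<zeta>) + 4 * X i)) \<longlonglongrightarrow> min 28 (56 * 0 * inverse (cmod \<zeta>) + 4 * 0)"
          by (intro tendsto_intros X(2))
        then have "(\<lambda>i. origin_bound (X i) \<zeta>) \<longlonglongrightarrow> 0" by (simp add: origin_bound_def divide_inverse)
        then show "(\<lambda>i. cmod (p \<zeta>) * origin_bound (X i) \<zeta>) \<longlonglongrightarrow> cmod (p \<zeta>) * 0" by (intro tendsto_intros)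
      qed
      show "integrable lborel (\<lambda>\<zeta>. cmod (p \<zeta>) * 28)" by (intro integrable_mult_left integrable_norm p)
      show "AE \<zeta> in lborel. norm (cmod (p \<zeta>) * origin_bound (X i) \<zeta>) \<le> cmod (p \<zeta>) * 28" for i
        using ob by (intro AE_I2) (auto simp: abs_mult intro!: mult_left_mono)
    qed measurable
    then have l0: "(\<lambda>i. integral\<^sup>L lborel (\<lambda>\<zeta>. cmod (p \<zeta>) * origin_bound (X i) \<zeta>)) \<longlonglongrightarrow> 0" by simp
    show "((\<lambda>\<epsilon>. (LINT \<zeta>:ball 0 \<epsilon>|lebesgue. cmod (potential \<zeta> - potential 0)) / measure lebesgue (ball (0::complex) \<epsilon>)) \<circ> X) \<longlonglongrightarrow> 0"
    proof (rule tendsto_sandwich[OF _ _ tendsto_const l0])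
      show "\<forall>\<^sub>F i in sequentially. 0 \<le> ((\<lambda>\<epsilon>. (LINT \<zeta>:ball 0 \<epsilon>|lebesgue. cmod (potential \<zeta> - potential 0)) / measure lebesgue (ball (0::complex) \<epsilon>)) \<circ> X) i"
        by (intro always_eventually allI) (auto simp: set_lebesgue_integral_def intro!: divide_nonneg_nonneg Bochner_Integration.integral_nonneg)
      show "\<forall>\<^sub>F i in sequentially. ((\<lambda>\<epsilon>. (LINT \<zeta>:ball 0 \<epsilon>|lebesgue. cmod (potential \<zeta> - potential 0)) / measure lebesgue (ball (0::complex) \<epsilon>)) \<circ> X) i
          \<le> integral\<^sup>L lborel (\<lambda>\<zeta>. cmod (p \<zeta>) * origin_bound (X i) \<zeta>)"
        using potential_average_le[OF X'] by (intro always_eventually allI) (simp add: o_def)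
    qed
  qed
qed

end

subsection \<open>Circle averages of the kernels\<close>

lemma circle_test_cnj: assumes "\<gamma> \<in> circle_test" shows "(\<lambda>t. cnj (\<gamma> t)) \<in> circle_test"
proof -
  define D where "D = (\<lambda>m t. cnj ((vderiv ^^ m) \<gamma> t))"
  have "D 0 \<in> circle_test"
  proof (rule circle_testI)
    show "D 0 (t + 2 * pi) = D 0 t" for t using circle_test_periodic[OF assms] by (simp add: D_def)
    show "(D m has_vector_derivative D (Suc m) t) (at t)" for m t
      unfolding D_def by (intro has_vector_derivative_cnj circle_test_vderiv assms)
  qed
  then show ?thesis by (simp add: D_def)
qed

lemma poisson_integral:
  assumes "cmod q < 1"
  shows "integrable circ (\<lambda>\<theta>. (1 - (cmod q)\<^sup>2) / (cmod (1 - q * cis \<theta>))\<^sup>2)"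
    and "integral\<^sup>L circ (\<lambda>\<theta>. (1 - (cmod q)\<^sup>2) / (cmod (1 - q * cis \<theta>))\<^sup>2) = 2 * pi"
proof -
  have I: "integral\<^sup>L circ (\<lambda>\<theta>. (1 + q * cis \<theta>) / (1 - q * cis \<theta>)) = 2 * of_real pi"
    using cayley_int_1[OF assms] by (simp add: cayley_int_def)
  \<comment> \<open>A non-integrable function has Bochner integral 0, so the nonzero value of the
    integral already proves integrability.\<close>
  then have i: "integrable circ (\<lambda>\<theta>. (1 + q * cis \<theta>) / (1 - q * cis \<theta>))"
    using not_integrable_integral_eq by fastforce
  have e: "Re ((1 + q * cis \<theta>) / (1 - q * cis \<theta>)) = (1 - (cmod q)\<^sup>2) / (cmod (1 - q * cis \<theta>))\<^sup>2" for \<theta>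
    unfolding Re_cayley by (simp add: norm_mult)
  show "integrable circ (\<lambda>\<theta>. (1 - (cmod q)\<^sup>2) / (cmod (1 - q * cis \<theta>))\<^sup>2)"
    using integrable_Re[OF i] unfolding e .
  show "integral\<^sup>L circ (\<lambda>\<theta>. (1 - (cmod q)\<^sup>2) / (cmod (1 - q * cis \<theta>))\<^sup>2) = 2 * pi"
    using integral_Re[OF i] unfolding e I by simp
qed

text \<open>Reflection in the circle reduces both cases to \<open>poisson_integral\<close>:
  \<open>q = r / \<zeta>\<close> for \<zeta> outside and \<open>q = cnj \<zeta> / r\<close> for
  \<zeta> inside. The distance from \<zeta> to the moving point is
  \<open>cmod (1 - q * cis \<theta>)\<close> times \<open>cmod \<zeta>\<close> or r.\<close>

lemma poisson_distance:
  assumes r: "r > 0" and ne: "cmod \<zeta> \<noteq> r"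
  shows "integrable circ (\<lambda>\<theta>. \<bar>(cmod \<zeta>)\<^sup>2 - r\<^sup>2\<bar> / (cmod (\<zeta> - of_real r * cis \<theta>))\<^sup>2)"
    and "integral\<^sup>L circ (\<lambda>\<theta>. \<bar>(cmod \<zeta>)\<^sup>2 - r\<^sup>2\<bar> / (cmod (\<zeta> - of_real r * cis \<theta>))\<^sup>2) = 2 * pi"
proof -
  obtain q where q: "cmod q < 1" and
    e: "\<And>\<theta>. (1 - (cmod q)\<^sup>2) / (cmod (1 - q * cis \<theta>))\<^sup>2 = \<bar>(cmod \<zeta>)\<^sup>2 - r\<^sup>2\<bar> / (cmod (\<zeta> - of_real r * cis \<theta>))\<^sup>2"
  proof (cases "r < cmod \<zeta>")
    case True
    then have z: "\<zeta> \<noteq> 0" "cmod \<zeta> > 0" using r by auto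
    have sq: "r\<^sup>2 \<le> (cmod \<zeta>)\<^sup>2" using True r by (intro power_mono) auto
    have e: "(1 - (cmod (of_real r / \<zeta>))\<^sup>2) / (cmod (1 - of_real r / \<zeta> * cis \<theta>))\<^sup>2 = \<bar>(cmod \<zeta>)\<^sup>2 - r\<^sup>2\<bar> / (cmod (\<zeta> - of_real r * cis \<theta>))\<^sup>2" for \<theta>
    proof -
      have "\<zeta> - of_real r * cis \<theta> = \<zeta> * (1 - of_real r / \<zeta> * cis \<theta>)" using z by (simp add: field_simps)
      then have "(cmod (\<zeta> - of_real r * cis \<theta>))\<^sup>2 = (cmod \<zeta>)\<^sup>2 * (cmod (1 - of_real r / \<zeta> * cis \<theta>))\<^sup>2"
        by (simp only: norm_mult power_mult_distrib)
      moreover have "\<bar>(cmod \<zeta>)\<^sup>2 - r\<^sup>2\<bar> = (cmod \<zeta>)\<^sup>2 * (1 - (cmod (of_real r / \<zeta>))\<^sup>2)"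
        using z sq r by (simp add: norm_divide power_divide right_diff_distrib)
      ultimately show ?thesis using z by simp
    qed
    show ?thesis by (rule that[of "of_real r / \<zeta>"]) (use e True r z in \<open>auto simp: norm_divide\<close>)
  next
    case False
    then have lt: "cmod \<zeta> < r" using ne by simp
    have sq: "(cmod \<zeta>)\<^sup>2 \<le> r\<^sup>2" using lt by (intro power_mono) auto
    have e: "(1 - (cmod (cnj \<zeta> / of_real r))\<^sup>2) / (cmod (1 - cnj \<zeta> / of_real r * cis \<theta>))\<^sup>2 = \<bar>(cmod \<zeta>)\<^sup>2 - r\<^sup>2\<bar> / (cmod (\<zeta> - of_real r * cis \<theta>))\<^sup>2" for \<theta>
    proof -
      have "cnj (\<zeta> - of_real r * cis \<theta>) = - of_real r * cis (- \<theta>) * (1 - cnj \<zeta> / of_real r * cis \<theta>)"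
        using r by (simp add: field_simps cis_cnj cis_mult)
      then have "cmod (cnj (\<zeta> - of_real r * cis \<theta>)) = r * cmod (1 - cnj \<zeta> / of_real r * cis \<theta>)"
        using r by (simp only: norm_mult norm_minus_cancel norm_cis norm_of_real abs_of_pos mult_1_right)
      then have "(cmod (\<zeta> - of_real r * cis \<theta>))\<^sup>2 = r\<^sup>2 * (cmod (1 - cnj \<zeta> / of_real r * cis \<theta>))\<^sup>2"
        by (simp only: complex_mod_cnj power_mult_distrib)
      moreover have "\<bar>(cmod \<zeta>)\<^sup>2 - r\<^sup>2\<bar> = r\<^sup>2 * (1 - (cmod (cnj \<zeta> / of_real r))\<^sup>2)"
        using sq r by (simp add: norm_divide power_divide right_diff_distrib)
      ultimately show ?thesis using r by simp
    qed
    show ?thesis by (rule that[of "cnj \<zeta> / of_real r"]) (use e lt r in \<open>auto simp: norm_divide\<close>)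
  qed
  show "integrable circ (\<lambda>\<theta>. \<bar>(cmod \<zeta>)\<^sup>2 - r\<^sup>2\<bar> / (cmod (\<zeta> - of_real r * cis \<theta>))\<^sup>2)"
    using poisson_integral(1)[OF q] unfolding e .
  show "integral\<^sup>L circ (\<lambda>\<theta>. \<bar>(cmod \<zeta>)\<^sup>2 - r\<^sup>2\<bar> / (cmod (\<zeta> - of_real r * cis \<theta>))\<^sup>2) = 2 * pi"
    using poisson_integral(2)[OF q] unfolding e .
qed

lemma circle_distance_ge: "r \<ge> 0 \<Longrightarrow> \<bar>cmod \<zeta> - r\<bar> \<le> cmod (\<zeta> - of_real r * cis \<theta>)"
  using norm_triangle_ineq3[of \<zeta> "of_real r * cis \<theta>"] by (simp add: norm_mult)

lemma cis_measurable_circ [measurable]: "cis \<in> borel_measurable circ"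
  by (rule sets_circ_borel) simp

text \<open>By the arithmetic-geometric mean inequality, with the Poisson integral for the square.\<close>

lemma inverse_distance:
  assumes r: "r > 0" and ne: "cmod \<zeta> \<noteq> r"
  shows "integrable circ (\<lambda>\<theta>. 1 / cmod (\<zeta> - of_real r * cis \<theta>))"
    and "integral\<^sup>L circ (\<lambda>\<theta>. 1 / cmod (\<zeta> - of_real r * cis \<theta>)) \<le> 2 * pi / sqrt r * (1 / sqrt \<bar>cmod \<zeta> - r\<bar>)"
proof -
  define D where "D = \<bar>(cmod \<zeta>)\<^sup>2 - r\<^sup>2\<bar>"
  define a where "a = sqrt D"
  have f: "D = \<bar>cmod \<zeta> - r\<bar> * (cmod \<zeta> + r)"
    using r by (simp add: D_def power2_eq_square square_diff_square_factored abs_mult mult.commute)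
  have pos: "\<bar>cmod \<zeta> - r\<bar> > 0" "cmod \<zeta> + r > 0" using ne r by (auto intro: add_nonneg_pos)
  then have D0: "D > 0" unfolding f by (rule mult_pos_pos)
  then have a: "a > 0" "D = a * a" by (auto simp: a_def)
  \<comment> \<open>The parameter \<open>a = sqrt D\<close> balances the two summands: both
    contribute \<open>2 * pi / (2 * a)\<close> after integration, so the bound becomes
    \<open>2 * pi / a\<close>.\<close>
  define g where "g = (\<lambda>\<theta>. 1 / (2 * a) * (D / (cmod (\<zeta> - of_real r * cis \<theta>))\<^sup>2 + 1))"
  have gi: "integrable circ g" unfolding g_def D_def
    by (intro integrable_mult_right Bochner_Integration.integrable_add poisson_distance r ne circ.integrable_const)
  have le: "1 / cmod (\<zeta> - of_real r * cis \<theta>) \<le> g \<theta>" for \<theta>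
  proof -
    define d where "d = cmod (\<zeta> - of_real r * cis \<theta>)"
    have "d > 0" unfolding d_def using r by (intro less_le_trans[OF pos(1) circle_distance_ge]) simp
    then have "g \<theta> - 1 / d = (a / d - 1)\<^sup>2 / (2 * a)"
      using a(1) unfolding g_def d_def[symmetric] a(2) by (simp add: field_simps power2_eq_square)
    also have "\<dots> \<ge> 0" using a by simp
    finally show ?thesis by (simp add: d_def)
  qed
  show i: "integrable circ (\<lambda>\<theta>. 1 / cmod (\<zeta> - of_real r * cis \<theta>))"
    by (rule Bochner_Integration.integrable_bound[OF gi]) (use le in \<open>auto intro!: AE_I2 order_trans[OF _ abs_ge_self]\<close>)
  have "integral\<^sup>L circ (\<lambda>\<theta>. 1 / cmod (\<zeta> - of_real r * cis \<theta>)) \<le> integral\<^sup>L circ g"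
    by (intro integral_mono i gi le)
  also have "\<dots> = 1 / (2 * a) * (2 * pi + 2 * pi)"
    unfolding g_def integral_mult_right_zero D_def
    by (subst Bochner_Integration.integral_add[OF poisson_distance(1)[OF r ne] circ.integrable_const])
       (simp add: poisson_distance(2)[OF r ne])
  also have "\<dots> = 2 * pi / a" using a by (simp add: field_simps)
  also have "\<dots> \<le> 2 * pi / (sqrt r * sqrt \<bar>cmod \<zeta> - r\<bar>)"
  proof (rule divide_left_mono)
    have "r * \<bar>cmod \<zeta> - r\<bar> \<le> (cmod \<zeta> + r) * \<bar>cmod \<zeta> - r\<bar>" by (intro mult_right_mono) auto
    then show "sqrt r * sqrt \<bar>cmod \<zeta> - r\<bar> \<le> a"
      unfolding a_def f real_sqrt_mult[symmetric] by (intro real_sqrt_le_mono) (simp add: mult.commute)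
    show "0 < a * (sqrt r * sqrt \<bar>cmod \<zeta> - r\<bar>)" using a pos r by simp
  qed simp
  finally show "integral\<^sup>L circ (\<lambda>\<theta>. 1 / cmod (\<zeta> - of_real r * cis \<theta>)) \<le> 2 * pi / sqrt r * (1 / sqrt \<bar>cmod \<zeta> - r\<bar>)" by simp
qed

text \<open>The first area kernel integrated over a circle: expanded in \<open>r / \<zeta>\<close>
  for \<zeta> outside, and in \<open>\<zeta> / r\<close> for \<zeta> inside, where frequencies of
  the opposite sign appear and are expressed by conjugation. For \<open>cmod \<zeta> < 1\<close>
  only the second branch survives as r tends to 1.\<close>

definition cauchy_ser :: "real \<Rightarrow> (real \<Rightarrow> complex) \<Rightarrow> complex \<Rightarrow> complex" where
  "cauchy_ser r \<gamma> \<zeta> = (if r < cmod \<zeta> then cayley_ser \<gamma> (of_real r / \<zeta>)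
     else - cnj (cayley_ser (\<lambda>t. cnj (\<gamma> t)) (cnj \<zeta> / of_real r)))"

lemma circle_integral_kernel1:
  assumes \<gamma>: "\<gamma> \<in> circle_test" and r: "r > 0" and ne: "cmod \<zeta> \<noteq> r"
  shows "integrable circ (\<lambda>\<theta>. (\<zeta> + of_real r * cis \<theta>) / (\<zeta> - of_real r * cis \<theta>) * \<gamma> \<theta>)"
    and "integral\<^sup>L circ (\<lambda>\<theta>. (\<zeta> + of_real r * cis \<theta>) / (\<zeta> - of_real r * cis \<theta>) * \<gamma> \<theta>) = cauchy_ser r \<gamma> \<zeta>"
proof -
  note [measurable] = circle_test_measurable[OF \<gamma>]
  obtain B where B: "\<And>t. cmod (\<gamma> t) \<le> B" using circle_test_bounded[OF \<gamma>] by blast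
  have pos: "\<bar>cmod \<zeta> - r\<bar> > 0" using ne by simp
  show "integrable circ (\<lambda>\<theta>. (\<zeta> + of_real r * cis \<theta>) / (\<zeta> - of_real r * cis \<theta>) * \<gamma> \<theta>)"
  proof (rule integrable_circ_bounded[of _ "(cmod \<zeta> + r) / \<bar>cmod \<zeta> - r\<bar> * B"])
    fix \<theta>
    have "cmod (\<zeta> + of_real r * cis \<theta>) \<le> cmod \<zeta> + r"
      using norm_triangle_ineq[of \<zeta> "of_real r * cis \<theta>"] r by (simp add: norm_mult)
    then have "cmod ((\<zeta> + of_real r * cis \<theta>) / (\<zeta> - of_real r * cis \<theta>)) \<le> (cmod \<zeta> + r) / \<bar>cmod \<zeta> - r\<bar>"
      unfolding norm_divide using circle_distance_ge[of r \<zeta> \<theta>] r pos by (intro frac_le) auto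
    then show "cmod ((\<zeta> + of_real r * cis \<theta>) / (\<zeta> - of_real r * cis \<theta>) * \<gamma> \<theta>) \<le> (cmod \<zeta> + r) / \<bar>cmod \<zeta> - r\<bar> * B"
      unfolding norm_mult using B r by (intro mult_mono) auto
  qed measurable
  show "integral\<^sup>L circ (\<lambda>\<theta>. (\<zeta> + of_real r * cis \<theta>) / (\<zeta> - of_real r * cis \<theta>) * \<gamma> \<theta>) = cauchy_ser r \<gamma> \<zeta>"
  proof (cases "r < cmod \<zeta>")
    case True
    then have z: "\<zeta> \<noteq> 0" using r by auto
    have "(\<zeta> + of_real r * cis \<theta>) / (\<zeta> - of_real r * cis \<theta>) = (1 + of_real r / \<zeta> * cis \<theta>) / (1 - of_real r / \<zeta> * cis \<theta>)" for \<theta>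
      using z mult_divide_mult_cancel_left[of \<zeta> "1 + of_real r / \<zeta> * cis \<theta>" "1 - of_real r / \<zeta> * cis \<theta>"]
      by (simp add: distrib_left right_diff_distrib)
    moreover have "cmod (of_real r / \<zeta>) < 1" using True r z by (simp add: norm_divide)
    ultimately show ?thesis using True by (simp only: cauchy_ser_def cayley_ser_eq[OF \<gamma>] cayley_int_def if_True)
  next
    case False
    then have lt: "cmod \<zeta> < r" using ne by simp
    define q where "q = cnj \<zeta> / of_real r"
    have q: "cmod q < 1" using lt r by (simp add: q_def norm_divide)
    have e: "(\<zeta> + of_real r * cis \<theta>) / (\<zeta> - of_real r * cis \<theta>) * \<gamma> \<theta> = - cnj ((1 + q * cis \<theta>) / (1 - q * cis \<theta>) * cnj (\<gamma> \<theta>))" for \<theta>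
    proof -
      define c where "c = complex_of_real r * cis \<theta>"
      have c: "c \<noteq> 0" using r by (simp add: c_def)
      have "cnj (q * cis \<theta>) = \<zeta> / c" by (simp add: q_def c_def cis_cnj divide_simps cis_mult r)
      then have "cnj ((1 + q * cis \<theta>) / (1 - q * cis \<theta>)) = (1 + \<zeta> / c) / (1 - \<zeta> / c)" by simp
      also have "\<dots> = (c * (1 + \<zeta> / c)) / (c * (1 - \<zeta> / c))" using c by (rule mult_divide_mult_cancel_left[symmetric])
      also have "\<dots> = (\<zeta> + c) / (- (\<zeta> - c))" using c by (simp add: distrib_left right_diff_distrib add.commute)
      finally have k: "cnj ((1 + q * cis \<theta>) / (1 - q * cis \<theta>)) = - ((\<zeta> + c) / (\<zeta> - c))" by (simp only: divide_minus_right)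
      show ?thesis unfolding complex_cnj_mult k complex_cnj_cnj c_def by simp
    qed
    show ?thesis unfolding e Bochner_Integration.integral_minus Bochner_Integration.integral_cnj
      using False cayley_ser_eq[OF circle_test_cnj[OF \<gamma>] q] by (simp add: cauchy_ser_def cayley_int_def q_def)
  qed
qed

lemma circle_integral_kernel2:
  assumes \<gamma>: "\<gamma> \<in> circle_test" and r: "0 < r" "r < 1" and z: "cmod \<zeta> \<le> 1"
  shows "integrable circ (\<lambda>\<theta>. (1 + of_real r * cis \<theta> * cnj \<zeta>) / (1 - of_real r * cis \<theta> * cnj \<zeta>) * \<gamma> \<theta>)"
    and "integral\<^sup>L circ (\<lambda>\<theta>. (1 + of_real r * cis \<theta> * cnj \<zeta>) / (1 - of_real r * cis \<theta> * cnj \<zeta>) * \<gamma> \<theta>) = cayley_ser \<gamma> (of_real r * cnj \<zeta>)"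
proof -
  note [measurable] = circle_test_measurable[OF \<gamma>]
  obtain B where B: "\<And>t. cmod (\<gamma> t) \<le> B" using circle_test_bounded[OF \<gamma>] by blast
  have rz: "r * cmod \<zeta> \<le> r * 1" using r z by (intro mult_left_mono) auto
  show "integrable circ (\<lambda>\<theta>. (1 + of_real r * cis \<theta> * cnj \<zeta>) / (1 - of_real r * cis \<theta> * cnj \<zeta>) * \<gamma> \<theta>)"
  proof (rule integrable_circ_bounded[of _ "2 / (1 - r) * B"])
    fix \<theta>
    have n: "cmod (of_real r * cis \<theta> * cnj \<zeta>) \<le> r" using rz r by (simp add: norm_mult)
    have "cmod (1 + of_real r * cis \<theta> * cnj \<zeta>) \<le> 2"
      using norm_triangle_ineq[of 1 "of_real r * cis \<theta> * cnj \<zeta>"] n r by simp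
    moreover have "1 - r \<le> cmod (1 - of_real r * cis \<theta> * cnj \<zeta>)"
      using norm_triangle_ineq2[of 1 "of_real r * cis \<theta> * cnj \<zeta>"] n by simp
    ultimately have "cmod ((1 + of_real r * cis \<theta> * cnj \<zeta>) / (1 - of_real r * cis \<theta> * cnj \<zeta>)) \<le> 2 / (1 - r)"
      unfolding norm_divide using r by (intro frac_le) auto
    then show "cmod ((1 + of_real r * cis \<theta> * cnj \<zeta>) / (1 - of_real r * cis \<theta> * cnj \<zeta>) * \<gamma> \<theta>) \<le> 2 / (1 - r) * B"
      unfolding norm_mult using B r by (intro mult_mono) auto
  qed measurable
  have "r * cmod \<zeta> < 1" using rz r by linarith
  then have "cmod (of_real r * cnj \<zeta>) < 1" using r by (simp add: norm_mult)
  then show "integral\<^sup>L circ (\<lambda>\<theta>. (1 + of_real r * cis \<theta> * cnj \<zeta>) / (1 - of_real r * cis \<theta> * cnj \<zeta>) * \<gamma> \<theta>) = cayley_ser \<gamma> (of_real r * cnj \<zeta>)"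
    by (simp only: cayley_ser_eq[OF \<gamma>] cayley_int_def) (simp add: mult_ac)
qed

lemma cauchy_ser_bound:
  assumes \<gamma>: "\<gamma> \<in> circle_test" shows "\<exists>M\<ge>0. \<forall>r \<zeta>. 0 < r \<longrightarrow> cmod (cauchy_ser r \<gamma> \<zeta>) \<le> M"
proof -
  obtain M where M: "M \<ge> 0" "\<And>q. cmod q \<le> 1 \<Longrightarrow> cmod (cayley_ser \<gamma> q) \<le> M" using cayley_ser_bound[OF \<gamma>] by blast
  obtain M' where M': "M' \<ge> 0" "\<And>q. cmod q \<le> 1 \<Longrightarrow> cmod (cayley_ser (\<lambda>t. cnj (\<gamma> t)) q) \<le> M'"
    using cayley_ser_bound[OF circle_test_cnj[OF \<gamma>]] by blast
  have "cmod (cauchy_ser r \<gamma> \<zeta>) \<le> M + M'" if "0 < r" for r \<zeta>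
  proof (cases "r < cmod \<zeta>")
    case True
    then have "cmod (of_real r / \<zeta>) \<le> 1" using that by (simp add: norm_divide divide_le_eq)
    then show ?thesis using True M(2) M'(1) by (simp add: cauchy_ser_def add_increasing2)
  next
    case False
    then have "cmod (cnj \<zeta> / of_real r) \<le> 1" using that by (simp add: norm_divide divide_le_eq)
    then show ?thesis using False M'(2) M(1) by (simp add: cauchy_ser_def add_increasing)
  qed
  then show ?thesis using M(1) M'(1) by (intro exI[of _ "M + M'"]) auto
qed

lemma cauchy_ser_tendsto:
  assumes \<gamma>: "\<gamma> \<in> circle_test" and X: "X \<longlonglongrightarrow> 1" and z: "cmod \<zeta> < 1"
  shows "(\<lambda>i. cauchy_ser (X i) \<gamma> \<zeta>) \<longlonglongrightarrow> - cnj (cayley_ser (\<lambda>t. cnj (\<gamma> t)) (cnj \<zeta>))"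
proof -
  \<comment> \<open>The bound by \<open>cmod \<zeta>\<close> selects the inner branch of
    \<open>cauchy_ser\<close>; the bound by \<open>1/2\<close> keeps the radii positive, also when
    \<zeta> is 0.\<close>
  have ev: "\<forall>\<^sub>F i in sequentially. max (cmod \<zeta>) (1/2) < X i"
    using z by (intro order_tendstoD(1)[OF X]) auto
  have "(\<lambda>i. - cnj (cayley_ser (\<lambda>t. cnj (\<gamma> t)) (cnj \<zeta> / of_real (X i)))) \<longlonglongrightarrow> - cnj (cayley_ser (\<lambda>t. cnj (\<gamma> t)) (cnj \<zeta>))"
  proof (intro tendsto_minus tendsto_cnj cayley_ser_tendsto circle_test_cnj \<gamma>)
    have "(\<lambda>i. cnj \<zeta> / of_real (X i)) \<longlonglongrightarrow> cnj \<zeta> / of_real 1" by (intro tendsto_intros X) simp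
    then show "(\<lambda>i. cnj \<zeta> / of_real (X i)) \<longlonglongrightarrow> cnj \<zeta>" by simp
    show "\<forall>\<^sub>F i in sequentially. cmod (cnj \<zeta> / of_real (X i)) \<le> 1"
      using ev by eventually_elim (auto simp: norm_divide divide_le_eq)
  qed simp
  then show ?thesis
  proof (rule Lim_transform_eventually)
    show "\<forall>\<^sub>F i in sequentially. - cnj (cayley_ser (\<lambda>t. cnj (\<gamma> t)) (cnj \<zeta> / of_real (X i))) = cauchy_ser (X i) \<gamma> \<zeta>"
      using ev by eventually_elim (auto simp: cauchy_ser_def)
  qed
qed

lemma AE_norm_neq: "AE \<zeta> in lborel. cmod \<zeta> \<noteq> r"
proof -
  have "negligible {\<zeta>::complex. dist \<zeta> 0 = r}" using negligible_sphere[of "0::complex" r] by (simp add: sphere_def dist_commute)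
  then have "AE \<zeta> in lebesgue. \<zeta> \<notin> {\<zeta>::complex. dist \<zeta> 0 = r}"
    unfolding negligible_iff_null_sets by (rule AE_not_in)
  then have "AE \<zeta> in lebesgue. cmod \<zeta> \<noteq> r" by simp
  then show ?thesis by (simp only: AE_completion_iff)
qed

subsection \<open>Good circles\<close>

text \<open>The singularity at \<open>r = s\<close> is split into its two sides, each bounded by the
  integral of \<open>u powr (-1/2)\<close> over the unit interval, which is 2. The bound does not
  depend on s.\<close>

lemma nn_integral_inverse_sqrt:
  "(\<integral>\<^sup>+r. ennreal (1 / sqrt \<bar>s - r\<bar>) * indicator {0<..<1} r \<partial>lborel) \<le> 4" if s: "0 \<le> s" "s \<le> 1"
proof -
  define g where "g = (\<lambda>u. ennreal (u powr (-1/2)) * indicator {0..1} u)"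
  have [measurable]: "g \<in> borel_measurable borel" unfolding g_def by measurable
  have g: "(\<integral>\<^sup>+u. g u \<partial>lborel) = 2"
    unfolding g_def using nn_integral_has_integral_lebesgue'[OF _ has_integral_powr_from_0[of "-1/2" 1]] by simp
  have "(\<integral>\<^sup>+r. ennreal (1 / sqrt \<bar>s - r\<bar>) * indicator {0<..<1} r \<partial>lborel) \<le> (\<integral>\<^sup>+r. g (s + (-1) * r) + g (- s + 1 * r) \<partial>lborel)"
  proof (rule nn_integral_mono)
    fix r :: real
    have pw: "1 / sqrt u = u powr (-1/2)" if "u \<ge> 0" for u :: real
      using that by (simp add: powr_half_sqrt[symmetric] powr_minus_divide)
    show "ennreal (1 / sqrt \<bar>s - r\<bar>) * indicator {0<..<1} r \<le> g (s + (-1) * r) + g (- s + 1 * r)"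
    proof (cases "r \<in> {0<..<1}")
      case r: True
      show ?thesis
      proof (cases "r \<le> s")
        case True
        then have "ennreal (1 / sqrt \<bar>s - r\<bar>) * indicator {0<..<1} r = g (s + (-1) * r)"
          using r s pw[of "s - r"] by (simp add: g_def)
        then show ?thesis by simp
      next
        case False
        then have "ennreal (1 / sqrt \<bar>s - r\<bar>) * indicator {0<..<1} r = g (- s + 1 * r)"
          using r s pw[of "r - s"] by (simp add: g_def)
        then show ?thesis by simp
      qed
    qed simp
  qed
  also have "\<dots> = (\<integral>\<^sup>+r. g (s + (-1) * r) \<partial>lborel) + (\<integral>\<^sup>+r. g (- s + 1 * r) \<partial>lborel)"
    by (rule nn_integral_add) measurable
  also have "\<dots> = 4"
    using nn_integral_real_affine[of g "-1" s] nn_integral_real_affine[of g 1 "- s"] g by simp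
  finally show ?thesis .
qed

subsection \<open>Null sets in polar coordinates\<close>

lemma AE_ex_between:
  assumes "AE r in lborel. P r" "s < (t::real)" shows "\<exists>r. s < r \<and> r < t \<and> P r"
proof (rule ccontr)
  assume no: "\<not> ?thesis"
  have "AE r in lborel. r \<notin> {s<..<t}" using assms(1) by eventually_elim (use no in auto)
  then have "emeasure lborel {s<..<t} = 0" by (subst (asm) AE_iff_measurable[of "{s<..<t}"]) auto
  then show False using assms(2) by simp
qed

text \<open>The exceptional points are the image, under the differentiable polar coordinate map, of
  a null set of radii times the line; differentiable maps between spaces of equal dimension preserve
  null sets.\<close>

lemma AE_norm:
  assumes "AE r in lborel. P r" shows "AE z::complex in lborel. P (cmod z)"
proof -
  obtain N where "N \<in> null_sets lborel" "{r \<in> space lborel. \<not> P r} \<subseteq> N" using assms unfolding eventually_ae_filter by blast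
  then have N: "N \<in> null_sets lborel" "\<And>r. r \<notin> N \<Longrightarrow> P r" by auto
  define f where "f = (\<lambda>x::real \<times> real. complex_of_real (fst x) * cis (snd x))"
  have "N \<times> UNIV \<in> null_sets (lborel \<Otimes>\<^sub>M lborel :: (real \<times> real) measure)" using N by auto
  then have "negligible (N \<times> (UNIV :: real set))" unfolding lborel_prod negligible_iff_null_sets by (rule null_sets_completionI)
  then have "negligible (f ` (N \<times> UNIV))"
  proof (rule negligible_differentiable_image_negligible[rotated])
    have "((\<lambda>t. cis (1 * t)) has_derivative (\<lambda>h. h *\<^sub>R (\<i> * of_real 1 * cis (1 * t)))) (at t)" for t
      using has_vector_derivative_cis[of 1 t] unfolding has_vector_derivative_def .
    then have d: "((\<lambda>x::real \<times> real. cis (1 * snd x)) has_derivative (\<lambda>h. snd h *\<^sub>R (\<i> * of_real 1 * cis (1 * snd x)))) (at x)" for x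
      by (rule has_derivative_compose[of snd snd, rotated]) (intro derivative_intros)
    have "f differentiable (at x)" for x
      using has_derivative_mult[OF has_derivative_of_real[OF has_derivative_fst[OF has_derivative_ident]] d[of x]]
      unfolding f_def mult_1 differentiable_def by blast
    then show "f differentiable_on N \<times> UNIV"
      by (intro differentiable_at_imp_differentiable_on) auto
  qed simp
  then have "AE z in lebesgue. z \<notin> f ` (N \<times> UNIV)" unfolding negligible_iff_null_sets by (rule AE_not_in)
  then have "AE z in lebesgue. P (cmod z)"
  proof eventually_elim
    case (elim z)
    have "z = f (cmod z, Arg z)" unfolding f_def fst_conv snd_conv by (metis rcis_cmod_Arg rcis_def)
    then have "z \<in> f ` (N \<times> UNIV)" if "cmod z \<in> N" by (rule image_eqI) (use that in simp)
    then have "cmod z \<notin> N" using elim by blast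
    then show ?case by (rule N(2))
  qed
  then show ?thesis by (simp only: AE_completion_iff)
qed

text \<open>\<open>Ln (- z)\<close> is smooth off the positive real axis, which only carries the angles 0 and \<open>2\<pi>\<close>.\<close>

lemma AE_circles:
  assumes "AE z in lebesgue. P z" shows "AE r in lborel. r > 0 \<longrightarrow> (AE \<theta> in circ. P (of_real r * cis \<theta>))"
proof -
  obtain N where "N \<in> null_sets lebesgue" "{z \<in> space lebesgue. \<not> P z} \<subseteq> N" using assms unfolding eventually_ae_filter by blast
  then have N: "N \<in> null_sets lebesgue" "\<And>z. z \<notin> N \<Longrightarrow> P z" by auto
  \<comment> \<open>The inverse of polar coordinates with angle between 0 and \<open>2 * pi\<close>:
    the argument of \<open>- z\<close> lies between \<open>- pi\<close> and \<open>pi\<close>, and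
    adding \<open>pi\<close> turns it into the angle of z. It carries null sets to null sets
    wherever it is differentiable.\<close>
  define g where "g = (\<lambda>z. (exp (Re (Ln (- z))), Im (Ln (- z)) + pi))"
  define N' where "N' = N \<inter> {z. - z \<notin> \<real>\<^sub>\<le>\<^sub>0}"
  have "negligible N'" using N(1) unfolding N'_def negligible_iff_null_sets[symmetric] by (rule negligible_subset) auto
  then have "negligible (g ` N')"
  proof (rule negligible_differentiable_image_negligible[rotated])
    have "g differentiable (at z)" if "z \<in> N'" for z
    proof -
      have "(\<lambda>z. Ln (- z)) field_differentiable (at z)"
        using that by (intro field_differentiable_compose[of uminus z Ln, unfolded o_def] field_differentiable_minus field_differentiable_ident field_differentiable_at_Ln) (auto simp: N'_def)
      then obtain D where D: "((\<lambda>z. Ln (- z)) has_derivative D) (at z)"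
        using field_differentiable_imp_differentiable unfolding differentiable_def by blast
      have "(g has_derivative (\<lambda>h. (exp (Re (Ln (- z))) * Re (D h), Im (D h) + 0))) (at z)"
        unfolding g_def by (intro has_derivative_Pair has_derivative_add has_derivative_compose[OF has_derivative_Re[OF D] DERIV_exp[unfolded has_field_derivative_def]] has_derivative_Re has_derivative_Im has_derivative_const D)
      then show ?thesis by (auto simp: differentiable_def)
    qed
    then show "g differentiable_on N'" by (intro differentiable_at_imp_differentiable_on) auto
  qed simp
  then have "AE x in lebesgue. x \<notin> g ` N'" unfolding negligible_iff_null_sets by (rule AE_not_in)
  then have "AE x in lborel \<Otimes>\<^sub>M lborel. x \<notin> g ` N'" unfolding lborel_prod by (simp only: AE_completion_iff)
  from lborel_pair.AE_pair[OF this] have "AE r in lborel. AE \<theta> in lborel. (r, \<theta>) \<notin> g ` N'" .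
  then show ?thesis
  proof eventually_elim
    case (elim r)
    show ?case
    proof
      assume r: "r > 0"
      \<comment> \<open>The two endpoint angles are discarded because they lie on the branch cut of
        \<open>g\<close>.\<close>
      have "AE \<theta> in lborel. \<theta> \<in> {0..2*pi} \<longrightarrow> P (of_real r * cis \<theta>)"
        using elim AE_lborel_singleton[of 0] AE_lborel_singleton[of "2 * pi"]
      proof eventually_elim
        case (elim \<theta>)
        show ?case
        proof
          assume "\<theta> \<in> {0..2*pi}"
          then have t: "0 < \<theta>" "\<theta> < 2 * pi" using elim by auto
          define z where "z = of_real r * cis \<theta>"
          have "- z = exp (of_real (ln r) + \<i> * of_real (\<theta> - pi))"
            using r by (simp add: z_def exp_add exp_of_real cis_conv_exp[symmetric] cis_divide[symmetric] diff_divide_distrib right_diff_distrib flip: of_real_diff)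
          then have L: "Ln (- z) = of_real (ln r) + \<i> * of_real (\<theta> - pi)"
            using t by (simp only:) (rule Ln_exp, auto)
          have g: "g z = (r, \<theta>)" using r by (simp add: g_def L)
          have "- z \<notin> \<real>\<^sub>\<le>\<^sub>0"
          proof
            assume "- z \<in> \<real>\<^sub>\<le>\<^sub>0"
            then have i: "Re (- z) \<le> 0" "Im (- z) = 0" by (auto simp: complex_nonpos_Reals_iff)
            have nz: "- z \<noteq> 0" using r by (simp add: z_def)
            then have "Re (- z) < 0" using i by (auto simp: complex_eq_iff)
            then have "Im (Ln (- z)) = pi" using Im_Ln_eq_pi[OF nz] i by blast
            then show False using t by (simp add: L)
          qed
          then have "(r, \<theta>) \<in> g ` N'" if "z \<in> N" using that g by (intro image_eqI[of _ _ z]) (auto simp: N'_def)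
          then have "z \<notin> N" using elim by blast
          then show "P (of_real r * cis \<theta>)" using N(2) by (simp add: z_def)
        qed
      qed
      then show "AE \<theta> in circ. P (of_real r * cis \<theta>)" unfolding circ_def by (simp add: AE_restrict_space_iff)
    qed
  qed
qed

interpretation lborel_circ: pair_sigma_finite "lborel :: complex measure" circ ..

context area_density
begin

text \<open>Exactly the integrability that \<open>inverse_distance\<close> leaves over after the
  integration in the angle; on such a circle the order of the two integrals may be
  exchanged.\<close>

definition good :: "real \<Rightarrow> bool" where
  "good r \<longleftrightarrow> integrable lborel (\<lambda>\<zeta>. cmod (p \<zeta>) * (1 / sqrt \<bar>cmod \<zeta> - r\<bar>))"

text \<open>Tonelli in \<zeta> and r: the inner integral over the radius is at most 4 for every
  \<zeta> in the disk, so the double integral is finite.\<close>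

lemma AE_good: "AE r in lborel. r \<in> {0<..<1} \<longrightarrow> good r"
proof -
  define G where "G = (\<lambda>\<zeta> r. ennreal (cmod (p \<zeta>) * (1 / sqrt \<bar>cmod \<zeta> - r\<bar>)) * indicator {0<..<1} r)"
  have [measurable]: "(\<lambda>(\<zeta>, r). G \<zeta> r) \<in> borel_measurable (lborel \<Otimes>\<^sub>M lborel)" unfolding G_def by measurable
  have fin: "(\<integral>\<^sup>+\<zeta>. ennreal (cmod (p \<zeta>)) * 4 \<partial>lborel) < \<infinity>"
    using p unfolding integrable_iff_bounded by (simp add: nn_integral_multc ennreal_mult_less_top)
  have "(\<integral>\<^sup>+r. (\<integral>\<^sup>+\<zeta>. G \<zeta> r \<partial>lborel) \<partial>lborel) = (\<integral>\<^sup>+\<zeta>. (\<integral>\<^sup>+r. G \<zeta> r \<partial>lborel) \<partial>lborel)"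
    by (rule lborel_pair.Fubini'[of "\<lambda>\<zeta> z. G \<zeta> z"]) measurable
  also have "\<dots> \<le> (\<integral>\<^sup>+\<zeta>. ennreal (cmod (p \<zeta>)) * 4 \<partial>lborel)"
  proof (rule nn_integral_mono)
    fix \<zeta>
    show "(\<integral>\<^sup>+r. G \<zeta> r \<partial>lborel) \<le> ennreal (cmod (p \<zeta>)) * 4"
    proof (cases "cmod \<zeta> \<ge> 1")
      case False
      have "(\<integral>\<^sup>+r. G \<zeta> r \<partial>lborel) = (\<integral>\<^sup>+r. ennreal (cmod (p \<zeta>)) * (ennreal (1 / sqrt \<bar>cmod \<zeta> - r\<bar>) * indicator {0<..<1} r) \<partial>lborel)"
        unfolding G_def by (subst ennreal_mult) (auto simp: mult.assoc)
      also have "\<dots> = ennreal (cmod (p \<zeta>)) * (\<integral>\<^sup>+r. ennreal (1 / sqrt \<bar>cmod \<zeta> - r\<bar>) * indicator {0<..<1} r \<partial>lborel)"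
        by (rule nn_integral_cmult) measurable
      also have "\<dots> \<le> ennreal (cmod (p \<zeta>)) * 4"
        using False by (intro mult_left_mono nn_integral_inverse_sqrt) auto
      finally show ?thesis .
    qed (simp add: G_def p_support)
  qed
  finally have "(\<integral>\<^sup>+r. (\<integral>\<^sup>+\<zeta>. G \<zeta> r \<partial>lborel) \<partial>lborel) \<noteq> \<infinity>" using fin by (auto simp: top_unique)
  then have "AE r in lborel. (\<integral>\<^sup>+\<zeta>. G \<zeta> r \<partial>lborel) \<noteq> \<infinity>"
    by (intro nn_integral_PInf_AE) measurable
  then show ?thesis
  proof eventually_elim
    case (elim r)
    show ?case
    proof
      assume r: "r \<in> {0<..<1}"
      have "(\<integral>\<^sup>+\<zeta>. ennreal (norm (cmod (p \<zeta>) * (1 / sqrt \<bar>cmod \<zeta> - r\<bar>))) \<partial>lborel) = (\<integral>\<^sup>+\<zeta>. G \<zeta> r \<partial>lborel)"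
        unfolding G_def using r by simp
      also have "\<dots> < \<infinity>" using elim by (simp add: less_top)
      finally show "good r" unfolding good_def by (intro integrableI_bounded) measurable
    qed
  qed
qed

text \<open>The majorant \<open>d\<close> separates the singular kernel, with numerator at most 2,
  from the second one, bounded by \<open>2 / (1 - r)\<close>. Its integral over the angle is a
  combination of the integrand in \<open>good\<close> and of the modulus of the density.\<close>

lemma kernel_circle_integrable:
  assumes g: "good r" and r: "0 < r" "r < 1" and \<gamma>: "\<gamma> \<in> circle_test"
  shows "integrable (lborel \<Otimes>\<^sub>M circ) (\<lambda>(\<zeta>, \<theta>). kernel (of_real r * cis \<theta>) \<zeta> * \<gamma> \<theta>)"
proof (rule lborel_circ.Fubini_integrable)
  have [measurable]: "\<gamma> \<in> borel_measurable circ" by (rule sets_circ_borel[OF circle_test_measurable[OF \<gamma>]])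
  show "(\<lambda>(\<zeta>, \<theta>). kernel (of_real r * cis \<theta>) \<zeta> * \<gamma> \<theta>) \<in> borel_measurable (lborel \<Otimes>\<^sub>M circ)"
    unfolding kernel_def by measurable
  obtain B where B: "B \<ge> 0" "\<And>t. cmod (\<gamma> t) \<le> B" using circle_test_bounded[OF \<gamma>] by blast
  define d where "d = (\<lambda>\<zeta> \<theta>. B * cmod (p \<zeta>) * (2 * (1 / cmod (\<zeta> - of_real r * cis \<theta>)) + 2 / (1 - r)))"
  have le: "norm (kernel (of_real r * cis \<theta>) \<zeta> * \<gamma> \<theta>) \<le> d \<zeta> \<theta>" for \<zeta> \<theta>
  proof (cases "cmod \<zeta> \<ge> 1")
    case False
    define z where "z = of_real r * cis \<theta>"
    have z: "cmod z = r" using r by (simp add: z_def norm_mult)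
    have "cmod (\<zeta> + z) \<le> 2" using norm_triangle_ineq[of \<zeta> z] False z r by simp
    then have "cmod (p \<zeta> * ((\<zeta> + z) / (\<zeta> - z))) \<le> cmod (p \<zeta>) * (2 * (1 / cmod (\<zeta> - z)))"
      unfolding norm_mult norm_divide by (intro mult_left_mono) (auto simp: divide_right_mono)
    moreover have "cmod (cnj (p \<zeta>) * ((1 + z * cnj \<zeta>) / (1 - z * cnj \<zeta>))) \<le> cmod (p \<zeta>) * (2 / (1 - r))"
      using kernel2_le[of z \<zeta>] z r by simp
    ultimately have "cmod (kernel z \<zeta>) \<le> cmod (p \<zeta>) * (2 * (1 / cmod (\<zeta> - z)) + 2 / (1 - r))"
      unfolding kernel_def distrib_left by (rule order_trans[OF norm_triangle_ineq add_mono])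
    then have "cmod (kernel z \<zeta>) * cmod (\<gamma> \<theta>) \<le> (cmod (p \<zeta>) * (2 * (1 / cmod (\<zeta> - z)) + 2 / (1 - r))) * B"
      using B r by (intro mult_mono) auto
    then show ?thesis by (simp only: d_def z_def norm_mult mult_ac)
  qed (simp add: kernel_def p_support d_def)
  have di: "integrable circ (d \<zeta>)" if "cmod \<zeta> \<noteq> r" for \<zeta> unfolding d_def
    by (intro integrable_mult_right Bochner_Integration.integrable_add inverse_distance r that circ.integrable_const)
  have ki: "integrable circ (\<lambda>\<theta>. kernel (of_real r * cis \<theta>) \<zeta> * \<gamma> \<theta>)" if "cmod \<zeta> \<noteq> r" for \<zeta>
    by (rule Bochner_Integration.integrable_bound[OF di[OF that]])
       (use le in \<open>auto simp: kernel_def intro!: AE_I2 order_trans[OF _ abs_ge_self]\<close>)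
  show "AE \<zeta> in lborel. integrable circ (\<lambda>\<theta>. case (\<zeta>, \<theta>) of (\<zeta>, \<theta>) \<Rightarrow> kernel (of_real r * cis \<theta>) \<zeta> * \<gamma> \<theta>)"
    using AE_norm_neq[of r] by eventually_elim (simp add: ki)
  define C where "C = B * 2 * (2 * pi / sqrt r)"
  define C' where "C' = B * (2 / (1 - r)) * (2 * pi)"
  have "integrable lborel (\<lambda>\<zeta>. C * (cmod (p \<zeta>) * (1 / sqrt \<bar>cmod \<zeta> - r\<bar>)) + C' * cmod (p \<zeta>))"
    using g p unfolding good_def by (intro Bochner_Integration.integrable_add integrable_mult_right integrable_norm)
  then show "integrable lborel (\<lambda>\<zeta>. \<integral>\<theta>. norm (case (\<zeta>, \<theta>) of (\<zeta>, \<theta>) \<Rightarrow> kernel (of_real r * cis \<theta>) \<zeta> * \<gamma> \<theta>) \<partial>circ)"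
  proof (rule Bochner_Integration.integrable_bound)
    show "(\<lambda>\<zeta>. \<integral>\<theta>. norm (case (\<zeta>, \<theta>) of (\<zeta>, \<theta>) \<Rightarrow> kernel (of_real r * cis \<theta>) \<zeta> * \<gamma> \<theta>) \<partial>circ) \<in> borel_measurable lborel"
      unfolding kernel_def by measurable
    show "AE \<zeta> in lborel. norm (\<integral>\<theta>. norm (case (\<zeta>, \<theta>) of (\<zeta>, \<theta>) \<Rightarrow> kernel (of_real r * cis \<theta>) \<zeta> * \<gamma> \<theta>) \<partial>circ)
        \<le> norm (C * (cmod (p \<zeta>) * (1 / sqrt \<bar>cmod \<zeta> - r\<bar>)) + C' * cmod (p \<zeta>))"
      using AE_norm_neq[of r]
    proof eventually_elim
      case (elim \<zeta>)
      define J where "J = integral\<^sup>L circ (\<lambda>\<theta>. norm (kernel (of_real r * cis \<theta>) \<zeta> * \<gamma> \<theta>))"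
      have J0: "J \<ge> 0" unfolding J_def by (rule Bochner_Integration.integral_nonneg) simp
      have "J \<le> integral\<^sup>L circ (d \<zeta>)" unfolding J_def by (intro integral_mono integrable_norm ki di elim le)
      also have "\<dots> = B * cmod (p \<zeta>) * (2 * integral\<^sup>L circ (\<lambda>\<theta>. 1 / cmod (\<zeta> - of_real r * cis \<theta>)) + 2 / (1 - r) * (2 * pi))"
        unfolding d_def integral_mult_right_zero
        by (subst Bochner_Integration.integral_add[OF integrable_mult_right[OF inverse_distance(1)[OF r(1) elim]] circ.integrable_const])
           (simp only: integral_mult_right_zero, simp)
      also have "\<dots> \<le> B * cmod (p \<zeta>) * (2 * (2 * pi / sqrt r * (1 / sqrt \<bar>cmod \<zeta> - r\<bar>)) + 2 / (1 - r) * (2 * pi))"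
        using B(1) by (intro mult_left_mono add_right_mono inverse_distance(2) r elim mult_nonneg_nonneg) auto
      also have "\<dots> = C * (cmod (p \<zeta>) * (1 / sqrt \<bar>cmod \<zeta> - r\<bar>)) + C' * cmod (p \<zeta>)"
        unfolding C_def C'_def by (simp only: distrib_left mult_ac)
      finally show ?case using J0 by (simp add: J_def)
    qed
  qed
qed

text \<open>After Fubini each kernel is integrated over the circle first, where it becomes a Cayley
  series in the Fourier coefficients of \<gamma> or of its conjugate. In this form the radius can be
  sent to 1 inside the area integral.\<close>

lemma potential_circle_integral:
  assumes g: "good r" and r: "0 < r" "r < 1" and \<gamma>: "\<gamma> \<in> circle_test"
  shows "integrable circ (\<lambda>\<theta>. potential (of_real r * cis \<theta>) * \<gamma> \<theta>)"
    and "integral\<^sup>L circ (\<lambda>\<theta>. potential (of_real r * cis \<theta>) * \<gamma> \<theta>)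
      = - (1 / (2 * of_real pi)) * integral\<^sup>L lborel (\<lambda>\<zeta>. p \<zeta> * cauchy_ser r \<gamma> \<zeta> + cnj (p \<zeta>) * cayley_ser \<gamma> (of_real r * cnj \<zeta>))"
    and "integrable lborel (\<lambda>\<zeta>. integral\<^sup>L circ (\<lambda>\<theta>. kernel (of_real r * cis \<theta>) \<zeta> * \<gamma> \<theta>))"
    and "AE \<zeta> in lborel. integral\<^sup>L circ (\<lambda>\<theta>. kernel (of_real r * cis \<theta>) \<zeta> * \<gamma> \<theta>) = p \<zeta> * cauchy_ser r \<gamma> \<zeta> + cnj (p \<zeta>) * cayley_ser \<gamma> (of_real r * cnj \<zeta>)"
proof -
  note i = kernel_circle_integrable[OF assms]
  have e: "potential (of_real r * cis \<theta>) * \<gamma> \<theta> = - (1 / (2 * of_real pi)) * integral\<^sup>L lborel (\<lambda>\<zeta>. kernel (of_real r * cis \<theta>) \<zeta> * \<gamma> \<theta>)" for \<theta>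
    unfolding potential_def integral_mult_left_zero by (simp only: mult.assoc)
  show "integrable circ (\<lambda>\<theta>. potential (of_real r * cis \<theta>) * \<gamma> \<theta>)"
    unfolding e by (rule integrable_mult_right[OF lborel_circ.integrable_snd[OF i]])
  show i1: "integrable lborel (\<lambda>\<zeta>. integral\<^sup>L circ (\<lambda>\<theta>. kernel (of_real r * cis \<theta>) \<zeta> * \<gamma> \<theta>))"
    using lborel_circ.integrable_fst[OF i] .
  show AE: "AE \<zeta> in lborel. integral\<^sup>L circ (\<lambda>\<theta>. kernel (of_real r * cis \<theta>) \<zeta> * \<gamma> \<theta>) = p \<zeta> * cauchy_ser r \<gamma> \<zeta> + cnj (p \<zeta>) * cayley_ser \<gamma> (of_real r * cnj \<zeta>)"
    using AE_norm_neq[of r]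
  proof eventually_elim
    case (elim \<zeta>)
    show ?case
    proof (cases "cmod \<zeta> \<ge> 1")
      case False
      then have z: "cmod \<zeta> \<le> 1" by simp
      have "kernel (of_real r * cis \<theta>) \<zeta> * \<gamma> \<theta> = p \<zeta> * ((\<zeta> + of_real r * cis \<theta>) / (\<zeta> - of_real r * cis \<theta>) * \<gamma> \<theta>)
        + cnj (p \<zeta>) * ((1 + of_real r * cis \<theta> * cnj \<zeta>) / (1 - of_real r * cis \<theta> * cnj \<zeta>) * \<gamma> \<theta>)" for \<theta>
        unfolding kernel_def by (simp only: distrib_right mult.assoc)
      then show ?thesis
        by (simp only: Bochner_Integration.integral_add[OF integrable_mult_right[OF circle_integral_kernel1(1)[OF \<gamma> r(1) elim]]
            integrable_mult_right[OF circle_integral_kernel2(1)[OF \<gamma> r z]]] integral_mult_right_zero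
            circle_integral_kernel1(2)[OF \<gamma> r(1) elim] circle_integral_kernel2(2)[OF \<gamma> r z])
    qed (simp add: kernel_def p_support)
  qed
  have "integral\<^sup>L circ (\<lambda>\<theta>. potential (of_real r * cis \<theta>) * \<gamma> \<theta>) = - (1 / (2 * of_real pi)) * integral\<^sup>L circ (\<lambda>\<theta>. integral\<^sup>L lborel (\<lambda>\<zeta>. kernel (of_real r * cis \<theta>) \<zeta> * \<gamma> \<theta>))"
    unfolding e integral_mult_right_zero ..
  also have "integral\<^sup>L circ (\<lambda>\<theta>. integral\<^sup>L lborel (\<lambda>\<zeta>. kernel (of_real r * cis \<theta>) \<zeta> * \<gamma> \<theta>)) = integral\<^sup>L lborel (\<lambda>\<zeta>. integral\<^sup>L circ (\<lambda>\<theta>. kernel (of_real r * cis \<theta>) \<zeta> * \<gamma> \<theta>))"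
    by (rule lborel_circ.Fubini_integral[OF i])
  also have "\<dots> = integral\<^sup>L lborel (\<lambda>\<zeta>. p \<zeta> * cauchy_ser r \<gamma> \<zeta> + cnj (p \<zeta>) * cayley_ser \<gamma> (of_real r * cnj \<zeta>))"
  proof (rule integral_cong_AE[OF _ _ AE])
    show m: "(\<lambda>\<zeta>. integral\<^sup>L circ (\<lambda>\<theta>. kernel (of_real r * cis \<theta>) \<zeta> * \<gamma> \<theta>)) \<in> borel_measurable lborel"
      using i1 by auto
    show "(\<lambda>\<zeta>. p \<zeta> * cauchy_ser r \<gamma> \<zeta> + cnj (p \<zeta>) * cayley_ser \<gamma> (of_real r * cnj \<zeta>)) \<in> borel_measurable lborel"
      unfolding cauchy_ser_def cayley_ser_def by measurable
  qed
  finally show "integral\<^sup>L circ (\<lambda>\<theta>. potential (of_real r * cis \<theta>) * \<gamma> \<theta>)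
      = - (1 / (2 * of_real pi)) * integral\<^sup>L lborel (\<lambda>\<zeta>. p \<zeta> * cauchy_ser r \<gamma> \<zeta> + cnj (p \<zeta>) * cayley_ser \<gamma> (of_real r * cnj \<zeta>))" .
qed

definition potential_bv :: "(real \<Rightarrow> complex) \<Rightarrow> complex" where
  "potential_bv \<gamma> = - (1 / (2 * of_real pi)) *
     integral\<^sup>L lborel (\<lambda>\<zeta>. p \<zeta> * - cnj (cayley_ser (\<lambda>t. cnj (\<gamma> t)) (cnj \<zeta>)) + cnj (p \<zeta>) * cayley_ser \<gamma> (cnj \<zeta>))"

text \<open>For real \<gamma> the integrand is a number minus its own conjugate; this is the
  reflection symmetry of the two area kernels on the unit circle.\<close>

lemma potential_bv_imaginary:
  assumes "\<And>t. \<gamma> t \<in> \<real>" shows "Re (potential_bv \<gamma>) = 0"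
proof -
  have "cnj (\<gamma> t) = \<gamma> t" for t using assms[of t] by (simp add: Reals_cnj_iff)
  then have g: "(\<lambda>t. cnj (\<gamma> t)) = \<gamma>" by auto
  define f where "f = (\<lambda>\<zeta>. p \<zeta> * - cnj (cayley_ser \<gamma> (cnj \<zeta>)) + cnj (p \<zeta>) * cayley_ser \<gamma> (cnj \<zeta>))"
  have "f \<zeta> = - cnj (f \<zeta>)" for \<zeta> by (simp add: f_def)
  then have "integral\<^sup>L lborel f = integral\<^sup>L lborel (\<lambda>\<zeta>. - cnj (f \<zeta>))" by metis
  also have "\<dots> = - cnj (integral\<^sup>L lborel f)" by (simp only: Bochner_Integration.integral_minus Bochner_Integration.integral_cnj)
  finally have "Re (integral\<^sup>L lborel f) = 0" by (simp add: complex_eq_iff)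
  moreover have "potential_bv \<gamma> = of_real (- (1 / (2 * pi))) * integral\<^sup>L lborel f"
    unfolding potential_bv_def g f_def by simp
  ultimately show ?thesis by (simp only: Re_complex_of_real Im_complex_of_real times_complex.sel mult_zero_left mult_zero_right diff_zero)
qed

lemma potential_bv_tendsto:
  assumes R: "\<And>i. good (R i)" "\<And>i. 0 < R i" "\<And>i. R i < 1" "R \<longlonglongrightarrow> 1" and \<gamma>: "\<gamma> \<in> circle_test"
  shows "(\<lambda>i. integral\<^sup>L circ (\<lambda>\<theta>. potential (of_real (R i) * cis \<theta>) * \<gamma> \<theta>)) \<longlonglongrightarrow> potential_bv \<gamma>"
  unfolding potential_bv_def potential_circle_integral(2)[OF R(1-3) \<gamma>]
proof (intro tendsto_mult tendsto_const)
  obtain M where M: "M \<ge> 0" "\<And>r \<zeta>. 0 < r \<Longrightarrow> cmod (cauchy_ser r \<gamma> \<zeta>) \<le> M" using cauchy_ser_bound[OF \<gamma>] by blast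
  obtain M' where M': "M' \<ge> 0" "\<And>q. cmod q \<le> 1 \<Longrightarrow> cmod (cayley_ser \<gamma> q) \<le> M'" using cayley_ser_bound[OF \<gamma>] by blast
  have q1: "cmod (of_real (R i) * cnj \<zeta>) \<le> 1" if "cmod \<zeta> < 1" for i \<zeta>
    using mult_mono[of "R i" 1 "cmod \<zeta>" 1] R(2,3)[of i] that by (simp add: norm_mult)
  show "(\<lambda>i. integral\<^sup>L lborel (\<lambda>\<zeta>. p \<zeta> * cauchy_ser (R i) \<gamma> \<zeta> + cnj (p \<zeta>) * cayley_ser \<gamma> (of_real (R i) * cnj \<zeta>)))
    \<longlonglongrightarrow> integral\<^sup>L lborel (\<lambda>\<zeta>. p \<zeta> * - cnj (cayley_ser (\<lambda>t. cnj (\<gamma> t)) (cnj \<zeta>)) + cnj (p \<zeta>) * cayley_ser \<gamma> (cnj \<zeta>))"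
  proof (rule integral_dominated_convergence[where w = "\<lambda>\<zeta>. cmod (p \<zeta>) * (M + M')"])
    show "integrable lborel (\<lambda>\<zeta>. cmod (p \<zeta>) * (M + M'))" by (intro integrable_mult_left integrable_norm p)
    show "AE \<zeta> in lborel. norm (p \<zeta> * cauchy_ser (R i) \<gamma> \<zeta> + cnj (p \<zeta>) * cayley_ser \<gamma> (of_real (R i) * cnj \<zeta>)) \<le> cmod (p \<zeta>) * (M + M')" for i
    proof (rule AE_I2)
      fix \<zeta>
      show "norm (p \<zeta> * cauchy_ser (R i) \<gamma> \<zeta> + cnj (p \<zeta>) * cayley_ser \<gamma> (of_real (R i) * cnj \<zeta>)) \<le> cmod (p \<zeta>) * (M + M')"
      proof (cases "cmod \<zeta> \<ge> 1")
        case False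
        then show ?thesis unfolding distrib_left
          using M(2)[OF R(2)] M'(2)[OF q1] by (intro order_trans[OF norm_triangle_ineq] add_mono) (auto simp: norm_mult intro!: mult_left_mono)
      qed (simp add: p_support)
    qed
    show "AE \<zeta> in lborel. (\<lambda>i. p \<zeta> * cauchy_ser (R i) \<gamma> \<zeta> + cnj (p \<zeta>) * cayley_ser \<gamma> (of_real (R i) * cnj \<zeta>))
      \<longlonglongrightarrow> p \<zeta> * - cnj (cayley_ser (\<lambda>t. cnj (\<gamma> t)) (cnj \<zeta>)) + cnj (p \<zeta>) * cayley_ser \<gamma> (cnj \<zeta>)"
    proof (rule AE_I2)
      fix \<zeta>
      show "(\<lambda>i. p \<zeta> * cauchy_ser (R i) \<gamma> \<zeta> + cnj (p \<zeta>) * cayley_ser \<gamma> (of_real (R i) * cnj \<zeta>))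
        \<longlonglongrightarrow> p \<zeta> * - cnj (cayley_ser (\<lambda>t. cnj (\<gamma> t)) (cnj \<zeta>)) + cnj (p \<zeta>) * cayley_ser \<gamma> (cnj \<zeta>)"
      proof (cases "cmod \<zeta> \<ge> 1")
        case False
        then have z: "cmod \<zeta> < 1" by simp
        have "(\<lambda>i. of_real (R i) * cnj \<zeta>) \<longlonglongrightarrow> of_real 1 * cnj \<zeta>" by (intro tendsto_intros R(4))
        then have l: "(\<lambda>i. of_real (R i) * cnj \<zeta>) \<longlonglongrightarrow> cnj \<zeta>" by simp
        show ?thesis
          by (intro tendsto_add tendsto_mult tendsto_const cauchy_ser_tendsto[OF \<gamma> R(4) z] cayley_ser_tendsto[OF \<gamma> l])
             (use q1[OF z] in auto)
      qed (simp add: p_support)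
    qed
  qed (unfold cauchy_ser_def cayley_ser_def, measurable)
qed

text \<open>Keeping r whenever it is good confines the change to a null set of radii; otherwise some
  good radius between r and 1 is chosen, which exists because almost every radius is good.\<close>

definition good_radius :: "real \<Rightarrow> real" where
  "good_radius r = (if good r then r else SOME s. r < s \<and> s < 1 \<and> good s)"

lemma good_radius:
  assumes r: "0 < r" "r < 1" shows "good (good_radius r)" "r \<le> good_radius r" "good_radius r < 1"
proof -
  have "\<exists>s. r < s \<and> s < 1 \<and> (s \<in> {0<..<1} \<longrightarrow> good s)" by (rule AE_ex_between[OF AE_good r(2)])
  then have "\<exists>s. r < s \<and> s < 1 \<and> good s" using r by auto
  from someI_ex[OF this] show "good (good_radius r)" "r \<le> good_radius r" "good_radius r < 1"
    using r by (auto simp: good_radius_def)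
qed

text \<open>On a circle where the area integral need not converge, the potential is replaced by its
  values on a slightly larger circle; the exceptional radii form a null set.\<close>

definition potential_rep :: "complex \<Rightarrow> complex" where
  "potential_rep z = potential (of_real (good_radius (cmod z)) * sgn z)"

lemma potential_rep_circle: "r > 0 \<Longrightarrow> potential_rep (of_real r * cis \<theta>) = potential (of_real (good_radius r) * cis \<theta>)"
  by (simp add: potential_rep_def norm_mult sgn_eq)

lemma potential_rep_AE: "AE z in lebesgue. z \<in> unit_disk \<longrightarrow> potential z = potential_rep z"
proof -
  have "AE z::complex in lborel. cmod z \<in> {0<..<1} \<longrightarrow> good (cmod z)" by (rule AE_norm[OF AE_good])
  then have "AE z in lborel. z \<in> unit_disk \<longrightarrow> potential z = potential_rep z"
    using AE_neq[of 0]
  proof eventually_elim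
    case (elim z)
    then show ?case by (auto simp: potential_rep_def good_radius_def sgn_eq)
  qed
  then show ?thesis by (simp only: AE_completion_iff)
qed

theorem potential_rep_boundary_value: "has_boundary_value potential_rep potential_bv"
  unfolding has_boundary_value_def
proof (intro conjI ballI)
  fix r :: real assume r: "r \<in> {0<..<1}"
  then have g: "good (good_radius r)" "0 < good_radius r" "good_radius r < 1" using good_radius[of r] by auto
  show "set_integrable lebesgue {0..2 * pi} (\<lambda>\<theta>. potential_rep (of_real r * cis \<theta>))"
    using r potential_circle_integral(1)[OF g circle_test_1]
    by (subst circ_set_integral(2)) (simp_all add: potential_rep_circle)
next
  fix \<gamma> assume \<gamma>: "\<gamma> \<in> circle_test"
  note [measurable] = circle_test_measurable[OF \<gamma>]
  have at: "at_left (1::real) = at 1 within {0<..<1}" by (rule at_within_nhd[of _ "{0<..}"]) auto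
  show "((\<lambda>r. LINT \<theta>:{0..2 * pi}|lebesgue. potential_rep (of_real r * cis \<theta>) * \<gamma> \<theta>) \<longlongrightarrow> potential_bv \<gamma>) (at_left 1)"
    unfolding at tendsto_at_iff_sequentially
  proof (intro allI impI)
    fix X :: "nat \<Rightarrow> real" assume X: "\<forall>i. X i \<in> {0<..<1} - {1}" "X \<longlonglongrightarrow> 1"
    then have X': "0 < X i" "X i < 1" for i by auto
    \<comment> \<open>The replaced radii lie between \<open>X i\<close> and 1, so they tend to 1 as
      well and \<open>potential_bv_tendsto\<close> applies to them.\<close>
    have "(\<lambda>i. good_radius (X i)) \<longlonglongrightarrow> 1"
      by (rule tendsto_sandwich[OF _ _ X(2) tendsto_const]) (use good_radius[OF X'] in \<open>auto intro!: always_eventually less_imp_le\<close>)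
    then have "(\<lambda>i. integral\<^sup>L circ (\<lambda>\<theta>. potential (of_real (good_radius (X i)) * cis \<theta>) * \<gamma> \<theta>)) \<longlonglongrightarrow> potential_bv \<gamma>"
      using less_le_trans[OF X'(1) good_radius(2)[OF X']] by (intro potential_bv_tendsto good_radius X' \<gamma>) auto
    then show "((\<lambda>r. LINT \<theta>:{0..2 * pi}|lebesgue. potential_rep (of_real r * cis \<theta>) * \<gamma> \<theta>) \<circ> X) \<longlonglongrightarrow> potential_bv \<gamma>"
      unfolding o_def potential_rep_circle[OF X'(1)] by (subst circ_set_integral(1)) measurable
  qed
qed

end

section \<open>Values at the origin and boundary values\<close>

definition deviation :: "(complex \<Rightarrow> complex) \<Rightarrow> complex \<Rightarrow> real \<Rightarrow> real" where
  "deviation u a \<epsilon> = (LINT \<zeta>:ball 0 \<epsilon>|lebesgue. cmod (u \<zeta> - a)) / measure lebesgue (ball (0::complex) \<epsilon>)"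

lemma has_value_at_iff: "has_value_at u 0 a \<longleftrightarrow> (deviation u a \<longlongrightarrow> 0) (at_right 0)"
  unfolding has_value_at_def deviation_def ..

lemma deviation_nonneg: "deviation u a \<epsilon> \<ge> 0"
  unfolding deviation_def set_lebesgue_integral_def by (intro divide_nonneg_nonneg Bochner_Integration.integral_nonneg) auto

lemma has_value_atI:
  assumes "\<And>\<epsilon>. 0 < \<epsilon> \<Longrightarrow> \<epsilon> < 1 \<Longrightarrow> deviation u a \<epsilon> \<le> K \<epsilon>" "(K \<longlongrightarrow> 0) (at_right 0)"
  shows "has_value_at u 0 a"
  unfolding has_value_at_iff
proof (rule tendsto_sandwich[OF _ _ tendsto_const assms(2)])
  show "\<forall>\<^sub>F \<epsilon> in at_right 0. deviation u a \<epsilon> \<le> K \<epsilon>"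
    using assms(1) unfolding eventually_at_right_field by (intro exI[of _ 1]) auto
qed (simp add: deviation_nonneg)

lemma deviation_integrable:
  assumes "locally_integrable u" "\<epsilon> < 1" shows "set_integrable lebesgue (ball 0 \<epsilon>) (\<lambda>\<zeta>. cmod (u \<zeta> - a))"
proof -
  have "compact (cball (0::complex) \<epsilon>) \<and> cball 0 \<epsilon> \<subseteq> unit_disk" using assms(2) by auto
  then have "set_integrable lebesgue (cball 0 \<epsilon>) u" using assms(1) unfolding locally_integrable_def by blast
  then have "set_integrable lebesgue (ball 0 \<epsilon>) u" by (rule set_integrable_subset) auto
  moreover have "set_integrable lebesgue (ball (0::complex) \<epsilon>) (\<lambda>\<zeta>. a)"
    unfolding set_integrable_def by (intro integrable_scaleR_left integrable_real_indicator) (use emeasure_lborel_ball_finite[of "0::complex" \<epsilon>] in auto)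
  ultimately show ?thesis by (intro set_integrable_norm set_integral_diff(1))
qed

lemma measure_ball_pos: "\<epsilon> > 0 \<Longrightarrow> measure lebesgue (ball (0::complex) \<epsilon>) > 0"
  by (simp add: measure_def emeasure_ball_complex)

lemma deviation_lincomb:
  assumes u: "locally_integrable u" and v: "locally_integrable v" and \<epsilon>: "0 < \<epsilon>" "\<epsilon> < 1"
  shows "deviation (\<lambda>z. x * u z + y * v z) (x * a + y * b) \<epsilon> \<le> cmod x * deviation u a \<epsilon> + cmod y * deviation v b \<epsilon>"
proof -
  note iu = deviation_integrable[OF u \<epsilon>(2), of a] and iv = deviation_integrable[OF v \<epsilon>(2), of b]
  have "(LINT \<zeta>:ball 0 \<epsilon>|lebesgue. cmod (x * u \<zeta> + y * v \<zeta> - (x * a + y * b)))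
    \<le> (LINT \<zeta>:ball 0 \<epsilon>|lebesgue. cmod x * cmod (u \<zeta> - a) + cmod y * cmod (v \<zeta> - b))"
  proof (rule set_integral_mono)
    show "set_integrable lebesgue (ball 0 \<epsilon>) (\<lambda>\<zeta>. cmod (x * u \<zeta> + y * v \<zeta> - (x * a + y * b)))"
      by (rule deviation_integrable[OF locally_integrable_lincomb[OF u v] \<epsilon>(2)])
    show "set_integrable lebesgue (ball 0 \<epsilon>) (\<lambda>\<zeta>. cmod x * cmod (u \<zeta> - a) + cmod y * cmod (v \<zeta> - b))"
      by (intro set_integral_add(1) set_integrable_mult_right iu iv)
    fix \<zeta>
    have "x * u \<zeta> + y * v \<zeta> - (x * a + y * b) = x * (u \<zeta> - a) + y * (v \<zeta> - b)" by (simp add: algebra_simps)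
    then show "cmod (x * u \<zeta> + y * v \<zeta> - (x * a + y * b)) \<le> cmod x * cmod (u \<zeta> - a) + cmod y * cmod (v \<zeta> - b)"
      using norm_triangle_ineq[of "x * (u \<zeta> - a)" "y * (v \<zeta> - b)"] by (simp only: norm_mult)
  qed
  also have "\<dots> = cmod x * (LINT \<zeta>:ball 0 \<epsilon>|lebesgue. cmod (u \<zeta> - a)) + cmod y * (LINT \<zeta>:ball 0 \<epsilon>|lebesgue. cmod (v \<zeta> - b))"
    by (subst set_integral_add(2)[OF set_integrable_mult_right[OF iu] set_integrable_mult_right[OF iv]]) simp
  finally show ?thesis
    using measure_ball_pos[OF \<epsilon>(1)] unfolding deviation_def by (simp add: divide_le_eq distrib_right)
qed

lemma deviation_const: "\<epsilon> > 0 \<Longrightarrow> deviation (\<lambda>z. c) a \<epsilon> = cmod (c - a)"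
  using measure_ball_pos[of \<epsilon>] by (simp add: deviation_def set_lebesgue_integral_def)

lemma has_value_at_lincomb:
  assumes "locally_integrable u" "locally_integrable v" "has_value_at u 0 a" "has_value_at v 0 b"
  shows "has_value_at (\<lambda>z. x * u z + y * v z) 0 (x * a + y * b)"
proof (rule has_value_atI[OF deviation_lincomb[OF assms(1,2)]])
  have "((\<lambda>\<epsilon>. cmod x * deviation u a \<epsilon> + cmod y * deviation v b \<epsilon>) \<longlongrightarrow> cmod x * 0 + cmod y * 0) (at_right 0)"
    using assms(3,4) unfolding has_value_at_iff by (intro tendsto_intros)
  then show "((\<lambda>\<epsilon>. cmod x * deviation u a \<epsilon> + cmod y * deviation v b \<epsilon>) \<longlongrightarrow> 0) (at_right 0)" by simp
qed

text \<open>On the \<epsilon>-ball the factor is at most \<open>2 * \<epsilon>\<close>, while the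
  mean of \<open>cmod (u \<zeta>)\<close> stays bounded by the deviation plus
  \<open>cmod a\<close>.\<close>

lemma has_value_at_mult_x:
  assumes u: "locally_integrable u" and v: "has_value_at u 0 a" shows "has_value_at (\<lambda>z. (z + cnj z) * u z) 0 0"
proof (rule has_value_atI)
  fix \<epsilon> :: real assume \<epsilon>: "0 < \<epsilon>" "\<epsilon> < 1"
  \<comment> \<open>The constant \<open>cmod a\<close> is treated as the deviation of the zero
    function from \<open>- a\<close>; hence the literal shape \<open>0 - - a\<close> below.\<close>
  note iu = deviation_integrable[OF u \<epsilon>(2), of a] and ic = deviation_integrable[OF locally_integrable_0 \<epsilon>(2), of "- a"]
  have "(LINT \<zeta>:ball 0 \<epsilon>|lebesgue. cmod ((\<zeta> + cnj \<zeta>) * u \<zeta> - 0))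
    \<le> (LINT \<zeta>:ball 0 \<epsilon>|lebesgue. (2 * \<epsilon>) * (cmod (u \<zeta> - a) + cmod (0 - - a)))"
  proof (rule set_integral_mono)
    show "set_integrable lebesgue (ball 0 \<epsilon>) (\<lambda>\<zeta>. cmod ((\<zeta> + cnj \<zeta>) * u \<zeta> - 0))"
      by (intro deviation_integrable[OF _ \<epsilon>(2)] locally_integrable_mult_continuous[OF u] continuous_intros)
    show "set_integrable lebesgue (ball 0 \<epsilon>) (\<lambda>\<zeta>. (2 * \<epsilon>) * (cmod (u \<zeta> - a) + cmod (0 - - a)))"
      by (intro set_integrable_mult_right set_integral_add(1) iu ic)
    fix \<zeta> :: complex assume "\<zeta> \<in> ball 0 \<epsilon>"
    then have "cmod (\<zeta> + cnj \<zeta>) \<le> 2 * \<epsilon>" using norm_triangle_ineq[of \<zeta> "cnj \<zeta>"] by simp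
    moreover have "cmod (u \<zeta>) \<le> cmod (u \<zeta> - a) + cmod (0 - - a)" using norm_triangle_ineq[of "u \<zeta> - a" a] by simp
    ultimately show "cmod ((\<zeta> + cnj \<zeta>) * u \<zeta> - 0) \<le> (2 * \<epsilon>) * (cmod (u \<zeta> - a) + cmod (0 - - a))"
      unfolding norm_mult diff_zero using \<epsilon> by (intro mult_mono) auto
  qed
  also have "\<dots> = (2 * \<epsilon>) * ((LINT \<zeta>:ball 0 \<epsilon>|lebesgue. cmod (u \<zeta> - a)) + (LINT \<zeta>:ball (0::complex) \<epsilon>|lebesgue. cmod (0 - - a)))"
    by (simp only: set_integral_mult_right set_integral_add(2)[OF iu ic])
  finally have "deviation (\<lambda>z. (z + cnj z) * u z) 0 \<epsilon> \<le> (2 * \<epsilon>) * ((LINT \<zeta>:ball 0 \<epsilon>|lebesgue. cmod (u \<zeta> - a)) + (LINT \<zeta>:ball (0::complex) \<epsilon>|lebesgue. cmod (0 - - a))) / measure lebesgue (ball (0::complex) \<epsilon>)"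
    unfolding deviation_def by (rule divide_right_mono) simp
  also have "\<dots> = (2 * \<epsilon>) * (deviation u a \<epsilon> + deviation (\<lambda>z. 0) (- a) \<epsilon>)"
    unfolding deviation_def by (simp only: add_divide_distrib[symmetric] times_divide_eq_right)
  finally show "deviation (\<lambda>z. (z + cnj z) * u z) 0 \<epsilon> \<le> (2 * \<epsilon>) * (deviation u a \<epsilon> + cmod a)"
    by (simp add: deviation_const \<epsilon>)
next
  have "((\<lambda>\<epsilon>. 2 * \<epsilon> * (deviation u a \<epsilon> + cmod a)) \<longlongrightarrow> 2 * 0 * (0 + cmod a)) (at_right 0)"
    using v unfolding has_value_at_iff by (intro tendsto_intros)
  then show "((\<lambda>\<epsilon>. 2 * \<epsilon> * (deviation u a \<epsilon> + cmod a)) \<longlongrightarrow> 0) (at_right 0)" by simp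
qed

lemma has_value_at_cong:
  assumes AE: "AE z in lebesgue. z \<in> unit_disk \<longrightarrow> u z = v z" and u: "locally_integrable u" and a: "has_value_at u 0 a"
  shows "has_value_at v 0 a"
proof (rule has_value_atI)
  show "(deviation u a \<longlongrightarrow> 0) (at_right 0)" using a by (simp add: has_value_at_iff)
  fix \<epsilon> :: real assume \<epsilon>: "0 < \<epsilon>" "\<epsilon> < 1"
  have "(LINT \<zeta>:ball 0 \<epsilon>|lebesgue. cmod (u \<zeta> - a)) = (LINT \<zeta>:ball 0 \<epsilon>|lebesgue. cmod (v \<zeta> - a))"
    unfolding set_lebesgue_integral_def
  proof (rule integral_cong_AE)
    show "(\<lambda>\<zeta>. indicator (ball 0 \<epsilon>) \<zeta> *\<^sub>R cmod (u \<zeta> - a)) \<in> borel_measurable lebesgue"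
      using deviation_integrable[OF u \<epsilon>(2)] unfolding set_integrable_def by auto
    show "(\<lambda>\<zeta>. indicator (ball 0 \<epsilon>) \<zeta> *\<^sub>R cmod (v \<zeta> - a)) \<in> borel_measurable lebesgue"
      using deviation_integrable[OF locally_integrable_cong[OF AE u] \<epsilon>(2)] unfolding set_integrable_def by auto
    show "AE \<zeta> in lebesgue. indicator (ball 0 \<epsilon>) \<zeta> *\<^sub>R cmod (u \<zeta> - a) = indicator (ball 0 \<epsilon>) \<zeta> *\<^sub>R cmod (v \<zeta> - a)"
      using AE by eventually_elim (use \<epsilon> in \<open>auto simp: indicator_def\<close>)
  qed
  then show "deviation v a \<epsilon> \<le> deviation u a \<epsilon>" by (simp add: deviation_def)
qed

lemma has_value_at_continuous:
  assumes u: "continuous_on unit_disk u" shows "has_value_at u 0 (u 0)"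
  unfolding has_value_at_iff
proof (rule tendstoI)
  fix e :: real assume e: "e > 0"
  have li: "locally_integrable u" by (rule continuous_locally_integrable[OF u])
  have "isCont u 0" using u by (simp add: continuous_on_eq_continuous_at)
  then obtain d where d: "d > 0" "\<And>z. cmod z < d \<Longrightarrow> cmod (u z - u 0) < e / 2"
    unfolding continuous_at_eps_delta using e by (metis dist_norm diff_zero half_gt_zero)
  have "dist (deviation u (u 0) \<epsilon>) 0 < e" if \<epsilon>: "0 < \<epsilon>" "\<epsilon> < min d 1" for \<epsilon>
  proof -
    have "(LINT \<zeta>:ball 0 \<epsilon>|lebesgue. cmod (u \<zeta> - u 0)) \<le> (LINT \<zeta>:ball (0::complex) \<epsilon>|lebesgue. cmod (of_real (e / 2) - 0))"
      using \<epsilon> d(2) e by (intro set_integral_mono deviation_integrable li locally_integrable_0 deviation_integrable[OF continuous_locally_integrable]) (auto intro: less_imp_le)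
    then have "deviation u (u 0) \<epsilon> \<le> deviation (\<lambda>z. of_real (e / 2)) 0 \<epsilon>"
      unfolding deviation_def by (rule divide_right_mono) simp
    also have "\<dots> < e" using e \<epsilon> by (simp add: deviation_const)
    finally show ?thesis using deviation_nonneg[of u "u 0" \<epsilon>] by simp
  qed
  then show "\<forall>\<^sub>F \<epsilon> in at_right 0. dist (deviation u (u 0) \<epsilon>) 0 < e"
    unfolding eventually_at_right_field using d(1) by (intro exI[of _ "min d 1"]) auto
qed

lemma has_value_at_unique:
  assumes u: "locally_integrable u" and a: "has_value_at u 0 a" and b: "has_value_at u 0 b" shows "a = b"
proof -
  have "has_value_at (\<lambda>z. 1 * u z + (-1) * u z) 0 (1 * a + (-1) * b)" by (rule has_value_at_lincomb[OF u u a b])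
  then have "(deviation (\<lambda>z. 0) (a - b) \<longlongrightarrow> 0) (at_right 0)" by (simp add: has_value_at_iff)
  then have "((\<lambda>\<epsilon>. cmod (0 - (a - b))) \<longlongrightarrow> 0) (at_right (0::real))"
  proof (rule Lim_transform_eventually)
    show "\<forall>\<^sub>F \<epsilon> in at_right 0. deviation (\<lambda>z. 0) (a - b) \<epsilon> = cmod (0 - (a - b))"
      unfolding eventually_at_right_field by (intro exI[of _ 1]) (simp add: deviation_const)
  qed
  then show ?thesis by (simp add: tendsto_const_iff)
qed

section \<open>Linear combinations of boundary values and their products with powers of
  \<open>z + cnj z\<close>\<close>

lemma circle_pairing_integrable:
  assumes "set_integrable lebesgue {0..2 * pi} g" "\<gamma> \<in> circle_test"
  shows "set_integrable lebesgue {0..2 * pi} (\<lambda>\<theta>. g \<theta> * \<gamma> \<theta>)"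
proof -
  obtain B where B: "B \<ge> 0" "\<And>t. cmod (\<gamma> t) \<le> B" using circle_test_bounded[OF assms(2)] by blast
  have i: "integrable lebesgue (\<lambda>\<theta>. indicator {0..2*pi} \<theta> *\<^sub>R g \<theta>)" using assms(1) unfolding set_integrable_def .
  have [measurable]: "\<gamma> \<in> borel_measurable lebesgue"
    using circle_test_measurable[OF assms(2)] by (intro measurable_completion) simp
  note [measurable] = borel_measurable_integrable[OF i]
  have "integrable lebesgue (\<lambda>\<theta>. (indicator {0..2*pi} \<theta> *\<^sub>R g \<theta>) * \<gamma> \<theta>)"
  proof (rule Bochner_Integration.integrable_bound[OF integrable_mult_left[OF integrable_norm[OF i], of B]])
    show "AE \<theta> in lebesgue. norm ((indicator {0..2*pi} \<theta> *\<^sub>R g \<theta>) * \<gamma> \<theta>) \<le> norm (norm (indicator {0..2*pi} \<theta> *\<^sub>R g \<theta>) * B)"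
      using B by (intro AE_I2) (auto simp: norm_mult mult.assoc intro!: mult_left_mono)
  qed measurable
  then show ?thesis unfolding set_integrable_def by (simp add: scaleR_conv_of_real mult.assoc)
qed

lemma has_boundary_value_lincomb:
  assumes u: "has_boundary_value u h" and v: "has_boundary_value v h'"
  shows "has_boundary_value (\<lambda>z. x * u z + y * v z) (\<lambda>\<gamma>. x * h \<gamma> + y * h' \<gamma>)"
  unfolding has_boundary_value_def
proof (intro conjI ballI)
  have i: "set_integrable lebesgue {0..2 * pi} (\<lambda>\<theta>. u (of_real r * cis \<theta>))" "set_integrable lebesgue {0..2 * pi} (\<lambda>\<theta>. v (of_real r * cis \<theta>))"
    if "r \<in> {0<..<1}" for r using assms that unfolding has_boundary_value_def by auto
  show "set_integrable lebesgue {0..2 * pi} (\<lambda>\<theta>. x * u (of_real r * cis \<theta>) + y * v (of_real r * cis \<theta>))" if "r \<in> {0<..<1}" for r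
    using i[OF that] by (intro set_integral_add(1) set_integrable_mult_right)
  fix \<gamma> assume \<gamma>: "\<gamma> \<in> circle_test"
  have "((\<lambda>r. x * (LINT \<theta>:{0..2 * pi}|lebesgue. u (of_real r * cis \<theta>) * \<gamma> \<theta>) + y * (LINT \<theta>:{0..2 * pi}|lebesgue. v (of_real r * cis \<theta>) * \<gamma> \<theta>)) \<longlongrightarrow> x * h \<gamma> + y * h' \<gamma>) (at_left 1)"
    using assms \<gamma> unfolding has_boundary_value_def by (intro tendsto_intros) auto
  then show "((\<lambda>r. LINT \<theta>:{0..2 * pi}|lebesgue. (x * u (of_real r * cis \<theta>) + y * v (of_real r * cis \<theta>)) * \<gamma> \<theta>) \<longlongrightarrow> x * h \<gamma> + y * h' \<gamma>) (at_left 1)"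
  proof (rule Lim_transform_eventually)
    have "x * (LINT \<theta>:{0..2 * pi}|lebesgue. u (of_real r * cis \<theta>) * \<gamma> \<theta>) + y * (LINT \<theta>:{0..2 * pi}|lebesgue. v (of_real r * cis \<theta>) * \<gamma> \<theta>)
      = (LINT \<theta>:{0..2 * pi}|lebesgue. (x * u (of_real r * cis \<theta>) + y * v (of_real r * cis \<theta>)) * \<gamma> \<theta>)" if r: "r \<in> {0<..<1}" for r
      unfolding distrib_right mult.assoc
      by (subst set_integral_add(2)[OF set_integrable_mult_right set_integrable_mult_right]) (use i[OF r] \<gamma> in \<open>auto intro: circle_pairing_integrable\<close>)
    then show "\<forall>\<^sub>F r in at_left 1. x * (LINT \<theta>:{0..2 * pi}|lebesgue. u (of_real r * cis \<theta>) * \<gamma> \<theta>) + y * (LINT \<theta>:{0..2 * pi}|lebesgue. v (of_real r * cis \<theta>) * \<gamma> \<theta>)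
      = (LINT \<theta>:{0..2 * pi}|lebesgue. (x * u (of_real r * cis \<theta>) + y * v (of_real r * cis \<theta>)) * \<gamma> \<theta>)"
      unfolding eventually_at_left_field by (intro exI[of _ 0]) auto
  qed
qed

lemma has_boundary_value_mult_x:
  assumes u: "has_boundary_value u h" shows "has_boundary_value (\<lambda>z. (z + cnj z) * u z) (mult_2cos 1 h)"
  unfolding has_boundary_value_def
proof (intro conjI ballI)
  have x: "of_real r * cis \<theta> + cnj (of_real r * cis \<theta>) = of_real r * complex_of_real (2 * cos \<theta>)" for r \<theta>
    by (simp add: complex_eq_iff)
  have c2: "(\<lambda>\<theta>. complex_of_real (2 * cos \<theta>)) \<in> circle_test" using circle_test_mult_2cos[OF circle_test_1] by simp
  show "set_integrable lebesgue {0..2 * pi} (\<lambda>\<theta>. (of_real r * cis \<theta> + cnj (of_real r * cis \<theta>)) * u (of_real r * cis \<theta>))" if r: "r \<in> {0<..<1}" for r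
  proof -
    have "set_integrable lebesgue {0..2 * pi} (\<lambda>\<theta>. of_real r * (u (of_real r * cis \<theta>) * complex_of_real (2 * cos \<theta>)))"
      using u r c2 unfolding has_boundary_value_def by (intro set_integrable_mult_right circle_pairing_integrable) auto
    then show ?thesis unfolding x by (simp only: mult_ac)
  qed
  fix \<gamma> assume \<gamma>: "\<gamma> \<in> circle_test"
  have "((\<lambda>r. of_real r * (LINT \<theta>:{0..2 * pi}|lebesgue. u (of_real r * cis \<theta>) * (complex_of_real (2 * cos \<theta>) * \<gamma> \<theta>))) \<longlongrightarrow> of_real 1 * h (\<lambda>t. of_real (2 * cos t) * \<gamma> t)) (at_left 1)"
    using u circle_test_mult_2cos[OF \<gamma>] unfolding has_boundary_value_def by (intro tendsto_intros) auto
  then have "((\<lambda>r. of_real r * (LINT \<theta>:{0..2 * pi}|lebesgue. u (of_real r * cis \<theta>) * (complex_of_real (2 * cos \<theta>) * \<gamma> \<theta>))) \<longlongrightarrow> mult_2cos 1 h \<gamma>) (at_left 1)"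
    by (simp add: mult_2cos_def)
  moreover have "of_real r * (LINT \<theta>:{0..2 * pi}|lebesgue. u (of_real r * cis \<theta>) * (complex_of_real (2 * cos \<theta>) * \<gamma> \<theta>))
    = (LINT \<theta>:{0..2 * pi}|lebesgue. (of_real r * cis \<theta> + cnj (of_real r * cis \<theta>)) * u (of_real r * cis \<theta>) * \<gamma> \<theta>)" for r
    unfolding x set_integral_mult_right[symmetric] by (simp only: mult_ac)
  ultimately show "((\<lambda>r. LINT \<theta>:{0..2 * pi}|lebesgue. (of_real r * cis \<theta> + cnj (of_real r * cis \<theta>)) * u (of_real r * cis \<theta>) * \<gamma> \<theta>) \<longlongrightarrow> mult_2cos 1 h \<gamma>) (at_left 1)"
    by simp
qed

text \<open>The three properties are bundled because linear combinations and multiplication by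
  \<open>z + cnj z\<close> preserve all of them at once; the latter also replaces the value at the
  origin by 0.\<close>

definition regular :: "(complex \<Rightarrow> complex) \<Rightarrow> ((real \<Rightarrow> complex) \<Rightarrow> complex) \<Rightarrow> complex \<Rightarrow> bool" where
  "regular u h a \<longleftrightarrow> locally_integrable u \<and> has_boundary_value u h \<and> has_value_at u 0 a"

lemma regular_lincomb:
  "regular u h a \<Longrightarrow> regular v h' b \<Longrightarrow> regular (\<lambda>z. x * u z + y * v z) (\<lambda>\<gamma>. x * h \<gamma> + y * h' \<gamma>) (x * a + y * b)"
  unfolding regular_def by (intro conjI locally_integrable_lincomb has_boundary_value_lincomb has_value_at_lincomb) auto

lemma regular_0: "regular (\<lambda>z. 0) (\<lambda>\<gamma>. 0) 0"
  unfolding regular_def using has_value_at_continuous[of "\<lambda>z. 0"]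
  by (auto simp: locally_integrable_0 has_boundary_value_def set_integrable_def set_lebesgue_integral_def)

lemma regular_cmult: "regular u h a \<Longrightarrow> regular (\<lambda>z. x * u z) (\<lambda>\<gamma>. x * h \<gamma>) (x * a)"
  using regular_lincomb[of u h a "\<lambda>z. 0" "\<lambda>\<gamma>. 0" 0 x 0] by (simp add: regular_0)

lemma regular_add: "regular u h a \<Longrightarrow> regular v h' b \<Longrightarrow> regular (\<lambda>z. u z + v z) (\<lambda>\<gamma>. h \<gamma> + h' \<gamma>) (a + b)"
  using regular_lincomb[of u h a v h' b 1 1] by simp

lemma regular_mult_x: "regular u h a \<Longrightarrow> regular (\<lambda>z. (z + cnj z) * u z) (mult_2cos 1 h) 0"
  unfolding regular_def
  by (elim conjE, intro conjI has_boundary_value_mult_x has_value_at_mult_x locally_integrable_mult_continuous continuous_intros) assumption+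

lemma regular_mult_x_power:
  assumes "regular u h a"
  shows "regular (\<lambda>z. (z + cnj z) ^ m * u z) (mult_2cos m h) (if m = 0 then a else 0)"
proof (induction m)
  case 0 then show ?case using assms by (simp add: mult_2cos_def[abs_def])
next
  case (Suc m)
  from regular_mult_x[OF this] show ?case by (simp add: mult_2cos_def[abs_def] mult_ac)
qed

lemma regular_schwarz: assumes b: "circle_distribution b" shows "regular (schwarz b) (schwarz_bv b) (schwarz b 0)"
proof -
  have c: "continuous_on unit_disk (schwarz b)"
    by (rule holomorphic_on_imp_continuous_on[OF power_series_holomorphic_disk[OF schwarz_sums[OF b]]])
  show ?thesis unfolding regular_def
    by (intro conjI continuous_locally_integrable has_value_at_continuous schwarz_has_boundary_value b c)
qed

lemma (in area_density) regular_potential: "regular potential_rep potential_bv (potential 0)"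
proof -
  have li: "locally_integrable potential" using potential_weak_d_zbar by (simp add: weak_d_zbar_iff)
  show ?thesis unfolding regular_def
    by (intro conjI locally_integrable_cong[OF potential_rep_AE li] potential_rep_boundary_value
        has_value_at_cong[OF potential_rep_AE li potential_value_at_0])
qed

lemma regular_const: "regular (\<lambda>z. c) (\<lambda>\<gamma>. c * integral\<^sup>L circ \<gamma>) c"
  unfolding regular_def
proof (intro conjI continuous_locally_integrable has_value_at_continuous continuous_on_const)
  show "has_boundary_value (\<lambda>z. c) (\<lambda>\<gamma>. c * integral\<^sup>L circ \<gamma>)"
    unfolding has_boundary_value_def
  proof (intro conjI ballI)
    show "set_integrable lebesgue {0..2 * pi} (\<lambda>\<theta>. c)" by (subst circ_set_integral(2)) (auto intro: circ.integrable_const)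
    fix \<gamma> assume "\<gamma> \<in> circle_test"
    note [measurable] = circle_test_measurable[OF this]
    have e: "(LINT \<theta>:{0..2 * pi}|lebesgue. c * \<gamma> \<theta>) = c * integral\<^sup>L circ \<gamma>" by (subst circ_set_integral(1)) auto
    show "((\<lambda>r. LINT \<theta>:{0..2 * pi}|lebesgue. c * \<gamma> \<theta>) \<longlongrightarrow> c * integral\<^sup>L circ \<gamma>) (at_left 1)" unfolding e by (rule tendsto_const)
  qed
qed

section \<open>Existence\<close>

text \<open>Only the prescribed parts are recorded, the real part on real test functions and the
  imaginary part of the origin value. They depend real-linearly on \<open>u\<close>, so scalars in
  the rules below are real.\<close>

definition has_data :: "(complex \<Rightarrow> complex) \<Rightarrow> ((real \<Rightarrow> complex) \<Rightarrow> real) \<Rightarrow> real \<Rightarrow> bool" where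
  "has_data u b c \<longleftrightarrow> (\<exists>h a. regular u h a \<and> Im a = c \<and> (\<forall>\<gamma>\<in>circle_test. (\<forall>t. \<gamma> t \<in> \<real>) \<longrightarrow> Re (h \<gamma>) = b \<gamma>))"

lemma has_data_cong:
  assumes "has_data u b c" "\<And>\<gamma>. \<gamma> \<in> circle_test \<Longrightarrow> (\<And>t. \<gamma> t \<in> \<real>) \<Longrightarrow> b \<gamma> = b' \<gamma>" "c = c'"
  shows "has_data u b' c'"
  using assms unfolding has_data_def by (elim exE conjE, intro exI conjI) auto

lemma has_data_add:
  assumes "has_data u b c" "has_data v b' c'" shows "has_data (\<lambda>z. u z + v z) (\<lambda>\<gamma>. b \<gamma> + b' \<gamma>) (c + c')"
proof -
  obtain h a where 1: "regular u h a" "Im a = c" "\<And>\<gamma>. \<gamma> \<in> circle_test \<Longrightarrow> \<forall>t. \<gamma> t \<in> \<real> \<Longrightarrow> Re (h \<gamma>) = b \<gamma>"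
    using assms(1) unfolding has_data_def by blast
  obtain h' a' where 2: "regular v h' a'" "Im a' = c'" "\<And>\<gamma>. \<gamma> \<in> circle_test \<Longrightarrow> \<forall>t. \<gamma> t \<in> \<real> \<Longrightarrow> Re (h' \<gamma>) = b' \<gamma>"
    using assms(2) unfolding has_data_def by blast
  show ?thesis unfolding has_data_def
    by (rule exI[of _ "\<lambda>\<gamma>. h \<gamma> + h' \<gamma>"], rule exI[of _ "a + a'"]) (use 1 2 in \<open>auto intro: regular_add\<close>)
qed

lemma has_data_cmult:
  assumes "has_data u b c" shows "has_data (\<lambda>z. of_real x * u z) (\<lambda>\<gamma>. x * b \<gamma>) (x * c)"
proof -
  obtain h a where 1: "regular u h a" "Im a = c" "\<And>\<gamma>. \<gamma> \<in> circle_test \<Longrightarrow> \<forall>t. \<gamma> t \<in> \<real> \<Longrightarrow> Re (h \<gamma>) = b \<gamma>"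
    using assms(1) unfolding has_data_def by blast
  show ?thesis unfolding has_data_def
    by (rule exI[of _ "\<lambda>\<gamma>. of_real x * h \<gamma>"], rule exI[of _ "of_real x * a"]) (use 1 in \<open>auto intro: regular_cmult\<close>)
qed

lemma has_data_sum:
  assumes "finite A" "\<And>i. i \<in> A \<Longrightarrow> has_data (u i) (b i) (c i)"
  shows "has_data (\<lambda>z. \<Sum>i\<in>A. u i z) (\<lambda>\<gamma>. \<Sum>i\<in>A. b i \<gamma>) (\<Sum>i\<in>A. c i)"
  using assms
proof (induction A rule: finite_induct)
  case empty
  have "has_data (\<lambda>z. 0) (\<lambda>\<gamma>. 0) 0" unfolding has_data_def
    by (rule exI[of _ "\<lambda>\<gamma>. 0"], rule exI[of _ 0]) (simp add: regular_0)
  then show ?case by simp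
qed (simp add: has_data_add)

lemma has_data_mult_x_power:
  assumes "has_data u b c"
  shows "has_data (\<lambda>z. (z + cnj z) ^ m * u z) (\<lambda>\<gamma>. b (\<lambda>t. of_real (2 * cos t) ^ m * \<gamma> t)) (if m = 0 then c else 0)"
proof -
  obtain h a where 1: "regular u h a" "Im a = c" "\<And>\<gamma>. \<gamma> \<in> circle_test \<Longrightarrow> \<forall>t. \<gamma> t \<in> \<real> \<Longrightarrow> Re (h \<gamma>) = b \<gamma>"
    using assms(1) unfolding has_data_def by blast
  show ?thesis unfolding has_data_def
  proof (intro exI conjI ballI impI)
    show "regular (\<lambda>z. (z + cnj z) ^ m * u z) (mult_2cos m h) (if m = 0 then a else 0)" by (rule regular_mult_x_power[OF 1(1)])
    fix \<gamma> assume \<gamma>: "\<gamma> \<in> circle_test" "\<forall>t. \<gamma> t \<in> \<real>"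
    have "\<forall>t. of_real (2 * cos t) ^ m * \<gamma> t \<in> \<real>" using \<gamma>(2) by (intro allI Reals_mult Reals_power Reals_of_real) auto
    then show "Re (mult_2cos m h \<gamma>) = b (\<lambda>t. of_real (2 * cos t) ^ m * \<gamma> t)"
      unfolding mult_2cos_def by (rule 1(3)[OF circle_test_mult_2cos_power[OF \<gamma>(1)]])
  qed (use 1(2) in simp)
qed

text \<open>For \<open>j = 0\<close> the truncated exponent \<open>j - 1\<close> is harmless, since
  its term carries the factor 0.\<close>

lemma weak_d_zbar_mult_x_power:
  assumes "weak_d_zbar 1 u g"
  shows "weak_d_zbar 1 (\<lambda>z. (z + cnj z) ^ j * u z) (\<lambda>z. of_nat j * (z + cnj z) ^ (j - 1) * u z + (z + cnj z) ^ j * g z)"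
proof (induction j)
  case (Suc j)
  have e: "(z + cnj z) ^ j * u z + (z + cnj z) * (of_nat j * (z + cnj z) ^ (j - 1) * u z + (z + cnj z) ^ j * g z)
    = of_nat (Suc j) * (z + cnj z) ^ (Suc j - 1) * u z + (z + cnj z) ^ Suc j * g z" for z
    by (cases j) (simp_all add: algebra_simps)
  from weak_d_zbar_mult_x[OF Suc] show ?case unfolding e by (simp only: power_Suc mult.assoc)
qed (use assms in simp)

text \<open>The kernel \<open>(- 1) ^ m * (\<zeta> - z + cnj (\<zeta> - z)) ^ m / m!\<close> of the \<open>m\<close>-fold primitive, expanded by the
  binomial theorem: \<open>U a\<close> is the integral against the density multiplied by \<open>(\<zeta> + cnj \<zeta>) ^ a\<close>.\<close>

definition lift :: "nat \<Rightarrow> (nat \<Rightarrow> complex \<Rightarrow> complex) \<Rightarrow> complex \<Rightarrow> complex" where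
  "lift m U z = of_real ((-1) ^ m / fact m) *
     (\<Sum>a\<le>m. of_real (of_nat (m choose a) * (-1) ^ (m - a)) * ((z + cnj z) ^ (m - a) * U a z))"

lemma alternating_binomial: "(\<Sum>a\<le>m. of_nat (m choose a) * (-1) ^ (m - a)) = (if m = 0 then 1 else (0::'a::comm_ring_1))"
  using binomial_ring[of "1::'a" "-1" m] by (cases m) auto

text \<open>The product rule yields two sums. The one containing \<open>g\<close> has the common
  factor \<open>(z + cnj z) ^ Suc m\<close> and vanishes by the alternating binomial sum; the other
  one is \<open>lift m U\<close> by absorption of binomial coefficients.\<close>

lemma lift_weak_d_zbar:
  assumes U: "\<And>a. weak_d_zbar 1 (U a) (\<lambda>z. (z + cnj z) ^ a * g z)"
  shows "weak_d_zbar 1 (lift (Suc m) U) (lift m U)"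
proof -
  define M where "M = Suc m"
  have w: "weak_d_zbar 1 (lift M U) (\<lambda>z. of_real ((-1) ^ M / fact M) *
     (\<Sum>a\<le>M. of_real (of_nat (M choose a) * (-1) ^ (M - a)) * (of_nat (M - a) * (z + cnj z) ^ (M - a - 1) * U a z + (z + cnj z) ^ (M - a) * ((z + cnj z) ^ a * g z))))"
    unfolding lift_def[abs_def] by (intro weak_d_zbar_cmult weak_d_zbar_sum weak_d_zbar_mult_x_power U) auto
  have "of_real ((-1) ^ M / fact M) *
     (\<Sum>a\<le>M. of_real (of_nat (M choose a) * (-1) ^ (M - a)) * (of_nat (M - a) * (z + cnj z) ^ (M - a - 1) * U a z + (z + cnj z) ^ (M - a) * ((z + cnj z) ^ a * g z)))
     = lift m U z" for z
  proof -
    define x where "x = z + cnj z"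
    have t: "of_real (of_nat (M choose a) * (-1) ^ (M - a)) * (of_nat (M - a) * x ^ (M - a - 1) * U a z + x ^ (M - a) * (x ^ a * g z))
      = of_nat ((M - a) * (M choose a)) * (-1) ^ (M - a) * x ^ (M - a - 1) * U a z + (of_nat (M choose a) * (-1) ^ (M - a)) * (x ^ M * g z)" if "a \<le> M" for a
    proof -
      have e: "x ^ (M - a) * (x ^ a * g z) = x ^ M * g z" using that by (simp only: mult.assoc[symmetric] power_add[symmetric] le_add_diff_inverse2)
      show ?thesis unfolding e
        by (simp only: of_real_mult of_real_power of_real_minus of_real_1 of_real_of_nat_eq of_nat_mult distrib_left mult_ac)
    qed
    \<comment> \<open>Absorption moves the factor \<open>M - a\<close> out as \<open>M\<close>; the
      missing power of -1 supplies the sign, and together they cancel one step of the factorial and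
      of the sign in front of the sum.\<close>
    have s: "of_nat ((M - a) * (M choose a)) * (-1) ^ (M - a) * x ^ (M - a - 1) * U a z
      = - of_nat M * (of_real (of_nat (m choose a) * (-1) ^ (m - a)) * (x ^ (m - a) * U a z))" if "a \<le> m" for a
    proof -
      have "(M - a) * (M choose a) = M * (m choose a)" using binomial_absorb_comp[of M a] by (simp add: M_def)
      moreover have "M - a = Suc (m - a)" using that by (simp add: M_def)
      ultimately show ?thesis by (simp add: mult_ac)
    qed
    have "(\<Sum>a\<le>M. of_real (of_nat (M choose a) * (-1) ^ (M - a)) * (of_nat (M - a) * x ^ (M - a - 1) * U a z + x ^ (M - a) * (x ^ a * g z)))
      = (\<Sum>a\<le>M. of_nat ((M - a) * (M choose a)) * (-1) ^ (M - a) * x ^ (M - a - 1) * U a z) + (\<Sum>a\<le>M. of_nat (M choose a) * (-1) ^ (M - a)) * (x ^ M * g z)"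
      unfolding sum_distrib_right sum.distrib[symmetric] by (intro sum.cong refl t) simp
    also have "(\<Sum>a\<le>M. of_nat (M choose a) * (-1) ^ (M - a)) = (0::complex)" by (simp add: alternating_binomial M_def)
    \<comment> \<open>The last summand has the factor \<open>M - a = 0\<close>, so the sum may stop
      at m.\<close>
    also have "(\<Sum>a\<le>M. of_nat ((M - a) * (M choose a)) * (-1) ^ (M - a) * x ^ (M - a - 1) * U a z)
      = (\<Sum>a\<le>m. of_nat ((M - a) * (M choose a)) * (-1) ^ (M - a) * x ^ (M - a - 1) * U a z)" by (simp add: M_def)
    also have "\<dots> = - of_nat M * (\<Sum>a\<le>m. of_real (of_nat (m choose a) * (-1) ^ (m - a)) * (x ^ (m - a) * U a z))"
      unfolding sum_distrib_left by (intro sum.cong refl s) simp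
    finally have e: "(\<Sum>a\<le>M. of_real (of_nat (M choose a) * (-1) ^ (M - a)) * (of_nat (M - a) * x ^ (M - a - 1) * U a z + x ^ (M - a) * (x ^ a * g z)))
      = - of_nat M * (\<Sum>a\<le>m. of_real (of_nat (m choose a) * (-1) ^ (m - a)) * (x ^ (m - a) * U a z))" by simp
    have "complex_of_real ((-1) ^ M / fact M) * (- of_nat M) = of_real ((-1) ^ m / fact m)"
    proof -
      have "(-1) ^ M / fact M * (- real M) = (-1) ^ m / fact m" by (simp add: M_def divide_simps) (simp add: algebra_simps)
      then show ?thesis by (metis of_real_minus of_real_mult of_real_of_nat_eq)
    qed
    then show ?thesis unfolding x_def[symmetric] e lift_def by (simp only: mult.assoc[symmetric])
  qed
  then show ?thesis using w by (simp only: M_def)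
qed

lemma lift_0: "lift 0 U = U 0"
  by (simp add: lift_def fun_eq_iff)

text \<open>On the boundary the power \<open>m - a\<close> from the explicit factor and the power
  \<open>a\<close> from \<open>U a\<close> join to the same power m of \<open>2 * cos t\<close> in
  every summand, so only the alternating binomial sum is left.\<close>

lemma lift_has_data:
  assumes U: "\<And>a. has_data (U a) (\<lambda>\<gamma>. \<beta> (\<lambda>t. of_real (2 * cos t) ^ a * \<gamma> t)) 0"
  shows "has_data (lift m U) (\<lambda>\<gamma>. if m = 0 then \<beta> \<gamma> else 0) 0"
proof -
  have "has_data (lift m U) (\<lambda>\<gamma>. (-1) ^ m / fact m * (\<Sum>a\<le>m. (of_nat (m choose a) * (-1) ^ (m - a)) *
      \<beta> (\<lambda>t. of_real (2 * cos t) ^ a * (of_real (2 * cos t) ^ (m - a) * \<gamma> t))))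
      ((-1) ^ m / fact m * (\<Sum>a\<le>m. (of_nat (m choose a) * (-1) ^ (m - a)) * (if m - a = 0 then 0 else 0)))"
    unfolding lift_def[abs_def] by (intro has_data_cmult has_data_sum has_data_mult_x_power U) auto
  then show ?thesis
  proof (rule has_data_cong)
    fix \<gamma> :: "real \<Rightarrow> complex"
    have e: "(\<lambda>t. of_real (2 * cos t) ^ a * (of_real (2 * cos t) ^ (m - a) * \<gamma> t)) = (\<lambda>t. of_real (2 * cos t) ^ m * \<gamma> t)" if "a \<le> m" for a
      using that by (simp only: mult.assoc[symmetric] power_add[symmetric] le_add_diff_inverse)
    have "(\<Sum>a\<le>m. (of_nat (m choose a) * (-1) ^ (m - a)) * \<beta> (\<lambda>t. of_real (2 * cos t) ^ a * (of_real (2 * cos t) ^ (m - a) * \<gamma> t)))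
      = (\<Sum>a\<le>m. of_nat (m choose a) * (-1) ^ (m - a)) * \<beta> (\<lambda>t. of_real (2 * cos t) ^ m * \<gamma> t)"
      unfolding sum_distrib_right by (intro sum.cong refl) (simp only: e atMost_iff)
    then show "(-1) ^ m / fact m * (\<Sum>a\<le>m. (of_nat (m choose a) * (-1) ^ (m - a)) *
      \<beta> (\<lambda>t. of_real (2 * cos t) ^ a * (of_real (2 * cos t) ^ (m - a) * \<gamma> t))) = (if m = 0 then \<beta> \<gamma> else 0)"
      by (simp add: alternating_binomial)
  qed simp
qed

lemma integral_circ_real:
  assumes "\<And>t. \<gamma> t \<in> \<real>" shows "Im (integral\<^sup>L circ \<gamma>) = 0"
proof -
  have "cnj (\<gamma> t) = \<gamma> t" for t using assms[of t] by (simp add: Reals_cnj_iff)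
  then have "cnj (integral\<^sup>L circ \<gamma>) = integral\<^sup>L circ \<gamma>" by (simp only: Bochner_Integration.integral_cnj[symmetric])
  then show ?thesis by (simp add: complex_eq_iff)
qed

text \<open>The m-fold primitive of the holomorphic function with boundary datum \<open>b\<close>
  and imaginary part \<open>c\<close> at the origin. \<open>d_zbar\<close> lowers m by one, and for
  \<open>m > 0\<close> all prescribed data vanish.\<close>

definition datum :: "real \<Rightarrow> ((real \<Rightarrow> complex) \<Rightarrow> complex) \<Rightarrow> nat \<Rightarrow> complex \<Rightarrow> complex" where
  "datum c b m z = of_real (c / fact m) * ((z + cnj z) ^ m * \<i>) + lift m (\<lambda>a. schwarz (mult_2cos a b)) z"

lemma weak_d_zbar_const: "weak_d_zbar 1 (\<lambda>z. c) (\<lambda>z. 0)"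
proof -
  have "(\<lambda>l. (if l = 0 then c else 0) * z ^ l) sums c" for z
    using sums_single[of 0 "\<lambda>l. c * z ^ l"] by (simp add: if_distrib[of "\<lambda>x. x * _"] cong: if_cong)
  then show ?thesis by (rule weak_d_zbar_power_series)
qed

lemma datum_props:
  assumes b: "real_distribution b"
  shows "weak_d_zbar 1 (datum c b (Suc m)) (datum c b m)" "weak_d_zbar 1 (datum c b 0) (\<lambda>z. 0)"
    and "has_data (datum c b m) (\<lambda>\<gamma>. if m = 0 then Re (b \<gamma>) else 0) (if m = 0 then c else 0)"
proof -
  have ba: "real_distribution (mult_2cos a b)" for a by (rule real_distribution_mult_2cos[OF b])
  then have bc: "circle_distribution (mult_2cos a b)" for a by (simp add: real_distribution_def)
  have ws: "weak_d_zbar 1 (schwarz (mult_2cos a b)) (\<lambda>z. (z + cnj z) ^ a * 0)" for a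
    using weak_d_zbar_power_series[OF schwarz_sums[OF bc[of a]]] by simp
  have "weak_d_zbar 1 (datum c b (Suc m)) (\<lambda>z. of_real (c / fact (Suc m)) *
      (of_nat (Suc m) * (z + cnj z) ^ (Suc m - 1) * \<i> + (z + cnj z) ^ Suc m * 0) + lift m (\<lambda>a. schwarz (mult_2cos a b)) z)"
    unfolding datum_def[abs_def]
    by (intro weak_d_zbar_add weak_d_zbar_cmult weak_d_zbar_mult_x_power weak_d_zbar_const lift_weak_d_zbar[OF ws])
  moreover have "of_real (c / fact (Suc m)) * (of_nat (Suc m) * (z + cnj z) ^ (Suc m - 1) * \<i> + (z + cnj z) ^ Suc m * 0) = of_real (c / fact m) * ((z + cnj z) ^ m * \<i>)" for z
  proof -
    have "complex_of_real (c / fact (Suc m)) * of_nat (Suc m) = of_real (c / fact m)"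
    proof -
      have "c / fact (Suc m) * real (Suc m) = c / fact m" by (simp add: divide_simps)
      then show ?thesis by (metis of_real_mult of_real_of_nat_eq)
    qed
    then show ?thesis by (simp add: mult.assoc[symmetric] del: of_nat_Suc fact_Suc)
  qed
  ultimately show "weak_d_zbar 1 (datum c b (Suc m)) (datum c b m)" unfolding datum_def[abs_def] by simp
  show "weak_d_zbar 1 (datum c b 0) (\<lambda>z. 0)"
    using weak_d_zbar_add[OF weak_d_zbar_const[of "of_real c * \<i>"] ws[of 0]] by (simp add: datum_def[abs_def] lift_0)
  \<comment> \<open>At the origin the Schwarz kernel is the constant 1, a real test function on
    which a real distribution is real.\<close>
  have Im0: "Im (schwarz (mult_2cos a b) 0) = 0" for a
  proof -
    have "mult_2cos a b (\<lambda>t. 1) \<in> \<real>" using ba[of a] circle_test_1 unfolding real_distribution_def by auto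
    then obtain s where "mult_2cos a b (\<lambda>t. 1) = of_real s" by (auto elim: Reals_cases)
    then have "schwarz (mult_2cos a b) 0 = of_real (s / (2 * pi))" by (simp add: schwarz_0)
    then show ?thesis by (simp only: Im_complex_of_real)
  qed
  have s: "has_data (schwarz (mult_2cos a b)) (\<lambda>\<gamma>. Re (b (\<lambda>t. of_real (2 * cos t) ^ a * \<gamma> t))) 0" for a
    unfolding has_data_def
  proof (intro exI conjI ballI impI)
    show "regular (schwarz (mult_2cos a b)) (schwarz_bv (mult_2cos a b)) (schwarz (mult_2cos a b) 0)" by (rule regular_schwarz[OF bc])
    show "Im (schwarz (mult_2cos a b) 0) = 0" by (rule Im0)
    fix \<gamma> assume "\<gamma> \<in> circle_test" "\<forall>t. \<gamma> t \<in> \<real>"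
    then show "Re (schwarz_bv (mult_2cos a b) \<gamma>) = Re (b (\<lambda>t. of_real (2 * cos t) ^ a * \<gamma> t))"
      using schwarz_bv_real_part[OF ba] by (simp add: mult_2cos_def)
  qed
  have i: "has_data (\<lambda>z. \<i>) (\<lambda>\<gamma>. 0) 1" unfolding has_data_def
    by (intro exI conjI ballI impI, rule regular_const[of \<i>]) (auto simp: integral_circ_real)
  have "has_data (datum c b m) (\<lambda>\<gamma>. c / fact m * 0 + (if m = 0 then Re (b \<gamma>) else 0)) (c / fact m * (if m = 0 then 1 else 0) + 0)"
    unfolding datum_def[abs_def]
    by (intro has_data_add has_data_cmult lift_has_data[of _ "\<lambda>\<gamma>. Re (b \<gamma>)"] s has_data_mult_x_power[OF i])
  then show "has_data (datum c b m) (\<lambda>\<gamma>. if m = 0 then Re (b \<gamma>) else 0) (if m = 0 then c else 0)"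
    by (rule has_data_cong) auto
qed

lemma x_power_le: "cmod \<zeta> \<le> 1 \<Longrightarrow> cmod ((\<zeta> + cnj \<zeta>) ^ a) \<le> 2 ^ a"
  unfolding norm_power using norm_triangle_ineq[of \<zeta> "cnj \<zeta>"] by (intro power_mono) auto

context area_density
begin

lemma area_density_x_power: "area_density (\<lambda>\<zeta>. (\<zeta> + cnj \<zeta>) ^ a * p \<zeta>)"
proof
  show "integrable lborel (\<lambda>\<zeta>. (\<zeta> + cnj \<zeta>) ^ a * p \<zeta>)"
  proof (rule Bochner_Integration.integrable_bound[OF integrable_mult_right[OF integrable_norm[OF p], of "2 ^ a"]])
    show "AE \<zeta> in lborel. norm ((\<zeta> + cnj \<zeta>) ^ a * p \<zeta>) \<le> norm (2 ^ a * norm (p \<zeta>))"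
    proof (rule AE_I2)
      fix \<zeta>
      show "norm ((\<zeta> + cnj \<zeta>) ^ a * p \<zeta>) \<le> norm (2 ^ a * norm (p \<zeta>))"
      proof (cases "cmod \<zeta> \<ge> 1")
        case False
        then show ?thesis using x_power_le[of \<zeta> a] by (simp add: norm_mult mult_right_mono)
      qed (simp add: p_support)
    qed
  qed measurable
qed (simp add: p_support)

definition area :: "nat \<Rightarrow> complex \<Rightarrow> complex" where
  "area m = lift m (\<lambda>a. area_density.potential_rep (\<lambda>\<zeta>. (\<zeta> + cnj \<zeta>) ^ a * p \<zeta>))"

lemma area_props:
  shows "weak_d_zbar 1 (area (Suc m)) (area m)" "weak_d_zbar 1 (area 0) (\<lambda>\<zeta>. \<zeta> * p \<zeta>)"
    and "has_data (area m) (\<lambda>\<gamma>. 0) 0"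
proof -
  have w: "weak_d_zbar 1 (area_density.potential_rep (\<lambda>\<zeta>. (\<zeta> + cnj \<zeta>) ^ a * p \<zeta>)) (\<lambda>\<zeta>. (\<zeta> + cnj \<zeta>) ^ a * (\<zeta> * p \<zeta>))" for a
  proof -
    interpret A: area_density "\<lambda>\<zeta>. (\<zeta> + cnj \<zeta>) ^ a * p \<zeta>" by (rule area_density_x_power)
    show ?thesis by (rule weak_d_zbar_cong[OF A.potential_rep_AE _ A.potential_weak_d_zbar]) (simp add: mult_ac)
  qed
  show "weak_d_zbar 1 (area (Suc m)) (area m)" unfolding area_def by (rule lift_weak_d_zbar[OF w])
  show "weak_d_zbar 1 (area 0) (\<lambda>\<zeta>. \<zeta> * p \<zeta>)" using w[of 0] by (simp add: area_def lift_0)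
  have "has_data (area_density.potential_rep (\<lambda>\<zeta>. (\<zeta> + cnj \<zeta>) ^ a * p \<zeta>)) (\<lambda>\<gamma>. 0) 0" for a
  proof -
    interpret A: area_density "\<lambda>\<zeta>. (\<zeta> + cnj \<zeta>) ^ a * p \<zeta>" by (rule area_density_x_power)
    show ?thesis unfolding has_data_def
      by (intro exI conjI ballI impI, rule A.regular_potential) (auto simp: A.potential_0 A.potential_bv_imaginary)
  qed
  from lift_has_data[of _ "\<lambda>\<gamma>. 0", OF this] show "has_data (area m) (\<lambda>\<gamma>. 0) 0"
    unfolding area_def by simp
qed

text \<open>The binomial expansion behind \<open>area\<close> is undone, which is legitimate
  wherever the kernel is integrable and the finitely many potentials agree with their
  representatives. The sign \<open>(-1) ^ Suc m\<close> joins that of \<open>lift\<close> with the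
  minus in \<open>potential\<close>.\<close>

lemma AE_area_eq:
  "AE z in lebesgue. z \<in> unit_disk \<longrightarrow> (-1) ^ Suc m / (2 * of_real pi * fact m) *
     integral\<^sup>L lborel (\<lambda>\<zeta>. kernel z \<zeta> * (\<zeta> - z + cnj (\<zeta> - z)) ^ m) = area m z"
proof -
  have A: "area_density (\<lambda>\<zeta>. (\<zeta> + cnj \<zeta>) ^ a * p \<zeta>)" for a by (rule area_density_x_power)
  have "AE z in lebesgue. \<forall>a\<in>{..m}. z \<in> unit_disk \<longrightarrow> area_density.potential (\<lambda>\<zeta>. (\<zeta> + cnj \<zeta>) ^ a * p \<zeta>) z = area_density.potential_rep (\<lambda>\<zeta>. (\<zeta> + cnj \<zeta>) ^ a * p \<zeta>) z"
    by (intro AE_finite_allI area_density.potential_rep_AE A finite_atMost)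
  moreover have "AE z in lborel. z \<in> unit_disk \<longrightarrow> integrable lborel (kernel z)"
    using AE_integrable_kernel by eventually_elim auto
  then have "AE z in lebesgue. z \<in> unit_disk \<longrightarrow> integrable lborel (kernel z)" by (simp only: AE_completion_iff)
  ultimately show ?thesis
  proof eventually_elim
    case (elim z)
    show ?case
    proof
      assume z: "z \<in> unit_disk"
      then have i: "integrable lborel (kernel z)" using elim by blast
      define x where "x = z + cnj z"
      define K where "K = (\<lambda>a \<zeta>. (\<zeta> + cnj \<zeta>) ^ a * kernel z \<zeta>)"
      have K: "area_density.kernel (\<lambda>\<zeta>. (\<zeta> + cnj \<zeta>) ^ a * p \<zeta>) z = K a" for a
      proof (rule ext)
        fix \<zeta>
        have "cnj ((\<zeta> + cnj \<zeta>) ^ a * p \<zeta>) = (\<zeta> + cnj \<zeta>) ^ a * cnj (p \<zeta>)" by (simp add: add.commute)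
        then show "area_density.kernel (\<lambda>\<zeta>. (\<zeta> + cnj \<zeta>) ^ a * p \<zeta>) z \<zeta> = K a \<zeta>"
          by (simp only: area_density.kernel_def[OF A] kernel_def K_def distrib_left mult.assoc)
      qed
      have Ki: "integrable lborel (K a)" for a
      proof (rule Bochner_Integration.integrable_bound[OF integrable_mult_right[OF integrable_norm[OF i], of "2 ^ a"]])
        show "AE \<zeta> in lborel. norm (K a \<zeta>) \<le> norm (2 ^ a * norm (kernel z \<zeta>))"
        proof (rule AE_I2)
          fix \<zeta>
          show "norm (K a \<zeta>) \<le> norm (2 ^ a * norm (kernel z \<zeta>))"
          proof (cases "cmod \<zeta> \<ge> 1")
            case False
            then show ?thesis using x_power_le[of \<zeta> a] by (simp add: K_def norm_mult mult_right_mono)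
          qed (simp add: K_def kernel_def p_support)
        qed
      qed (use borel_measurable_integrable[OF i] in \<open>simp add: K_def[abs_def]\<close>)
      have "kernel z \<zeta> * (\<zeta> - z + cnj (\<zeta> - z)) ^ m = (\<Sum>a\<le>m. of_nat (m choose a) * (- x) ^ (m - a) * K a \<zeta>)" for \<zeta>
      proof -
        have "\<zeta> - z + cnj (\<zeta> - z) = (\<zeta> + cnj \<zeta>) + - x" by (simp add: x_def)
        then show ?thesis by (simp only: binomial_ring sum_distrib_left K_def mult_ac)
      qed
      then have "integral\<^sup>L lborel (\<lambda>\<zeta>. kernel z \<zeta> * (\<zeta> - z + cnj (\<zeta> - z)) ^ m) = (\<Sum>a\<le>m. of_nat (m choose a) * (- x) ^ (m - a) * integral\<^sup>L lborel (K a))"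
        by (simp only: Bochner_Integration.integral_sum[OF integrable_mult_right[OF Ki]] integral_mult_right_zero)
      also have "\<dots> = - (2 * of_real pi) * (\<Sum>a\<le>m. of_real (of_nat (m choose a) * (-1) ^ (m - a)) * (x ^ (m - a) * area_density.potential_rep (\<lambda>\<zeta>. (\<zeta> + cnj \<zeta>) ^ a * p \<zeta>) z))"
        unfolding sum_distrib_left
      proof (rule sum.cong[OF refl])
        fix a assume a: "a \<in> {..m}"
        have "integral\<^sup>L lborel (K a) = - (2 * of_real pi) * area_density.potential (\<lambda>\<zeta>. (\<zeta> + cnj \<zeta>) ^ a * p \<zeta>) z"
          by (simp add: area_density.potential_def[OF A] K)
        also have "area_density.potential (\<lambda>\<zeta>. (\<zeta> + cnj \<zeta>) ^ a * p \<zeta>) z = area_density.potential_rep (\<lambda>\<zeta>. (\<zeta> + cnj \<zeta>) ^ a * p \<zeta>) z"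
          using elim a z by blast
        finally show "of_nat (m choose a) * (- x) ^ (m - a) * integral\<^sup>L lborel (K a)
          = - (2 * of_real pi) * (of_real (of_nat (m choose a) * (-1) ^ (m - a)) * (x ^ (m - a) * area_density.potential_rep (\<lambda>\<zeta>. (\<zeta> + cnj \<zeta>) ^ a * p \<zeta>) z))"
          by (simp add: power_minus[of x] mult_ac)
      qed
      finally show "(-1) ^ Suc m / (2 * of_real pi * fact m) * integral\<^sup>L lborel (\<lambda>\<zeta>. kernel z \<zeta> * (\<zeta> - z + cnj (\<zeta> - z)) ^ m) = area m z"
        unfolding area_def lift_def x_def by (simp add: mult_ac)
    qed
  qed
qed

end

section \<open>The scalar problem for powers of the weak derivative\<close>

definition scalar_solution ::
  "nat \<Rightarrow> (complex \<Rightarrow> complex) \<Rightarrow> (nat \<Rightarrow> (real \<Rightarrow> complex) \<Rightarrow> complex) \<Rightarrow> (nat \<Rightarrow> real) \<Rightarrow> (complex \<Rightarrow> complex) \<Rightarrow> bool" where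
  "scalar_solution n f b c w \<longleftrightarrow> weak_d_zbar n w f \<and>
     (\<forall>k<n. \<exists>g. weak_d_zbar k w g \<and> (\<exists>h. has_boundary_value g h \<and> is_real_part (b k) h) \<and>
        (\<exists>a. has_value_at g 0 a \<and> Im a = c k))"

definition scalar_formula ::
  "nat \<Rightarrow> (complex \<Rightarrow> complex) \<Rightarrow> (nat \<Rightarrow> (real \<Rightarrow> complex) \<Rightarrow> complex) \<Rightarrow> (nat \<Rightarrow> real) \<Rightarrow> complex \<Rightarrow> complex" where
  "scalar_formula n f b c z =
     \<i> * (\<Sum>k=0..n-1. of_real (c k) / fact k * (z + cnj z) ^ k)
     + (\<Sum>k=0..n-1. (-1) ^ k / (2 * of_real pi * fact k) * b k (schwarz_test k z))
     + (-1) ^ n / (2 * of_real pi * fact (n - 1)) *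
       (LINT \<zeta>:unit_disk|lebesgue.
          (f \<zeta> / \<zeta> * ((\<zeta> + z) / (\<zeta> - z)) + cnj (f \<zeta>) / cnj \<zeta> * ((1 + z * cnj \<zeta>) / (1 - z * cnj \<zeta>)))
          * (\<zeta> - z + cnj (\<zeta> - z)) ^ (n - 1))"

lemma datum_formula:
  assumes b: "circle_distribution b" and z: "cmod z < 1"
  shows "datum c b k z = \<i> * (of_real c / fact k * (z + cnj z) ^ k) + (-1) ^ k / (2 * of_real pi * fact k) * b (schwarz_test k z)"
proof -
  define x where "x = z + cnj z"
  have "b (schwarz_test k z) = 2 * of_real pi * (\<Sum>a\<le>k. of_real (of_nat (k choose a) * (-1) ^ (k - a)) * (x ^ (k - a) * schwarz (mult_2cos a b) z))"
    unfolding schwarz_test_pairing[OF b z] x_def[symmetric] sum_distrib_left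
    by (intro sum.cong refl) (simp add: power_minus[of x] mult_ac)
  then show ?thesis unfolding datum_def lift_def x_def[symmetric] by simp
qed

text \<open>A Borel version, extended by 0, is what the Fubini arguments for
  \<open>area_density\<close> work with; it agrees with the given function almost everywhere on the
  disk.\<close>

lemma disk_density:
  assumes "set_integrable lebesgue unit_disk (\<lambda>\<zeta>. f \<zeta> / \<zeta>)"
  obtains p where "area_density p" "AE \<zeta> in lebesgue. \<zeta> \<in> unit_disk \<longrightarrow> f \<zeta> / \<zeta> = p \<zeta>"
proof -
  have i: "integrable lebesgue (\<lambda>\<zeta>. indicator unit_disk \<zeta> *\<^sub>R (f \<zeta> / \<zeta>))" using assms unfolding set_integrable_def .
  obtain g where g [measurable]: "g \<in> borel_measurable borel" and AE: "AE \<zeta> in lebesgue. indicator unit_disk \<zeta> *\<^sub>R (f \<zeta> / \<zeta>) = g \<zeta>"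
    using lebesgue_borel_version[OF borel_measurable_integrable[OF i]] by blast
  define p where "p = (\<lambda>\<zeta>. indicator unit_disk \<zeta> *\<^sub>R g \<zeta>)"
  have [measurable]: "p \<in> borel_measurable borel" unfolding p_def by measurable
  have AE1: "AE \<zeta> in lebesgue. indicator unit_disk \<zeta> *\<^sub>R (f \<zeta> / \<zeta>) = p \<zeta>"
    using AE by eventually_elim (auto simp: p_def indicator_def)
  have "integrable lebesgue p"
    by (rule integrable_cong_AE_imp[OF i _ AE1]) (intro measurable_completion, simp)
  then have "integrable lborel p" by (simp add: integrable_completion)
  then have "area_density p" by unfold_locales (auto simp: p_def)
  moreover have "AE \<zeta> in lebesgue. \<zeta> \<in> unit_disk \<longrightarrow> f \<zeta> / \<zeta> = p \<zeta>" using AE1 by eventually_elim auto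
  ultimately show ?thesis by (rule that)
qed

lemma (in area_density) disk_integral_kernel:
  assumes AE: "AE \<zeta> in lebesgue. \<zeta> \<in> unit_disk \<longrightarrow> f \<zeta> / \<zeta> = p \<zeta>"
  shows "(LINT \<zeta>:unit_disk|lebesgue. (f \<zeta> / \<zeta> * ((\<zeta> + z) / (\<zeta> - z)) + cnj (f \<zeta>) / cnj \<zeta> * ((1 + z * cnj \<zeta>) / (1 - z * cnj \<zeta>)))
      * (\<zeta> - z + cnj (\<zeta> - z)) ^ m) = integral\<^sup>L lborel (\<lambda>\<zeta>. kernel z \<zeta> * (\<zeta> - z + cnj (\<zeta> - z)) ^ m)" (is "set_lebesgue_integral _ _ ?I = _")
proof -
  have km: "(\<lambda>\<zeta>. kernel z \<zeta> * (\<zeta> - z + cnj (\<zeta> - z)) ^ m) \<in> borel_measurable borel" unfolding kernel_def by measurable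
  have eq: "AE \<zeta> in lebesgue. kernel z \<zeta> * (\<zeta> - z + cnj (\<zeta> - z)) ^ m = indicator unit_disk \<zeta> *\<^sub>R ?I \<zeta>"
    using AE
  proof eventually_elim
    case (elim \<zeta>)
    show ?case
    proof (cases "\<zeta> \<in> unit_disk")
      case True
      then have "p \<zeta> = f \<zeta> / \<zeta>" using elim by simp
      then show ?thesis using True by (simp add: kernel_def)
    qed (simp add: kernel_def p_support)
  qed
  have kl: "(\<lambda>\<zeta>. kernel z \<zeta> * (\<zeta> - z + cnj (\<zeta> - z)) ^ m) \<in> borel_measurable lebesgue"
    using km by (intro measurable_completion) simp
  have "integral\<^sup>L lebesgue (\<lambda>\<zeta>. kernel z \<zeta> * (\<zeta> - z + cnj (\<zeta> - z)) ^ m) = integral\<^sup>L lebesgue (\<lambda>\<zeta>. indicator unit_disk \<zeta> *\<^sub>R ?I \<zeta>)"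
    by (rule integral_cong_AE[OF kl borel_measurable_lebesgue_AE[OF kl eq] eq])
  then show ?thesis unfolding set_lebesgue_integral_def using km by (simp add: integral_completion)
qed

theorem scalar_existence:
  assumes n: "n \<ge> 1" and fi: "set_integrable lebesgue unit_disk (\<lambda>\<zeta>. f \<zeta> / \<zeta>)"
    and b: "\<And>k. k < n \<Longrightarrow> real_distribution (b k)"
    and w: "\<And>z. z \<in> unit_disk \<Longrightarrow> w z = scalar_formula n f b c z"
  shows "scalar_solution n f b c w"
proof -
  obtain p where "area_density p" and fp: "AE \<zeta> in lebesgue. \<zeta> \<in> unit_disk \<longrightarrow> f \<zeta> / \<zeta> = p \<zeta>"
    using disk_density[OF fi] by blast
  then interpret area_density p by simp
  \<comment> \<open>The candidate for the j-th derivative: data of index below j have been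
    differentiated away, the others are lowered by j, and after n steps only the right-hand side
    remains.\<close>
  define G where "G = (\<lambda>j. if j < n then (\<lambda>z. (\<Sum>k\<in>{j..<n}. datum (c k) (b k) (k - j) z) + area (n - 1 - j) z) else (\<lambda>z. z * p z))"
  have step: "weak_d_zbar 1 (G j) (G (Suc j))" if j: "j < n" for j
  proof -
    \<comment> \<open>The summand with \<open>k = j\<close> has become holomorphic and is
      annihilated; all others drop by one level.\<close>
    have "weak_d_zbar 1 (datum (c k) (b k) (k - j)) (\<lambda>z. if k = j then 0 else datum (c k) (b k) (k - Suc j) z)" if "k \<in> {j..<n}" for k
    proof (cases "k = j")
      case True
      then show ?thesis using datum_props(2)[OF b[OF j]] by simp
    next
      case False
      then have "k - j = Suc (k - Suc j)" using that by auto
      then show ?thesis using False that datum_props(1)[OF b[of k]] by simp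
    qed
    then have "weak_d_zbar 1 (\<lambda>z. \<Sum>k\<in>{j..<n}. datum (c k) (b k) (k - j) z) (\<lambda>z. \<Sum>k\<in>{j..<n}. if k = j then 0 else datum (c k) (b k) (k - Suc j) z)"
      by (intro weak_d_zbar_sum) auto
    moreover have "(\<Sum>k\<in>{j..<n}. if k = j then 0 else datum (c k) (b k) (k - Suc j) z) = (\<Sum>k\<in>{Suc j..<n}. datum (c k) (b k) (k - Suc j) z)" for z
      unfolding sum.atLeast_Suc_lessThan[OF j] by (auto intro: sum.cong)
    ultimately have d: "weak_d_zbar 1 (\<lambda>z. \<Sum>k\<in>{j..<n}. datum (c k) (b k) (k - j) z) (\<lambda>z. \<Sum>k\<in>{Suc j..<n}. datum (c k) (b k) (k - Suc j) z)" by simp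
    show ?thesis
    proof (cases "Suc j < n")
      case True
      then have "n - 1 - j = Suc (n - 1 - Suc j)" by simp
      then have "weak_d_zbar 1 (area (n - 1 - j)) (area (n - 1 - Suc j))" using area_props(1) by simp
      from weak_d_zbar_add[OF d this] show ?thesis using True j by (simp add: G_def)
    next
      case False
      then have e: "n = Suc j" using j by simp
      from weak_d_zbar_add[OF d area_props(2)] show ?thesis by (simp add: G_def e)
    qed
  qed
  have li: "locally_integrable (G i)" if "i \<le> n" for i
  proof (cases "i < n")
    case True then show ?thesis using step[OF True] by (simp add: weak_d_zbar_iff)
  next
    case False
    then have "i = Suc (n - 1)" "n - 1 < n" using that n by auto
    then show ?thesis using step[of "n - 1"] by (simp add: weak_d_zbar_iff)
  qed
  have G: "weak_d_zbar j (G i) (G (i + j))" if "i + j \<le> n" for i j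
    using that
  proof (induction j arbitrary: i)
    case 0 then show ?case using weak_d_zbar_0_self[OF li] by simp
  next
    case (Suc j)
    then have j: "i < n" "Suc i + j \<le> n" by auto
    from weak_d_zbar_Suc[OF step[OF j(1)] Suc.IH[OF j(2)]] show ?case by simp
  qed
  have w0: "AE z in lebesgue. z \<in> unit_disk \<longrightarrow> G 0 z = w z"
    using AE_area_eq[of "n - 1"]
  proof eventually_elim
    case (elim z)
    show ?case
    proof
      assume z: "z \<in> unit_disk"
      have S: "{0..n - 1} = {0..<n}" using n by auto
      have "(\<Sum>k\<in>{0..<n}. datum (c k) (b k) k z) = \<i> * (\<Sum>k=0..n-1. of_real (c k) / fact k * (z + cnj z) ^ k)
          + (\<Sum>k=0..n-1. (-1) ^ k / (2 * of_real pi * fact k) * b k (schwarz_test k z))"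
        unfolding S sum_distrib_left sum.distrib[symmetric]
        by (intro sum.cong refl datum_formula) (use b z in \<open>auto simp: real_distribution_def\<close>)
      moreover have "area (n - 1) z = (-1) ^ n / (2 * of_real pi * fact (n - 1)) *
         integral\<^sup>L lborel (\<lambda>\<zeta>. kernel z \<zeta> * (\<zeta> - z + cnj (\<zeta> - z)) ^ (n - 1))" using elim z n by simp
      ultimately show "G 0 z = w z"
        unfolding w[OF z] scalar_formula_def disk_integral_kernel[OF fp] using n by (simp add: G_def)
    qed
  qed
  have fn: "AE z in lebesgue. z \<in> unit_disk \<longrightarrow> G n z = f z"
  proof -
    \<comment> \<open>The density recovers \<open>f z\<close> as \<open>z * p z\<close> only away
      from the origin, where the division by z is genuine.\<close>
    have "AE z in lebesgue. z \<noteq> (0::complex)" using AE_neq[of 0] by (simp only: AE_completion_iff)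
    with fp show ?thesis by eventually_elim (auto simp: G_def field_simps)
  qed
  show ?thesis unfolding scalar_solution_def
  proof (intro conjI allI impI)
    show "weak_d_zbar n w f" by (rule weak_d_zbar_cong[OF w0 fn]) (use G[of 0 n] in simp)
    fix j assume j: "j < n"
    have "has_data (\<lambda>z. (\<Sum>k\<in>{j..<n}. datum (c k) (b k) (k - j) z) + area (n - 1 - j) z)
       (\<lambda>\<gamma>. (\<Sum>k\<in>{j..<n}. if k - j = 0 then Re (b k \<gamma>) else 0) + 0) ((\<Sum>k\<in>{j..<n}. if k - j = 0 then c k else 0) + 0)"
      by (intro has_data_add has_data_sum datum_props(3) area_props(3) b) auto
    \<comment> \<open>Only the datum that has reached level 0 contributes to the boundary and origin
      conditions of order j.\<close>
    moreover have "(\<Sum>k\<in>{j..<n}. if k - j = 0 then y k else 0) = y j" for y :: "nat \<Rightarrow> real"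
      unfolding sum.atLeast_Suc_lessThan[OF j] by (auto intro: sum.neutral)
    ultimately have "has_data (G j) (\<lambda>\<gamma>. Re (b j \<gamma>)) (c j)" using j by (simp add: G_def)
    then obtain h a where h: "regular (G j) h a" "Im a = c j" "\<And>\<gamma>. \<gamma> \<in> circle_test \<Longrightarrow> \<forall>t. \<gamma> t \<in> \<real> \<Longrightarrow> Re (h \<gamma>) = Re (b j \<gamma>)"
      unfolding has_data_def by blast
    have "is_real_part (b j) h" unfolding is_real_part_def
    proof (intro ballI impI)
      fix \<gamma> assume \<gamma>: "\<gamma> \<in> circle_test" "\<forall>t. \<gamma> t \<in> \<real>"
      then have "b j \<gamma> \<in> \<real>" using b[OF j] unfolding real_distribution_def by blast
      then show "b j \<gamma> = of_real (Re (h \<gamma>))" using h(3)[OF \<gamma>] by (simp add: of_real_Re)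
    qed
    moreover have "weak_d_zbar j w (G j)"
      by (rule weak_d_zbar_cong[OF w0 _ G[of 0 j, simplified]]) (use j in auto)
    ultimately show "\<exists>g. weak_d_zbar j w g \<and> (\<exists>h. has_boundary_value g h \<and> is_real_part (b j) h) \<and> (\<exists>a. has_value_at g 0 a \<and> Im a = c j)"
      using h unfolding regular_def by (intro exI[of _ "G j"] conjI exI[of _ h] exI[of _ a]) auto
  qed
qed

section \<open>Uniqueness\<close>

lemma fourier_lincomb:
  assumes "\<gamma> \<in> circle_test" "\<delta> \<in> circle_test"
  shows "fourier (\<lambda>t. x * \<gamma> t + y * \<delta> t) j = x * fourier \<gamma> j + y * fourier \<delta> j"
proof -
  have i: "integrable circ (\<lambda>\<theta>. cis (real j * \<theta>) * \<eta> \<theta>)" if \<eta>: "\<eta> \<in> circle_test" for \<eta>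
  proof -
    note [measurable] = circle_test_measurable[OF \<eta>]
    obtain B where "\<And>t. cmod (\<eta> t) \<le> B" using circle_test_bounded[OF \<eta>] by blast
    then show ?thesis by (intro integrable_circ_bounded[of _ B]) (auto simp: norm_mult)
  qed
  have "cis (real j * \<theta>) * (x * \<gamma> \<theta> + y * \<delta> \<theta>) = x * (cis (real j * \<theta>) * \<gamma> \<theta>) + y * (cis (real j * \<theta>) * \<delta> \<theta>)" for \<theta>
    by (simp add: algebra_simps)
  then show ?thesis unfolding fourier_def
    by (simp only: Bochner_Integration.integral_add[OF integrable_mult_right[OF i[OF assms(1)]] integrable_mult_right[OF i[OF assms(2)]]] integral_mult_right_zero)
qed

lemma fourier_cis_neg: "fourier (\<lambda>t. cis (- (real l * t))) j = (if j = l then 2 * of_real pi else 0)"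
proof (cases "l \<le> j")
  case True
  then have "cis (real j * \<theta>) * cis (- (real l * \<theta>)) = cis (real (j - l) * \<theta>) * 1" for \<theta>
    by (simp add: cis_mult of_nat_diff algebra_simps)
  then have "fourier (\<lambda>t. cis (- (real l * t))) j = fourier (\<lambda>t. 1) (j - l)" unfolding fourier_def by (simp only:)
  then show ?thesis using True by (auto simp: fourier_1)
next
  case False
  then have "cis (real j * \<theta>) * cis (- (real l * \<theta>)) = cnj (cis (real (l - j) * \<theta>) * 1)" for \<theta>
    by (simp add: cis_mult cis_cnj of_nat_diff algebra_simps)
  then have "fourier (\<lambda>t. cis (- (real l * t))) j = cnj (fourier (\<lambda>t. 1) (l - j))"
    unfolding fourier_def by (simp only: Bochner_Integration.integral_cnj)
  then show ?thesis using False by (auto simp: fourier_1)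
qed

lemma fourier_cis: "fourier (\<lambda>t. cis (real l * t)) j = (if j + l = 0 then 2 * of_real pi else 0)"
proof -
  have "cis (real j * \<theta>) * cis (real l * \<theta>) = cis (real (j + l) * \<theta>) * 1" for \<theta> by (simp add: cis_mult algebra_simps)
  then have "fourier (\<lambda>t. cis (real l * t)) j = fourier (\<lambda>t. 1) (j + l)" unfolding fourier_def by (simp only:)
  then show ?thesis by (simp only: fourier_1)
qed

lemma circle_test_cis_pos: "(\<lambda>t. cis (real l * t)) \<in> circle_test"
  using circle_test_cnj[OF circle_test_cis[of l]] by (simp add: cis_cnj)

text \<open>The given representative equals the holomorphic function only almost everywhere, so
  circle integrals can be compared only on almost every circle. Since the limit exists along all
  radii, a sequence of admissible radii tending to 1 identifies it, and a test function with a
  single nonzero coefficient isolates one Taylor coefficient.\<close>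

lemma boundary_value_coefficient:
  assumes H: "\<And>z. cmod z < 1 \<Longrightarrow> (\<lambda>l. a l * z ^ l) sums H z" and AE: "AE z in lebesgue. z \<in> unit_disk \<longrightarrow> d z = H z"
    and bv: "has_boundary_value d h" and \<gamma>: "\<gamma> \<in> circle_test" and f: "\<And>j. fourier \<gamma> j = (if j = l then c else 0)"
  shows "h \<gamma> = a l * c"
proof -
  note [measurable] = circle_test_measurable[OF \<gamma>]
  obtain B where B: "\<And>t. cmod (\<gamma> t) \<le> B" using circle_test_bounded[OF \<gamma>] by blast
  define Q where "Q = (\<lambda>r. AE \<theta> in circ. of_real r * cis \<theta> \<in> unit_disk \<longrightarrow> d (of_real r * cis \<theta>) = H (of_real r * cis \<theta>))"
  have "\<exists>r. s < r \<and> r < 1 \<and> Q r" if s: "0 < s" "s < 1" for s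
    using AE_ex_between[OF AE_circles[OF AE] s(2)] s(1) unfolding Q_def by (meson less_trans)
  \<comment> \<open>The shift \<open>i + 2\<close> makes the lower bounds positive from the first
    index on, as the circles must have positive radius.\<close>
  then have "\<forall>i. \<exists>r. 1 - 1 / real (i + 2) < r \<and> r < 1 \<and> Q r" by simp
  then obtain R where R: "\<And>i. 1 - 1 / real (i + 2) < R i" "\<And>i. R i < 1" "\<And>i. Q (R i)" by metis
  have R0: "0 < R i" for i using R(1)[of i] by (rule less_trans[rotated]) simp
  have lim: "R \<longlonglongrightarrow> 1"
  proof (rule tendsto_sandwich[OF _ _ _ tendsto_const])
    have "(\<lambda>i. 1 - 1 / real (i + 2)) \<longlonglongrightarrow> 1 - 0"
      by (intro tendsto_diff tendsto_const LIMSEQ_ignore_initial_segment[OF lim_1_over_n, of 2])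
    then show "(\<lambda>i. 1 - 1 / real (i + 2)) \<longlonglongrightarrow> 1" by simp
  qed (use R in \<open>auto intro!: always_eventually less_imp_le\<close>)
  have e: "(LINT \<theta>:{0..2 * pi}|lebesgue. d (of_real (R i) * cis \<theta>) * \<gamma> \<theta>) = a l * of_real (R i) ^ l * c" for i
  proof -
    have Hm: "(\<lambda>\<theta>. H (of_real (R i) * cis \<theta>)) \<in> borel_measurable borel"
      by (rule power_series_circle_integral(2)[OF _ circle_test_measurable[OF \<gamma>] B R0 R(2)]) (rule H)
    have "AE \<theta> in lborel. \<theta> \<in> {0..2*pi} \<longrightarrow> d (of_real (R i) * cis \<theta>) = H (of_real (R i) * cis \<theta>)"
      using R(3)[of i] R(2)[of i] R0[of i] unfolding Q_def circ_def by (simp add: AE_restrict_space_iff norm_mult)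
    then have AE: "AE \<theta> in lebesgue. \<theta> \<in> {0..2*pi} \<longrightarrow> d (of_real (R i) * cis \<theta>) = H (of_real (R i) * cis \<theta>)" by (simp only: AE_completion_iff)
    have "set_integrable lebesgue {0..2 * pi} (\<lambda>\<theta>. d (of_real (R i) * cis \<theta>) * \<gamma> \<theta>)"
      using bv R(2)[of i] R0[of i] unfolding has_boundary_value_def by (intro circle_pairing_integrable \<gamma>) auto
    then have m: "(\<lambda>\<theta>. indicator {0..2*pi} \<theta> *\<^sub>R (d (of_real (R i) * cis \<theta>) * \<gamma> \<theta>)) \<in> borel_measurable lebesgue"
      unfolding set_integrable_def by auto
    have m': "(\<lambda>\<theta>. indicator {0..2*pi} \<theta> *\<^sub>R (H (of_real (R i) * cis \<theta>) * \<gamma> \<theta>)) \<in> borel_measurable lebesgue"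
    proof -
      have "(\<lambda>\<theta>. indicator {0..2*pi} \<theta> *\<^sub>R (H (of_real (R i) * cis \<theta>) * \<gamma> \<theta>)) \<in> borel_measurable borel"
        using Hm circle_test_measurable[OF \<gamma>] by (intro borel_measurable_scaleR borel_measurable_times) auto
      then show ?thesis by (intro measurable_completion) simp
    qed
    have "(LINT \<theta>:{0..2 * pi}|lebesgue. d (of_real (R i) * cis \<theta>) * \<gamma> \<theta>) = (LINT \<theta>:{0..2 * pi}|lebesgue. H (of_real (R i) * cis \<theta>) * \<gamma> \<theta>)"
      unfolding set_lebesgue_integral_def
      by (rule integral_cong_AE[OF m m']) (use AE in eventually_elim, auto simp: indicator_def)
    also have "\<dots> = integral\<^sup>L circ (\<lambda>\<theta>. H (of_real (R i) * cis \<theta>) * \<gamma> \<theta>)"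
      by (intro circ_set_integral(1) borel_measurable_times Hm circle_test_measurable[OF \<gamma>])
    also have "\<dots> = a l * of_real (R i) ^ l * c"
    proof -
      have "(\<lambda>j. a j * of_real (R i) ^ j * fourier \<gamma> j) sums integral\<^sup>L circ (\<lambda>\<theta>. H (of_real (R i) * cis \<theta>) * \<gamma> \<theta>)"
        by (rule power_series_circle_integral(1)[OF _ circle_test_measurable[OF \<gamma>] B R0 R(2)]) (rule H)
      moreover have "a j * of_real (R i) ^ j * fourier \<gamma> j = (if j = l then a l * of_real (R i) ^ l * c else 0)" for j by (simp add: f)
      ultimately have "(\<lambda>j. if j = l then a l * of_real (R i) ^ l * c else 0) sums integral\<^sup>L circ (\<lambda>\<theta>. H (of_real (R i) * cis \<theta>) * \<gamma> \<theta>)" by simp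
      then show ?thesis using sums_unique2 sums_single[of l "\<lambda>_. a l * of_real (R i) ^ l * c"] by blast
    qed
    finally show ?thesis .
  qed
  have "filterlim R (at_left 1) sequentially"
    using lim R(2) unfolding filterlim_at by (auto intro!: always_eventually simp: less_imp_neq)
  moreover have "((\<lambda>r. LINT \<theta>:{0..2 * pi}|lebesgue. d (of_real r * cis \<theta>) * \<gamma> \<theta>) \<longlongrightarrow> h \<gamma>) (at_left 1)"
    using bv \<gamma> unfolding has_boundary_value_def by blast
  ultimately have "(\<lambda>i. LINT \<theta>:{0..2 * pi}|lebesgue. d (of_real (R i) * cis \<theta>) * \<gamma> \<theta>) \<longlonglongrightarrow> h \<gamma>"
    by (rule filterlim_compose[rotated])
  then have "(\<lambda>i. a l * of_real (R i) ^ l * c) \<longlonglongrightarrow> h \<gamma>" unfolding e .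
  moreover have "(\<lambda>i. a l * of_real (R i) ^ l * c) \<longlonglongrightarrow> a l * of_real 1 ^ l * c" by (intro tendsto_intros lim)
  ultimately show ?thesis using LIMSEQ_unique by fastforce
qed

lemma homogeneous_trivial:
  assumes d: "weak_d_zbar 1 d (\<lambda>z. 0)" and bv: "has_boundary_value d h"
    and re: "\<And>\<gamma>. \<gamma> \<in> circle_test \<Longrightarrow> (\<And>t. \<gamma> t \<in> \<real>) \<Longrightarrow> Re (h \<gamma>) = 0"
    and v: "has_value_at d 0 v" "Im v = 0"
  shows "AE z in lebesgue. z \<in> unit_disk \<longrightarrow> d z = 0"
proof -
  obtain H where H: "H holomorphic_on unit_disk" and AE: "AE z in lebesgue. z \<in> unit_disk \<longrightarrow> d z = H z"
    using weyl[OF d] by blast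
  define a where "a = (\<lambda>l. (deriv ^^ l) H 0 / fact l)"
  have s: "(\<lambda>l. a l * z ^ l) sums H z" if "cmod z < 1" for z
    using holomorphic_power_series[OF H, of z] that by (simp add: a_def)
  have co: "h \<gamma> = a l * c" if \<gamma>: "\<gamma> \<in> circle_test" "\<And>j. fourier \<gamma> j = (if j = l then c else 0)" for \<gamma> l c
    by (rule boundary_value_coefficient[OF _ AE bv \<gamma>]) (rule s)
  have a_pos: "a l = 0" if l: "l > 0" for l
  proof -
    \<comment> \<open>This is \<open>2 * cos (l * t)\<close>, and \<delta> below is
      \<open>- 2 * sin (l * t)\<close>. Both are real, and their pairings are \<open>2 * pi\<close>
      times the coefficient and \<open>- \<i>\<close> times that, so the two vanishing real parts
      force real and imaginary part of the coefficient to be 0.\<close>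
    define \<gamma> where "\<gamma> = (\<lambda>t. 1 * cis (real l * t) + 1 * cis (- (real l * t)))"
    have \<gamma>: "\<gamma> \<in> circle_test" unfolding \<gamma>_def by (intro circle_test_lincomb circle_test_cis circle_test_cis_pos)
    have "fourier \<gamma> j = (if j = l then 2 * of_real pi else 0)" for j
      using l unfolding \<gamma>_def by (subst fourier_lincomb[OF circle_test_cis_pos circle_test_cis]) (simp add: fourier_cis fourier_cis_neg)
    from co[OF \<gamma> this] have 1: "h \<gamma> = a l * (2 * of_real pi)" .
    define \<delta> where "\<delta> = (\<lambda>t. \<i> * cis (real l * t) + (- \<i>) * cis (- (real l * t)))"
    have \<delta>: "\<delta> \<in> circle_test" unfolding \<delta>_def by (intro circle_test_lincomb circle_test_cis circle_test_cis_pos)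
    have "fourier \<delta> j = (if j = l then - \<i> * (2 * of_real pi) else 0)" for j
      using l unfolding \<delta>_def by (subst fourier_lincomb[OF circle_test_cis_pos circle_test_cis]) (simp add: fourier_cis fourier_cis_neg)
    from co[OF \<delta> this] have 2: "h \<delta> = a l * (- \<i> * (2 * of_real pi))" .
    have "Re (h \<gamma>) = 0" by (rule re[OF \<gamma>]) (simp add: \<gamma>_def complex_is_Real_iff)
    moreover have "Re (h \<delta>) = 0" by (rule re[OF \<delta>]) (simp add: \<delta>_def complex_is_Real_iff)
    ultimately show "a l = 0" unfolding 1 2 by (simp add: complex_eq_iff)
  qed
  have "h (\<lambda>t. 1) = a 0 * (2 * of_real pi)" by (rule co[OF circle_test_1]) (simp add: fourier_1)
  moreover have "Re (h (\<lambda>t. 1)) = 0" by (rule re[OF circle_test_1]) simp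
  ultimately have re0: "Re (a 0) = 0" by simp
  have H0: "H 0 = a 0" using sums_unique2[OF s[of 0] powser_sums_zero[of a]] by simp
  have cH: "continuous_on unit_disk H" by (rule holomorphic_on_imp_continuous_on[OF H])
  have "has_value_at H 0 v" using d by (intro has_value_at_cong[OF AE _ v(1)]) (simp add: weak_d_zbar_iff)
  then have "v = H 0" by (rule has_value_at_unique[OF continuous_locally_integrable[OF cH] _ has_value_at_continuous[OF cH]])
  then have "a 0 = 0" using re0 v(2) H0 by (simp add: complex_eq_iff)
  then have a0: "a l = 0" for l using a_pos[of l] by (cases "l = 0") auto
  have "H z = 0" if "cmod z < 1" for z
    using s[OF that] sums_unique2[OF _ sums_zero] by (simp add: a0)
  then show ?thesis using AE by (auto elim: eventually_mono)
qed

theorem scalar_uniqueness: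
  assumes v: "scalar_solution n f b c v" and w: "scalar_solution n f b c w"
  shows "AE z in lebesgue. z \<in> unit_disk \<longrightarrow> v z = w z"
proof -
  define u where "u = (\<lambda>z. 1 * v z + (-1) * w z)"
  \<comment> \<open>Descending induction on the order of the derivative, expressed by an increasing
    j; at \<open>j = n\<close> it says that \<open>u\<close> itself vanishes almost
    everywhere.\<close>
  have "weak_d_zbar (n - j) u (\<lambda>z. 0)" if "j \<le> n" for j
    using that
  proof (induction j)
    case 0
    have "weak_d_zbar n u (\<lambda>z. 1 * f z + (-1) * f z)"
      using v w unfolding u_def scalar_solution_def by (intro weak_d_zbar_lincomb) auto
    then show ?case by simp
  next
    case (Suc j)
    define k where "k = n - Suc j"
    have k: "k < n" "n - j = Suc k" using Suc.prems by (auto simp: k_def)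
    obtain g h a where 1: "weak_d_zbar k v g" "has_boundary_value g h" "is_real_part (b k) h" "has_value_at g 0 a" "Im a = c k"
      using v k unfolding scalar_solution_def by blast
    obtain g' h' a' where 2: "weak_d_zbar k w g'" "has_boundary_value g' h'" "is_real_part (b k) h'" "has_value_at g' 0 a'" "Im a' = c k"
      using w k unfolding scalar_solution_def by blast
    define d where "d = (\<lambda>z. 1 * g z + (-1) * g' z)"
    have ud: "weak_d_zbar k u d" unfolding u_def d_def by (intro weak_d_zbar_lincomb 1 2)
    have AE: "AE z in lebesgue. z \<in> unit_disk \<longrightarrow> d z = 0"
    proof (rule homogeneous_trivial)
      show "weak_d_zbar 1 d (\<lambda>z. 0)" using Suc k by (intro weak_d_zbar_quotient[OF ud]) simp
      show "has_boundary_value d (\<lambda>\<gamma>. 1 * h \<gamma> + (-1) * h' \<gamma>)" unfolding d_def by (intro has_boundary_value_lincomb 1 2)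
      show "has_value_at d 0 (1 * a + (-1) * a')" unfolding d_def
        using 1 2 by (intro has_value_at_lincomb) (auto simp: weak_d_zbar_iff)
      show "Im (1 * a + (-1) * a') = 0" using 1 2 by simp
      fix \<gamma> assume \<gamma>: "\<gamma> \<in> circle_test" "\<And>t. \<gamma> t \<in> \<real>"
      then have "b k \<gamma> = of_real (Re (h \<gamma>))" "b k \<gamma> = of_real (Re (h' \<gamma>))"
        using 1(3) 2(3) unfolding is_real_part_def by auto
      then show "Re (1 * h \<gamma> + (-1) * h' \<gamma>) = 0" by simp
    qed
    show ?case unfolding k_def[symmetric] by (rule weak_d_zbar_cong[OF _ AE ud]) simp
  qed
  from this[of n] have "weak_d_zbar 0 u (\<lambda>z. 0)" by simp
  from weak_d_zbar_0_AE[OF this] show ?thesis by eventually_elim (auto simp: u_def)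
qed

section \<open>The bicomplex problem\<close>

text \<open>Conjugating the circle integral also conjugates the test function, so conjugation is
  needed on both sides to obtain a complex-linear functional again. On real test functions this only
  conjugates the values and leaves the real part unchanged.\<close>

lemma has_boundary_value_cnj:
  assumes "has_boundary_value g h" shows "has_boundary_value (\<lambda>z. cnj (g z)) (\<lambda>\<gamma>. cnj (h (\<lambda>t. cnj (\<gamma> t))))"
  unfolding has_boundary_value_def
proof (intro conjI ballI)
  fix r :: real assume "r \<in> {0<..<1}"
  then have "integrable lebesgue (\<lambda>\<theta>. cnj (indicator {0..2 * pi} \<theta> *\<^sub>R g (of_real r * cis \<theta>)))"
    using assms unfolding has_boundary_value_def set_integrable_def by (intro Bochner_Integration.integrable_cnj) auto
  then show "set_integrable lebesgue {0..2 * pi} (\<lambda>\<theta>. cnj (g (of_real r * cis \<theta>)))"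
    unfolding set_integrable_def by simp
next
  fix \<gamma> assume "\<gamma> \<in> circle_test"
  from circle_test_cnj[OF this] have "((\<lambda>r. cnj (LINT \<theta>:{0..2 * pi}|lebesgue. g (of_real r * cis \<theta>) * cnj (\<gamma> \<theta>))) \<longlongrightarrow> cnj (h (\<lambda>t. cnj (\<gamma> t)))) (at_left 1)"
    using assms unfolding has_boundary_value_def by (intro tendsto_cnj) auto
  moreover have "cnj (LINT \<theta>:{0..2 * pi}|lebesgue. g (of_real r * cis \<theta>) * cnj (\<gamma> \<theta>)) = (LINT \<theta>:{0..2 * pi}|lebesgue. cnj (g (of_real r * cis \<theta>)) * \<gamma> \<theta>)" for r
    unfolding set_lebesgue_integral_def Bochner_Integration.integral_cnj[symmetric] by simp
  ultimately show "((\<lambda>r. LINT \<theta>:{0..2 * pi}|lebesgue. cnj (g (of_real r * cis \<theta>)) * \<gamma> \<theta>) \<longlongrightarrow> cnj (h (\<lambda>t. cnj (\<gamma> t)))) (at_left 1)"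
    by simp
qed

lemma has_value_at_cnj: "has_value_at g z a \<Longrightarrow> has_value_at (\<lambda>z. cnj (g z)) z (cnj a)"
  unfolding has_value_at_def by (simp only: complex_cnj_diff[symmetric] complex_mod_cnj)

lemma is_real_part_cnj: "is_real_part b h \<Longrightarrow> is_real_part b (\<lambda>\<gamma>. cnj (h (\<lambda>t. cnj (\<gamma> t))))"
  unfolding is_real_part_def by (simp add: Reals_cnj_iff)

text \<open>Passing to the conjugate keeps the boundary condition on the real part and reverses the
  sign of the imaginary part at the origin; this is where \<open>- cp k\<close> in the plus
  component comes from.\<close>

lemma boundary_data_cnj_iff:
  "(\<exists>h. has_boundary_value (\<lambda>z. cnj (g z)) h \<and> is_real_part b h) \<longleftrightarrow> (\<exists>h. has_boundary_value g h \<and> is_real_part b h)"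
  "(\<exists>a. has_value_at (\<lambda>z. cnj (g z)) 0 a \<and> Im a = - c) \<longleftrightarrow> (\<exists>a. has_value_at g 0 a \<and> Im a = c)"
proof -
  show "(\<exists>h. has_boundary_value (\<lambda>z. cnj (g z)) h \<and> is_real_part b h) \<longleftrightarrow> (\<exists>h. has_boundary_value g h \<and> is_real_part b h)"
  proof
    assume "\<exists>h. has_boundary_value (\<lambda>z. cnj (g z)) h \<and> is_real_part b h"
    then obtain h where h: "has_boundary_value (\<lambda>z. cnj (g z)) h" "is_real_part b h" by blast
    from has_boundary_value_cnj[OF h(1)] is_real_part_cnj[OF h(2)]
    show "\<exists>h. has_boundary_value g h \<and> is_real_part b h" unfolding complex_cnj_cnj by blast
  next
    assume "\<exists>h. has_boundary_value g h \<and> is_real_part b h"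
    then show "\<exists>h. has_boundary_value (\<lambda>z. cnj (g z)) h \<and> is_real_part b h"
      using has_boundary_value_cnj is_real_part_cnj by blast
  qed
  show "(\<exists>a. has_value_at (\<lambda>z. cnj (g z)) 0 a \<and> Im a = - c) \<longleftrightarrow> (\<exists>a. has_value_at g 0 a \<and> Im a = c)"
  proof
    assume "\<exists>a. has_value_at (\<lambda>z. cnj (g z)) 0 a \<and> Im a = - c"
    then obtain a where a: "has_value_at (\<lambda>z. cnj (g z)) 0 a" "Im a = - c" by blast
    from has_value_at_cnj[OF a(1)] a(2) show "\<exists>a. has_value_at g 0 a \<and> Im a = c"
      unfolding complex_cnj_cnj by (intro exI[of _ "cnj a"]) simp
  next
    assume "\<exists>a. has_value_at g 0 a \<and> Im a = c"
    then obtain a where a: "has_value_at g 0 a" "Im a = c" by blast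
    from has_value_at_cnj[OF a(1)] a(2) show "\<exists>a. has_value_at (\<lambda>z. cnj (g z)) 0 a \<and> Im a = - c"
      by (intro exI[of _ "cnj a"]) simp
  qed
qed

lemma schwarz_solution_iff:
  "schwarz_solution n f bp bm cp cm w \<longleftrightarrow>
     scalar_solution n (\<lambda>z. cnj (bc_plus (f z))) bp (\<lambda>k. - cp k) (\<lambda>z. cnj (bc_plus (w z))) \<and>
     scalar_solution n (\<lambda>z. bc_minus (f z)) bm cm (\<lambda>z. bc_minus (w z))" (is "?S \<longleftrightarrow> ?P \<and> ?M")
proof
  assume S: ?S
  have k: "\<exists>g. bc_dbar k w g \<and>
        (\<exists>h. has_boundary_value (\<lambda>z. bc_plus (g z)) h \<and> is_real_part (bp k) h) \<and>
        (\<exists>h. has_boundary_value (\<lambda>z. bc_minus (g z)) h \<and> is_real_part (bm k) h) \<and>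
        (\<exists>a. has_value_at (\<lambda>z. bc_plus (g z)) 0 a \<and> Im a = cp k) \<and>
        (\<exists>a. has_value_at (\<lambda>z. bc_minus (g z)) 0 a \<and> Im a = cm k)" if "k < n" for k
    using S that unfolding schwarz_solution_def by blast
  show "?P \<and> ?M" unfolding scalar_solution_def
  proof (intro conjI allI impI)
    show "weak_d_zbar n (\<lambda>z. cnj (bc_plus (w z))) (\<lambda>z. cnj (bc_plus (f z)))" "weak_d_zbar n (\<lambda>z. bc_minus (w z)) (\<lambda>z. bc_minus (f z))"
      using S unfolding schwarz_solution_def bc_dbar_def weak_d_z_iff by auto
    fix k assume "k < n"
    then obtain g where g: "bc_dbar k w g"
        "\<exists>h. has_boundary_value (\<lambda>z. bc_plus (g z)) h \<and> is_real_part (bp k) h"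
        "\<exists>h. has_boundary_value (\<lambda>z. bc_minus (g z)) h \<and> is_real_part (bm k) h"
        "\<exists>a. has_value_at (\<lambda>z. bc_plus (g z)) 0 a \<and> Im a = cp k"
        "\<exists>a. has_value_at (\<lambda>z. bc_minus (g z)) 0 a \<and> Im a = cm k"
      using k by blast
    show "\<exists>g. weak_d_zbar k (\<lambda>z. cnj (bc_plus (w z))) g \<and> (\<exists>h. has_boundary_value g h \<and> is_real_part (bp k) h) \<and>
        (\<exists>a. has_value_at g 0 a \<and> Im a = - cp k)"
      by (rule exI[of _ "\<lambda>z. cnj (bc_plus (g z))"], unfold boundary_data_cnj_iff) (use g in \<open>simp add: bc_dbar_def weak_d_z_iff\<close>)
    show "\<exists>g. weak_d_zbar k (\<lambda>z. bc_minus (w z)) g \<and> (\<exists>h. has_boundary_value g h \<and> is_real_part (bm k) h) \<and>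
        (\<exists>a. has_value_at g 0 a \<and> Im a = cm k)"
      by (rule exI[of _ "\<lambda>z. bc_minus (g z)"]) (use g in \<open>simp add: bc_dbar_def\<close>)
  qed
next
  assume PM: "?P \<and> ?M"
  show ?S unfolding schwarz_solution_def
  proof (intro conjI allI impI)
    show "bc_dbar n w f" using PM unfolding scalar_solution_def bc_dbar_def weak_d_z_iff by blast
    fix k assume k: "k < n"
    obtain g where g: "weak_d_zbar k (\<lambda>z. cnj (bc_plus (w z))) g" "\<exists>h. has_boundary_value g h \<and> is_real_part (bp k) h" "\<exists>a. has_value_at g 0 a \<and> Im a = - cp k"
      using PM k unfolding scalar_solution_def by blast
    obtain g' where g': "weak_d_zbar k (\<lambda>z. bc_minus (w z)) g'" "\<exists>h. has_boundary_value g' h \<and> is_real_part (bm k) h" "\<exists>a. has_value_at g' 0 a \<and> Im a = cm k"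
      using PM k unfolding scalar_solution_def by blast
    \<comment> \<open>The derivatives of the two components come with independently chosen
      representatives; the idempotent decomposition glues them into a single bicomplex
      function.\<close>
    define G where "G = (\<lambda>z. bc_pp \<odot> bc_of (cnj (g z)) + bc_pm \<odot> bc_of (g' z))"
    have "cnj (g z) = bc_plus (G z)" "g' z = bc_minus (G z)" for z
      using bc_decomp_iff[of "G z" "cnj (g z)" "g' z"] by (auto simp: G_def)
    then have G: "(\<lambda>z. bc_plus (G z)) = (\<lambda>z. cnj (g z))" "(\<lambda>z. bc_minus (G z)) = g'" by auto
    show "\<exists>g. bc_dbar k w g \<and>
        (\<exists>h. has_boundary_value (\<lambda>z. bc_plus (g z)) h \<and> is_real_part (bp k) h) \<and>
        (\<exists>h. has_boundary_value (\<lambda>z. bc_minus (g z)) h \<and> is_real_part (bm k) h) \<and>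
        (\<exists>a. has_value_at (\<lambda>z. bc_plus (g z)) 0 a \<and> Im a = cp k) \<and>
        (\<exists>a. has_value_at (\<lambda>z. bc_minus (g z)) 0 a \<and> Im a = cm k)"
      unfolding bc_dbar_def weak_d_z_iff
    proof (intro exI[of _ G] conjI)
      show "weak_d_zbar k (\<lambda>z. cnj (bc_plus (w z))) (\<lambda>z. cnj (bc_plus (G z)))" using g(1) by (simp add: fun_cong[OF G(1)])
      show "\<exists>a. has_value_at (\<lambda>z. bc_plus (G z)) 0 a \<and> Im a = cp k"
        using g(3) boundary_data_cnj_iff(2)[of g "- cp k"] by (simp add: G)
    qed (use g g' in \<open>simp_all add: G boundary_data_cnj_iff\<close>)
  qed
qed

lemma component_integrable:
  assumes f: "bc_L1 f" and f0: "integrable (lebesgue_on unit_disk) (\<lambda>\<zeta>. bc_norm (f \<zeta>) / cmod \<zeta>)"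
    and P: "P \<in> borel_measurable borel" "\<And>z. cmod (P z) \<le> 2 * bc_norm z"
  shows "set_integrable lebesgue unit_disk (\<lambda>\<zeta>. P (f \<zeta>) / \<zeta>)"
proof -
  have m: "f \<in> borel_measurable (lebesgue_on unit_disk)" using f by (simp add: bc_L1_def)
  have Pm: "(\<lambda>\<zeta>. P (f \<zeta>)) \<in> borel_measurable (lebesgue_on unit_disk)" by (rule measurable_compose[OF m P(1)])
  have im: "(\<lambda>\<zeta>. \<zeta>) \<in> borel_measurable (lebesgue_on unit_disk)"
    by (rule measurable_restrict_space1) (intro measurable_completion, simp)
  have "integrable (lebesgue_on unit_disk) (\<lambda>\<zeta>. P (f \<zeta>) / \<zeta>)"
  proof (rule Bochner_Integration.integrable_bound[OF integrable_mult_right[OF f0, of 2]])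
    show "(\<lambda>\<zeta>. P (f \<zeta>) / \<zeta>) \<in> borel_measurable (lebesgue_on unit_disk)" by (intro borel_measurable_divide Pm im)
    show "AE \<zeta> in lebesgue_on unit_disk. norm (P (f \<zeta>) / \<zeta>) \<le> norm (2 * (bc_norm (f \<zeta>) / cmod \<zeta>))"
    proof (rule AE_I2)
      fix \<zeta>
      have "cmod (P (f \<zeta>)) / cmod \<zeta> \<le> (2 * bc_norm (f \<zeta>)) / cmod \<zeta>" by (intro divide_right_mono P(2)) simp
      then show "norm (P (f \<zeta>) / \<zeta>) \<le> norm (2 * (bc_norm (f \<zeta>) / cmod \<zeta>))"
        unfolding norm_divide by (intro order_trans[OF _ abs_ge_self[THEN order_trans, OF eq_refl[OF real_norm_def[symmetric]]]]) simp
    qed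
  qed
  then show ?thesis unfolding set_integrable_def by (subst (asm) integrable_restrict_space) auto
qed

lemma component_le: "cmod (bc_plus z) \<le> 2 * bc_norm z" "cmod (bc_minus z) \<le> 2 * bc_norm z"
proof -
  have e: "2 * bc_norm z = sqrt (4 * (((cmod (bc_plus z))\<^sup>2 + (cmod (bc_minus z))\<^sup>2) / 2))"
    unfolding bc_norm_def real_sqrt_mult by simp
  show "cmod (bc_plus z) \<le> 2 * bc_norm z" "cmod (bc_minus z) \<le> 2 * bc_norm z"
    unfolding e by (rule real_le_rsqrt, simp)+
qed

lemma component_measurable: "(\<lambda>z. cnj (bc_plus z)) \<in> borel_measurable borel" "bc_minus \<in> borel_measurable borel"
  unfolding bc_plus_def bc_minus_def[abs_def] by (intro borel_measurable_continuous_onI continuous_intros)+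

text \<open>Conjugation turns the plus component into the scalar problem with imaginary data
  \<open>- cp k\<close>, so the formulas for \<open>cnj (wp z)\<close> and \<open>wm z\<close> are
  both instances of \<open>scalar_formula\<close>. Weak derivatives see functions only up to null
  sets, and uniqueness is meant in this sense.\<close>

theorem theorem3p5:
  fixes n :: nat
    and bp bm :: "nat \<Rightarrow> (real \<Rightarrow> complex) \<Rightarrow> complex"
    and pp pm :: "nat \<Rightarrow> real"
    and cp cm :: "nat \<Rightarrow> real"
    and f w :: "complex \<Rightarrow> bicomplex"
    and wp wm :: "complex \<Rightarrow> complex"
  assumes n: "n \<ge> 1"
    and b0: "real_distribution (bp 0)" "real_distribution (bm 0)"
    and p: "\<And>k. 1 \<le> k \<Longrightarrow> k \<le> n - 1 \<Longrightarrow> pp k > 1/2 \<and> pm k > 1/2"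
    and b: "\<And>k. 1 \<le> k \<Longrightarrow> k \<le> n - 1 \<Longrightarrow>
              bp k \<in> Re_Hp_boundary (pp k) \<and> bm k \<in> Re_Hp_boundary (pm k)"
    and f: "bc_L1 f"
    and f_at_0: "integrable (lebesgue_on unit_disk) (\<lambda>\<zeta>. bc_norm (f \<zeta>) / cmod \<zeta>)"
    and wp: "\<And>z. z \<in> unit_disk \<Longrightarrow> cnj (wp z) =
       - \<i> * (\<Sum>k=0..n-1. of_real (cp k) / fact k * (z + cnj z) ^ k)
       + (\<Sum>k=0..n-1. (-1) ^ k / (2 * of_real pi * fact k) * bp k (schwarz_test k z))
       + (-1) ^ n / (2 * of_real pi * fact (n - 1)) *
         (LINT \<zeta>:unit_disk|lebesgue.
            (cnj (bc_plus (f \<zeta>)) / \<zeta> * ((\<zeta> + z) / (\<zeta> - z))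
             + bc_plus (f \<zeta>) / cnj \<zeta> * ((1 + z * cnj \<zeta>) / (1 - z * cnj \<zeta>)))
            * (\<zeta> - z + cnj (\<zeta> - z)) ^ (n - 1))"
    and wm: "\<And>z. z \<in> unit_disk \<Longrightarrow> wm z =
       \<i> * (\<Sum>k=0..n-1. of_real (cm k) / fact k * (z + cnj z) ^ k)
       + (\<Sum>k=0..n-1. (-1) ^ k / (2 * of_real pi * fact k) * bm k (schwarz_test k z))
       + (-1) ^ n / (2 * of_real pi * fact (n - 1)) *
         (LINT \<zeta>:unit_disk|lebesgue.
            (bc_minus (f \<zeta>) / \<zeta> * ((\<zeta> + z) / (\<zeta> - z))
             + cnj (bc_minus (f \<zeta>)) / cnj \<zeta> * ((1 + z * cnj \<zeta>) / (1 - z * cnj \<zeta>)))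
            * (\<zeta> - z + cnj (\<zeta> - z)) ^ (n - 1))"
    and w: "\<And>z. z \<in> unit_disk \<Longrightarrow> w z = bc_pp \<odot> bc_of (wp z) + bc_pm \<odot> bc_of (wm z)"
  shows "schwarz_solution n f bp bm cp cm w \<and>
         (\<forall>v. schwarz_solution n f bp bm cp cm v \<longrightarrow> (AE z in lebesgue_on unit_disk. v z = w z))"
proof -
  \<comment> \<open>A real part takes real values on real test functions by its definition, so
    membership in \<open>Re_Hp_boundary\<close> supplies the reality that the Schwarz integral
    needs.\<close>
  have real: "real_distribution b" if "b \<in> Re_Hp_boundary q" for b q
    using that unfolding Re_Hp_boundary_def real_distribution_def is_real_part_def by auto
  have "real_distribution (bp k) \<and> real_distribution (bm k)" if "k < n" for k
  proof (cases "k = 0")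
    case False
    then have "1 \<le> k" "k \<le> n - 1" using that by auto
    from b[OF this] show ?thesis using real by blast
  qed (use b0 in simp)
  then have rb: "k < n \<Longrightarrow> real_distribution (bp k)" "k < n \<Longrightarrow> real_distribution (bm k)" for k by blast+
  have c: "bc_plus (w z) = wp z" "bc_minus (w z) = wm z" if "z \<in> unit_disk" for z
    using bc_decomp_iff[of "w z" "wp z" "wm z"] w[OF that] by auto
  have sol: "schwarz_solution n f bp bm cp cm w"
    unfolding schwarz_solution_iff
  proof (intro conjI scalar_existence n rb component_integrable[OF f f_at_0] component_measurable)
    show "cmod (cnj (bc_plus z)) \<le> 2 * bc_norm z" "cmod (bc_minus z) \<le> 2 * bc_norm z" for z by (simp_all add: component_le)
    fix z assume z: "z \<in> unit_disk"
    show "cnj (bc_plus (w z)) = scalar_formula n (\<lambda>z. cnj (bc_plus (f z))) bp (\<lambda>k. - cp k) z"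
      unfolding c(1)[OF z] wp[OF z] scalar_formula_def by (simp add: sum_negf)
    show "bc_minus (w z) = scalar_formula n (\<lambda>z. bc_minus (f z)) bm cm z"
      unfolding c(2)[OF z] wm[OF z] scalar_formula_def ..
  qed
  moreover have "AE z in lebesgue_on unit_disk. v z = w z" if v: "schwarz_solution n f bp bm cp cm v" for v
  proof -
    note scalar = v[unfolded schwarz_solution_iff] sol[unfolded schwarz_solution_iff]
    have "AE z in lebesgue. z \<in> unit_disk \<longrightarrow> cnj (bc_plus (v z)) = cnj (bc_plus (w z))"
      by (rule scalar_uniqueness[OF conjunct1[OF scalar(1)] conjunct1[OF scalar(2)]])
    moreover have "AE z in lebesgue. z \<in> unit_disk \<longrightarrow> bc_minus (v z) = bc_minus (w z)"
      by (rule scalar_uniqueness[OF conjunct2[OF scalar(1)] conjunct2[OF scalar(2)]])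
    ultimately have "AE z in lebesgue. z \<in> unit_disk \<longrightarrow> v z = w z"
    proof eventually_elim
      case (elim z)
      then show ?case by (metis bc_decomp_iff complex_cnj_cancel_iff)
    qed
    then show ?thesis by (simp add: AE_restrict_space_iff)
  qed
  ultimately show ?thesis by blast
qed

end
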